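(* Let $p:(\mathcal D,K)\to(\mathcal C,J)$ and $p':(\mathcal D',K')\to(\mathcal C,J)$ be local fibrations, and let $A:(\mathcal D,K)\to(\mathcal D',K')$ be a morphism of sites together with a natural isomorphism $\varphi:p'A\simeq p$. Then the following are equivalent: (i) The geometric morphism $\mathrm{Sh}(A):\widehat{\mathcal D'}_{K'}\to\widehat{\mathcal D}_K$ induced by $A$ is a morphism of relative toposes $[C_{p'}]\to[C_p]$ over $\widehat{\mathcal C}_J$ (that is, the natural transformation $\widetilde\varphi:\mathrm{Sh}(A)^*C_p^*\Rightarrow C_{p'}^*$ is an isomorphism). (ii) The $\eta$-extension $\widetilde A^*:(\widehat{\mathcal D}_K/C_p^* )\to(\widehat{\mathcal D'}_{K'}/C_{p'}^* )$ is a morphism of fibrations over $\widehat{\mathcal C}_J$. (iii) The functor $A$ is a morphism of local fibrations.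
   Context: Topos means Grothendieck topos; sites are such that their categories of sheaves are Grothendieck toposes. For a site $(\mathcal C,J)$: $\widehat{\mathcal C}_J$ is the topos of sheaves, $a_J$ is sheafification, and $l_J:\mathcal C\to\widehat{\mathcal C}_J$ is the Yoneda embedding followed by $a_J$. A comorphism of sites $p:(\mathcal D,K)\to(\mathcal C,J)$ is a functor such that for every object $d$ and every $J$-covering sieve $S$ on $p(d)$ there is a $K$-covering sieve $R$ on $d$ with $p(R)\subset S$. It induces a geometric morphism $C_p:\widehat{\mathcal D}_K\to\widehat{\mathcal C}_J$ with $C_p^*(E)=a_K(E\circ p^{op})$; we write $[C_p]$ for it seen as a relative topos over $\widehat{\mathcal C}_J$. A functor $A:(\mathcal D,K)\to(\mathcal D',K')$ is continuous if precomposition with $A$ sends $K'$-sheaves to $K$-sheaves; it then induces a colimit-preserving functor $\mathrm{Sh}(A)^*:\widehat{\mathcal D}_K\to\widehat{\mathcal D'}_{K'}$ with $\mathrm{Sh}(A)^*l_K\simeq l_{K'}A$, left adjoint to $\mathrm{Sh}(A)_*=(-\circ A^{op})$. $A$ is a morphism of sites if it is continuous and $\mathrm{Sh}(A)^*$ preserves finite limits, giving a geometric morphism $\mathrm{Sh}(A):\widehat{\mathcal D'}_{K'}\to\widehat{\mathcal D}_K$. Cartesian arrows: for a functor $p:\mathcal D\to\mathcal C$, an arrow $f:d'\to d$ is cartesian if for all $g:d''\to d$ and $h:p(d'')\to p(d')$ with $p(f)h=p(g)$ there is a unique $h':d''\to d'$ with $p(h')=h$ and $fh'=g$. A functor between fibrations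 over the same base, commuting with the projections up to isomorphism, is a morphism of fibrations if it sends cartesian arrows to cartesian arrows. For a comorphism of sites $p:(\mathcal D,K)\to(\mathcal C,J)$, $(\widehat{\mathcal D}_K/C_p^* )$ is the comma category with objects the triples $(F,E,\alpha:F\to C_p^*E)$, $F\in\widehat{\mathcal D}_K$, $E\in\widehat{\mathcal C}_J$, and arrows $(F,E,\alpha)\to(F',E',\alpha')$ the pairs $(g:F\to F',h:E\to E')$ with $\alpha'g=C_p^*(h)\alpha$; the projection $(F,E,\alpha)\mapsto E$ makes it a fibration over $\widehat{\mathcal C}_J$. The functor $\eta_{\mathcal D}:\mathcal D\to(\widehat{\mathcal D}_K/C_p^* )$ sends $d$ to $(l_K(d),l_J(p(d)),\eta(d))$, where $\eta(d):l_K(d)\to C_p^*l_Jp(d)\simeq a_K(\mathrm{Hom}_{\mathcal C}(p(-),p(d)))$ is the sheafification of $g\mapsto p(g)$, and sends $f$ to $(l_K(f),l_Jp(f))$. An arrow $f:d'\to d$ of $\mathcal D$ is locally cartesian if $\eta_{\mathcal D}(f)$ is a cartesian arrow of $(\widehat{\mathcal D}_K/C_p^* )\to\widehat{\mathcal C}_J$ (equivalently, the square formed by $l_K(f)$, $\eta(d')$, $\eta(d)$, $C_p^*l_Jp(f)$ is a pullback in $\widehat{\mathcal D}_K$). A comorphism of sites $p$ is a local fibration if for every arrow $f:c\to p(d)$ in $\mathcal C$ there are a $J$-covering family $(f_i:p(d_i)\to c)_i$ and locally cartesian arrows $\widehat{f_i}:d_i\to d$ with $f f_i=p(\widehat{f_i})$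 for all $i$. A functor $A$ between local fibrations $p,p'$ over $(\mathcal C,J)$ with $p'A\simeq p$ is a morphism of local fibrations if it sends locally cartesian arrows to locally cartesian arrows. The $\eta$-extension: $\varphi$ induces $E\circ p^{op}\to E\circ p'^{op}\circ A^{op}$, hence by adjunction a natural transformation $\mathrm{lan}_{A^{op}}(-\circ p^{op})\Rightarrow(-\circ p'^{op})$, and by sheafification $\widetilde\varphi:\mathrm{Sh}(A)^*C_p^*\Rightarrow C_{p'}^*$. Then $\widetilde A^*$ sends $(F,E,\alpha)$ to $(\mathrm{Sh}(A)^*F,E,\widetilde\varphi_E\circ\mathrm{Sh}(A)^*(\alpha))$ and $(g,h)$ to $(\mathrm{Sh}(A)^*(g),h)$. *)

theory Defs
  imports Main "HOL-Library.FuncSet"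
begin

section \<open>Universes\<close>

text \<open>
  Sheaves take values in the members of a family U of subsets of a type, which plays the role of
  the universe of small sets. An index set I is small when U is closed under I-indexed unions and
  (up to bijection) I-indexed products. If U consists of the sets of cardinality below an
  inaccessible cardinal, then U is a universe and the small sets are exactly the sets in bijection
  with a member of U, so this is the usual notion. Closure of U under
  all products indexed by its own members is not demanded: HOL does not prove that such a family
  with an infinite member exists, whereas every set is small for some universe in the sense below
  (lemma \<open>universe_exists\<close>).
\<close>

definition fits :: "'u set set \<Rightarrow> 'x set \<Rightarrow> bool" where
  "fits U X \<longleftrightarrow> (\<exists>e. inj_on e X \<and> e ` X \<in> U)"

definition small :: "'u set set \<Rightarrow> 'i set \<Rightarrow> bool" where
  "small U I \<longleftrightarrow>
    (\<forall>X. (\<forall>i\<in>I. X i \<in> U) \<longrightarrow> (\<Union>i\<in>I. X i) \<in> U \<and> fits U (Pi\<^sub>E I X))"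

definition universe :: "'u set set \<Rightarrow> bool" where
  "universe U \<longleftrightarrow>
    (\<forall>X\<in>U. \<forall>Y. Y \<subseteq> X \<longrightarrow> Y \<in> U) \<and>
    (\<forall>X\<in>U. \<forall>f :: 'u \<Rightarrow> 'u. f ` X \<in> U) \<and>
    (\<forall>X\<in>U. \<forall>Y\<in>U. X \<union> Y \<in> U \<and> fits U (X \<times> Y)) \<and>
    (\<exists>X\<in>U. \<exists>x\<in>X. \<exists>y\<in>X. x \<noteq> y)"

lemma fits_Pow_UNIV:
  fixes e :: "'x \<Rightarrow> 'u" and X :: "'x set"
  shows "inj e \<Longrightarrow> fits (Pow (UNIV :: 'u set)) X"
  unfolding fits_def by (intro exI[of _ e] conjI) (auto intro: inj_on_subset)

lemma universe_exists:
  fixes I :: "'i set"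
  defines "U \<equiv> Pow (UNIV :: ((bool + 'i) list \<Rightarrow> bool) set)"
  shows "universe U" and "small U I"
proof -
  let ?pair = "\<lambda>(a, b) l. case l of [] \<Rightarrow> False
    | t # l' \<Rightarrow> (if t = Inl True then a l' else if t = Inl False then b l' else False)"
  have "inj (?pair :: (((bool + 'i) list \<Rightarrow> bool) \<times> ((bool + 'i) list \<Rightarrow> bool)) \<Rightarrow> _)"
  proof (rule injI)
    fix v w :: "((bool + 'i) list \<Rightarrow> bool) \<times> ((bool + 'i) list \<Rightarrow> bool)"
    assume eq: "?pair v = ?pair w"
    have "fst v l = fst w l" "snd v l = snd w l" for l
      using fun_cong[OF eq, of "Inl True # l"] fun_cong[OF eq, of "Inl False # l"]
      by (simp_all add: split_beta)
    then show "v = w" by (auto simp: prod_eq_iff)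
  qed
  then have pair: "fits U (X \<times> Y)" for X Y :: "((bool + 'i) list \<Rightarrow> bool) set"
    unfolding U_def by (rule fits_Pow_UNIV)
  have "(\<lambda>_. True) \<noteq> (\<lambda>_ :: (bool + 'i) list. False)"
    by (auto dest: fun_cong)
  then show "universe U"
    unfolding universe_def using pair by (auto simp: U_def)
  let ?tup = "\<lambda>w l. case l of [] \<Rightarrow> False | t # l' \<Rightarrow> (case t of Inl _ \<Rightarrow> False | Inr i \<Rightarrow> w i l')"
  have "inj (?tup :: ('i \<Rightarrow> (bool + 'i) list \<Rightarrow> bool) \<Rightarrow> _)"
  proof (rule injI, rule ext, rule ext)
    fix v w :: "'i \<Rightarrow> (bool + 'i) list \<Rightarrow> bool" and i l
    assume "?tup v = ?tup w"
    from fun_cong[OF this, of "Inr i # l"] show "v i l = w i l" by simp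
  qed
  then show "small U I"
    unfolding small_def U_def by (blast intro: fits_Pow_UNIV)
qed


section \<open>Categories, functors, natural transformations\<close>

record ('o, 'a) cat =
  Ob :: "'o set"
  Ar :: "'a set"
  Dom :: "'a \<Rightarrow> 'o"
  Cod :: "'a \<Rightarrow> 'o"
  Idn :: "'o \<Rightarrow> 'a"
  Cmp :: "'a \<Rightarrow> 'a \<Rightarrow> 'a"  (infixl "\<cdot>\<index>" 70)

definition hom :: "('o, 'a) cat \<Rightarrow> 'o \<Rightarrow> 'o \<Rightarrow> 'a set" where
  "hom C a b = {f \<in> Ar C. Dom C f = a \<and> Cod C f = b}"

locale category =
  fixes C :: "('o, 'a) cat" (structure)
  assumes Dom_Ob: "f \<in> Ar C \<Longrightarrow> Dom C f \<in> Ob C"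
    and Cod_Ob: "f \<in> Ar C \<Longrightarrow> Cod C f \<in> Ob C"
    and Idn_hom: "a \<in> Ob C \<Longrightarrow> Idn C a \<in> hom C a a"
    and Cmp_hom: "f \<in> hom C a b \<Longrightarrow> g \<in> hom C b c \<Longrightarrow> g \<cdot> f \<in> hom C a c"
    and Cmp_Idn: "f \<in> hom C a b \<Longrightarrow> f \<cdot> Idn C a = f"
    and Idn_Cmp: "f \<in> hom C a b \<Longrightarrow> Idn C b \<cdot> f = f"
    and Cmp_assoc: "f \<in> hom C a b \<Longrightarrow> g \<in> hom C b c \<Longrightarrow> h \<in> hom C c d \<Longrightarrow>
      (h \<cdot> g) \<cdot> f = h \<cdot> (g \<cdot> f)"

definition iso :: "('o, 'a) cat \<Rightarrow> 'a \<Rightarrow> bool" where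
  "iso C f \<longleftrightarrow> f \<in> Ar C \<and> (\<exists>g \<in> hom C (Cod C f) (Dom C f).
    g \<cdot>\<^bsub>C\<^esub> f = Idn C (Dom C f) \<and> f \<cdot>\<^bsub>C\<^esub> g = Idn C (Cod C f))"

definition full_sub :: "('o, 'a) cat \<Rightarrow> 'o set \<Rightarrow> ('o, 'a) cat" where
  "full_sub C X = C\<lparr>Ob := X, Ar := {f \<in> Ar C. Dom C f \<in> X \<and> Cod C f \<in> X}\<rparr>"

record ('o, 'a, 'p, 'b) funct =
  FO :: "'o \<Rightarrow> 'p"
  FA :: "'a \<Rightarrow> 'b"

locale cat_functor = C: category C + D: category D
  for C :: "('o, 'a) cat" and D :: "('p, 'b) cat" +
  fixes F :: "('o, 'a, 'p, 'b) funct"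
  assumes FO_Ob: "a \<in> Ob C \<Longrightarrow> FO F a \<in> Ob D"
    and FA_hom: "f \<in> hom C a b \<Longrightarrow> FA F f \<in> hom D (FO F a) (FO F b)"
    and FA_Idn: "a \<in> Ob C \<Longrightarrow> FA F (Idn C a) = Idn D (FO F a)"
    and FA_Cmp: "f \<in> hom C a b \<Longrightarrow> g \<in> hom C b c \<Longrightarrow>
      FA F (g \<cdot>\<^bsub>C\<^esub> f) = FA F g \<cdot>\<^bsub>D\<^esub> FA F f"

definition comp_funct ::
  "('p, 'b, 'q, 'c) funct \<Rightarrow> ('o, 'a, 'p, 'b) funct \<Rightarrow> ('o, 'a, 'q, 'c) funct"  (infixl "\<odot>" 70) where
  "G \<odot> F = \<lparr>FO = \<lambda>a. FO G (FO F a), FA = \<lambda>f. FA G (FA F f)\<rparr>"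

definition incl :: "('o, 'a, 'o, 'a) funct" where
  "incl = \<lparr>FO = \<lambda>a. a, FA = \<lambda>f. f\<rparr>"

definition nat_trans :: "('o, 'a) cat \<Rightarrow> ('p, 'b) cat \<Rightarrow>
    ('o, 'a, 'p, 'b) funct \<Rightarrow> ('o, 'a, 'p, 'b) funct \<Rightarrow> ('o \<Rightarrow> 'b) \<Rightarrow> bool" where
  "nat_trans C D F G t \<longleftrightarrow> cat_functor C D F \<and> cat_functor C D G \<and>
    (\<forall>a\<in>Ob C. t a \<in> hom D (FO F a) (FO G a)) \<and>
    (\<forall>f\<in>Ar C. t (Cod C f) \<cdot>\<^bsub>D\<^esub> FA F f = FA G f \<cdot>\<^bsub>D\<^esub> t (Dom C f))"

definition nat_iso :: "('o, 'a) cat \<Rightarrow> ('p, 'b) cat \<Rightarrow>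
    ('o, 'a, 'p, 'b) funct \<Rightarrow> ('o, 'a, 'p, 'b) funct \<Rightarrow> ('o \<Rightarrow> 'b) \<Rightarrow> bool" where
  "nat_iso C D F G t \<longleftrightarrow> nat_trans C D F G t \<and> (\<forall>a\<in>Ob C. iso D (t a))"


section \<open>Finite limits\<close>

definition cone :: "('o, 'a) cat \<Rightarrow> ('i, 'j) cat \<Rightarrow> ('i, 'j, 'o, 'a) funct \<Rightarrow> 'o \<Rightarrow> ('i \<Rightarrow> 'a) \<Rightarrow> bool" where
  "cone A I X v t \<longleftrightarrow> v \<in> Ob A \<and> (\<forall>i\<in>Ob I. t i \<in> hom A v (FO X i)) \<and>
    (\<forall>u\<in>Ar I. FA X u \<cdot>\<^bsub>A\<^esub> t (Dom I u) = t (Cod I u))"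

definition limit_cone :: "('o, 'a) cat \<Rightarrow> ('i, 'j) cat \<Rightarrow> ('i, 'j, 'o, 'a) funct \<Rightarrow> 'o \<Rightarrow> ('i \<Rightarrow> 'a) \<Rightarrow> bool" where
  "limit_cone A I X v t \<longleftrightarrow> cone A I X v t \<and>
    (\<forall>v' t'. cone A I X v' t' \<longrightarrow> (\<exists>!w. w \<in> hom A v' v \<and> (\<forall>i\<in>Ob I. t i \<cdot>\<^bsub>A\<^esub> w = t' i)))"

text \<open>Every finite category is isomorphic to one whose objects and arrows are natural numbers.\<close>

definition preserves_finite_limits ::
  "('o, 'a) cat \<Rightarrow> ('p, 'b) cat \<Rightarrow> ('o, 'a, 'p, 'b) funct \<Rightarrow> bool" where
  "preserves_finite_limits A B T \<longleftrightarrow>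
    (\<forall>(I :: (nat, nat) cat) X v t.
      finite (Ob I) \<and> finite (Ar I) \<and> cat_functor I A X \<and> limit_cone A I X v t \<longrightarrow>
      limit_cone B I (T \<odot> X) (FO T v) (\<lambda>i. FA T (t i)))"


section \<open>Left adjoints\<close>

text \<open>
  The left adjoint of R : B \<rightarrow> A, given by a choice of a universal arrow
  a \<rightarrow> R (L a) for every object a of A.
\<close>

definition universal_arrow :: "('o, 'a) cat \<Rightarrow> ('p, 'b) cat \<Rightarrow> ('p, 'b, 'o, 'a) funct \<Rightarrow>
    'o \<Rightarrow> 'p \<times> 'a \<Rightarrow> bool" where
  "universal_arrow A B R a = (\<lambda>(b, u). b \<in> Ob B \<and> u \<in> hom A a (FO R b) \<and>
    (\<forall>b'\<in>Ob B. \<forall>v\<in>hom A a (FO R b'). \<exists>!w. w \<in> hom B b b' \<and> FA R w \<cdot>\<^bsub>A\<^esub> u = v))"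

definition left_adjoint_ob where
  "left_adjoint_ob A B R a = fst (SOME bu. universal_arrow A B R a bu)"

definition adj_unit where
  "adj_unit A B R a = snd (SOME bu. universal_arrow A B R a bu)"

definition transpose :: "('o, 'a) cat \<Rightarrow> ('p, 'b) cat \<Rightarrow> ('p, 'b, 'o, 'a) funct \<Rightarrow>
    'o \<Rightarrow> 'p \<Rightarrow> 'a \<Rightarrow> 'b" where
  "transpose A B R a b v =
    (THE w. w \<in> hom B (left_adjoint_ob A B R a) b \<and> FA R w \<cdot>\<^bsub>A\<^esub> adj_unit A B R a = v)"

definition left_adjoint :: "('o, 'a) cat \<Rightarrow> ('p, 'b) cat \<Rightarrow> ('p, 'b, 'o, 'a) funct \<Rightarrow>
    ('o, 'a, 'p, 'b) funct" where
  "left_adjoint A B R = \<lparr>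
    FO = left_adjoint_ob A B R,
    FA = \<lambda>f. transpose A B R (Dom A f) (left_adjoint_ob A B R (Cod A f))
      (adj_unit A B R (Cod A f) \<cdot>\<^bsub>A\<^esub> f)\<rparr>"


section \<open>Sites\<close>

definition sieve :: "('o, 'a) cat \<Rightarrow> 'o \<Rightarrow> 'a set \<Rightarrow> bool" where
  "sieve C c S \<longleftrightarrow> S \<subseteq> {f \<in> Ar C. Cod C f = c} \<and>
    (\<forall>f\<in>S. \<forall>g\<in>Ar C. Cod C g = Dom C f \<longrightarrow> f \<cdot>\<^bsub>C\<^esub> g \<in> S)"

definition pull_sieve :: "('o, 'a) cat \<Rightarrow> 'a \<Rightarrow> 'a set \<Rightarrow> 'a set" where
  "pull_sieve C f S = {g \<in> Ar C. Cod C g = Dom C f \<and> f \<cdot>\<^bsub>C\<^esub> g \<in> S}"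

definition generated_sieve :: "('o, 'a) cat \<Rightarrow> 'a set \<Rightarrow> 'a set" where
  "generated_sieve C X = {f \<cdot>\<^bsub>C\<^esub> g | f g. f \<in> X \<and> g \<in> Ar C \<and> Cod C g = Dom C f}"

locale grothendieck_topology = category C
  for C :: "('o, 'a) cat" (structure) +
  fixes J :: "'o \<Rightarrow> 'a set set"
  assumes covering_sieve: "c \<in> Ob C \<Longrightarrow> S \<in> J c \<Longrightarrow> sieve C c S"
    and maximal: "c \<in> Ob C \<Longrightarrow> {f \<in> Ar C. Cod C f = c} \<in> J c"
    and stable: "f \<in> hom C b c \<Longrightarrow> S \<in> J c \<Longrightarrow> pull_sieve C f S \<in> J b"
    and local: "c \<in> Ob C \<Longrightarrow> S \<in> J c \<Longrightarrow> sieve C c R \<Longrightarrow>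
      (\<And>f. f \<in> S \<Longrightarrow> pull_sieve C f R \<in> J (Dom C f)) \<Longrightarrow> R \<in> J c"

definition covering_family :: "('o, 'a) cat \<Rightarrow> ('o \<Rightarrow> 'a set set) \<Rightarrow> 'o \<Rightarrow> 'a set \<Rightarrow> bool" where
  "covering_family C J c X \<longleftrightarrow>
    X \<subseteq> {f \<in> Ar C. Cod C f = c} \<and> generated_sieve C X \<in> J c"

text \<open>
  A site may be large, but it is locally small and has a small dense set G of objects, so that its
  sheaves form a Grothendieck topos when U is a Grothendieck universe.
\<close>

definition site :: "'u set set \<Rightarrow> ('o, 'a) cat \<Rightarrow> ('o \<Rightarrow> 'a set set) \<Rightarrow> bool" where
  "site U C J \<longleftrightarrow> grothendieck_topology C J \<and>
    (\<forall>a\<in>Ob C. \<forall>b\<in>Ob C. small U (hom C a b)) \<and>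
    (\<exists>G\<subseteq>Ob C. small U G \<and>
      (\<forall>c\<in>Ob C. covering_family C J c {f \<in> Ar C. Cod C f = c \<and> Dom C f \<in> G}))"


section \<open>Presheaves and sheaves\<close>

record ('o, 'a, 'u) presheaf =
  Sec :: "'o \<Rightarrow> 'u set"
  Res :: "'a \<Rightarrow> 'u \<Rightarrow> 'u"

text \<open>
  Presheaves and their morphisms are normalised to be empty, respectively undefined, outside their
  domains, so that HOL equality is equality of presheaves and of morphisms. In particular the
  component of a morphism at a non-object is the only function on the empty set.
\<close>

definition is_presheaf :: "'u set set \<Rightarrow> ('o, 'a) cat \<Rightarrow> ('o, 'a, 'u) presheaf \<Rightarrow> bool" where
  "is_presheaf U C F \<longleftrightarrow>
    (\<forall>c\<in>Ob C. Sec F c \<in> U) \<and> (\<forall>c. c \<notin> Ob C \<longrightarrow> Sec F c = {}) \<and>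
    (\<forall>f\<in>Ar C. Res F f \<in> Sec F (Cod C f) \<rightarrow>\<^sub>E Sec F (Dom C f)) \<and>
    (\<forall>f. f \<notin> Ar C \<longrightarrow> Res F f = (\<lambda>_. undefined)) \<and>
    (\<forall>c\<in>Ob C. \<forall>x\<in>Sec F c. Res F (Idn C c) x = x) \<and>
    (\<forall>f\<in>Ar C. \<forall>g\<in>Ar C. Cod C g = Dom C f \<longrightarrow>
      (\<forall>x\<in>Sec F (Cod C f). Res F (f \<cdot>\<^bsub>C\<^esub> g) x = Res F g (Res F f x)))"

definition presheaf_map :: "('o, 'a) cat \<Rightarrow> ('o, 'a, 'u) presheaf \<Rightarrow> ('o, 'a, 'u) presheaf \<Rightarrow>
    ('o \<Rightarrow> 'u \<Rightarrow> 'u) \<Rightarrow> bool" where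
  "presheaf_map C F G t \<longleftrightarrow>
    (\<forall>c. t c \<in> Sec F c \<rightarrow>\<^sub>E Sec G c) \<and>
    (\<forall>f\<in>Ar C. \<forall>x\<in>Sec F (Cod C f). t (Dom C f) (Res F f x) = Res G f (t (Cod C f) x))"

type_synonym ('o, 'a, 'u) psh_arr =
  "('o, 'a, 'u) presheaf \<times> ('o, 'a, 'u) presheaf \<times> ('o \<Rightarrow> 'u \<Rightarrow> 'u)"

type_synonym ('o, 'a, 'u) psh_cat = "(('o, 'a, 'u) presheaf, ('o, 'a, 'u) psh_arr) cat"

definition presheaf_cat :: "'u set set \<Rightarrow> ('o, 'a) cat \<Rightarrow> ('o, 'a, 'u) psh_cat" where
  "presheaf_cat U C = \<lparr>
    Ob = {F. is_presheaf U C F},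
    Ar = {(F, G, t). is_presheaf U C F \<and> is_presheaf U C G \<and> presheaf_map C F G t},
    Dom = (\<lambda>(F, G, t). F),
    Cod = (\<lambda>(F, G, t). G),
    Idn = (\<lambda>F. (F, F, \<lambda>c. \<lambda>x\<in>Sec F c. x)),
    Cmp = (\<lambda>(_, H, s) (F, _, t). (F, H, \<lambda>c. compose (Sec F c) (s c) (t c)))\<rparr>"

definition matching_family :: "('o, 'a) cat \<Rightarrow> ('o, 'a, 'u) presheaf \<Rightarrow> 'a set \<Rightarrow> ('a \<Rightarrow> 'u) \<Rightarrow> bool" where
  "matching_family C F S m \<longleftrightarrow> (\<forall>f\<in>S. m f \<in> Sec F (Dom C f)) \<and>
    (\<forall>f\<in>S. \<forall>g\<in>Ar C. Cod C g = Dom C f \<longrightarrow> m (f \<cdot>\<^bsub>C\<^esub> g) = Res F g (m f))"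

definition is_sheaf :: "'u set set \<Rightarrow> ('o, 'a) cat \<Rightarrow> ('o \<Rightarrow> 'a set set) \<Rightarrow>
    ('o, 'a, 'u) presheaf \<Rightarrow> bool" where
  "is_sheaf U C J F \<longleftrightarrow> is_presheaf U C F \<and>
    (\<forall>c\<in>Ob C. \<forall>S\<in>J c. \<forall>m. matching_family C F S m \<longrightarrow>
      (\<exists>!x. x \<in> Sec F c \<and> (\<forall>f\<in>S. Res F f x = m f)))"

definition sheaf_cat :: "'u set set \<Rightarrow> ('o, 'a) cat \<Rightarrow> ('o \<Rightarrow> 'a set set) \<Rightarrow> ('o, 'a, 'u) psh_cat" where
  "sheaf_cat U C J = full_sub (presheaf_cat U C) {F. is_sheaf U C J F}"

type_synonym ('o, 'a, 'p, 'b, 'u) psh_funct =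
  "(('o, 'a, 'u) presheaf, ('o, 'a, 'u) psh_arr, ('p, 'b, 'u) presheaf, ('p, 'b, 'u) psh_arr) funct"

definition sheafification :: "'u set set \<Rightarrow> ('o, 'a) cat \<Rightarrow> ('o \<Rightarrow> 'a set set) \<Rightarrow>
    ('o, 'a, 'o, 'a, 'u) psh_funct" where
  "sheafification U C J = left_adjoint (presheaf_cat U C) (sheaf_cat U C J) incl"

definition sheafification_unit :: "'u set set \<Rightarrow> ('o, 'a) cat \<Rightarrow> ('o \<Rightarrow> 'a set set) \<Rightarrow>
    ('o, 'a, 'u) presheaf \<Rightarrow> ('o, 'a, 'u) psh_arr" where
  "sheafification_unit U C J = adj_unit (presheaf_cat U C) (sheaf_cat U C J) incl"

definition precomp :: "('o, 'a) cat \<Rightarrow> ('o, 'a, 'p, 'b) funct \<Rightarrow> ('p, 'b, 'o, 'a, 'u) psh_funct" where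
  "precomp D A = (let
      P = (\<lambda>F. \<lparr>Sec = \<lambda>d. if d \<in> Ob D then Sec F (FO A d) else {},
                Res = \<lambda>f. if f \<in> Ar D then Res F (FA A f) else (\<lambda>_. undefined)\<rparr>)
    in \<lparr>FO = P,
        FA = \<lambda>(F, G, t). (P F, P G, \<lambda>d. if d \<in> Ob D then t (FO A d) else (\<lambda>_. undefined))\<rparr>)"


section \<open>Representable presheaves\<close>

text \<open>Hom-sets are copied into the universe along a chosen injection.\<close>

definition enc :: "'u set set \<Rightarrow> 'x set \<Rightarrow> 'x \<Rightarrow> 'u" where
  "enc U X = (SOME e. inj_on e X \<and> e ` X \<in> U)"

definition enc_hom :: "'u set set \<Rightarrow> ('o, 'a) cat \<Rightarrow> 'o \<Rightarrow> 'o \<Rightarrow> 'a \<Rightarrow> 'u" where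
  "enc_hom U C b c = enc U (hom C b c)"

definition dec_hom :: "'u set set \<Rightarrow> ('o, 'a) cat \<Rightarrow> 'o \<Rightarrow> 'o \<Rightarrow> 'u \<Rightarrow> 'a" where
  "dec_hom U C b c = inv_into (hom C b c) (enc_hom U C b c)"

definition representable :: "'u set set \<Rightarrow> ('o, 'a) cat \<Rightarrow> 'o \<Rightarrow> ('o, 'a, 'u) presheaf" where
  "representable U C c = \<lparr>
    Sec = \<lambda>b. if b \<in> Ob C then enc_hom U C b c ` hom C b c else {},
    Res = \<lambda>f. if f \<in> Ar C
      then (\<lambda>x \<in> enc_hom U C (Cod C f) c ` hom C (Cod C f) c.
              enc_hom U C (Dom C f) c (dec_hom U C (Cod C f) c x \<cdot>\<^bsub>C\<^esub> f))
      else (\<lambda>_. undefined)\<rparr>"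

definition yoneda :: "'u set set \<Rightarrow> ('o, 'a) cat \<Rightarrow>
    ('o, 'a, ('o, 'a, 'u) presheaf, ('o, 'a, 'u) psh_arr) funct" where
  "yoneda U C = \<lparr>
    FO = representable U C,
    FA = \<lambda>g. (representable U C (Dom C g), representable U C (Cod C g),
      \<lambda>b. \<lambda>x \<in> Sec (representable U C (Dom C g)) b.
        enc_hom U C b (Cod C g) (g \<cdot>\<^bsub>C\<^esub> dec_hom U C b (Dom C g) x))\<rparr>"

definition ell :: "'u set set \<Rightarrow> ('o, 'a) cat \<Rightarrow> ('o \<Rightarrow> 'a set set) \<Rightarrow>
    ('o, 'a, ('o, 'a, 'u) presheaf, ('o, 'a, 'u) psh_arr) funct" where
  "ell U C J = sheafification U C J \<odot> yoneda U C"


section \<open>Comorphisms and morphisms of sites\<close>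

definition comorphism_of_sites :: "'u set set \<Rightarrow> ('p, 'b) cat \<Rightarrow> ('p \<Rightarrow> 'b set set) \<Rightarrow>
    ('o, 'a) cat \<Rightarrow> ('o \<Rightarrow> 'a set set) \<Rightarrow> ('p, 'b, 'o, 'a) funct \<Rightarrow> bool" where
  "comorphism_of_sites U D K C J p \<longleftrightarrow> site U D K \<and> site U C J \<and> cat_functor D C p \<and>
    (\<forall>d\<in>Ob D. \<forall>S\<in>J (FO p d). \<exists>R\<in>K d. FA p ` R \<subseteq> S)"

text \<open>The inverse image of the geometric morphism induced by a comorphism.\<close>

definition C_star :: "'u set set \<Rightarrow> ('p, 'b) cat \<Rightarrow> ('p \<Rightarrow> 'b set set) \<Rightarrow>
    ('p, 'b, 'o, 'a) funct \<Rightarrow> ('o, 'a, 'p, 'b, 'u) psh_funct" where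
  "C_star U D K p = sheafification U D K \<odot> precomp D p"

definition continuous_functor :: "'u set set \<Rightarrow> ('p, 'b) cat \<Rightarrow> ('p \<Rightarrow> 'b set set) \<Rightarrow>
    ('q, 'c) cat \<Rightarrow> ('q \<Rightarrow> 'c set set) \<Rightarrow> ('p, 'b, 'q, 'c) funct \<Rightarrow> bool" where
  "continuous_functor U D K D' K' A \<longleftrightarrow> site U D K \<and> site U D' K' \<and> cat_functor D D' A \<and>
    (\<forall>F. is_sheaf U D' K' F \<longrightarrow> is_sheaf U D K (FO (precomp D A) F))"

definition Sh_star :: "'u set set \<Rightarrow> ('p, 'b) cat \<Rightarrow> ('p \<Rightarrow> 'b set set) \<Rightarrow>
    ('q, 'c) cat \<Rightarrow> ('q \<Rightarrow> 'c set set) \<Rightarrow> ('p, 'b, 'q, 'c) funct \<Rightarrow> ('p, 'b, 'q, 'c, 'u) psh_funct" where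
  "Sh_star U D K D' K' A = left_adjoint (sheaf_cat U D K) (sheaf_cat U D' K') (precomp D A)"

definition morphism_of_sites :: "'u set set \<Rightarrow> ('p, 'b) cat \<Rightarrow> ('p \<Rightarrow> 'b set set) \<Rightarrow>
    ('q, 'c) cat \<Rightarrow> ('q \<Rightarrow> 'c set set) \<Rightarrow> ('p, 'b, 'q, 'c) funct \<Rightarrow> bool" where
  "morphism_of_sites U D K D' K' A \<longleftrightarrow> continuous_functor U D K D' K' A \<and>
    preserves_finite_limits (sheaf_cat U D K) (sheaf_cat U D' K') (Sh_star U D K D' K' A)"


section \<open>Fibrations\<close>

definition cartesian :: "('p, 'b) cat \<Rightarrow> ('o, 'a) cat \<Rightarrow> ('p, 'b, 'o, 'a) funct \<Rightarrow> 'b \<Rightarrow> bool" where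
  "cartesian D C p f \<longleftrightarrow> f \<in> Ar D \<and>
    (\<forall>g\<in>Ar D. Cod D g = Cod D f \<longrightarrow>
      (\<forall>h\<in>hom C (FO p (Dom D g)) (FO p (Dom D f)). FA p f \<cdot>\<^bsub>C\<^esub> h = FA p g \<longrightarrow>
        (\<exists>!k. k \<in> hom D (Dom D g) (Dom D f) \<and> FA p k = h \<and> f \<cdot>\<^bsub>D\<^esub> k = g)))"

definition fibration :: "('p, 'b) cat \<Rightarrow> ('o, 'a) cat \<Rightarrow> ('p, 'b, 'o, 'a) funct \<Rightarrow> bool" where
  "fibration D C p \<longleftrightarrow> cat_functor D C p \<and>
    (\<forall>d\<in>Ob D. \<forall>f\<in>Ar C. Cod C f = FO p d \<longrightarrow>
      (\<exists>f'. cartesian D C p f' \<and> Cod D f' = d \<and> FA p f' = f))"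

definition morphism_of_fibrations :: "('p, 'b) cat \<Rightarrow> ('p, 'b, 'o, 'a) funct \<Rightarrow>
    ('q, 'c) cat \<Rightarrow> ('q, 'c, 'o, 'a) funct \<Rightarrow> ('o, 'a) cat \<Rightarrow> ('p, 'b, 'q, 'c) funct \<Rightarrow> bool" where
  "morphism_of_fibrations D p D' p' C T \<longleftrightarrow>
    fibration D C p \<and> fibration D' C p' \<and> cat_functor D D' T \<and>
    (\<exists>t. nat_iso D C (p' \<odot> T) p t) \<and>
    (\<forall>f. cartesian D C p f \<longrightarrow> cartesian D' C p' (FA T f))"

type_synonym ('o, 'a, 'p) comma_ob = "'o \<times> 'p \<times> 'a"

type_synonym ('o, 'a, 'p, 'b) comma_arr =
  "('o, 'a, 'p) comma_ob \<times> ('o, 'a, 'p) comma_ob \<times> 'a \<times> 'b"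

text \<open>The comma category (A / T) of a functor T : B \<rightarrow> A and its projection to B.\<close>

definition comma_cat :: "('o, 'a) cat \<Rightarrow> ('p, 'b) cat \<Rightarrow> ('p, 'b, 'o, 'a) funct \<Rightarrow>
    (('o, 'a, 'p) comma_ob, ('o, 'a, 'p, 'b) comma_arr) cat" where
  "comma_cat A B T = (let
      X = {(F, E, \<alpha>). F \<in> Ob A \<and> E \<in> Ob B \<and> \<alpha> \<in> hom A F (FO T E)}
    in \<lparr>
      Ob = X,
      Ar = {(x, y, g, h). x \<in> X \<and> y \<in> X \<and>
        (case x of (F, E, \<alpha>) \<Rightarrow> case y of (F', E', \<alpha>') \<Rightarrow>
          g \<in> hom A F F' \<and> h \<in> hom B E E' \<and> \<alpha>' \<cdot>\<^bsub>A\<^esub> g = FA T h \<cdot>\<^bsub>A\<^esub> \<alpha>)},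
      Dom = (\<lambda>(x, y, g, h). x),
      Cod = (\<lambda>(x, y, g, h). y),
      Idn = (\<lambda>(F, E, \<alpha>). ((F, E, \<alpha>), (F, E, \<alpha>), Idn A F, Idn B E)),
      Cmp = (\<lambda>(_, z, g', h') (x, _, g, h). (x, z, g' \<cdot>\<^bsub>A\<^esub> g, h' \<cdot>\<^bsub>B\<^esub> h))\<rparr>)"

definition comma_proj :: "(('o, 'a, 'p) comma_ob, ('o, 'a, 'p, 'b) comma_arr, 'p, 'b) funct" where
  "comma_proj = \<lparr>FO = \<lambda>(F, E, \<alpha>). E, FA = \<lambda>(x, y, g, h). h\<rparr>"


section \<open>Local fibrations\<close>

text \<open>The comma category of the inverse image functor of a comorphism, over the sheaves on the base.\<close>

definition gluing :: "'u set set \<Rightarrow> ('p, 'b) cat \<Rightarrow> ('p \<Rightarrow> 'b set set) \<Rightarrow>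
    ('o, 'a) cat \<Rightarrow> ('o \<Rightarrow> 'a set set) \<Rightarrow> ('p, 'b, 'o, 'a) funct \<Rightarrow>
    ((('p, 'b, 'u) presheaf, ('p, 'b, 'u) psh_arr, ('o, 'a, 'u) presheaf) comma_ob,
     (('p, 'b, 'u) presheaf, ('p, 'b, 'u) psh_arr, ('o, 'a, 'u) presheaf, ('o, 'a, 'u) psh_arr) comma_arr) cat" where
  "gluing U D K C J p = comma_cat (sheaf_cat U D K) (sheaf_cat U C J) (C_star U D K p)"

text \<open>The morphism Hom(-, d) \<rightarrow> Hom(p(-), p(d)) given by the action of p on arrows.\<close>

definition hom_action :: "'u set set \<Rightarrow> ('p, 'b) cat \<Rightarrow> ('o, 'a) cat \<Rightarrow> ('p, 'b, 'o, 'a) funct \<Rightarrow>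
    'p \<Rightarrow> ('p, 'b, 'u) psh_arr" where
  "hom_action U D C p d =
    (representable U D d, FO (precomp D p) (representable U C (FO p d)),
     \<lambda>e. \<lambda>x \<in> Sec (representable U D d) e.
       enc_hom U C (FO p e) (FO p d) (FA p (dec_hom U D e d x)))"

text \<open>
  The component at d of the unit. Its codomain is the sheafification of the composite of p with the
  sheaf l(p d), hence the additional composition with the sheafification unit of Hom(-, p d), which
  the sheafification over D turns into the canonical isomorphism from the sheafification of
  Hom(p(-), p d).
\<close>

definition eta_ob :: "'u set set \<Rightarrow> ('p, 'b) cat \<Rightarrow> ('p \<Rightarrow> 'b set set) \<Rightarrow>
    ('o, 'a) cat \<Rightarrow> ('o \<Rightarrow> 'a set set) \<Rightarrow> ('p, 'b, 'o, 'a) funct \<Rightarrow> 'p \<Rightarrow> ('p, 'b, 'u) psh_arr" where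
  "eta_ob U D K C J p d = FA (sheafification U D K)
    (FA (precomp D p) (sheafification_unit U C J (representable U C (FO p d)))
      \<cdot>\<^bsub>presheaf_cat U D\<^esub> hom_action U D C p d)"

definition eta_functor :: "'u set set \<Rightarrow> ('p, 'b) cat \<Rightarrow> ('p \<Rightarrow> 'b set set) \<Rightarrow>
    ('o, 'a) cat \<Rightarrow> ('o \<Rightarrow> 'a set set) \<Rightarrow> ('p, 'b, 'o, 'a) funct \<Rightarrow>
    ('p, 'b,
     (('p, 'b, 'u) presheaf, ('p, 'b, 'u) psh_arr, ('o, 'a, 'u) presheaf) comma_ob,
     (('p, 'b, 'u) presheaf, ('p, 'b, 'u) psh_arr, ('o, 'a, 'u) presheaf, ('o, 'a, 'u) psh_arr) comma_arr) funct" where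
  "eta_functor U D K C J p = (let
      N = (\<lambda>d. (FO (ell U D K) d, FO (ell U C J) (FO p d), eta_ob U D K C J p d))
    in \<lparr>FO = N,
        FA = \<lambda>f. (N (Dom D f), N (Cod D f), FA (ell U D K) f, FA (ell U C J) (FA p f))\<rparr>)"

definition locally_cartesian :: "'u set set \<Rightarrow> ('p, 'b) cat \<Rightarrow> ('p \<Rightarrow> 'b set set) \<Rightarrow>
    ('o, 'a) cat \<Rightarrow> ('o \<Rightarrow> 'a set set) \<Rightarrow> ('p, 'b, 'o, 'a) funct \<Rightarrow> 'b \<Rightarrow> bool" where
  "locally_cartesian U D K C J p f \<longleftrightarrow> f \<in> Ar D \<and>
    cartesian (gluing U D K C J p) (sheaf_cat U C J) comma_proj (FA (eta_functor U D K C J p) f)"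

text \<open>
  In the next definition P is the set of the pairs consisting of a member of the covering family
  and of its locally cartesian lift.
\<close>

definition local_fibration :: "'u set set \<Rightarrow> ('p, 'b) cat \<Rightarrow> ('p \<Rightarrow> 'b set set) \<Rightarrow>
    ('o, 'a) cat \<Rightarrow> ('o \<Rightarrow> 'a set set) \<Rightarrow> ('p, 'b, 'o, 'a) funct \<Rightarrow> bool" where
  "local_fibration U D K C J p \<longleftrightarrow> comorphism_of_sites U D K C J p \<and>
    (\<forall>d\<in>Ob D. \<forall>f\<in>Ar C. Cod C f = FO p d \<longrightarrow>
      (\<exists>P :: ('a \<times> 'b) set. covering_family C J (Dom C f) (fst ` P) \<and>
        (\<forall>(k, m)\<in>P. locally_cartesian U D K C J p m \<and> Cod D m = d \<and>
          k \<in> hom C (FO p (Dom D m)) (Dom C f) \<and> f \<cdot>\<^bsub>C\<^esub> k = FA p m)))"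

definition morphism_of_local_fibrations :: "'u set set \<Rightarrow>
    ('p, 'b) cat \<Rightarrow> ('p \<Rightarrow> 'b set set) \<Rightarrow> ('p, 'b, 'o, 'a) funct \<Rightarrow>
    ('q, 'c) cat \<Rightarrow> ('q \<Rightarrow> 'c set set) \<Rightarrow> ('q, 'c, 'o, 'a) funct \<Rightarrow>
    ('o, 'a) cat \<Rightarrow> ('o \<Rightarrow> 'a set set) \<Rightarrow> ('p, 'b, 'q, 'c) funct \<Rightarrow> bool" where
  "morphism_of_local_fibrations U D K p D' K' p' C J A \<longleftrightarrow>
    local_fibration U D K C J p \<and> local_fibration U D' K' C J p' \<and> cat_functor D D' A \<and>
    (\<exists>t. nat_iso D C (p' \<odot> A) p t) \<and>
    (\<forall>f. locally_cartesian U D K C J p f \<longrightarrow> locally_cartesian U D' K' C J p' (FA A f))"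


section \<open>The comparison transformation and the extension of a morphism of sites\<close>

definition phi_psh :: "('p, 'b) cat \<Rightarrow> ('q, 'c) cat \<Rightarrow> ('p, 'b, 'q, 'c) funct \<Rightarrow>
    ('p, 'b, 'o, 'a) funct \<Rightarrow> ('q, 'c, 'o, 'a) funct \<Rightarrow> ('p \<Rightarrow> 'a) \<Rightarrow>
    ('o, 'a, 'u) presheaf \<Rightarrow> ('p, 'b, 'u) psh_arr" where
  "phi_psh D D' A p p' \<phi> E =
    (FO (precomp D p) E, FO (precomp D A) (FO (precomp D' p') E),
     \<lambda>d. \<lambda>x \<in> Sec (FO (precomp D p) E) d. Res E (\<phi> d) x)"

text \<open>
  The component at E is obtained from E p \<rightarrow> E p' A \<rightarrow> a(E p') A by transposing
  along sheafification over D and then along the adjunction between Sh(A)^* and precomposition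
  with A. Transposing first along left Kan extension and then along sheafification over D' is
  the same, since both composites of left adjoints are left adjoint to the restriction of
  precomposition with A to sheaves; the present order does not need Kan extensions of
  presheaves, which a large site may lack.
\<close>

definition phi_tilde :: "'u set set \<Rightarrow> ('p, 'b) cat \<Rightarrow> ('p \<Rightarrow> 'b set set) \<Rightarrow>
    ('q, 'c) cat \<Rightarrow> ('q \<Rightarrow> 'c set set) \<Rightarrow> ('p, 'b, 'q, 'c) funct \<Rightarrow>
    ('p, 'b, 'o, 'a) funct \<Rightarrow> ('q, 'c, 'o, 'a) funct \<Rightarrow> ('p \<Rightarrow> 'a) \<Rightarrow>
    ('o, 'a, 'u) presheaf \<Rightarrow> ('q, 'c, 'u) psh_arr" where
  "phi_tilde U D K D' K' A p p' \<phi> E = (let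
      Ep = FO (precomp D p) E;
      Ep' = FO (precomp D' p') E;
      C'E = FO (C_star U D' K' p') E;
      v = FA (precomp D A) (sheafification_unit U D' K' Ep')
            \<cdot>\<^bsub>presheaf_cat U D\<^esub> phi_psh D D' A p p' \<phi> E;
      w = transpose (presheaf_cat U D) (sheaf_cat U D K) incl Ep (FO (precomp D A) C'E) v
    in transpose (sheaf_cat U D K) (sheaf_cat U D' K') (precomp D A) (FO (C_star U D K p) E) C'E w)"

definition eta_extension :: "'u set set \<Rightarrow> ('p, 'b) cat \<Rightarrow> ('p \<Rightarrow> 'b set set) \<Rightarrow>
    ('q, 'c) cat \<Rightarrow> ('q \<Rightarrow> 'c set set) \<Rightarrow> ('p, 'b, 'q, 'c) funct \<Rightarrow>
    ('p, 'b, 'o, 'a) funct \<Rightarrow> ('q, 'c, 'o, 'a) funct \<Rightarrow> ('p \<Rightarrow> 'a) \<Rightarrow>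
    ((('p, 'b, 'u) presheaf, ('p, 'b, 'u) psh_arr, ('o, 'a, 'u) presheaf) comma_ob,
     (('p, 'b, 'u) presheaf, ('p, 'b, 'u) psh_arr, ('o, 'a, 'u) presheaf, ('o, 'a, 'u) psh_arr) comma_arr,
     (('q, 'c, 'u) presheaf, ('q, 'c, 'u) psh_arr, ('o, 'a, 'u) presheaf) comma_ob,
     (('q, 'c, 'u) presheaf, ('q, 'c, 'u) psh_arr, ('o, 'a, 'u) presheaf, ('o, 'a, 'u) psh_arr) comma_arr) funct" where
  "eta_extension U D K D' K' A p p' \<phi> = (let
      S = Sh_star U D K D' K' A;
      N = (\<lambda>(F, E, \<alpha>). (FO S F, E,
            phi_tilde U D K D' K' A p p' \<phi> E \<cdot>\<^bsub>sheaf_cat U D' K'\<^esub> FA S \<alpha>))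
    in \<lparr>FO = N, FA = \<lambda>(x, y, g, h). (N x, N y, FA S g, h)\<rparr>)"

definition morphism_of_relative_toposes :: "'u set set \<Rightarrow> ('p, 'b) cat \<Rightarrow> ('p \<Rightarrow> 'b set set) \<Rightarrow>
    ('q, 'c) cat \<Rightarrow> ('q \<Rightarrow> 'c set set) \<Rightarrow> ('o, 'a) cat \<Rightarrow> ('o \<Rightarrow> 'a set set) \<Rightarrow>
    ('p, 'b, 'q, 'c) funct \<Rightarrow> ('p, 'b, 'o, 'a) funct \<Rightarrow> ('q, 'c, 'o, 'a) funct \<Rightarrow> ('p \<Rightarrow> 'a) \<Rightarrow> bool" where
  "morphism_of_relative_toposes U D K D' K' C J A p p' \<phi> \<longleftrightarrow>
    nat_iso (sheaf_cat U C J) (sheaf_cat U D' K')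
      (Sh_star U D K D' K' A \<odot> C_star U D K p) (C_star U D' K' p')
      (phi_tilde U D K D' K' A p p' \<phi>)"

end

theory Submission
  imports Defs
begin

text \<open>
  Write T and T' for the inverse images of p and p', S for the inverse image along A, and l, l' for the
  canonical functors into sheaves. An arrow of a comma category (A / T) is cartesian iff the
  square it consists of is a pullback (\<open>cartesian_iff_pullback\<close>), and S preserves pullbacks. If the
  comparison S T \<Rightarrow> T' is invertible, pasting it to the image under S of a pullback square leaves a pullback
  square, so the extension preserves cartesian arrows (\<open>ext_cartesian\<close>). The extension carries the
  unit arrow of f to the unit arrow of A f up to isomorphism (\<open>ext_eta\<close>), so if it preserves cartesian arrows then
  A preserves locally cartesian ones (\<open>locally_cartesian_image\<close>).

  The substantial step leads back from locally cartesian arrows to the comparison. Both S T E and T' E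
  receive a morphism from the presheaf E p, after composition with A, and S T E is universal with this
  property; so it suffices that T' E is universal as well, that is, that every morphism t from E p to
  H A with H a sheaf extends uniquely to E p' (\<open>extension_ex\<close>, \<open>extension_unique\<close>). This follows from
  two facts about a section x of E over p' e.

  First, x is locally induced by a section of E p along an arrow into the image of A
  (\<open>locally_induced\<close>). As S preserves the terminal object, there are locally arrows w from e to A d.
  The local fibration p covers p' e by objects p d1 such that the composites p d1 \<rightarrow> p' e \<rightarrow> p d have locally
  cartesian lifts m : d1 \<rightarrow> d. As A m is locally cartesian, w lifts locally through A m, and it does so compatibly
  with the cover (\<open>locally_lifts\<close>); so x is induced by its restriction to p d1.

  Second, the image under t of the inducing section does not depend on the choices (\<open>induced_unique\<close>). As S
  preserves binary products, two arrows e \<rightarrow> A d1 and e \<rightarrow> A d2 factor locally through a common e \<rightarrow> A d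
  (\<open>locally_common_refinement\<close>). The two inducing sections are thereby moved to p d, where they need
  not be equal but agree after restriction to p' e; the same lifting argument moves
  them to some p d1 on which they do agree.

  To speak about sections of sheaves, which are only given by universal properties, three
  facts suffice: the left adjoints exist (\<open>universal_arrow_ex\<close>), a universal sheaf is locally generated by the
  image of its unit (\<open>universal_generated\<close>), and sections identified by sheafification agree locally
  (\<open>a_kernel\<close>). The sites may be large and the universe is closed under few operations, so the sheaves
  constructed for these three facts are bounded through a small dense set of objects.
\<close>

section \<open>Small sets and sets fitting into the universe\<close>

text \<open>
  The sets that fit play the role of the small sets in the values of presheaves; the sets that are small index
  products and unions. The closure properties of the universe are formulated for its members only, and they
  pass to arbitrary sets by transport along injections.
\<close>

lemma fits_inj:
  assumes "universe U" "fits U Y" "inj_on f X" "f ` X \<subseteq> Y"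
  shows "fits U X"
proof -
  obtain e where e: "inj_on e Y" "e ` Y \<in> U"
    using assms(2) by (auto simp: fits_def)
  have "(e \<circ> f) ` X \<subseteq> e ` Y"
    using assms(4) by auto
  then have "(e \<circ> f) ` X \<in> U"
    using assms(1) e(2) by (auto simp: universe_def)
  moreover have "inj_on (e \<circ> f) X"
    using assms(3,4) e(1) by (auto intro: comp_inj_on inj_on_subset)
  ultimately show ?thesis
    by (auto simp: fits_def)
qed

lemma fits_subset: "universe U \<Longrightarrow> fits U Y \<Longrightarrow> X \<subseteq> Y \<Longrightarrow> fits U X"
  by (rule fits_inj[where f = id]) auto

lemma fits_member: "X \<in> U \<Longrightarrow> fits U X"
  unfolding fits_def by (intro exI[of _ id]) auto

lemma fits_Times:
  assumes "universe U" "fits U X" "fits U Y"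
  shows "fits U (X \<times> Y)"
proof -
  obtain e f where "inj_on e X" "e ` X \<in> U" "inj_on f Y" "f ` Y \<in> U"
    using assms by (auto simp: fits_def)
  then show ?thesis
    using assms(1)
    by (intro fits_inj[where f = "map_prod e f" and Y = "e ` X \<times> f ` Y"])
      (auto simp: universe_def intro: map_prod_inj_on)
qed

lemma fits_bool:
  assumes "universe U"
  shows "fits U (UNIV :: bool set)"
proof -
  have "\<exists>X\<in>U. \<exists>x\<in>X. \<exists>y\<in>X. x \<noteq> y"
    using assms unfolding universe_def by (elim conjE)
  then obtain X x y where "X \<in> U" "x \<in> X" "y \<in> X" "x \<noteq> y"
    by (elim bexE)
  then show ?thesis
    using assms
    by (intro fits_inj[where f = "\<lambda>b. if b then x else y" and Y = X] fits_member) (auto simp: inj_on_def split: if_splits)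
qed

lemma fits_option:
  assumes "universe U" "fits U X"
  shows "fits U (insert None (Some ` X))"
proof (cases "X = {}")
  case True
  show ?thesis
    by (rule fits_inj[OF assms(1) fits_bool[OF assms(1)], where f = "\<lambda>_. True"])
      (auto simp: True)
next
  case False
  then obtain x where x: "x \<in> X" by blast
  show ?thesis
  proof (rule fits_inj[OF assms(1) fits_Times[OF assms(1) fits_bool[OF assms(1)] assms(2)]])
    show "inj_on (case_option (False, x) (Pair True)) (insert None (Some ` X))"
      by (auto simp: inj_on_def)
    show "case_option (False, x) (Pair True) ` insert None (Some ` X) \<subseteq> UNIV \<times> X"
      using x by auto
  qed
qed

text \<open>Products of fitting sets are encoded factor by factor.\<close>

lemma fits_PiE:
  assumes "universe U" "small U I" "\<And>i. i \<in> I \<Longrightarrow> fits U (X i)"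
  shows "fits U (Pi\<^sub>E I X)"
proof -
  obtain e where e: "\<And>i. i \<in> I \<Longrightarrow> inj_on (e i) (X i) \<and> e i ` X i \<in> U"
    using assms(3) unfolding fits_def by metis
  let ?f = "\<lambda>x. \<lambda>i\<in>I. e i (x i)"
  have "fits U (Pi\<^sub>E I (\<lambda>i. e i ` X i))"
    using assms(2) e by (auto simp: small_def)
  moreover have "inj_on ?f (Pi\<^sub>E I X)"
  proof (rule inj_onI)
    fix x y assume x: "x \<in> Pi\<^sub>E I X" and y: "y \<in> Pi\<^sub>E I X" and eq: "?f x = ?f y"
    show "x = y"
    proof (rule PiE_ext[OF x y])
      fix i assume i: "i \<in> I"
      then have "e i (x i) = e i (y i)"
        using fun_cong[OF eq, of i] by simp
      then show "x i = y i"
        using e[OF i] x y i by (auto dest: inj_onD)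
    qed
  qed
  ultimately show ?thesis
    by (rule fits_inj[OF assms(1)]) auto
qed

lemma fits_Pow:
  assumes "universe U" "small U I"
  shows "fits U (Pow I)"
proof (rule fits_inj[OF assms(1)])
  show "fits U (Pi\<^sub>E I (\<lambda>_. UNIV :: bool set))"
    by (rule fits_PiE[OF assms fits_bool[OF assms(1)]])
  show "inj_on (\<lambda>X. \<lambda>i\<in>I. i \<in> X) (Pow I)"
  proof (rule inj_onI)
    fix X Y assume "X \<in> Pow I" "Y \<in> Pow I" and eq: "(\<lambda>i\<in>I. i \<in> X) = (\<lambda>i\<in>I. i \<in> Y)"
    moreover have "i \<in> X \<longleftrightarrow> i \<in> Y" if "i \<in> I" for i
      using fun_cong[OF eq, of i] that by simp
    ultimately show "X = Y" by blast
  qed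
  show "(\<lambda>X. \<lambda>i\<in>I. i \<in> X) ` Pow I \<subseteq> Pi\<^sub>E I (\<lambda>_. UNIV)"
    by (auto intro!: restrict_PiE_iff[THEN iffD2])
qed

lemma fits_small: "universe U \<Longrightarrow> small U I \<Longrightarrow> fits U I"
  by (rule fits_inj[OF _ fits_Pow, where f = "\<lambda>i. {i}"]) auto

lemma fits_Sigma:
  assumes "universe U" "small U I" "\<And>i. i \<in> I \<Longrightarrow> fits U (X i)"
  shows "fits U (Sigma I X)"
proof -
  obtain e where e: "\<And>i. i \<in> I \<Longrightarrow> inj_on (e i) (X i) \<and> e i ` X i \<in> U"
    using assms(3) unfolding fits_def by metis
  then have "(\<Union>i\<in>I. e i ` X i) \<in> U"
    using assms(2) by (auto simp: small_def)
  then have "fits U (I \<times> (\<Union>i\<in>I. e i ` X i))"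
    using assms by (intro fits_Times fits_small fits_member)
  moreover have "inj_on (\<lambda>(i, x). (i, e i x)) (Sigma I X)"
    using e by (auto simp: inj_on_def)
  ultimately show ?thesis
    by (rule fits_inj[OF assms(1)]) auto
qed

text \<open>Sections over a union are determined by their restrictions to the members of the union.\<close>

lemma small_UN:
  assumes "universe U" "small U I" "\<And>i. i \<in> I \<Longrightarrow> small U (J i)"
  shows "small U (\<Union>i\<in>I. J i)"
  unfolding small_def
proof (intro allI impI conjI)
  fix X assume X: "\<forall>j\<in>\<Union>i\<in>I. J i. X j \<in> U"
  have "(\<Union>j\<in>J i. X j) \<in> U" if "i \<in> I" for i
    using assms(3)[OF that] X that by (auto simp: small_def)
  then have "(\<Union>i\<in>I. \<Union>j\<in>J i. X j) \<in> U"
    using assms(2) by (auto simp: small_def)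
  moreover have "(\<Union>j\<in>\<Union>i\<in>I. J i. X j) = (\<Union>i\<in>I. \<Union>j\<in>J i. X j)"
    by blast
  ultimately show "(\<Union>j\<in>\<Union>i\<in>I. J i. X j) \<in> U"
    by simp
  show "fits U (Pi\<^sub>E (\<Union>i\<in>I. J i) X)"
  proof (rule fits_inj[OF assms(1)])
    show "fits U (Pi\<^sub>E I (\<lambda>i. Pi\<^sub>E (J i) X))"
      using assms X by (intro fits_PiE fits_member) auto
    show "inj_on (\<lambda>x. \<lambda>i\<in>I. restrict x (J i)) (Pi\<^sub>E (\<Union>i\<in>I. J i) X)"
    proof (rule inj_onI)
      fix x y
      assume x: "x \<in> Pi\<^sub>E (\<Union>i\<in>I. J i) X" and y: "y \<in> Pi\<^sub>E (\<Union>i\<in>I. J i) X"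
        and eq: "(\<lambda>i\<in>I. restrict x (J i)) = (\<lambda>i\<in>I. restrict y (J i))"
      show "x = y"
      proof (rule PiE_ext[OF x y])
        fix j assume "j \<in> (\<Union>i\<in>I. J i)"
        then obtain i where i: "i \<in> I" "j \<in> J i" by blast
        then have "restrict x (J i) = restrict y (J i)"
          using fun_cong[OF eq, of i] by simp
        then show "x j = y j"
          using i(2) by (metis restrict_apply')
      qed
    qed
    show "(\<lambda>x. \<lambda>i\<in>I. restrict x (J i)) ` Pi\<^sub>E (\<Union>i\<in>I. J i) X \<subseteq> Pi\<^sub>E I (\<lambda>i. Pi\<^sub>E (J i) X)"
      by fastforce
  qed
qed

lemma small_image:
  assumes "universe U" "small U I"
  shows "small U (f ` I)"
  unfolding small_def
proof (intro allI impI conjI)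
  fix X assume X: "\<forall>j\<in>f ` I. X j \<in> U"
  then have *: "(\<Union>i\<in>I. X (f i)) \<in> U" "fits U (Pi\<^sub>E I (\<lambda>i. X (f i)))"
    using assms(2) by (auto simp: small_def)
  show "(\<Union>j\<in>f ` I. X j) \<in> U"
    using *(1) by simp
  show "fits U (Pi\<^sub>E (f ` I) X)"
  proof (rule fits_inj[OF assms(1) *(2)])
    show "inj_on (\<lambda>x. \<lambda>i\<in>I. x (f i)) (Pi\<^sub>E (f ` I) X)"
    proof (rule inj_onI)
      fix x y assume x: "x \<in> Pi\<^sub>E (f ` I) X" and y: "y \<in> Pi\<^sub>E (f ` I) X"
        and eq: "(\<lambda>i\<in>I. x (f i)) = (\<lambda>i\<in>I. y (f i))"
      show "x = y"
      proof (rule PiE_ext[OF x y])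
        fix j assume "j \<in> f ` I"
        then obtain i where "i \<in> I" "j = f i" by blast
        then show "x j = y j"
          using fun_cong[OF eq, of i] by simp
      qed
    qed
    show "(\<lambda>x. \<lambda>i\<in>I. x (f i)) ` Pi\<^sub>E (f ` I) X \<subseteq> Pi\<^sub>E I (\<lambda>i. X (f i))"
      by auto
  qed
qed

lemma small_Times:
  assumes "universe U" "small U I" "small U J"
  shows "small U (I \<times> J)"
proof -
  have "I \<times> J = (\<Union>i\<in>I. Pair i ` J)" by auto
  moreover have "small U (\<Union>i\<in>I. Pair i ` J)"
    by (rule small_UN[OF assms(1,2) small_image[OF assms(1,3)]])
  ultimately show ?thesis by simp
qed

lemma fits_image:
  assumes "universe U" "fits U X"
  shows "fits U (f ` X)"
  by (rule fits_inj[OF assms, where f = "inv_into X f"]) (auto simp: inj_on_inv_into inv_into_into)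

lemma enc:
  assumes "fits U X"
  shows enc_inj: "inj_on (enc U X) X" and enc_in_universe: "enc U X ` X \<in> U"
  using someI_ex[OF assms[unfolded fits_def]] by (simp_all add: enc_def)

lemma inv_into_enc: "fits U X \<Longrightarrow> x \<in> X \<Longrightarrow> inv_into X (enc U X) (enc U X x) = x"
  by (simp add: enc_inj)


section \<open>Local properties on a site\<close>

lemma homI: "f \<in> Ar C \<Longrightarrow> Dom C f = a \<Longrightarrow> Cod C f = b \<Longrightarrow> f \<in> hom C a b"
  by (simp add: hom_def)

lemma homD:
  assumes "f \<in> hom C a b"
  shows "f \<in> Ar C" "Dom C f = a" "Cod C f = b"
  using assms by (auto simp: hom_def)

context category
begin

lemma hom_Ob: "f \<in> hom C a b \<Longrightarrow> a \<in> Ob C" "f \<in> hom C a b \<Longrightarrow> b \<in> Ob C"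
  using Dom_Ob Cod_Ob by (auto simp: hom_def)

lemma Cmp_Ar:
  assumes "g \<in> Ar C" "f \<in> Ar C" "Cod C f = Dom C g"
  shows "g \<cdot> f \<in> Ar C" "Dom C (g \<cdot> f) = Dom C f" "Cod C (g \<cdot> f) = Cod C g"
  using Cmp_hom[of f "Dom C f" "Dom C g" g "Cod C g"] assms by (auto simp: hom_def)

lemma Cmp_Ar_assoc:
  "f \<in> Ar C \<Longrightarrow> g \<in> Ar C \<Longrightarrow> h \<in> Ar C \<Longrightarrow> Cod C f = Dom C g \<Longrightarrow> Cod C g = Dom C h \<Longrightarrow>
    (h \<cdot> g) \<cdot> f = h \<cdot> (g \<cdot> f)"
  by (rule Cmp_assoc) (auto simp: hom_def)

lemma Idn_Ar:
  assumes "a \<in> Ob C"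
  shows "Idn C a \<in> Ar C" "Dom C (Idn C a) = a" "Cod C (Idn C a) = a"
  using Idn_hom[OF assms] by (auto simp: hom_def)

lemma Idn_Cmp_Ar: "f \<in> Ar C \<Longrightarrow> Idn C (Cod C f) \<cdot> f = f"
  and Cmp_Idn_Ar: "f \<in> Ar C \<Longrightarrow> f \<cdot> Idn C (Dom C f) = f"
  using Idn_Cmp Cmp_Idn by (auto simp: hom_def)

end

lemma (in cat_functor) FA_Ar:
  assumes "f \<in> Ar C"
  shows "FA F f \<in> Ar D" "Dom D (FA F f) = FO F (Dom C f)" "Cod D (FA F f) = FO F (Cod C f)"
  using FA_hom[of f "Dom C f" "Cod C f"] assms by (auto simp: hom_def)

lemma (in cat_functor) FA_Cmp_Ar:
  "f \<in> Ar C \<Longrightarrow> g \<in> Ar C \<Longrightarrow> Cod C f = Dom C g \<Longrightarrow> FA F (g \<cdot>\<^bsub>C\<^esub> f) = FA F g \<cdot>\<^bsub>D\<^esub> FA F f"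
  by (rule FA_Cmp) (auto simp: hom_def)

text \<open>
  Arguments on a site are carried out in terms of properties that hold on a covering sieve. The rules below
  make this a modality: it is stable under pullback, and it can be nested.
\<close>

definition locally :: "('o, 'a) cat \<Rightarrow> ('o \<Rightarrow> 'a set set) \<Rightarrow> 'o \<Rightarrow> ('a \<Rightarrow> bool) \<Rightarrow> bool" where
  "locally C J c Q \<longleftrightarrow> (\<exists>S\<in>J c. \<forall>f\<in>S. Q f)"

context grothendieck_topology
begin

lemma coverD:
  assumes "c \<in> Ob C" "S \<in> J c" "f \<in> S"
  shows "f \<in> Ar C" "Cod C f = c"
  using covering_sieve[OF assms(1,2)] assms(3) by (auto simp: sieve_def)

lemma cover_Cmp:
  "c \<in> Ob C \<Longrightarrow> S \<in> J c \<Longrightarrow> f \<in> S \<Longrightarrow> g \<in> Ar C \<Longrightarrow> Cod C g = Dom C f \<Longrightarrow> f \<cdot> g \<in> S"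
  using covering_sieve[of c S] by (auto simp: sieve_def)

lemma cover_superset:
  assumes "c \<in> Ob C" "S \<in> J c" "sieve C c R" "S \<subseteq> R"
  shows "R \<in> J c"
proof (rule local[OF assms(1-3)])
  fix f assume f: "f \<in> S"
  note * = coverD[OF assms(1,2) f]
  have "pull_sieve C f R = {g \<in> Ar C. Cod C g = Dom C f}"
    using cover_Cmp[OF assms(1,2) f] assms(4) by (auto simp: pull_sieve_def)
  then show "pull_sieve C f R \<in> J (Dom C f)"
    using maximal[OF Dom_Ob[OF *(1)]] by simp
qed

lemma locally_everywhere:
  "c \<in> Ob C \<Longrightarrow> (\<And>f. f \<in> Ar C \<Longrightarrow> Cod C f = c \<Longrightarrow> Q f) \<Longrightarrow> locally C J c Q"
  unfolding locally_def by (rule bexI[OF _ maximal]) auto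

lemma locally_mono:
  "locally C J c Q \<Longrightarrow> c \<in> Ob C \<Longrightarrow> (\<And>f. f \<in> Ar C \<Longrightarrow> Cod C f = c \<Longrightarrow> Q f \<Longrightarrow> Q' f) \<Longrightarrow>
    locally C J c Q'"
  unfolding locally_def by (elim bexE, rule bexI) (auto dest: coverD)

lemma locally_pull:
  assumes "locally C J c Q" "f \<in> Ar C" "Cod C f = c"
  shows "locally C J (Dom C f) (\<lambda>g. Q (f \<cdot> g))"
proof -
  obtain S where S: "S \<in> J c" "\<forall>f\<in>S. Q f"
    using assms(1) by (auto simp: locally_def)
  have "pull_sieve C f S \<in> J (Dom C f)"
    using stable[OF homI[OF assms(2) refl assms(3)] S(1)] .
  then show ?thesis
    unfolding locally_def by (rule bexI[rotated]) (use S(2) in \<open>auto simp: pull_sieve_def\<close>)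
qed

lemma locally_trans:
  assumes Q: "locally C J c Q" and c: "c \<in> Ob C"
    and Q': "\<And>f. f \<in> Ar C \<Longrightarrow> Cod C f = c \<Longrightarrow> Q f \<Longrightarrow> locally C J (Dom C f) (\<lambda>g. Q' (f \<cdot> g))"
  shows "locally C J c Q'"
proof -
  obtain S where S: "S \<in> J c" "\<forall>f\<in>S. Q f"
    using Q by (auto simp: locally_def)
  have "\<exists>R\<in>J (Dom C f). \<forall>g\<in>R. Q' (f \<cdot> g)" if "f \<in> S" for f
    using Q'[of f] coverD[OF c S(1) that] S(2) that by (auto simp: locally_def)
  then obtain R where R: "\<And>f. f \<in> S \<Longrightarrow> R f \<in> J (Dom C f) \<and> (\<forall>g\<in>R f. Q' (f \<cdot> g))"
    by metis
  define T where "T = {f \<cdot> g | f g. f \<in> S \<and> g \<in> R f}"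
  have RD: "f \<in> Ar C" "Cod C f = c" "g \<in> Ar C" "Cod C g = Dom C f" if "f \<in> S" "g \<in> R f" for f g
    using coverD[OF c S(1)] that R[of f] coverD[of "Dom C f" "R f" g] Dom_Ob by auto
  have "sieve C c T"
    unfolding sieve_def
  proof (intro conjI ballI impI)
    show "T \<subseteq> {f \<in> Ar C. Cod C f = c}"
      using RD Cmp_Ar by (auto simp: T_def)
    fix k h assume k: "k \<in> T" and h: "h \<in> Ar C" "Cod C h = Dom C k"
    then obtain f g where fg: "f \<in> S" "g \<in> R f" "k = f \<cdot> g"
      by (auto simp: T_def)
    note * = RD[OF fg(1,2)]
    have "Dom C k = Dom C g"
      using fg * Cmp_Ar by auto
    then have "g \<cdot> h \<in> R f" "k \<cdot> h = f \<cdot> (g \<cdot> h)"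
      using fg * h R[OF fg(1)] cover_Cmp[of "Dom C f" "R f" g h] Dom_Ob
      by (auto intro: Cmp_Ar_assoc)
    then show "k \<cdot> h \<in> T"
      using fg(1) by (auto simp: T_def)
  qed
  moreover have "pull_sieve C f T \<in> J (Dom C f)" if f: "f \<in> S" for f
  proof (rule cover_superset)
    show "Dom C f \<in> Ob C" "R f \<in> J (Dom C f)"
      using R[OF f] coverD[OF c S(1) f] Dom_Ob by auto
    show "R f \<subseteq> pull_sieve C f T"
      using RD f by (auto simp: pull_sieve_def T_def)
    have *: "f \<in> Ar C" using coverD[OF c S(1) f] by simp
    show "sieve C (Dom C f) (pull_sieve C f T)"
      unfolding sieve_def
    proof (intro conjI ballI impI)
      fix g h assume g: "g \<in> pull_sieve C f T" and h: "h \<in> Ar C" "Cod C h = Dom C g"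
      then have "(f \<cdot> g) \<cdot> h \<in> T"
        using \<open>sieve C c T\<close> * Cmp_Ar[of f g] by (auto simp: sieve_def pull_sieve_def)
      then show "g \<cdot> h \<in> pull_sieve C f T"
        using g h * Cmp_Ar_assoc[of h g f] Cmp_Ar[of g h] by (auto simp: pull_sieve_def)
    qed (auto simp: pull_sieve_def)
  qed
  ultimately have "T \<in> J c"
    by (rule local[OF c S(1)])
  moreover have "\<forall>k\<in>T. Q' k"
    using R by (auto simp: T_def)
  ultimately show ?thesis
    by (auto simp: locally_def)
qed

lemma locally_conj:
  assumes "locally C J c Q" "locally C J c Q'" "c \<in> Ob C"
    and "\<And>f g. f \<in> Ar C \<Longrightarrow> Cod C f = c \<Longrightarrow> Q f \<Longrightarrow> g \<in> Ar C \<Longrightarrow> Cod C g = Dom C f \<Longrightarrow> Q (f \<cdot> g)"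
  shows "locally C J c (\<lambda>f. Q f \<and> Q' f)"
  by (rule locally_trans[OF assms(1,3)], rule locally_mono[OF locally_pull[OF assms(2)]])
    (use assms(4) Dom_Ob in auto)

end

section \<open>Presheaves and their morphisms through sections\<close>

lemma presheafD:
  assumes "is_presheaf U C F"
  shows Sec_Ob: "x \<in> Sec F c \<Longrightarrow> c \<in> Ob C"
    and Res_Sec: "f \<in> Ar C \<Longrightarrow> x \<in> Sec F (Cod C f) \<Longrightarrow> Res F f x \<in> Sec F (Dom C f)"
    and Res_Idn: "x \<in> Sec F c \<Longrightarrow> Res F (Idn C c) x = x"
    and Res_Cmp: "f \<in> Ar C \<Longrightarrow> g \<in> Ar C \<Longrightarrow> Cod C g = Dom C f \<Longrightarrow> x \<in> Sec F (Cod C f) \<Longrightarrow>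
      Res F (f \<cdot>\<^bsub>C\<^esub> g) x = Res F g (Res F f x)"
    and Sec_universe: "c \<in> Ob C \<Longrightarrow> Sec F c \<in> U"
proof -
  show Ob: "c \<in> Ob C" if "x \<in> Sec F c" for x c
    using that assms by (auto simp: is_presheaf_def)
  show "Res F f x \<in> Sec F (Dom C f)" if "f \<in> Ar C" "x \<in> Sec F (Cod C f)" for f x
  proof -
    have "Res F f \<in> Sec F (Cod C f) \<rightarrow>\<^sub>E Sec F (Dom C f)"
      using assms that(1) by (simp add: is_presheaf_def)
    then show ?thesis using that(2) by auto
  qed
qed (use assms in \<open>auto simp: is_presheaf_def\<close>)

text \<open>
  A morphism of presheaves is determined by its values on sections, so identities between morphisms
  are checked there. The arrow with given values is cut down to the normal form demanded of arrows.
\<close>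

definition ap :: "('o, 'a, 'u) psh_arr \<Rightarrow> 'o \<Rightarrow> 'u \<Rightarrow> 'u" where
  "ap f = snd (snd f)"

definition psh_mor :: "('o, 'a, 'u) presheaf \<Rightarrow> ('o, 'a, 'u) presheaf \<Rightarrow> ('o \<Rightarrow> 'u \<Rightarrow> 'u) \<Rightarrow>
    ('o, 'a, 'u) psh_arr" where
  "psh_mor F G \<tau> = (F, G, \<lambda>c. restrict (\<tau> c) (Sec F c))"

lemma psh_hom_iff:
  "f \<in> hom (presheaf_cat U C) F G \<longleftrightarrow> is_presheaf U C F \<and> is_presheaf U C G \<and>
    f = (F, G, ap f) \<and> presheaf_map C F G (ap f)"
  by (cases f) (auto simp: hom_def presheaf_cat_def ap_def)

lemma psh_homD:
  assumes "f \<in> hom (presheaf_cat U C) F G"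
  shows psh_hom_presheaf: "is_presheaf U C F" "is_presheaf U C G"
    and ap_Sec: "x \<in> Sec F c \<Longrightarrow> ap f c x \<in> Sec G c"
    and ap_Res: "k \<in> Ar C \<Longrightarrow> x \<in> Sec F (Cod C k) \<Longrightarrow>
      ap f (Dom C k) (Res F k x) = Res G k (ap f (Cod C k) x)"
proof -
  show "ap f c x \<in> Sec G c" if "x \<in> Sec F c" for c x
  proof -
    have "ap f c \<in> Sec F c \<rightarrow>\<^sub>E Sec G c"
      using assms by (simp add: psh_hom_iff presheaf_map_def)
    then show ?thesis using that by auto
  qed
qed (use assms in \<open>auto simp: psh_hom_iff presheaf_map_def\<close>)

lemma psh_hom_eqI:
  assumes f: "f \<in> hom (presheaf_cat U C) F G" and g: "g \<in> hom (presheaf_cat U C) F G"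
    and eq: "\<And>c x. x \<in> Sec F c \<Longrightarrow> ap f c x = ap g c x"
  shows "f = g"
proof -
  have "ap f c = ap g c" for c
  proof (rule PiE_ext)
    show "ap f c \<in> Sec F c \<rightarrow>\<^sub>E Sec G c" "ap g c \<in> Sec F c \<rightarrow>\<^sub>E Sec G c"
      using f g by (simp_all add: psh_hom_iff presheaf_map_def)
  qed (rule eq)
  then have "ap f = ap g" by auto
  then show ?thesis
    using f g by (metis psh_hom_iff)
qed

lemma psh_mor_hom:
  assumes F: "is_presheaf U C F" and G: "is_presheaf U C G"
    and \<tau>: "\<And>c x. x \<in> Sec F c \<Longrightarrow> \<tau> c x \<in> Sec G c"
    and nat: "\<And>k x. k \<in> Ar C \<Longrightarrow> x \<in> Sec F (Cod C k) \<Longrightarrow>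
      \<tau> (Dom C k) (Res F k x) = Res G k (\<tau> (Cod C k) x)"
  shows "psh_mor F G \<tau> \<in> hom (presheaf_cat U C) F G"
  using assms Res_Sec[OF F]
  by (auto simp: psh_hom_iff presheaf_map_def psh_mor_def ap_def)

lemma ap_psh_mor: "x \<in> Sec F c \<Longrightarrow> ap (psh_mor F G \<tau>) c x = \<tau> c x"
  by (simp add: ap_def psh_mor_def)

lemma ap_Cmp:
  assumes "f \<in> hom (presheaf_cat U C) F G" "g \<in> hom (presheaf_cat U C) G H" "x \<in> Sec F c"
  shows "ap (g \<cdot>\<^bsub>presheaf_cat U C\<^esub> f) c x = ap g c (ap f c x)"
  using assms(1,2)[unfolded psh_hom_iff] assms(3)
  by (cases f; cases g) (auto simp: presheaf_cat_def ap_def compose_def)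

lemma ap_Idn: "x \<in> Sec F c \<Longrightarrow> ap (Idn (presheaf_cat U C) F) c x = x"
  by (simp add: presheaf_cat_def ap_def)

lemma psh_Cmp_hom:
  assumes f: "f \<in> hom (presheaf_cat U C) F G" and g: "g \<in> hom (presheaf_cat U C) G H"
  shows "g \<cdot>\<^bsub>presheaf_cat U C\<^esub> f \<in> hom (presheaf_cat U C) F H"
proof -
  have "g \<cdot>\<^bsub>presheaf_cat U C\<^esub> f = psh_mor F H (\<lambda>c x. ap g c (ap f c x))"
    using f g unfolding psh_hom_iff
    by (cases f; cases g) (auto simp: presheaf_cat_def ap_def psh_mor_def compose_def)
  moreover have "psh_mor F H (\<lambda>c x. ap g c (ap f c x)) \<in> hom (presheaf_cat U C) F H"
    using psh_homD[OF f] psh_homD[OF g] by (intro psh_mor_hom) auto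
  ultimately show ?thesis by simp
qed

lemma psh_Idn_hom:
  assumes "is_presheaf U C F"
  shows "Idn (presheaf_cat U C) F \<in> hom (presheaf_cat U C) F F"
proof -
  have "psh_mor F F (\<lambda>c x. x) \<in> hom (presheaf_cat U C) F F"
    using assms by (intro psh_mor_hom) auto
  then show ?thesis
    by (simp add: presheaf_cat_def psh_mor_def)
qed

lemma presheaf_category: "category (presheaf_cat U C)"
proof
  fix f assume "f \<in> Ar (presheaf_cat U C)"
  then show "Dom (presheaf_cat U C) f \<in> Ob (presheaf_cat U C)"
    "Cod (presheaf_cat U C) f \<in> Ob (presheaf_cat U C)"
    by (auto simp: presheaf_cat_def)
next
  fix F assume "F \<in> Ob (presheaf_cat U C)"
  then show "Idn (presheaf_cat U C) F \<in> hom (presheaf_cat U C) F F"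
    by (intro psh_Idn_hom) (simp add: presheaf_cat_def)
next
  fix F G f assume f: "f \<in> hom (presheaf_cat U C) F G"
  note * = psh_Idn_hom[OF psh_hom_presheaf(1)[OF f]] psh_Idn_hom[OF psh_hom_presheaf(2)[OF f]]
  show "f \<cdot>\<^bsub>presheaf_cat U C\<^esub> Idn (presheaf_cat U C) F = f"
    by (rule psh_hom_eqI[OF psh_Cmp_hom[OF *(1) f] f])
      (simp add: ap_Cmp[OF *(1) f] ap_Idn)
  show "Idn (presheaf_cat U C) G \<cdot>\<^bsub>presheaf_cat U C\<^esub> f = f"
    by (rule psh_hom_eqI[OF psh_Cmp_hom[OF f *(2)] f])
      (simp add: ap_Cmp[OF f *(2)] ap_Idn ap_Sec[OF f])
next
  fix f F G g H h K
  assume f: "f \<in> hom (presheaf_cat U C) F G" and g: "g \<in> hom (presheaf_cat U C) G H"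
    and h: "h \<in> hom (presheaf_cat U C) H K"
  note gf = psh_Cmp_hom[OF f g] and hg = psh_Cmp_hom[OF g h]
  show "h \<cdot>\<^bsub>presheaf_cat U C\<^esub> g \<cdot>\<^bsub>presheaf_cat U C\<^esub> f =
      h \<cdot>\<^bsub>presheaf_cat U C\<^esub> (g \<cdot>\<^bsub>presheaf_cat U C\<^esub> f)"
    by (rule psh_hom_eqI[OF psh_Cmp_hom[OF f hg] psh_Cmp_hom[OF gf h]])
      (simp add: ap_Cmp[OF f hg] ap_Cmp[OF gf h] ap_Cmp[OF f g] ap_Cmp[OF g h] ap_Sec[OF f])
qed (rule psh_Cmp_hom)

lemma full_sub_category:
  assumes "category A" "X \<subseteq> Ob A"
  shows "category (full_sub A X)"
proof -
  interpret category A by fact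
  have hom: "hom (full_sub A X) a b = (if a \<in> X \<and> b \<in> X then hom A a b else {})" for a b
    by (auto simp: hom_def full_sub_def)
  have eqs: "Cmp (full_sub A X) = Cmp A" "Idn (full_sub A X) = Idn A"
    by (simp_all add: full_sub_def)
  show ?thesis
  proof
    fix f assume "f \<in> Ar (full_sub A X)"
    then show "Dom (full_sub A X) f \<in> Ob (full_sub A X)" "Cod (full_sub A X) f \<in> Ob (full_sub A X)"
      by (auto simp: full_sub_def)
  next
    fix a assume "a \<in> Ob (full_sub A X)"
    then show "Idn (full_sub A X) a \<in> hom (full_sub A X) a a"
      using assms(2) Idn_hom unfolding hom by (auto simp: full_sub_def)
  qed (auto simp: hom eqs Cmp_hom Cmp_Idn Idn_Cmp Cmp_assoc split: if_splits)
qed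

lemma sheaf_cat_simps:
  "Cmp (sheaf_cat U C J) = Cmp (presheaf_cat U C)" "Idn (sheaf_cat U C J) = Idn (presheaf_cat U C)"
  "Dom (sheaf_cat U C J) = Dom (presheaf_cat U C)" "Cod (sheaf_cat U C J) = Cod (presheaf_cat U C)"
  "F \<in> Ob (sheaf_cat U C J) \<longleftrightarrow> is_sheaf U C J F" "F \<in> Ob (presheaf_cat U C) \<longleftrightarrow> is_presheaf U C F"
  "f \<in> hom (sheaf_cat U C J) F G \<longleftrightarrow>
    f \<in> hom (presheaf_cat U C) F G \<and> is_sheaf U C J F \<and> is_sheaf U C J G"
  by (auto simp: sheaf_cat_def full_sub_def presheaf_cat_def hom_def)

lemma sheaf_presheaf: "is_sheaf U C J F \<Longrightarrow> is_presheaf U C F"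
  by (simp add: is_sheaf_def)

lemma sheaf_category: "category (sheaf_cat U C J)"
  unfolding sheaf_cat_def
  by (rule full_sub_category[OF presheaf_category]) (auto simp: sheaf_cat_simps sheaf_presheaf)

lemma incl_sheaf_functor: "cat_functor (sheaf_cat U C J) (presheaf_cat U C) incl"
  unfolding cat_functor_def cat_functor_axioms_def
  by (auto simp: presheaf_category sheaf_category incl_def sheaf_cat_simps sheaf_presheaf)

lemma incl_simps: "FO incl x = x" "FA incl f = f"
  by (simp_all add: incl_def)

lemma incl_functor: "category C \<Longrightarrow> cat_functor C C incl"
  unfolding cat_functor_def cat_functor_axioms_def by (auto simp: incl_def)

context cat_functor
begin

lemma Sec_precomp: "c \<in> Ob C \<Longrightarrow> Sec (FO (precomp C F) P) c = Sec P (FO F c)"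
  by (simp add: precomp_def)

lemma Sec_precompD: "x \<in> Sec (FO (precomp C F) P) c \<Longrightarrow> c \<in> Ob C \<and> x \<in> Sec P (FO F c)"
  by (auto simp: precomp_def split: if_splits)

lemma Res_precomp: "f \<in> Ar C \<Longrightarrow> Res (FO (precomp C F) P) f = Res P (FA F f)"
  by (simp add: precomp_def)

lemma precomp_presheaf:
  assumes "is_presheaf U D P"
  shows "is_presheaf U C (FO (precomp C F) P)"
  unfolding is_presheaf_def
proof (intro conjI ballI allI impI)
  fix f assume f: "f \<in> Ar C"
  have "Res P (FA F f) \<in> Sec P (Cod D (FA F f)) \<rightarrow>\<^sub>E Sec P (Dom D (FA F f))"
    using assms FA_Ar(1)[OF f] by (simp add: is_presheaf_def)
  then show "Res (FO (precomp C F) P) f \<in>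
      Sec (FO (precomp C F) P) (Cod C f) \<rightarrow>\<^sub>E Sec (FO (precomp C F) P) (Dom C f)"
    using f C.Dom_Ob C.Cod_Ob FA_Ar by (simp add: Res_precomp Sec_precomp)
next
  fix f g x
  assume f: "f \<in> Ar C" and g: "g \<in> Ar C" and fg: "Cod C g = Dom C f"
    and "x \<in> Sec (FO (precomp C F) P) (Cod C f)"
  then have "x \<in> Sec P (Cod D (FA F f))"
    using FA_Ar by (simp add: Sec_precomp C.Cod_Ob)
  then show "Res (FO (precomp C F) P) (f \<cdot>\<^bsub>C\<^esub> g) x =
      Res (FO (precomp C F) P) g (Res (FO (precomp C F) P) f x)"
    using f g fg FA_Ar C.Cmp_Ar by (simp add: Res_precomp FA_Cmp_Ar Res_Cmp[OF assms])
next
  fix c assume "c \<in> Ob C"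
  then show "Sec (FO (precomp C F) P) c \<in> U"
    using FO_Ob Sec_universe[OF assms] by (simp add: Sec_precomp)
next
  fix c x assume "c \<in> Ob C" "x \<in> Sec (FO (precomp C F) P) c"
  then show "Res (FO (precomp C F) P) (Idn C c) x = x"
    by (simp add: Sec_precomp Res_precomp C.Idn_Ar FA_Idn Res_Idn[OF assms])
qed (auto simp: precomp_def)

lemma ap_precomp: "c \<in> Ob C \<Longrightarrow> ap (FA (precomp C F) t) c x = ap t (FO F c) x"
  by (cases t) (simp add: precomp_def ap_def)

lemma precomp_hom:
  assumes "t \<in> hom (presheaf_cat U D) P Q"
  shows "FA (precomp C F) t \<in> hom (presheaf_cat U C) (FO (precomp C F) P) (FO (precomp C F) Q)"
  unfolding psh_hom_iff
proof (intro conjI)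
  show "is_presheaf U C (FO (precomp C F) P)" "is_presheaf U C (FO (precomp C F) Q)"
    using psh_hom_presheaf[OF assms] by (auto intro: precomp_presheaf)
  show "FA (precomp C F) t =
      (FO (precomp C F) P, FO (precomp C F) Q, ap (FA (precomp C F) t))"
    using assms by (cases t) (auto simp: psh_hom_iff precomp_def ap_def)
  show "presheaf_map C (FO (precomp C F) P) (FO (precomp C F) Q) (ap (FA (precomp C F) t))"
    unfolding presheaf_map_def
  proof (intro conjI allI ballI)
    fix c show "ap (FA (precomp C F) t) c \<in>
        Sec (FO (precomp C F) P) c \<rightarrow>\<^sub>E Sec (FO (precomp C F) Q) c"
    proof (cases "c \<in> Ob C")
      case True
      have "ap t (FO F c) \<in> Sec P (FO F c) \<rightarrow>\<^sub>E Sec Q (FO F c)"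
        using assms by (simp add: psh_hom_iff presheaf_map_def)
      moreover have "ap (FA (precomp C F) t) c = ap t (FO F c)"
        by (rule ext) (rule ap_precomp[OF True])
      ultimately show ?thesis
        using True by (simp add: Sec_precomp)
    next
      case False
      then show ?thesis by (cases t) (auto simp: precomp_def ap_def)
    qed
  next
    fix f x assume "f \<in> Ar C" "x \<in> Sec (FO (precomp C F) P) (Cod C f)"
    then show "ap (FA (precomp C F) t) (Dom C f) (Res (FO (precomp C F) P) f x) =
        Res (FO (precomp C F) Q) f (ap (FA (precomp C F) t) (Cod C f) x)"
      using ap_Res[OF assms FA_Ar(1), of f x] FA_Ar[of f]
      by (simp add: ap_precomp Sec_precomp Res_precomp C.Dom_Ob C.Cod_Ob)
  qed
qed

lemma precomp_functor: "cat_functor (presheaf_cat U D) (presheaf_cat U C) (precomp C F)"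
proof -
  interpret P: category "presheaf_cat U C" by (rule presheaf_category)
  interpret Q: category "presheaf_cat U D" by (rule presheaf_category)
  show ?thesis
  proof
    fix P assume "P \<in> Ob (presheaf_cat U D)"
    then have P: "is_presheaf U D P" by (simp add: sheaf_cat_simps)
    then show "FO (precomp C F) P \<in> Ob (presheaf_cat U C)"
      by (simp add: sheaf_cat_simps precomp_presheaf)
    show "FA (precomp C F) (Idn (presheaf_cat U D) P) =
        Idn (presheaf_cat U C) (FO (precomp C F) P)"
      by (rule psh_hom_eqI[OF precomp_hom[OF psh_Idn_hom[OF P]]
            psh_Idn_hom[OF precomp_presheaf[OF P]]])
        (auto dest!: Sec_precompD simp: ap_precomp ap_Idn Sec_precomp)
  next
    fix f P Q g R
    assume f: "f \<in> hom (presheaf_cat U D) P Q" and g: "g \<in> hom (presheaf_cat U D) Q R"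
    show "FA (precomp C F) (g \<cdot>\<^bsub>presheaf_cat U D\<^esub> f) =
        FA (precomp C F) g \<cdot>\<^bsub>presheaf_cat U C\<^esub> FA (precomp C F) f"
      by (rule psh_hom_eqI[OF precomp_hom[OF psh_Cmp_hom[OF f g]]
            psh_Cmp_hom[OF precomp_hom[OF f] precomp_hom[OF g]]])
        (auto dest!: Sec_precompD simp: ap_precomp Sec_precomp ap_Cmp[OF f g]
          ap_Cmp[OF precomp_hom[OF f] precomp_hom[OF g]])
  qed (rule precomp_hom)
qed

end

text \<open>
  For identity functors, precomposition returns the very same presheaf because presheaves are normalised
  outside their domains. This lets sheafification appear as the inverse image along the identity.
\<close>

lemma precomp_incl:
  assumes "is_presheaf U C F"
  shows "FO (precomp C incl) F = F"
proof (rule presheaf.equality)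
  show "Sec (FO (precomp C incl) F) = Sec F"
    using assms by (auto simp: precomp_def incl_def is_presheaf_def fun_eq_iff)
  show "Res (FO (precomp C incl) F) = Res F"
    using assms by (auto simp: precomp_def incl_def is_presheaf_def fun_eq_iff)
qed simp


section \<open>Sheaves\<close>

locale small_site = grothendieck_topology C J
  for U :: "'u set set" and C :: "('o, 'a) cat" (structure) and J +
  assumes universe: "universe U" and site: "site U C J"
begin

sublocale Sh: category "sheaf_cat U C J"
  by (rule sheaf_category)

lemma sheaf_separated:
  assumes F: "is_sheaf U C J F" and x: "x \<in> Sec F c" and y: "y \<in> Sec F c"
    and eq: "locally C J c (\<lambda>f. Res F f x = Res F f y)"
  shows "x = y"
proof -
  note P = sheaf_presheaf[OF F]
  have c: "c \<in> Ob C" using Sec_Ob[OF P x] .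
  obtain S where S: "S \<in> J c" "\<And>f. f \<in> S \<Longrightarrow> Res F f x = Res F f y"
    using eq by (auto simp: locally_def)
  have "matching_family C F S (\<lambda>f. Res F f x)"
    unfolding matching_family_def
    using coverD[OF c S(1)] Res_Sec[OF P] Res_Cmp[OF P] x by auto
  then have "\<exists>!z. z \<in> Sec F c \<and> (\<forall>f\<in>S. Res F f z = Res F f x)"
    using F c S(1) by (simp add: is_sheaf_def)
  then show ?thesis
    using x y S(2) by metis
qed

text \<open>
  The local values are described by a relation V that is functional and stable under
  restriction. This avoids the choice of values on a covering, which would have to be shown to match.
\<close>

lemma sheaf_glue:
  assumes F: "is_sheaf U C J F" and c: "c \<in> Ob C"
    and ex: "locally C J c (\<lambda>f. \<exists>z. V f z)"
    and Sec: "\<And>f z. f \<in> Ar C \<Longrightarrow> Cod C f = c \<Longrightarrow> V f z \<Longrightarrow> z \<in> Sec F (Dom C f)"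
    and unique: "\<And>f z z'. f \<in> Ar C \<Longrightarrow> Cod C f = c \<Longrightarrow> V f z \<Longrightarrow> V f z' \<Longrightarrow> z = z'"
    and stable: "\<And>f g z. f \<in> Ar C \<Longrightarrow> Cod C f = c \<Longrightarrow> V f z \<Longrightarrow> g \<in> Ar C \<Longrightarrow>
      Cod C g = Dom C f \<Longrightarrow> V (f \<cdot> g) (Res F g z)"
  obtains x where "x \<in> Sec F c"
    "\<And>f z. f \<in> Ar C \<Longrightarrow> Cod C f = c \<Longrightarrow> V f z \<Longrightarrow> Res F f x = z"
proof -
  note P = sheaf_presheaf[OF F]
  obtain S where S: "S \<in> J c" "\<And>f. f \<in> S \<Longrightarrow> \<exists>z. V f z"
    using ex by (auto simp: locally_def)
  note SD = coverD[OF c S(1)]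
  define m where "m f = (SOME z. V f z)" for f
  have m: "V f (m f)" if "f \<in> S" for f
    unfolding m_def using S(2)[OF that] by (rule someI_ex)
  have "matching_family C F S m"
    unfolding matching_family_def
  proof (intro conjI ballI impI)
    show "m f \<in> Sec F (Dom C f)" if "f \<in> S" for f
      using Sec SD[OF that] m[OF that] by blast
    fix f g assume f: "f \<in> S" and g: "g \<in> Ar C" "Cod C g = Dom C f"
    then have "V (f \<cdot> g) (Res F g (m f))" "f \<cdot> g \<in> S"
      using stable SD m cover_Cmp[OF c S(1)] by auto
    then show "m (f \<cdot> g) = Res F g (m f)"
      using unique SD m by blast
  qed
  then have "\<exists>!x. x \<in> Sec F c \<and> (\<forall>f\<in>S. Res F f x = m f)"
    using F c S(1) by (simp add: is_sheaf_def)
  then obtain x where x: "x \<in> Sec F c" "\<And>f. f \<in> S \<Longrightarrow> Res F f x = m f"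
    by blast
  show thesis
  proof (rule that[OF x(1)])
    fix f z assume f: "f \<in> Ar C" "Cod C f = c" and z: "V f z"
    show "Res F f x = z"
    proof (rule sheaf_separated[OF F])
      show "Res F f x \<in> Sec F (Dom C f)" "z \<in> Sec F (Dom C f)"
        using Res_Sec[OF P f(1)] x(1) f Sec z by auto
      have "locally C J c (\<lambda>f. f \<in> S)"
        using S(1) by (auto simp: locally_def)
      from locally_pull[OF this f]
      show "locally C J (Dom C f) (\<lambda>g. Res F g (Res F f x) = Res F g z)"
      proof (rule locally_mono)
        fix g assume g: "g \<in> Ar C" "Cod C g = Dom C f" and fg: "f \<cdot> g \<in> S"
        have "V (f \<cdot> g) (Res F g z)"
          using stable f z g by auto
        then have "Res F g z = m (f \<cdot> g)"
          using m[OF fg] unique SD[OF fg] by auto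
        also have "\<dots> = Res F (f \<cdot> g) x"
          using x(2)[OF fg] by simp
        also have "\<dots> = Res F g (Res F f x)"
          using Res_Cmp[OF P f(1) g] x(1) f by simp
        finally show "Res F g (Res F f x) = Res F g z" by simp
      qed (use Dom_Ob f in auto)
    qed
  qed
qed

lemma sheaf_map_eqI:
  assumes F: "is_presheaf U C F" and H: "is_sheaf U C J H"
    and f: "f \<in> hom (presheaf_cat U C) F H" and g: "g \<in> hom (presheaf_cat U C) F H"
    and eq: "\<And>c x. x \<in> Sec F c \<Longrightarrow>
      locally C J c (\<lambda>k. ap f (Dom C k) (Res F k x) = ap g (Dom C k) (Res F k x))"
  shows "f = g"
proof (rule psh_hom_eqI[OF f g])
  fix c x assume x: "x \<in> Sec F c"
  show "ap f c x = ap g c x"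
    by (rule sheaf_separated[OF H ap_Sec[OF f x] ap_Sec[OF g x] locally_mono[OF eq[OF x]]])
      (use x ap_Res[OF f] ap_Res[OF g] Sec_Ob[OF F x] in auto)
qed

end


section \<open>Subsheaves\<close>

definition sub_presheaf :: "('o, 'a) cat \<Rightarrow> ('o, 'a, 'u) presheaf \<Rightarrow> ('o \<Rightarrow> 'u set) \<Rightarrow>
    ('o, 'a, 'u) presheaf" where
  "sub_presheaf C F Q = \<lparr>Sec = Q,
    Res = \<lambda>f. if f \<in> Ar C then restrict (Res F f) (Q (Cod C f)) else (\<lambda>_. undefined)\<rparr>"

context small_site
begin

context
  fixes F :: "('o, 'a, 'u) presheaf" and Q :: "'o \<Rightarrow> 'u set"
  assumes F: "is_sheaf U C J F" and Q: "\<And>c. Q c \<subseteq> Sec F c"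
    and Q_Res: "\<And>f x. f \<in> Ar C \<Longrightarrow> x \<in> Q (Cod C f) \<Longrightarrow> Res F f x \<in> Q (Dom C f)"
    and Q_local: "\<And>c x. x \<in> Sec F c \<Longrightarrow> locally C J c (\<lambda>f. Res F f x \<in> Q (Dom C f)) \<Longrightarrow> x \<in> Q c"
begin

lemma sub_presheaf: "is_presheaf U C (sub_presheaf C F Q)"
proof -
  note P = sheaf_presheaf[OF F]
  have "Q c \<in> U" if "c \<in> Ob C" for c
    using Sec_universe[OF P that] Q[of c] universe by (auto simp: universe_def)
  moreover have "Q c = {}" if "c \<notin> Ob C" for c
    using Q[of c] Sec_Ob[OF P] that by blast
  moreover have "Res F (f \<cdot> g) x = Res F g (Res F f x)"
    if "f \<in> Ar C" "g \<in> Ar C" "Cod C g = Dom C f" "x \<in> Q (Cod C f)" for f g x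
    using that Q Res_Cmp[OF P] by blast
  moreover have "Res F (Idn C c) x = x" if "x \<in> Q c" for c x
    using that Q Res_Idn[OF P] by blast
  ultimately show ?thesis
    using Q_Res unfolding is_presheaf_def sub_presheaf_def
    by (auto simp: Idn_Ar Cmp_Ar)
qed

lemma sub_sheaf: "is_sheaf U C J (sub_presheaf C F Q)"
  unfolding is_sheaf_def
proof (intro conjI ballI allI impI)
  fix c S m assume c: "c \<in> Ob C" and S: "S \<in> J c"
    and m: "matching_family C (sub_presheaf C F Q) S m"
  note SD = coverD[OF c S]
  have "matching_family C F S m"
    using m SD subsetD[OF Q] by (simp add: matching_family_def sub_presheaf_def)
  then have ex: "\<exists>!x. x \<in> Sec F c \<and> (\<forall>f\<in>S. Res F f x = m f)"
    using F c S by (simp add: is_sheaf_def)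
  then obtain x where x: "x \<in> Sec F c" "\<And>f. f \<in> S \<Longrightarrow> Res F f x = m f"
    by blast
  have "locally C J c (\<lambda>f. Res F f x \<in> Q (Dom C f))"
    unfolding locally_def using S m x(2)
    by (intro bexI[OF _ S]) (auto simp: matching_family_def sub_presheaf_def)
  then have xQ: "x \<in> Q c"
    by (rule Q_local[OF x(1)])
  show "\<exists>!x. x \<in> Sec (sub_presheaf C F Q) c \<and> (\<forall>f\<in>S. Res (sub_presheaf C F Q) f x = m f)"
  proof (rule ex1I[of _ x])
    show "x \<in> Sec (sub_presheaf C F Q) c \<and> (\<forall>f\<in>S. Res (sub_presheaf C F Q) f x = m f)"
      using xQ x(2) SD by (simp add: sub_presheaf_def)
    fix y assume "y \<in> Sec (sub_presheaf C F Q) c \<and> (\<forall>f\<in>S. Res (sub_presheaf C F Q) f y = m f)"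
    then have "y \<in> Sec F c \<and> (\<forall>f\<in>S. Res F f y = m f)"
      using subsetD[OF Q] SD by (auto simp: sub_presheaf_def)
    then show "y = x" using ex x by blast
  qed
qed (rule sub_presheaf)

lemma sub_presheaf_incl:
  "psh_mor (sub_presheaf C F Q) F (\<lambda>_ x. x) \<in> hom (presheaf_cat U C) (sub_presheaf C F Q) F"
  using Q by (intro psh_mor_hom sub_presheaf sheaf_presheaf[OF F]) (auto simp: sub_presheaf_def)

end

end


section \<open>Presheaves of sets of any type\<close>

text \<open>
  A set-valued functor whose values fit into the universe is copied into the universe along
  chosen injections, as the hom-sets are for representable presheaves.
\<close>

definition encode :: "'u set set \<Rightarrow> ('o, 'a) cat \<Rightarrow> ('o \<Rightarrow> 'x set) \<Rightarrow> ('a \<Rightarrow> 'x \<Rightarrow> 'x) \<Rightarrow>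
    ('o, 'a, 'u) presheaf" where
  "encode U C X r = \<lparr>
    Sec = \<lambda>c. if c \<in> Ob C then enc U (X c) ` X c else {},
    Res = \<lambda>f. if f \<in> Ar C
      then (\<lambda>x \<in> enc U (X (Cod C f)) ` X (Cod C f).
              enc U (X (Dom C f)) (r f (inv_into (X (Cod C f)) (enc U (X (Cod C f))) x)))
      else (\<lambda>_. undefined)\<rparr>"

locale set_presheaf = category C
  for U :: "'u set set" and C :: "('o, 'a) cat" (structure)
    and X :: "'o \<Rightarrow> 'x set" and r :: "'a \<Rightarrow> 'x \<Rightarrow> 'x" +
  assumes fits: "c \<in> Ob C \<Longrightarrow> fits U (X c)"
    and r_mem: "f \<in> Ar C \<Longrightarrow> x \<in> X (Cod C f) \<Longrightarrow> r f x \<in> X (Dom C f)"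
    and r_Idn: "c \<in> Ob C \<Longrightarrow> x \<in> X c \<Longrightarrow> r (Idn C c) x = x"
    and r_Cmp: "f \<in> Ar C \<Longrightarrow> g \<in> Ar C \<Longrightarrow> Cod C g = Dom C f \<Longrightarrow> x \<in> X (Cod C f) \<Longrightarrow>
      r (f \<cdot> g) x = r g (r f x)"
begin

lemma Sec_encode: "c \<in> Ob C \<Longrightarrow> Sec (encode U C X r) c = enc U (X c) ` X c"
  by (simp add: encode_def)

lemma enc_Sec: "c \<in> Ob C \<Longrightarrow> x \<in> X c \<Longrightarrow> enc U (X c) x \<in> Sec (encode U C X r) c"
  by (simp add: Sec_encode)

lemma Sec_encodeE:
  assumes "s \<in> Sec (encode U C X r) c"
  obtains x where "c \<in> Ob C" "x \<in> X c" "s = enc U (X c) x"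
  using assms by (auto simp: encode_def split: if_splits)

lemma enc_eq: "c \<in> Ob C \<Longrightarrow> x \<in> X c \<Longrightarrow> y \<in> X c \<Longrightarrow> enc U (X c) x = enc U (X c) y \<longleftrightarrow> x = y"
  using inj_on_eq_iff[OF enc_inj[OF fits]] by blast

lemma Res_encode:
  "f \<in> Ar C \<Longrightarrow> x \<in> X (Cod C f) \<Longrightarrow>
    Res (encode U C X r) f (enc U (X (Cod C f)) x) = enc U (X (Dom C f)) (r f x)"
  by (simp add: encode_def inv_into_enc fits Cod_Ob)

lemma encode_presheaf: "is_presheaf U C (encode U C X r)"
  unfolding is_presheaf_def
proof (intro conjI ballI allI impI)
  fix c assume "c \<in> Ob C"
  then show "Sec (encode U C X r) c \<in> U"
    by (simp add: Sec_encode enc_in_universe fits)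
next
  fix f assume f: "f \<in> Ar C"
  then show "Res (encode U C X r) f \<in>
      Sec (encode U C X r) (Cod C f) \<rightarrow>\<^sub>E Sec (encode U C X r) (Dom C f)"
    by (auto simp: Dom_Ob Cod_Ob Res_encode r_mem Sec_encode)
      (simp add: encode_def)
next
  fix c x assume "c \<in> Ob C" "x \<in> Sec (encode U C X r) c"
  then show "Res (encode U C X r) (Idn C c) x = x"
    using Res_encode[OF Idn_Ar(1)] by (auto simp: Sec_encode Idn_Ar r_Idn)
next
  fix f g x assume "f \<in> Ar C" "g \<in> Ar C" "Cod C g = Dom C f"
    "x \<in> Sec (encode U C X r) (Cod C f)"
  then show "Res (encode U C X r) (f \<cdot> g) x =
      Res (encode U C X r) g (Res (encode U C X r) f x)"
    using Res_encode[of "f \<cdot> g"] Res_encode[of g]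
    by (auto simp: Sec_encode Cod_Ob Cmp_Ar Res_encode r_Cmp r_mem)
qed (auto simp: encode_def)

lemma encode_sheaf:
  assumes J: "grothendieck_topology C J"
    and separated: "\<And>c S x y. c \<in> Ob C \<Longrightarrow> S \<in> J c \<Longrightarrow> x \<in> X c \<Longrightarrow> y \<in> X c \<Longrightarrow>
      (\<And>f. f \<in> S \<Longrightarrow> r f x = r f y) \<Longrightarrow> x = y"
    and glue: "\<And>c S m. c \<in> Ob C \<Longrightarrow> S \<in> J c \<Longrightarrow> (\<And>f. f \<in> S \<Longrightarrow> m f \<in> X (Dom C f)) \<Longrightarrow>
      (\<And>f g. f \<in> S \<Longrightarrow> g \<in> Ar C \<Longrightarrow> Cod C g = Dom C f \<Longrightarrow> m (f \<cdot> g) = r g (m f)) \<Longrightarrow>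
      \<exists>x\<in>X c. \<forall>f\<in>S. r f x = m f"
  shows "is_sheaf U C J (encode U C X r)"
  unfolding is_sheaf_def
proof (intro conjI ballI allI impI)
  interpret grothendieck_topology C J by fact
  fix c S m assume c: "c \<in> Ob C" and S: "S \<in> J c"
    and m: "matching_family C (encode U C X r) S m"
  note SD = coverD[OF c S]
  define n where "n f = inv_into (X (Dom C f)) (enc U (X (Dom C f))) (m f)" for f
  have n: "n f \<in> X (Dom C f)" "m f = enc U (X (Dom C f)) (n f)" if "f \<in> S" for f
  proof -
    have "m f \<in> enc U (X (Dom C f)) ` X (Dom C f)"
      using m that unfolding matching_family_def Sec_encode[OF Dom_Ob[OF SD(1)[OF that]], symmetric]
      by blast
    then show "n f \<in> X (Dom C f)" "m f = enc U (X (Dom C f)) (n f)"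
      unfolding n_def by (rule inv_into_into, simp add: f_inv_into_f)
  qed
  have "n (f \<cdot> g) = r g (n f)" if f: "f \<in> S" and g: "g \<in> Ar C" "Cod C g = Dom C f" for f g
  proof -
    have fg: "f \<cdot> g \<in> S" "Dom C (f \<cdot> g) = Dom C g"
      using cover_Cmp[OF c S f g] SD[OF f] g Cmp_Ar by auto
    have "enc U (X (Dom C g)) (n (f \<cdot> g)) = Res (encode U C X r) g (m f)"
      using m f g fg n(2)[OF fg(1)] by (simp add: matching_family_def)
    also have "\<dots> = enc U (X (Dom C g)) (r g (n f))"
      using n[OF f] g Res_encode[OF g(1), of "n f"] by simp
    finally show ?thesis
      using enc_eq[OF Dom_Ob[OF g(1)]] n(1)[OF fg(1)] fg(2) r_mem[OF g(1)] n(1)[OF f] g(2) by simp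
  qed
  then obtain x where x: "x \<in> X c" "\<And>f. f \<in> S \<Longrightarrow> r f x = n f"
    using glue[OF c S n(1)] by blast
  have Res: "Res (encode U C X r) f (enc U (X c) y) = enc U (X (Dom C f)) (r f y)"
    if "f \<in> S" "y \<in> X c" for f y
    using Res_encode[OF SD(1)[OF that(1)]] that SD(2)[OF that(1)] by simp
  show "\<exists>!s. s \<in> Sec (encode U C X r) c \<and> (\<forall>f\<in>S. Res (encode U C X r) f s = m f)"
  proof (rule ex1I[of _ "enc U (X c) x"])
    show "enc U (X c) x \<in> Sec (encode U C X r) c \<and>
        (\<forall>f\<in>S. Res (encode U C X r) f (enc U (X c) x) = m f)"
      using c x Res n by (simp add: Sec_encode)
    fix s assume s: "s \<in> Sec (encode U C X r) c \<and> (\<forall>f\<in>S. Res (encode U C X r) f s = m f)"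
    then obtain y where y: "y \<in> X c" "s = enc U (X c) y"
      using c by (auto simp: Sec_encode)
    have "r f y = r f x" if f: "f \<in> S" for f
    proof -
      have "enc U (X (Dom C f)) (r f y) = m f"
        using bspec[OF conjunct2[OF s] f] unfolding y(2) Res[OF f y(1)] .
      also have "\<dots> = enc U (X (Dom C f)) (r f x)"
        using n(2)[OF f] x(2)[OF f] by simp
      finally have "enc U (X (Dom C f)) (r f y) = enc U (X (Dom C f)) (r f x)" .
      then show ?thesis
        using enc_eq[OF Dom_Ob[OF SD(1)[OF f]]] r_mem[OF SD(1)[OF f]] SD(2)[OF f] x(1) y(1)
        by simp
    qed
    then show "s = enc U (X c) x"
      using separated[OF c S y(1) x(1)] y(2) by simp
  qed
qed (rule encode_presheaf)

end

section \<open>Left adjoints from universal arrows\<close>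

lemma universal_arrowD:
  assumes "universal_arrow A B R a (b, u)"
  shows "b \<in> Ob B" "u \<in> hom A a (FO R b)"
    "b' \<in> Ob B \<Longrightarrow> v \<in> hom A a (FO R b') \<Longrightarrow> \<exists>!w. w \<in> hom B b b' \<and> FA R w \<cdot>\<^bsub>A\<^esub> u = v"
  using assms by (auto simp: universal_arrow_def)

locale has_left_adjoint = cat_functor B A R
  for B :: "('p, 'b) cat" and A :: "('o, 'a) cat" and R :: "('p, 'b, 'o, 'a) funct" +
  assumes universal_arrow_ex: "a \<in> Ob A \<Longrightarrow> \<exists>bu. universal_arrow A B R a bu"
begin

abbreviation "L \<equiv> left_adjoint_ob A B R"
abbreviation "u \<equiv> adj_unit A B R"

lemma adj_universal: "a \<in> Ob A \<Longrightarrow> universal_arrow A B R a (L a, u a)"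
  unfolding left_adjoint_ob_def adj_unit_def prod.collapse
  by (rule someI_ex[OF universal_arrow_ex])

lemma L_Ob: "a \<in> Ob A \<Longrightarrow> L a \<in> Ob B"
  and unit_hom: "a \<in> Ob A \<Longrightarrow> u a \<in> hom A a (FO R (L a))"
  using universal_arrowD[OF adj_universal] by auto

lemma transpose:
  assumes "a \<in> Ob A" "b \<in> Ob B" "v \<in> hom A a (FO R b)"
  shows transpose_hom: "transpose A B R a b v \<in> hom B (L a) b"
    and transpose_unit: "FA R (transpose A B R a b v) \<cdot>\<^bsub>A\<^esub> u a = v"
  using theI'[OF universal_arrowD(3)[OF adj_universal[OF assms(1)] assms(2,3)]]
  by (simp_all add: transpose_def)

lemma unit_cancel:
  assumes "a \<in> Ob A" "w \<in> hom B (L a) b" "w' \<in> hom B (L a) b"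
    "FA R w \<cdot>\<^bsub>A\<^esub> u a = FA R w' \<cdot>\<^bsub>A\<^esub> u a"
  shows "w = w'"
proof -
  have "FA R w' \<cdot>\<^bsub>A\<^esub> u a \<in> hom A a (FO R b)"
    by (rule D.Cmp_hom[OF unit_hom FA_hom]) fact+
  from universal_arrowD(3)[OF adj_universal[OF assms(1)] C.hom_Ob(2)[OF assms(2)] this]
  show ?thesis using assms(2-4) by blast
qed

lemma left_adjoint_simps:
  "FO (left_adjoint A B R) a = L a"
  "f \<in> hom A a a' \<Longrightarrow> FA (left_adjoint A B R) f = transpose A B R a (L a') (u a' \<cdot>\<^bsub>A\<^esub> f)"
  by (auto simp: left_adjoint_def hom_def)

lemma left_adjoint_hom:
  assumes f: "f \<in> hom A a a'"
  shows "FA (left_adjoint A B R) f \<in> hom B (L a) (L a')"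
    and left_adjoint_unit: "FA R (FA (left_adjoint A B R) f) \<cdot>\<^bsub>A\<^esub> u a = u a' \<cdot>\<^bsub>A\<^esub> f"
proof -
  note * = transpose[OF D.hom_Ob(1)[OF f] L_Ob[OF D.hom_Ob(2)[OF f]]
      D.Cmp_hom[OF f unit_hom[OF D.hom_Ob(2)[OF f]]]]
  show "FA (left_adjoint A B R) f \<in> hom B (L a) (L a')"
    "FA R (FA (left_adjoint A B R) f) \<cdot>\<^bsub>A\<^esub> u a = u a' \<cdot>\<^bsub>A\<^esub> f"
    using * by (simp_all add: left_adjoint_simps(2)[OF f])
qed

lemma left_adjoint_functor: "cat_functor A B (left_adjoint A B R)"
proof
  fix a assume a: "a \<in> Ob A"
  show "FO (left_adjoint A B R) a \<in> Ob B"
    by (simp add: left_adjoint_simps L_Ob a)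
  have "FA R (FA (left_adjoint A B R) (Idn A a)) \<cdot>\<^bsub>A\<^esub> u a = u a"
    using left_adjoint_unit[OF D.Idn_hom[OF a]] D.Cmp_Idn[OF unit_hom[OF a]] by simp
  also have "u a = FA R (Idn B (L a)) \<cdot>\<^bsub>A\<^esub> u a"
    using D.Idn_Cmp[OF unit_hom[OF a]] FA_Idn[OF L_Ob[OF a]] by simp
  finally show "FA (left_adjoint A B R) (Idn A a) = Idn B (FO (left_adjoint A B R) a)"
    unfolding left_adjoint_simps(1)
    by (rule unit_cancel[OF a left_adjoint_hom(1)[OF D.Idn_hom[OF a]] C.Idn_hom[OF L_Ob[OF a]]])
next
  fix a a' f assume "f \<in> hom A a a'"
  then show "FA (left_adjoint A B R) f \<in> hom B (FO (left_adjoint A B R) a) (FO (left_adjoint A B R) a')"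
    by (simp add: left_adjoint_hom left_adjoint_simps(1))
next
  fix f a a' g a''
  assume f: "f \<in> hom A a a'" and g: "g \<in> hom A a' a''"
  note Lf = left_adjoint_hom(1)[OF f] and Lg = left_adjoint_hom(1)[OF g]
  note gf = D.Cmp_hom[OF f g]
  note ua = unit_hom[OF D.hom_Ob(1)[OF f]] unit_hom[OF D.hom_Ob(1)[OF g]] unit_hom[OF D.hom_Ob(2)[OF g]]
  have "FA R (FA (left_adjoint A B R) g \<cdot>\<^bsub>B\<^esub> FA (left_adjoint A B R) f) \<cdot>\<^bsub>A\<^esub> u a =
      FA R (FA (left_adjoint A B R) g) \<cdot>\<^bsub>A\<^esub> (FA R (FA (left_adjoint A B R) f) \<cdot>\<^bsub>A\<^esub> u a)"
    using FA_Cmp[OF Lf Lg] D.Cmp_assoc[OF ua(1) FA_hom[OF Lf] FA_hom[OF Lg]] by simp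
  also have "\<dots> = (FA R (FA (left_adjoint A B R) g) \<cdot>\<^bsub>A\<^esub> u a') \<cdot>\<^bsub>A\<^esub> f"
    using left_adjoint_unit[OF f] D.Cmp_assoc[OF f ua(2) FA_hom[OF Lg]] by simp
  also have "\<dots> = u a'' \<cdot>\<^bsub>A\<^esub> (g \<cdot>\<^bsub>A\<^esub> f)"
    using left_adjoint_unit[OF g] D.Cmp_assoc[OF f g ua(3)] by simp
  also have "\<dots> = FA R (FA (left_adjoint A B R) (g \<cdot>\<^bsub>A\<^esub> f)) \<cdot>\<^bsub>A\<^esub> u a"
    using left_adjoint_unit[OF gf] by simp
  finally show "FA (left_adjoint A B R) (g \<cdot>\<^bsub>A\<^esub> f) =
      FA (left_adjoint A B R) g \<cdot>\<^bsub>B\<^esub> FA (left_adjoint A B R) f"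
    by (intro unit_cancel[OF D.hom_Ob(1)[OF f] left_adjoint_hom(1)[OF gf] C.Cmp_hom[OF Lf Lg]]) simp
qed

end

lemma universal_arrow_cong:
  assumes hom: "\<And>b. b \<in> Ob B \<Longrightarrow> hom A a (FO R b) = hom A' a (FO R' b)"
    and cmp: "\<And>b b' w u. w \<in> hom B b b' \<Longrightarrow> u \<in> hom A a (FO R b) \<Longrightarrow> b \<in> Ob B \<Longrightarrow>
      FA R w \<cdot>\<^bsub>A\<^esub> u = FA R' w \<cdot>\<^bsub>A'\<^esub> u"
  shows "universal_arrow A B R a bu \<longleftrightarrow> universal_arrow A' B R' a bu"
proof (cases bu)
  case (Pair b u)
  have "(w \<in> hom B b b' \<and> FA R w \<cdot>\<^bsub>A\<^esub> u = v) = (w \<in> hom B b b' \<and> FA R' w \<cdot>\<^bsub>A'\<^esub> u = v)"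
    if "b \<in> Ob B" "u \<in> hom A a (FO R b)" for w b' v
    using cmp[of w b b' u] that by auto
  then show ?thesis
    unfolding Pair universal_arrow_def prod.case using hom by (simp cong: conj_cong)
qed

lemma (in cat_functor) iso_image:
  assumes "iso C f"
  shows "iso D (FA F f)"
proof -
  obtain g where f: "f \<in> Ar C" and g: "g \<in> hom C (Cod C f) (Dom C f)"
    and eq: "g \<cdot>\<^bsub>C\<^esub> f = Idn C (Dom C f)" "f \<cdot>\<^bsub>C\<^esub> g = Idn C (Cod C f)"
    using assms by (auto simp: iso_def)
  have f': "f \<in> hom C (Dom C f) (Cod C f)"
    using f by (simp add: hom_def)
  have "FA F g \<cdot>\<^bsub>D\<^esub> FA F f = Idn D (FO F (Dom C f))" "FA F f \<cdot>\<^bsub>D\<^esub> FA F g = Idn D (FO F (Cod C f))"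
    using FA_Cmp[OF f' g] FA_Cmp[OF g f'] eq FA_Idn C.hom_Ob[OF f'] by simp_all
  then show ?thesis
    unfolding iso_def using FA_Ar[OF f] FA_hom[OF g] by auto
qed

lemma comp_functor:
  assumes "cat_functor A B F" "cat_functor B E G"
  shows "cat_functor A E (G \<odot> F)"
proof -
  interpret F: cat_functor A B F by fact
  interpret G: cat_functor B E G by fact
  show ?thesis
  proof
    fix f a b g c assume f: "f \<in> hom A a b" and g: "g \<in> hom A b c"
    show "FA (G \<odot> F) (g \<cdot>\<^bsub>A\<^esub> f) = FA (G \<odot> F) g \<cdot>\<^bsub>E\<^esub> FA (G \<odot> F) f"
      using F.FA_Cmp[OF f g] G.FA_Cmp[OF F.FA_hom[OF f] F.FA_hom[OF g]]
      by (simp add: comp_funct_def)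
  qed (auto simp: comp_funct_def F.FO_Ob G.FO_Ob F.FA_Idn G.FA_Idn intro: F.FA_hom G.FA_hom)
qed

section \<open>The universal sheaf along a continuous functor\<close>

context small_site
begin

text \<open>
  A section of a sheaf is determined by its restrictions to the objects of a dense set, which bounds the sheaves
  that are constructed below.
\<close>

definition dense :: "'o set" where
  "dense = (SOME G. G \<subseteq> Ob C \<and> small U G \<and>
    (\<forall>c\<in>Ob C. covering_family C J c {f \<in> Ar C. Cod C f = c \<and> Dom C f \<in> G}))"

lemma dense:
  "dense \<subseteq> Ob C" "small U dense"
  "c \<in> Ob C \<Longrightarrow> covering_family C J c {f \<in> Ar C. Cod C f = c \<and> Dom C f \<in> dense}"
proof -
  have "\<exists>G. G \<subseteq> Ob C \<and> small U G \<and>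
      (\<forall>c\<in>Ob C. covering_family C J c {f \<in> Ar C. Cod C f = c \<and> Dom C f \<in> G})"
    using site by (auto simp: site_def)
  from someI_ex[OF this] show "dense \<subseteq> Ob C" "small U dense"
    "c \<in> Ob C \<Longrightarrow> covering_family C J c {f \<in> Ar C. Cod C f = c \<and> Dom C f \<in> dense}"
    unfolding dense_def by auto
qed

lemma locally_dense:
  assumes "c \<in> Ob C"
    and "\<And>f g. f \<in> Ar C \<Longrightarrow> Cod C f = c \<Longrightarrow> Dom C f \<in> dense \<Longrightarrow> g \<in> Ar C \<Longrightarrow>
      Cod C g = Dom C f \<Longrightarrow> Q (f \<cdot> g)"
  shows "locally C J c Q"
  using dense(3)[OF assms(1)] assms(2)
  unfolding locally_def covering_family_def
  by (intro bexI[of _ "generated_sieve C {f \<in> Ar C. Cod C f = c \<and> Dom C f \<in> dense}"])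
    (auto simp: generated_sieve_def)

lemma small_hom: "a \<in> Ob C \<Longrightarrow> b \<in> Ob C \<Longrightarrow> small U (hom C a b)"
  using site by (auto simp: site_def)

definition dense_over :: "'o \<Rightarrow> 'a set" where
  "dense_over c = {f \<in> Ar C. Cod C f = c \<and> Dom C f \<in> dense}"

lemma small_dense_over:
  assumes "c \<in> Ob C"
  shows "small U (dense_over c)"
proof -
  have "dense_over c = (\<Union>a\<in>dense. hom C a c)"
    by (auto simp: dense_over_def hom_def)
  moreover have "small U (\<Union>a\<in>dense. hom C a c)"
    by (rule small_UN[OF universe dense(2)]) (use small_hom dense(1) assms in blast)
  ultimately show ?thesis by simp
qed

end

locale continuous_site =
  D: small_site U D K + D': small_site U D' K' + A: cat_functor D D' A
  for U :: "'u set set" and D :: "('p, 'b) cat" and K :: "'p \<Rightarrow> 'b set set"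
    and D' :: "('q, 'c) cat" and K' :: "'q \<Rightarrow> 'c set set" and A :: "('p, 'b, 'q, 'c) funct" +
  assumes continuous: "is_sheaf U D' K' H \<Longrightarrow> is_sheaf U D K (FO (precomp D A) H)"

text \<open>
  For a presheaf F on D consider all pairs of a sheaf H on D' and a morphism F \<rightarrow> H A. Their
  product would receive F and map to every H, but it is too large for the universe and has too many
  morphisms to H. The subsheaf B of the tuples that locally come from F has neither defect: there are few such
  tuples, and a morphism out of B is determined on F. Taking all targets at once makes the relations
  between the generators automatic, so that no quotient has to be formed.
\<close>

locale universal_sheaf = continuous_site U D K D' K' A
  for U :: "'u set set" and D :: "('p, 'b) cat" and K :: "'p \<Rightarrow> 'b set set"
    and D' :: "('q, 'c) cat" and K' :: "'q \<Rightarrow> 'c set set" and A :: "('p, 'b, 'q, 'c) funct" +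
  fixes F :: "('p, 'b, 'u) presheaf"
  assumes F: "is_presheaf U D F"
begin

definition targets :: "(('q, 'c, 'u) presheaf \<times> ('p, 'b, 'u) psh_arr) set" where
  "targets = {(H, t). is_sheaf U D' K' H \<and> t \<in> hom (presheaf_cat U D) F (FO (precomp D A) H)}"

definition tup_res where
  "tup_res v z = (\<lambda>i\<in>targets. Res (fst i) v (z i))"

definition germ where
  "germ d x w = (\<lambda>i\<in>targets. Res (fst i) w (ap (snd i) d x))"

definition germs where
  "germs e = (\<lambda>(d, x, w). germ d x w) ` (SIGMA d:D.dense. Sec F d \<times> hom D' e (FO A d))"

definition tuples where
  "tuples e = Pi\<^sub>E targets (\<lambda>i. Sec (fst i) e)"

definition elems where
  "elems e = {z \<in> tuples e. locally D' K' e (\<lambda>v. tup_res v z \<in> germs (Dom D' v))}"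

lemma targetsD:
  assumes "i \<in> targets"
  shows "is_sheaf U D' K' (fst i)" "is_presheaf U D' (fst i)"
    "snd i \<in> hom (presheaf_cat U D) F (FO (precomp D A) (fst i))"
    "x \<in> Sec F d \<Longrightarrow> ap (snd i) d x \<in> Sec (fst i) (FO A d)"
  using assms ap_Sec[of "snd i" U D F "FO (precomp D A) (fst i)" x d]
  by (auto simp: targets_def dest: sheaf_presheaf A.Sec_precompD)

lemma tup_res_tuples: "v \<in> Ar D' \<Longrightarrow> z \<in> tuples (Cod D' v) \<Longrightarrow> tup_res v z \<in> tuples (Dom D' v)"
  using targetsD(2) by (fastforce simp: tuples_def tup_res_def intro: Res_Sec)

lemma tuples_Sec: "z \<in> tuples e \<Longrightarrow> i \<in> targets \<Longrightarrow> z i \<in> Sec (fst i) e"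
  by (auto simp: tuples_def)

lemma tuples_eqI:
  assumes "y \<in> tuples e" "z \<in> tuples e" "\<And>i. i \<in> targets \<Longrightarrow> y i = z i"
  shows "y = z"
  using assms unfolding tuples_def by (rule PiE_ext)

lemma tup_res_Idn:
  assumes "e \<in> Ob D'" "z \<in> tuples e"
  shows "tup_res (Idn D' e) z = z"
proof (rule tuples_eqI)
  show "tup_res (Idn D' e) z \<in> tuples e"
    using tup_res_tuples[of "Idn D' e" z] assms by (simp add: D'.Idn_Ar)
  show "tup_res (Idn D' e) z i = z i" if i: "i \<in> targets" for i
    using Res_Idn[OF targetsD(2)[OF i] tuples_Sec[OF assms(2) i]] i by (simp add: tup_res_def)
qed (fact assms(2))

lemma tup_res_Cmp:
  assumes "f \<in> Ar D'" "g \<in> Ar D'" "Cod D' g = Dom D' f" "z \<in> tuples (Cod D' f)"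
  shows "tup_res (f \<cdot>\<^bsub>D'\<^esub> g) z = tup_res g (tup_res f z)"
  unfolding tup_res_def
  by (rule restrict_ext)
    (use assms in \<open>simp add: Res_Cmp[OF targetsD(2) _ _ _ tuples_Sec]\<close>)

lemma germ_tuples:
  assumes "x \<in> Sec F d" "w \<in> hom D' e (FO A d)"
  shows "germ d x w \<in> tuples e"
  unfolding tuples_def germ_def
  using Res_Sec[OF targetsD(2) homD(1)[OF assms(2)]] targetsD(4) homD[OF assms(2)] assms(1)
  by auto

lemma tup_res_germ:
  assumes "x \<in> Sec F d" "w \<in> hom D' (Cod D' v) (FO A d)" "v \<in> Ar D'"
  shows "tup_res v (germ d x w) = germ d x (w \<cdot>\<^bsub>D'\<^esub> v)"
  unfolding tup_res_def germ_def
  by (rule restrict_ext)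
    (use assms homD[OF assms(2)] in \<open>simp add: Res_Cmp[OF targetsD(2)] targetsD(4)\<close>)

lemma germs_stable:
  assumes "v \<in> Ar D'" "z \<in> germs (Cod D' v)"
  shows "tup_res v z \<in> germs (Dom D' v)"
proof -
  obtain d x w where z: "z = germ d x w" "d \<in> D.dense" "x \<in> Sec F d" "w \<in> hom D' (Cod D' v) (FO A d)"
    using assms(2) by (auto simp: germs_def)
  have "w \<cdot>\<^bsub>D'\<^esub> v \<in> hom D' (Dom D' v) (FO A d)"
    using z(4) assms(1) D'.Cmp_Ar by (auto simp: hom_def)
  then show ?thesis
    using z tup_res_germ[OF z(3,4) assms(1)] by (force simp: germs_def)
qed

lemma germs_tuples: "germs e \<subseteq> tuples e"
  by (auto simp: germs_def intro: germ_tuples)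

lemma germs_elems:
  assumes "z \<in> germs e" "e \<in> Ob D'"
  shows "z \<in> elems e"
  using assms germs_tuples germs_stable
  by (auto simp: elems_def intro!: D'.locally_everywhere)

lemma elems_tuples: "z \<in> elems e \<Longrightarrow> z \<in> tuples e"
  by (simp add: elems_def)

lemma elems_locally:
  "z \<in> elems e \<Longrightarrow> locally D' K' e (\<lambda>v. tup_res v z \<in> germs (Dom D' v))"
  by (simp add: elems_def)

lemma tuples_separated:
  assumes y: "y \<in> tuples e" and z: "z \<in> tuples e"
    and eq: "locally D' K' e (\<lambda>v. tup_res v y = tup_res v z)" and e: "e \<in> Ob D'"
  shows "y = z"
proof (rule tuples_eqI[OF y z])
  fix i assume i: "i \<in> targets"
  show "y i = z i"
  proof (rule D'.sheaf_separated[OF targetsD(1)[OF i]])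
    show "y i \<in> Sec (fst i) e" "z i \<in> Sec (fst i) e"
      using y z i by (auto simp: tuples_def)
    show "locally D' K' e (\<lambda>v. Res (fst i) v (y i) = Res (fst i) v (z i))"
      by (rule D'.locally_mono[OF eq e]) (use i in \<open>auto simp: tup_res_def dest!: fun_cong[of _ _ i]\<close>)
  qed
qed

text \<open>
  The product of all the targets is too large for the universe, but a locally generated tuple is
  determined by those of its restrictions along arrows from the dense set that are germs, and
  there are few germs.
\<close>

lemma fits_elems:
  assumes e: "e \<in> Ob D'"
  shows "fits U (elems e)"
proof (rule fits_inj[OF D.universe])
  let ?code = "\<lambda>z. \<lambda>v\<in>D'.dense_over e. if tup_res v z \<in> germs (Dom D' v) then Some (tup_res v z) else None"
  have "fits U (germs a)" if "a \<in> Ob D'" for a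
    unfolding germs_def
    using D.dense A.FO_Ob that
    by (intro fits_image fits_Sigma fits_Times fits_member D.universe fits_small D'.small_hom
        Sec_universe[OF F]) auto
  then show "fits U (Pi\<^sub>E (D'.dense_over e) (\<lambda>v. insert None (Some ` germs (Dom D' v))))"
    using D'.small_dense_over[OF e] D'.dense(1)
    by (intro fits_PiE fits_option D.universe) (auto simp: D'.dense_over_def)
  show "?code ` elems e \<subseteq> Pi\<^sub>E (D'.dense_over e) (\<lambda>v. insert None (Some ` germs (Dom D' v)))"
    by auto
  show "inj_on ?code (elems e)"
  proof (rule inj_onI)
    fix y z assume y: "y \<in> elems e" and z: "z \<in> elems e" and eq: "?code y = ?code z"
    have yt: "y \<in> tuples e" and zt: "z \<in> tuples e"
      using y z by (auto simp: elems_tuples)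
    show "y = z"
    proof (rule tuples_separated[OF yt zt _ e], rule D'.locally_trans[OF elems_locally[OF y] e])
      fix v assume v: "v \<in> Ar D'" "Cod D' v = e" and yv: "tup_res v y \<in> germs (Dom D' v)"
      show "locally D' K' (Dom D' v) (\<lambda>g. tup_res (v \<cdot>\<^bsub>D'\<^esub> g) y = tup_res (v \<cdot>\<^bsub>D'\<^esub> g) z)"
      proof (rule D'.locally_dense)
        fix g h assume g: "g \<in> Ar D'" "Cod D' g = Dom D' v" "Dom D' g \<in> D'.dense"
          and h: "h \<in> Ar D'" "Cod D' h = Dom D' g"
        note vg = D'.Cmp_Ar[OF v(1) g(1,2)]
        have over: "v \<cdot>\<^bsub>D'\<^esub> g \<in> D'.dense_over e"
          using vg v(2) g(3) by (simp add: D'.dense_over_def)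
        have "tup_res (v \<cdot>\<^bsub>D'\<^esub> g) y \<in> germs (Dom D' (v \<cdot>\<^bsub>D'\<^esub> g))"
          using germs_stable[of g "tup_res v y"] g yv vg tup_res_Cmp[OF v(1) g(1,2)] yt v(2) by simp
        then have "tup_res (v \<cdot>\<^bsub>D'\<^esub> g) y = tup_res (v \<cdot>\<^bsub>D'\<^esub> g) z"
          using fun_cong[OF eq, of "v \<cdot>\<^bsub>D'\<^esub> g"] over by (simp split: if_splits)
        then show "tup_res (v \<cdot>\<^bsub>D'\<^esub> (g \<cdot>\<^bsub>D'\<^esub> h)) y = tup_res (v \<cdot>\<^bsub>D'\<^esub> (g \<cdot>\<^bsub>D'\<^esub> h)) z"
          using tup_res_Cmp[OF vg(1) h(1)] vg h g v yt zt D'.Cmp_Ar_assoc[OF h(1) g(1) v(1)] by simp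
      qed (use v D'.Dom_Ob in auto)
    qed
  qed
qed

sublocale set_presheaf U D' elems tup_res
proof
  fix f x assume f: "f \<in> Ar D'" and x: "x \<in> elems (Cod D' f)"
  have "locally D' K' (Dom D' f) (\<lambda>g. tup_res (f \<cdot>\<^bsub>D'\<^esub> g) x \<in> germs (Dom D' (f \<cdot>\<^bsub>D'\<^esub> g)))"
    using D'.locally_pull[OF elems_locally[OF x] f refl] .
  then have "locally D' K' (Dom D' f) (\<lambda>g. tup_res g (tup_res f x) \<in> germs (Dom D' g))"
    by (rule D'.locally_mono)
      (use f x D'.Dom_Ob D'.Cmp_Ar in \<open>auto simp: tup_res_Cmp elems_tuples\<close>)
  then show "tup_res f x \<in> elems (Dom D' f)"
    using tup_res_tuples[OF f elems_tuples[OF x]] by (simp add: elems_def)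
qed (auto simp: fits_elems tup_res_Idn tup_res_Cmp elems_tuples)

abbreviation "B \<equiv> encode U D' elems tup_res"

lemma B_sheaf: "is_sheaf U D' K' B"
proof (rule encode_sheaf)
  fix e S y z assume e: "e \<in> Ob D'" and S: "S \<in> K' e" and y: "y \<in> elems e" and z: "z \<in> elems e"
    and eq: "\<And>f. f \<in> S \<Longrightarrow> tup_res f y = tup_res f z"
  show "y = z"
    by (rule tuples_separated[OF elems_tuples[OF y] elems_tuples[OF z] _ e])
      (use S eq in \<open>auto simp: locally_def\<close>)
next
  fix e S m assume e: "e \<in> Ob D'" and S: "S \<in> K' e"
    and m: "\<And>f. f \<in> S \<Longrightarrow> m f \<in> elems (Dom D' f)"
    and comp: "\<And>f g. f \<in> S \<Longrightarrow> g \<in> Ar D' \<Longrightarrow> Cod D' g = Dom D' f \<Longrightarrow> m (f \<cdot>\<^bsub>D'\<^esub> g) = tup_res g (m f)"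
  note SD = D'.coverD[OF e S]
  have "\<exists>x\<in>Sec (fst i) e. \<forall>f\<in>S. Res (fst i) f x = m f i" if i: "i \<in> targets" for i
  proof -
    have "matching_family D' (fst i) S (\<lambda>f. m f i)"
      unfolding matching_family_def
      using elems_tuples[OF m] comp i by (auto simp: tuples_def tup_res_def)
    then show ?thesis
      using targetsD(1)[OF i] e S unfolding is_sheaf_def by blast
  qed
  then obtain x where x: "\<And>i. i \<in> targets \<Longrightarrow> x i \<in> Sec (fst i) e \<and> (\<forall>f\<in>S. Res (fst i) f (x i) = m f i)"
    by metis
  define z where "z = restrict x targets"
  have zt: "z \<in> tuples e"
    using x by (auto simp: z_def tuples_def)
  have zm: "tup_res f z = m f" if f: "f \<in> S" for f
  proof (rule tuples_eqI)
    show "tup_res f z \<in> tuples (Dom D' f)" "m f \<in> tuples (Dom D' f)"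
      using tup_res_tuples[of f z] SD[OF f] zt elems_tuples[OF m[OF f]] by auto
  qed (use x f in \<open>auto simp: tup_res_def z_def\<close>)
  have "locally D' K' e (\<lambda>v. v \<in> S)"
    using S by (auto simp: locally_def)
  then have "locally D' K' e (\<lambda>v. tup_res v z \<in> germs (Dom D' v))"
  proof (rule D'.locally_trans[OF _ e])
    fix f assume f: "f \<in> Ar D'" "Cod D' f = e" "f \<in> S"
    show "locally D' K' (Dom D' f) (\<lambda>g. tup_res (f \<cdot>\<^bsub>D'\<^esub> g) z \<in> germs (Dom D' (f \<cdot>\<^bsub>D'\<^esub> g)))"
      by (rule D'.locally_mono[OF elems_locally[OF m[OF f(3)]]])
        (use f zm zt D'.Dom_Ob D'.Cmp_Ar in \<open>auto simp: tup_res_Cmp\<close>)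
  qed
  then show "\<exists>x\<in>elems e. \<forall>f\<in>S. tup_res f x = m f"
    using zt zm by (auto simp: elems_def)
qed unfold_locales

definition utup where
  "utup d x = (\<lambda>i\<in>targets. ap (snd i) d x)"

lemma utup_tuples: "x \<in> Sec F d \<Longrightarrow> utup d x \<in> tuples (FO A d)"
  by (auto simp: utup_def tuples_def targetsD(4))

lemma tup_res_utup: "w \<in> hom D' e (FO A d) \<Longrightarrow> tup_res w (utup d x) = germ d x w"
  by (auto simp: tup_res_def utup_def germ_def)

lemma utup_Res:
  assumes "k \<in> Ar D" "x \<in> Sec F (Cod D k)"
  shows "utup (Dom D k) (Res F k x) = tup_res (FA A k) (utup (Cod D k) x)"
  unfolding utup_def tup_res_def
  by (rule restrict_ext) (use assms ap_Res[OF targetsD(3)] in \<open>simp add: A.Res_precomp\<close>)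

text \<open>
  The tuple of a section over an object outside the dense set is locally a germ over the source
  site only; that it is so over the target site is where continuity enters: the germs over the
  dense set glue in the sheaf B along A.
\<close>

lemma utup_elems:
  assumes x: "x \<in> Sec F d"
  shows "utup d x \<in> elems (FO A d)"
proof -
  have d: "d \<in> Ob D" using Sec_Ob[OF F x] .
  \<comment> \<open>The values that lie in B already; they do so for v from the dense set.\<close>
  let ?y = "\<lambda>v. utup (Dom D v) (Res F v x)"
  let ?V = "\<lambda>v s. ?y v \<in> elems (FO A (Dom D v)) \<and> s = enc U (elems (FO A (Dom D v))) (?y v)"
  have loc: "locally D K d (\<lambda>v. \<exists>s. ?V v s)"
  proof (rule D.locally_dense[OF d])
    fix f g assume f: "f \<in> Ar D" "Cod D f = d" "Dom D f \<in> D.dense" and g: "g \<in> Ar D" "Cod D g = Dom D f"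
    have fx: "Res F f x \<in> Sec F (Dom D f)"
      using Res_Sec[OF F f(1)] x f(2) by simp
    have Ag: "FA A g \<in> hom D' (FO A (Dom D g)) (FO A (Dom D f))"
      using A.FA_Ar[OF g(1)] g(2) by (simp add: hom_def)
    have "?y (f \<cdot>\<^bsub>D\<^esub> g) = tup_res (FA A g) (utup (Dom D f) (Res F f x))"
      using utup_Res[OF g(1)] fx g f x D.Cmp_Ar[OF f(1) g] Res_Cmp[OF F f(1) g] by simp
    also have "\<dots> \<in> germs (FO A (Dom D g))"
      unfolding tup_res_utup[OF Ag] germs_def using f(3) fx Ag by force
    finally show "\<exists>s. ?V (f \<cdot>\<^bsub>D\<^esub> g) s"
      using germs_elems A.FO_Ob[OF D.Dom_Ob[OF g(1)]] D.Cmp_Ar[OF f(1) g] by auto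
  qed
  obtain s where s: "s \<in> Sec (FO (precomp D A) B) d"
    "\<And>v z. v \<in> Ar D \<Longrightarrow> Cod D v = d \<Longrightarrow> ?V v z \<Longrightarrow> Res (FO (precomp D A) B) v s = z"
  proof (rule D.sheaf_glue[OF continuous[OF B_sheaf] d loc])
    fix v z assume "v \<in> Ar D" "Cod D v = d" "?V v z"
    then show "z \<in> Sec (FO (precomp D A) B) (Dom D v)"
      using D.Dom_Ob A.FO_Ob enc_Sec by (simp add: A.Sec_precomp)
  next
    fix f g z assume f: "f \<in> Ar D" "Cod D f = d" and z: "?V f z" and g: "g \<in> Ar D" "Cod D g = Dom D f"
    have fx: "Res F f x \<in> Sec F (Dom D f)"
      using Res_Sec[OF F f(1)] x f(2) by simp
    have eq: "?y (f \<cdot>\<^bsub>D\<^esub> g) = tup_res (FA A g) (?y f)"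
      using utup_Res[OF g(1)] fx g f x D.Cmp_Ar[OF f(1) g] Res_Cmp[OF F f(1) g] by simp
    show "?V (f \<cdot>\<^bsub>D\<^esub> g) (Res (FO (precomp D A) B) g z)"
      using z g Res_encode[OF A.FA_Ar(1)[OF g(1)], of "?y f"] r_mem[OF A.FA_Ar(1)[OF g(1)], of "?y f"]
        A.FA_Ar[OF g(1)] eq[unfolded D.Cmp_Ar(2)[OF f(1) g]]
      by (simp add: A.Res_precomp D.Cmp_Ar(2)[OF f(1) g])
  qed auto
  then obtain z where z: "z \<in> elems (FO A d)" "s = enc U (elems (FO A d)) z"
    using d by (auto simp: A.Sec_precomp elim: Sec_encodeE)
  have "utup d x = z"
  proof (rule tuples_eqI[OF utup_tuples[OF x] elems_tuples[OF z(1)]])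
    fix i assume i: "i \<in> targets"
    note H = targetsD[OF i]
    show "utup d x i = z i"
    proof (rule D.sheaf_separated[OF continuous[OF H(1)]])
      show "utup d x i \<in> Sec (FO (precomp D A) (fst i)) d" "z i \<in> Sec (FO (precomp D A) (fst i)) d"
        using utup_tuples[OF x] elems_tuples[OF z(1)] i d by (auto simp: tuples_def A.Sec_precomp)
      show "locally D K d (\<lambda>v. Res (FO (precomp D A) (fst i)) v (utup d x i) =
          Res (FO (precomp D A) (fst i)) v (z i))"
      proof (rule D.locally_mono[OF loc d])
        fix v assume v: "v \<in> Ar D" "Cod D v = d" and V: "\<exists>s. ?V v s"
        note Av = A.FA_Ar[OF v(1)]
        have "enc U (elems (FO A (Dom D v))) (tup_res (FA A v) z) = enc U (elems (FO A (Dom D v))) (?y v)"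
          using s(2)[OF v] V v Av z Res_encode[OF Av(1), of z] by (auto simp: A.Res_precomp)
        then have "tup_res (FA A v) z = ?y v"
          using enc_eq[OF A.FO_Ob[OF D.Dom_Ob[OF v(1)]]] r_mem[OF Av(1), of z] z(1) V Av v by auto
        also have "\<dots> = tup_res (FA A v) (utup d x)"
          using utup_Res[OF v(1)] x v by simp
        finally show "Res (FO (precomp D A) (fst i)) v (utup d x i) =
            Res (FO (precomp D A) (fst i)) v (z i)"
          using i v by (auto simp: A.Res_precomp tup_res_def dest!: fun_cong[of _ _ i])
      qed
    qed
  qed
  then show ?thesis using z(1) by simp
qed

definition B_unit :: "('p, 'b, 'u) psh_arr" where
  "B_unit = psh_mor F (FO (precomp D A) B) (\<lambda>d x. enc U (elems (FO A d)) (utup d x))"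

lemma B_unit_hom: "B_unit \<in> hom (presheaf_cat U D) F (FO (precomp D A) B)"
  unfolding B_unit_def
proof (rule psh_mor_hom[OF F sheaf_presheaf[OF continuous[OF B_sheaf]]])
  show "enc U (elems (FO A d)) (utup d x) \<in> Sec (FO (precomp D A) B) d" if "x \<in> Sec F d" for d x
    using that Sec_Ob[OF F that] A.FO_Ob enc_Sec utup_elems by (simp add: A.Sec_precomp)
  fix k x assume k: "k \<in> Ar D" and x: "x \<in> Sec F (Cod D k)"
  then show "enc U (elems (FO A (Dom D k))) (utup (Dom D k) (Res F k x)) =
      Res (FO (precomp D A) B) k (enc U (elems (FO A (Cod D k))) (utup (Cod D k) x))"
    using Res_encode[OF A.FA_Ar(1)[OF k], of "utup (Cod D k) x"] utup_elems[OF x] A.FA_Ar[OF k]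
    by (simp add: A.Res_precomp utup_Res)
qed

lemma ap_B_unit: "x \<in> Sec F d \<Longrightarrow> ap B_unit d x = enc U (elems (FO A d)) (utup d x)"
  unfolding B_unit_def by (rule ap_psh_mor)

definition B_proj :: "('q, 'c, 'u) presheaf \<times> ('p, 'b, 'u) psh_arr \<Rightarrow> ('q, 'c, 'u) psh_arr" where
  "B_proj i = psh_mor B (fst i) (\<lambda>e s. inv_into (elems e) (enc U (elems e)) s i)"

lemma ap_B_proj:
  "e \<in> Ob D' \<Longrightarrow> z \<in> elems e \<Longrightarrow> ap (B_proj i) e (enc U (elems e) z) = z i"
  unfolding B_proj_def by (simp add: ap_psh_mor enc_Sec inv_into_enc fits)

lemma B_proj_hom:
  assumes i: "i \<in> targets"
  shows "B_proj i \<in> hom (presheaf_cat U D') B (fst i)"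
  unfolding B_proj_def
proof (rule psh_mor_hom[OF encode_presheaf targetsD(2)[OF i]])
  fix e s assume "s \<in> Sec B e"
  then show "inv_into (elems e) (enc U (elems e)) s i \<in> Sec (fst i) e"
    by (elim Sec_encodeE) (use i elems_tuples in \<open>auto simp: inv_into_enc fits tuples_def\<close>)
next
  fix k s assume k: "k \<in> Ar D'" and "s \<in> Sec B (Cod D' k)"
  then obtain z where z: "z \<in> elems (Cod D' k)" "s = enc U (elems (Cod D' k)) z"
    by (elim Sec_encodeE) auto
  then show "inv_into (elems (Dom D' k)) (enc U (elems (Dom D' k))) (Res B k s) i =
      Res (fst i) k (inv_into (elems (Cod D' k)) (enc U (elems (Cod D' k))) s i)"
    using i k r_mem[OF k z(1)] D'.Dom_Ob D'.Cod_Ob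
    by (simp add: Res_encode inv_into_enc fits) (simp add: tup_res_def)
qed

lemma universal:
  "universal_arrow (presheaf_cat U D) (sheaf_cat U D' K') (precomp D A) F (B, B_unit)"
  unfolding universal_arrow_def prod.case
proof (intro conjI ballI)
  show "B \<in> Ob (sheaf_cat U D' K')"
    using B_sheaf by (simp add: sheaf_cat_simps)
  show "B_unit \<in> hom (presheaf_cat U D) F (FO (precomp D A) B)"
    by (rule B_unit_hom)
  fix H t assume "H \<in> Ob (sheaf_cat U D' K')" and t: "t \<in> hom (presheaf_cat U D) F (FO (precomp D A) H)"
  then have H: "is_sheaf U D' K' H" by (simp add: sheaf_cat_simps)
  then have i: "(H, t) \<in> targets" using t by (simp add: targets_def)
  note proj = B_proj_hom[OF i, unfolded fst_conv]
  have proj_t: "FA (precomp D A) (B_proj (H, t)) \<cdot>\<^bsub>presheaf_cat U D\<^esub> B_unit = t"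
  proof (rule psh_hom_eqI[OF psh_Cmp_hom[OF B_unit_hom A.precomp_hom[OF proj]] t])
    fix d x assume x: "x \<in> Sec F d"
    have d: "d \<in> Ob D" using Sec_Ob[OF F x] .
    show "ap (FA (precomp D A) (B_proj (H, t)) \<cdot>\<^bsub>presheaf_cat U D\<^esub> B_unit) d x = ap t d x"
      using ap_Cmp[OF B_unit_hom A.precomp_hom[OF proj] x] ap_B_unit[OF x] A.FO_Ob[OF d]
        utup_elems[OF x] i
      by (simp add: A.ap_precomp d ap_B_proj) (simp add: utup_def)
  qed
  show "\<exists>!w. w \<in> hom (sheaf_cat U D' K') B H \<and>
      FA (precomp D A) w \<cdot>\<^bsub>presheaf_cat U D\<^esub> B_unit = t"
  proof (rule ex1I[of _ "B_proj (H, t)"])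
    show "B_proj (H, t) \<in> hom (sheaf_cat U D' K') B H \<and>
        FA (precomp D A) (B_proj (H, t)) \<cdot>\<^bsub>presheaf_cat U D\<^esub> B_unit = t"
      using proj proj_t B_sheaf H by (simp add: sheaf_cat_simps)
    fix w assume "w \<in> hom (sheaf_cat U D' K') B H \<and>
        FA (precomp D A) w \<cdot>\<^bsub>presheaf_cat U D\<^esub> B_unit = t"
    then have w: "w \<in> hom (presheaf_cat U D') B H"
      and wt: "FA (precomp D A) w \<cdot>\<^bsub>presheaf_cat U D\<^esub> B_unit = t"
      by (simp_all add: sheaf_cat_simps)
    have on_germ: "ap v e (enc U (elems e) (germ d x f)) = Res H f (ap t d x)"
      if v: "v \<in> hom (presheaf_cat U D') B H" "FA (precomp D A) v \<cdot>\<^bsub>presheaf_cat U D\<^esub> B_unit = t"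
        and x: "x \<in> Sec F d" and f: "f \<in> hom D' e (FO A d)" for v e d x f
    proof -
      have d: "d \<in> Ob D" using Sec_Ob[OF F x] .
      note f' = homD[OF f]
      have "ap t d x = ap v (FO A d) (enc U (elems (FO A d)) (utup d x))"
        using ap_Cmp[OF B_unit_hom A.precomp_hom[OF v(1)] x] v(2) ap_B_unit[OF x]
        by (simp add: A.ap_precomp d)
      moreover have "Res B f (enc U (elems (FO A d)) (utup d x)) = enc U (elems e) (germ d x f)"
        using Res_encode[OF f'(1), of "utup d x"] f' utup_elems[OF x] tup_res_utup[OF f] by simp
      ultimately show ?thesis
        using ap_Res[OF v(1) f'(1), of "enc U (elems (FO A d)) (utup d x)"] f'
          enc_Sec[OF A.FO_Ob[OF d] utup_elems[OF x]] by simp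
    qed
    show "w = B_proj (H, t)"
    proof (rule D'.sheaf_map_eqI[OF encode_presheaf H w proj])
      fix e s assume "s \<in> Sec B e"
      then obtain z where z: "e \<in> Ob D'" "z \<in> elems e" "s = enc U (elems e) z"
        by (rule Sec_encodeE)
      show "locally D' K' e (\<lambda>k. ap w (Dom D' k) (Res B k s) = ap (B_proj (H, t)) (Dom D' k) (Res B k s))"
      proof (rule D'.locally_mono[OF elems_locally[OF z(2)] z(1)])
        fix k assume k: "k \<in> Ar D'" "Cod D' k = e" and g: "tup_res k z \<in> germs (Dom D' k)"
        then obtain d x f where "x \<in> Sec F d" "f \<in> hom D' (Dom D' k) (FO A d)" "tup_res k z = germ d x f"
          by (auto simp: germs_def)
        then show "ap w (Dom D' k) (Res B k s) = ap (B_proj (H, t)) (Dom D' k) (Res B k s)"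
          using on_germ[OF w wt] on_germ[OF proj proj_t] Res_encode[OF k(1), of z] k z by simp
      qed
    qed
  qed
qed

end

context continuous_site
begin

text \<open>
  For a sheaf F this is a universal arrow for the inverse image along A between the categories of sheaves, and
  for the identity functor it is a universal arrow for sheafification.
\<close>

lemma universal_arrow_ex:
  "is_presheaf U D F \<Longrightarrow>
    \<exists>bu. universal_arrow (presheaf_cat U D) (sheaf_cat U D' K') (precomp D A) F bu"
  by (rule exI, rule universal_sheaf.universal[of U D K D' K' A F], unfold_locales)

end

section \<open>Generators of a universal sheaf\<close>

lemma (in continuous_site) precomp_sheaf_functor:
  "cat_functor (sheaf_cat U D' K') (sheaf_cat U D K) (precomp D A)"
proof -
  interpret P: cat_functor "presheaf_cat U D'" "presheaf_cat U D" "precomp D A"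
    by (rule A.precomp_functor)
  show ?thesis
    unfolding cat_functor_def cat_functor_axioms_def
    by (auto simp: sheaf_category sheaf_cat_simps continuous sheaf_presheaf intro: P.FA_hom P.FA_Idn P.FA_Cmp)
qed

lemma universal_arrow_sheaf_iff:
  assumes "is_sheaf U D K F" "\<And>H. is_sheaf U D' K' H \<Longrightarrow> is_sheaf U D K (FO R H)"
  shows "universal_arrow (sheaf_cat U D K) (sheaf_cat U D' K') R F bu \<longleftrightarrow>
    universal_arrow (presheaf_cat U D) (sheaf_cat U D' K') R F bu"
  by (rule universal_arrow_cong) (use assms in \<open>auto simp: sheaf_cat_simps\<close>)

context continuous_site
begin

text \<open>
  The locally generated sections form a subsheaf through which the universal arrow factors, by
  continuity; by universality this subsheaf is everything.
\<close>

lemma universal_generated: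
  assumes ua: "universal_arrow (presheaf_cat U D) (sheaf_cat U D' K') (precomp D A) F (B, u)"
    and F: "is_presheaf U D F"
    and gen: "\<And>d x. x \<in> Sec F d \<Longrightarrow> locally D K d (\<lambda>v. Res F v x \<in> P (Dom D v))"
    and P: "\<And>d. P d \<subseteq> Sec F d"
    and s: "s \<in> Sec B e"
  shows "locally D' K' e (\<lambda>v. \<exists>d x w. x \<in> P d \<and> w \<in> hom D' (Dom D' v) (FO A d) \<and>
    Res B v s = Res B w (ap u d x))"
proof -
  let ?g = "\<lambda>v s. \<exists>d x w. x \<in> P d \<and> w \<in> hom D' (Dom D' v) (FO A d) \<and> Res B v s = Res B w (ap u d x)"
  define Q where "Q e = {s \<in> Sec B e. locally D' K' e (\<lambda>v. ?g v s)}" for e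
  note ua' = universal_arrowD[OF ua]
  have B: "is_sheaf U D' K' B" and u: "u \<in> hom (presheaf_cat U D) F (FO (precomp D A) B)"
    using ua'(1,2) by (simp_all add: sheaf_cat_simps)
  note PB = sheaf_presheaf[OF B]
  have Q_sub: "Q c \<subseteq> Sec B c" for c
    by (auto simp: Q_def)
  have Q_Res: "Res B f x \<in> Q (Dom D' f)" if f: "f \<in> Ar D'" and x: "x \<in> Q (Cod D' f)" for f x
  proof -
    have "locally D' K' (Cod D' f) (\<lambda>v. ?g v x)" and xB: "x \<in> Sec B (Cod D' f)"
      using x by (simp_all add: Q_def)
    from D'.locally_pull[OF this(1) f refl]
    have "locally D' K' (Dom D' f) (\<lambda>g. ?g g (Res B f x))"
      by (rule D'.locally_mono) (use f xB D'.Dom_Ob D'.Cmp_Ar in \<open>auto simp: Res_Cmp[OF PB]\<close>)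
    then show ?thesis
      using Res_Sec[OF PB f xB] by (simp add: Q_def)
  qed
  have Q_local: "x \<in> Q c" if x: "x \<in> Sec B c" and loc: "locally D' K' c (\<lambda>f. Res B f x \<in> Q (Dom D' f))" for c x
  proof -
    have c: "c \<in> Ob D'" using Sec_Ob[OF PB x] .
    have "locally D' K' c (\<lambda>v. ?g v x)"
    proof (rule D'.locally_trans[OF loc c])
      fix f assume f: "f \<in> Ar D'" "Cod D' f = c" and "Res B f x \<in> Q (Dom D' f)"
      then have "locally D' K' (Dom D' f) (\<lambda>g. ?g g (Res B f x))"
        by (simp add: Q_def)
      then show "locally D' K' (Dom D' f) (\<lambda>g. ?g (f \<cdot>\<^bsub>D'\<^esub> g) x)"
        by (rule D'.locally_mono) (use f x D'.Dom_Ob D'.Cmp_Ar in \<open>auto simp: Res_Cmp[OF PB]\<close>)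
    qed
    then show ?thesis
      using x by (simp add: Q_def)
  qed
  note sub = D'.sub_presheaf_incl[OF B Q_sub Q_Res Q_local] D'.sub_sheaf[OF B Q_sub Q_Res Q_local]
  let ?S = "sub_presheaf D' B Q"
  let ?i = "psh_mor ?S B (\<lambda>_ x. x)"
  note S_sheaf = sub(2)
  have SecS: "Sec ?S = Q" and ResS: "\<And>f x. f \<in> Ar D' \<Longrightarrow> x \<in> Q (Cod D' f) \<Longrightarrow> Res ?S f x = Res B f x"
    by (simp_all add: sub_presheaf_def)
  have u_Q: "ap u d x \<in> Q (FO A d)" if x: "x \<in> Sec F d" for d x
  proof -
    have d: "d \<in> Ob D" using Sec_Ob[OF F x] .
    let ?y = "\<lambda>v. ap u (Dom D v) (Res F v x)"
    let ?V = "\<lambda>v z. ?y v \<in> Q (FO A (Dom D v)) \<and> z = ?y v"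
    have Fv: "Res F v x \<in> Sec F (Dom D v)" if "v \<in> Ar D" "Cod D v = d" for v
      using Res_Sec[OF F that(1)] x that(2) by simp
    have loc: "locally D K d (\<lambda>v. \<exists>z. ?V v z)"
    proof (rule D.locally_mono[OF gen[OF x] d])
      fix v assume v: "v \<in> Ar D" "Cod D v = d" and Pv: "Res F v x \<in> P (Dom D v)"
      have dv: "Dom D v \<in> Ob D" using D.Dom_Ob[OF v(1)] .
      have yv: "?y v \<in> Sec B (FO A (Dom D v))"
        using ap_Sec[OF u Fv[OF v]] by (simp add: A.Sec_precomp dv)
      have "locally D' K' (FO A (Dom D v)) (\<lambda>w. ?g w (?y v))"
        using Pv A.FO_Ob[OF dv] by (intro D'.locally_everywhere) (auto simp: hom_def)
      then show "\<exists>z. ?V v z"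
        using yv by (simp add: Q_def)
    qed
    have Res_y: "Res B (FA A g) (?y f) = ?y (f \<cdot>\<^bsub>D\<^esub> g)"
      if "f \<in> Ar D" "Cod D f = d" "g \<in> Ar D" "Cod D g = Dom D f" for f g
      using ap_Res[OF u that(3), of "Res F f x"] Fv[OF that(1,2)] that(4) Res_Cmp[OF F that(1,3,4)] x that(2)
        D.Cmp_Ar[OF that(1,3,4)]
      by (simp add: A.Res_precomp that(3))
    obtain z where z: "z \<in> Sec (FO (precomp D A) ?S) d"
      "\<And>v z'. v \<in> Ar D \<Longrightarrow> Cod D v = d \<Longrightarrow> ?V v z' \<Longrightarrow> Res (FO (precomp D A) ?S) v z = z'"
    proof (rule D.sheaf_glue[OF continuous[OF S_sheaf] d loc])
      fix f g z assume f: "f \<in> Ar D" "Cod D f = d" and V: "?V f z" and g: "g \<in> Ar D" "Cod D g = Dom D f"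
      show "?V (f \<cdot>\<^bsub>D\<^esub> g) (Res (FO (precomp D A) ?S) g z)"
        using V Q_Res[OF A.FA_Ar(1)[OF g(1)], of z] ResS[OF A.FA_Ar(1)[OF g(1)], of z]
          A.FA_Ar[OF g(1)] g Res_y[OF f g] D.Cmp_Ar[OF f(1) g]
        by (simp add: A.Res_precomp)
    qed (auto simp: A.Sec_precomp D.Dom_Ob SecS)
    have zQ: "z \<in> Q (FO A d)"
      using z(1) d by (simp add: A.Sec_precomp SecS)
    have "ap u d x = z"
    proof (rule D.sheaf_separated[OF continuous[OF B] ap_Sec[OF u x]])
      show "z \<in> Sec (FO (precomp D A) B) d"
        using zQ Q_sub d by (auto simp: A.Sec_precomp)
      show "locally D K d (\<lambda>v. Res (FO (precomp D A) B) v (ap u d x) = Res (FO (precomp D A) B) v z)"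
      proof (rule D.locally_mono[OF loc d])
        fix v assume v: "v \<in> Ar D" "Cod D v = d" and V: "\<exists>z. ?V v z"
        have "Res ?S (FA A v) z = ?y v"
          using z(2)[OF v] V by (simp add: A.Res_precomp v)
        moreover have "Res (FO (precomp D A) B) v (ap u d x) = ?y v"
          using ap_Res[OF u v(1), of x] x v by simp
        ultimately show "Res (FO (precomp D A) B) v (ap u d x) = Res (FO (precomp D A) B) v z"
          using ResS[OF A.FA_Ar(1)[OF v(1)], of z] zQ A.FA_Ar[OF v(1)] v by (simp add: A.Res_precomp)
      qed
    qed
    then show ?thesis using zQ by simp
  qed
  let ?t = "psh_mor F (FO (precomp D A) ?S) (\<lambda>d x. ap u d x)"
  have t: "?t \<in> hom (presheaf_cat U D) F (FO (precomp D A) ?S)"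
  proof (rule psh_mor_hom[OF F sheaf_presheaf[OF continuous[OF S_sheaf]]])
    show "ap u d x \<in> Sec (FO (precomp D A) ?S) d" if "x \<in> Sec F d" for d x
      using u_Q[OF that] Sec_Ob[OF F that] by (simp add: A.Sec_precomp SecS)
    show "ap u (Dom D k) (Res F k x) = Res (FO (precomp D A) ?S) k (ap u (Cod D k) x)"
      if k: "k \<in> Ar D" and x: "x \<in> Sec F (Cod D k)" for k x
      using ap_Res[OF u k x] u_Q[OF x] ResS[OF A.FA_Ar(1)[OF k]] A.FA_Ar[OF k]
      by (simp add: A.Res_precomp k)
  qed
  obtain w where w: "w \<in> hom (presheaf_cat U D') B ?S"
    "FA (precomp D A) w \<cdot>\<^bsub>presheaf_cat U D\<^esub> u = ?t"
    using ua'(3)[OF _ t] S_sheaf by (auto simp: sheaf_cat_simps)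
  have iw: "?i \<cdot>\<^bsub>presheaf_cat U D'\<^esub> w \<in> hom (presheaf_cat U D') B B"
    by (rule psh_Cmp_hom[OF w(1) sub(1)])
  have *: "ap ?i e (ap w e s) = ap w e s" if "s \<in> Sec B e" for e s
    using ap_Sec[OF w(1) that] by (rule ap_psh_mor)
  have "FA (precomp D A) (?i \<cdot>\<^bsub>presheaf_cat U D'\<^esub> w) \<cdot>\<^bsub>presheaf_cat U D\<^esub> u = u"
  proof (rule psh_hom_eqI[OF psh_Cmp_hom[OF u A.precomp_hom[OF iw]] u])
    fix d x assume x: "x \<in> Sec F d"
    have d: "d \<in> Ob D" using Sec_Ob[OF F x] .
    have ux: "ap u d x \<in> Sec B (FO A d)"
      using ap_Sec[OF u x] by (simp add: A.Sec_precomp d)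
    have "ap w (FO A d) (ap u d x) = ap u d x"
      using ap_Cmp[OF u A.precomp_hom[OF w(1)] x] w(2) ap_psh_mor[OF x, of "FO (precomp D A) ?S" "ap u"]
      by (simp add: A.ap_precomp d)
    then show "ap (FA (precomp D A) (?i \<cdot>\<^bsub>presheaf_cat U D'\<^esub> w) \<cdot>\<^bsub>presheaf_cat U D\<^esub> u) d x = ap u d x"
      using ap_Cmp[OF u A.precomp_hom[OF iw] x] ap_Cmp[OF w(1) sub(1) ux] *[OF ux]
      by (simp add: A.ap_precomp d)
  qed
  moreover have "FA (precomp D A) (Idn (presheaf_cat U D') B) \<cdot>\<^bsub>presheaf_cat U D\<^esub> u = u"
  proof -
    interpret P: cat_functor "presheaf_cat U D'" "presheaf_cat U D" "precomp D A"
      by (rule A.precomp_functor)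
    show ?thesis
      using P.FA_Idn[of B] P.D.Idn_Cmp[OF u] PB by (simp add: sheaf_cat_simps)
  qed
  ultimately have "?i \<cdot>\<^bsub>presheaf_cat U D'\<^esub> w = Idn (presheaf_cat U D') B"
    using ua'(3)[OF ua'(1,2)] iw psh_Idn_hom[OF PB] B by (auto simp: sheaf_cat_simps)
  then have "s = ap w e s"
    using ap_Cmp[OF w(1) sub(1) s] ap_Idn[OF s, of U D'] *[OF s] by simp
  then have "s \<in> Q e"
    using ap_Sec[OF w(1) s] by (simp add: SecS)
  then show ?thesis
    by (simp add: Q_def)
qed

end


section \<open>Sheafification\<close>

lemma (in category) precomp_incl_hom:
  assumes "w \<in> hom (presheaf_cat U C) F G"
  shows "FA (precomp C incl) w = w"
proof -
  interpret I: cat_functor C C incl by (rule incl_functor) unfold_locales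
  note FG = precomp_incl[OF psh_hom_presheaf(1)[OF assms]] precomp_incl[OF psh_hom_presheaf(2)[OF assms]]
  show ?thesis
    by (rule psh_hom_eqI[OF I.precomp_hom[OF assms, unfolded FG] assms])
      (use Sec_Ob[OF psh_hom_presheaf(1)[OF assms]] in \<open>simp add: I.ap_precomp\<close>, simp add: incl_def)
qed

context small_site
begin

sublocale idf: continuous_site U C J C J incl
proof -
  interpret cat_functor C C incl by (rule incl_functor) unfold_locales
  show "continuous_site U C J C J incl"
    by unfold_locales (auto simp: precomp_incl[OF sheaf_presheaf])
qed

lemma universal_arrow_incl_iff:
  "universal_arrow (presheaf_cat U C) (sheaf_cat U C J) incl F bu \<longleftrightarrow>
    universal_arrow (presheaf_cat U C) (sheaf_cat U C J) (precomp C incl) F bu"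
  by (rule universal_arrow_cong)
    (auto simp: sheaf_cat_simps precomp_incl[OF sheaf_presheaf] precomp_incl_hom incl_simps)

sublocale sh: has_left_adjoint "sheaf_cat U C J" "presheaf_cat U C" incl
proof -
  interpret cat_functor "sheaf_cat U C J" "presheaf_cat U C" incl by (rule incl_sheaf_functor)
  show "has_left_adjoint (sheaf_cat U C J) (presheaf_cat U C) incl"
    by unfold_locales
      (simp add: sheaf_cat_simps universal_arrow_incl_iff idf.universal_arrow_ex del: split_paired_Ex)
qed

abbreviation "sheafify \<equiv> FO (sheafification U C J)"
abbreviation "\<eta> P \<equiv> ap (sheafification_unit U C J P)"

lemma sheafification_functor: "cat_functor (presheaf_cat U C) (sheaf_cat U C J) (sheafification U C J)"
  unfolding sheafification_def by (rule sh.left_adjoint_functor)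

lemma a_sheaf: "is_presheaf U C P \<Longrightarrow> is_sheaf U C J (sheafify P)"
  using sh.L_Ob[of P] by (simp add: sheafification_def sh.left_adjoint_simps sheaf_cat_simps)

lemma unit_hom:
  "is_presheaf U C P \<Longrightarrow> sheafification_unit U C J P \<in> hom (presheaf_cat U C) P (sheafify P)"
  using sh.unit_hom[of P]
  by (simp add: sheafification_def sheafification_unit_def sh.left_adjoint_simps sheaf_cat_simps incl_simps)

lemma a_hom: "f \<in> hom (presheaf_cat U C) P Q \<Longrightarrow> FA (sheafification U C J) f \<in> hom (presheaf_cat U C) (sheafify P) (sheafify Q)"
  using sh.left_adjoint_hom(1)[of f P Q]
  by (simp add: sheafification_def sh.left_adjoint_simps(1) sheaf_cat_simps)

lemma ap_a:
  assumes f: "f \<in> hom (presheaf_cat U C) P Q" and x: "x \<in> Sec P c"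
  shows "ap (FA (sheafification U C J) f) c (\<eta> P c x) = \<eta> Q c (ap f c x)"
proof -
  have "FA (sheafification U C J) f \<cdot>\<^bsub>presheaf_cat U C\<^esub> sheafification_unit U C J P =
      sheafification_unit U C J Q \<cdot>\<^bsub>presheaf_cat U C\<^esub> f"
    using sh.left_adjoint_unit[OF f]
    by (simp add: sheafification_def sheafification_unit_def incl_simps)
  then show ?thesis
    using ap_Cmp[OF unit_hom a_hom[OF f] x] ap_Cmp[OF f unit_hom x] psh_hom_presheaf[OF f] by simp
qed

lemma a_transpose:
  assumes f: "f \<in> hom (presheaf_cat U C) P H" and H: "is_sheaf U C J H"
  defines "g \<equiv> transpose (presheaf_cat U C) (sheaf_cat U C J) incl P H f"
  shows "g \<in> hom (presheaf_cat U C) (sheafify P) H"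
    and "x \<in> Sec P c \<Longrightarrow> ap g c (\<eta> P c x) = ap f c x"
proof -
  note P = psh_hom_presheaf(1)[OF f]
  note * = sh.transpose[of P H f]
  show g: "g \<in> hom (presheaf_cat U C) (sheafify P) H"
    using *(1) P H f
    by (simp add: sheaf_cat_simps g_def sheafification_def sh.left_adjoint_simps incl_simps)
  have "g \<cdot>\<^bsub>presheaf_cat U C\<^esub> sheafification_unit U C J P = f"
    using *(2) P H f by (simp add: sheaf_cat_simps g_def sheafification_unit_def incl_simps)
  then show "ap g c (\<eta> P c x) = ap f c x" if "x \<in> Sec P c"
    using ap_Cmp[OF unit_hom[OF P] g that] by simp
qed

lemma a_cancel:
  assumes P: "is_presheaf U C P" and H: "is_sheaf U C J H"
    and f: "f \<in> hom (presheaf_cat U C) (sheafify P) H" and g: "g \<in> hom (presheaf_cat U C) (sheafify P) H"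
    and eq: "\<And>c x. x \<in> Sec P c \<Longrightarrow> ap f c (\<eta> P c x) = ap g c (\<eta> P c x)"
  shows "f = g"
proof (rule sh.unit_cancel[of P f H g])
  have "f \<cdot>\<^bsub>presheaf_cat U C\<^esub> sheafification_unit U C J P =
      g \<cdot>\<^bsub>presheaf_cat U C\<^esub> sheafification_unit U C J P"
    by (rule psh_hom_eqI[OF psh_Cmp_hom[OF unit_hom[OF P] f] psh_Cmp_hom[OF unit_hom[OF P] g]])
      (simp add: ap_Cmp[OF unit_hom[OF P] f] ap_Cmp[OF unit_hom[OF P] g] eq)
  then show "FA incl f \<cdot>\<^bsub>presheaf_cat U C\<^esub> adj_unit (presheaf_cat U C) (sheaf_cat U C J) incl P =
      FA incl g \<cdot>\<^bsub>presheaf_cat U C\<^esub> adj_unit (presheaf_cat U C) (sheaf_cat U C J) incl P"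
    by (simp add: sheafification_unit_def incl_simps)
qed (use P H f g a_sheaf[OF P] in
  \<open>simp_all add: sheaf_cat_simps sheafification_def sh.left_adjoint_simps\<close>)

lemma a_generated:
  assumes P: "is_presheaf U C P" and s: "s \<in> Sec (sheafify P) c"
  shows "locally C J c (\<lambda>v. \<exists>x\<in>Sec P (Dom C v). Res (sheafify P) v s = \<eta> P (Dom C v) x)"
proof -
  have "universal_arrow (presheaf_cat U C) (sheaf_cat U C J) (precomp C incl) P
      (sheafify P, sheafification_unit U C J P)"
    using sh.adj_universal[of P] P
    by (simp add: universal_arrow_incl_iff sheaf_cat_simps sheafification_def sheafification_unit_def
        sh.left_adjoint_simps)
  note generated = idf.universal_generated[OF this P, unfolded incl_simps]
  have "locally C J c (\<lambda>v. \<exists>d x w. x \<in> Sec P d \<and> w \<in> hom C (Dom C v) d \<and>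
      Res (sheafify P) v s = Res (sheafify P) w (\<eta> P d x))"
  proof (rule generated)
    show "locally C J d (\<lambda>v. Res P v x \<in> Sec P (Dom C v))" if "x \<in> Sec P d" for d x
      using that by (auto intro: locally_everywhere Res_Sec[OF P] Sec_Ob[OF P])
  qed (use s in auto)
  then show ?thesis
  proof (rule locally_mono[OF _ Sec_Ob[OF sheaf_presheaf[OF a_sheaf[OF P]] s]])
    fix v assume "\<exists>d x w. x \<in> Sec P d \<and> w \<in> hom C (Dom C v) d \<and>
      Res (sheafify P) v s = Res (sheafify P) w (\<eta> P d x)"
    then obtain d x w where *: "x \<in> Sec P d" "w \<in> hom C (Dom C v) d" "Res (sheafify P) v s = Res (sheafify P) w (\<eta> P d x)"
      by blast
    note w = homD[OF *(2)]
    show "\<exists>x\<in>Sec P (Dom C v). Res (sheafify P) v s = \<eta> P (Dom C v) x"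
      using *(1,3) w Res_Sec[OF P w(1), of x] ap_Res[OF unit_hom[OF P] w(1), of x]
      by (intro bexI[of _ "Res P w x"]) auto
  qed
qed

subsection \<open>Sections identified by sheafification agree locally\<close>

text \<open>
  Given a section y of a presheaf P over b, a section x of P over c determines the set of the spans
  (f, h) from c to b with x f and y h locally equal. Such a set is stable under composition and closed under
  local membership. All the sets of spans with these two properties form a sheaf, namely the exponential of the
  sheaf of closed sieves by the representable presheaf of b. For x over b, the span of
  identities belongs to the set of x iff x and y agree locally.
\<close>

definition spans :: "'o \<Rightarrow> 'o \<Rightarrow> ('a \<times> 'a) set" where
  "spans b c = {(f, h). f \<in> Ar C \<and> Cod C f = c \<and> h \<in> Ar C \<and> Cod C h = b \<and> Dom C f = Dom C h}"

definition closed_spans :: "'o \<Rightarrow> 'o \<Rightarrow> ('a \<times> 'a) set set" where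
  "closed_spans b c = {R. R \<subseteq> spans b c \<and>
    (\<forall>f h g. (f, h) \<in> R \<longrightarrow> g \<in> Ar C \<longrightarrow> Cod C g = Dom C f \<longrightarrow> (f \<cdot> g, h \<cdot> g) \<in> R) \<and>
    (\<forall>f h. (f, h) \<in> spans b c \<longrightarrow> locally C J (Dom C f) (\<lambda>g. (f \<cdot> g, h \<cdot> g) \<in> R) \<longrightarrow> (f, h) \<in> R)}"

definition pull_spans :: "'o \<Rightarrow> 'a \<Rightarrow> ('a \<times> 'a) set \<Rightarrow> ('a \<times> 'a) set" where
  "pull_spans b k R = {(f, h) \<in> spans b (Dom C k). (k \<cdot> f, h) \<in> R}"

lemma spansD:
  assumes "(f, h) \<in> spans b c"
  shows "f \<in> Ar C" "Cod C f = c" "h \<in> Ar C" "Cod C h = b" "Dom C f = Dom C h" "Dom C h \<in> Ob C"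
  using assms Dom_Ob by (auto simp: spans_def)

lemma closed_spansD:
  assumes "R \<in> closed_spans b c"
  shows "(f, h) \<in> R \<Longrightarrow> (f, h) \<in> spans b c"
    and "(f, h) \<in> R \<Longrightarrow> g \<in> Ar C \<Longrightarrow> Cod C g = Dom C f \<Longrightarrow> (f \<cdot> g, h \<cdot> g) \<in> R"
    and "(f, h) \<in> spans b c \<Longrightarrow> locally C J (Dom C f) (\<lambda>g. (f \<cdot> g, h \<cdot> g) \<in> R) \<Longrightarrow> (f, h) \<in> R"
  using assms by (auto simp: closed_spans_def)

lemma spans_eqI:
  assumes "R \<subseteq> spans b c" "T \<subseteq> spans b c"
    and "\<And>f h. (f, h) \<in> spans b c \<Longrightarrow> (f, h) \<in> R \<longleftrightarrow> (f, h) \<in> T"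
  shows "R = T"
  by (intro subset_antisym subrelI) (use assms in \<open>auto dest: subsetD\<close>)

lemma closed_spansI:
  assumes "R \<subseteq> spans b c"
    and "\<And>f h g. (f, h) \<in> R \<Longrightarrow> g \<in> Ar C \<Longrightarrow> Cod C g = Dom C f \<Longrightarrow> (f \<cdot> g, h \<cdot> g) \<in> R"
    and "\<And>f h. (f, h) \<in> spans b c \<Longrightarrow> locally C J (Dom C f) (\<lambda>g. (f \<cdot> g, h \<cdot> g) \<in> R) \<Longrightarrow> (f, h) \<in> R"
  shows "R \<in> closed_spans b c"
  using assms unfolding closed_spans_def by (intro CollectI conjI allI impI)

lemma spans_Cmp: "(f, h) \<in> spans b c \<Longrightarrow> g \<in> Ar C \<Longrightarrow> Cod C g = Dom C f \<Longrightarrow> (f \<cdot> g, h \<cdot> g) \<in> spans b c"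
  using Cmp_Ar by (auto simp: spans_def)

lemma spans_post: "(f, h) \<in> spans b (Dom C k) \<Longrightarrow> k \<in> Ar C \<Longrightarrow> (k \<cdot> f, h) \<in> spans b (Cod C k)"
  using Cmp_Ar by (auto simp: spans_def)

lemma spans_assoc:
  "(f, h) \<in> spans b c \<Longrightarrow> g \<in> Ar C \<Longrightarrow> Cod C g = Dom C f \<Longrightarrow> g' \<in> Ar C \<Longrightarrow> Cod C g' = Dom C g \<Longrightarrow>
    ((f \<cdot> g) \<cdot> g', (h \<cdot> g) \<cdot> g') = (f \<cdot> (g \<cdot> g'), h \<cdot> (g \<cdot> g'))"
  by (auto simp: spans_def Cmp_Ar_assoc)

lemma fits_closed_spans:
  assumes b: "b \<in> Ob C" and c: "c \<in> Ob C"
  shows "fits U (closed_spans b c)"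
proof (rule fits_inj[OF universe])
  let ?I = "\<Union>a\<in>dense. hom C a c \<times> hom C a b"
  show "fits U (Pow ?I)"
    using dense(1,2) b c by (intro fits_Pow small_UN small_Times small_hom universe) auto
  show "inj_on (\<lambda>R. R \<inter> ?I) (closed_spans b c)"
  proof (rule inj_onI)
    have sub: "R \<subseteq> T" if R: "R \<in> closed_spans b c" and T: "T \<in> closed_spans b c" and eq: "R \<inter> ?I = T \<inter> ?I" for R T
    proof (intro subrelI)
      fix f h assume fh: "(f, h) \<in> R"
      note s = spansD[OF closed_spansD(1)[OF R fh]]
      show "(f, h) \<in> T"
      proof (rule closed_spansD(3)[OF T closed_spansD(1)[OF R fh]], rule locally_dense)
        fix g g' assume g: "g \<in> Ar C" "Cod C g = Dom C f" "Dom C g \<in> dense"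
          and g': "g' \<in> Ar C" "Cod C g' = Dom C g"
        have "(f \<cdot> g, h \<cdot> g) \<in> R \<inter> ?I"
          using closed_spansD(2)[OF R fh g(1,2)] g s Cmp_Ar[of f g] Cmp_Ar[of h g] by (auto simp: hom_def)
        then have "((f \<cdot> g) \<cdot> g', (h \<cdot> g) \<cdot> g') \<in> T"
          using closed_spansD(2)[OF T] g' eq g s Cmp_Ar[of f g] by auto
        then show "(f \<cdot> (g \<cdot> g'), h \<cdot> (g \<cdot> g')) \<in> T"
          using spans_assoc[OF closed_spansD(1)[OF R fh] g(1,2) g'] by simp
      qed (use s in simp)
    qed
    fix R T assume "R \<in> closed_spans b c" "T \<in> closed_spans b c" "R \<inter> ?I = T \<inter> ?I"
    then show "R = T" using sub by blast
  qed
qed auto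

lemma pull_spans_closed:
  assumes k: "k \<in> Ar C" and R: "R \<in> closed_spans b (Cod C k)"
  shows "pull_spans b k R \<in> closed_spans b (Dom C k)"
proof -
  have k_assoc: "k \<cdot> (f \<cdot> g) = (k \<cdot> f) \<cdot> g" if "(f, h) \<in> spans b (Dom C k)" "g \<in> Ar C" "Cod C g = Dom C f" for f h g
    using spansD[OF that(1)] that(2,3) k by (simp add: Cmp_Ar_assoc)
  have 1: "(f \<cdot> g, h \<cdot> g) \<in> pull_spans b k R"
    if "(f, h) \<in> pull_spans b k R" "g \<in> Ar C" "Cod C g = Dom C f" for f h g
    using that closed_spansD(2)[OF R, of "k \<cdot> f" h g] k_assoc[of f h g] spans_Cmp[of f h b "Dom C k" g]
      Cmp_Ar[of k f] k spansD(1,2)[of f h b "Dom C k"]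
    by (auto simp: pull_spans_def)
  have 2: "(f, h) \<in> pull_spans b k R"
    if s: "(f, h) \<in> spans b (Dom C k)" and loc: "locally C J (Dom C f) (\<lambda>g. (f \<cdot> g, h \<cdot> g) \<in> pull_spans b k R)" for f h
  proof -
    note f = spansD[OF s]
    have "locally C J (Dom C f) (\<lambda>g. ((k \<cdot> f) \<cdot> g, h \<cdot> g) \<in> R)"
      by (rule locally_mono[OF loc]) (use f k_assoc[OF s] in \<open>auto simp: pull_spans_def\<close>)
    then have "(k \<cdot> f, h) \<in> R"
      using closed_spansD(3)[OF R spans_post[OF s k]] Cmp_Ar[of k f] k f by simp
    then show ?thesis using s by (simp add: pull_spans_def)
  qed
  show ?thesis
    by (rule closed_spansI[OF _ 1 2]) (auto simp: pull_spans_def)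
qed

lemma set_presheaf_spans:
  assumes b: "b \<in> Ob C"
  shows "set_presheaf U C (closed_spans b) (pull_spans b)"
proof
  fix c R assume c: "c \<in> Ob C" and R: "R \<in> closed_spans b c"
  have "(f, h) \<in> pull_spans b (Idn C c) R \<longleftrightarrow> (f, h) \<in> R" if "(f, h) \<in> spans b c" for f h
    using Idn_Cmp_Ar[OF spansD(1)[OF that]] spansD(2)[OF that] that Idn_Ar(2)[OF c]
    by (simp add: pull_spans_def)
  moreover have "pull_spans b (Idn C c) R \<subseteq> spans b c"
    using Idn_Ar(2)[OF c] by (auto simp: pull_spans_def)
  ultimately show "pull_spans b (Idn C c) R = R"
    using closed_spansD(1)[OF R] by (intro spans_eqI[of _ b c]) auto
next
  fix f g R assume f: "f \<in> Ar C" and g: "g \<in> Ar C" "Cod C g = Dom C f" and "R \<in> closed_spans b (Cod C f)"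
  have "(k, h) \<in> pull_spans b (f \<cdot> g) R \<longleftrightarrow> (k, h) \<in> pull_spans b g (pull_spans b f R)"
    if s: "(k, h) \<in> spans b (Dom C g)" for k h
    using s spans_post[OF s g(1)] Cmp_Ar[OF f g] Cmp_Ar_assoc[OF spansD(1)[OF s] g(1) f] spansD(2)[OF s] g(2)
    by (simp add: pull_spans_def)
  moreover have "pull_spans b (f \<cdot> g) R \<subseteq> spans b (Dom C g)" "pull_spans b g T \<subseteq> spans b (Dom C g)" for T
    using Cmp_Ar(2)[OF f g] by (auto simp: pull_spans_def)
  ultimately show "pull_spans b (f \<cdot> g) R = pull_spans b g (pull_spans b f R)"
    by (intro spans_eqI[of _ b "Dom C g"]) 
qed (use b in \<open>auto intro: fits_closed_spans pull_spans_closed\<close>)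

lemma closed_spans_sheaf:
  assumes b: "b \<in> Ob C"
  shows "is_sheaf U C J (encode U C (closed_spans b) (pull_spans b))"
proof -
  interpret set_presheaf U C "closed_spans b" "pull_spans b"
    by (rule set_presheaf_spans[OF b])
  have Id_pull: "(Idn C (Dom C g), h) \<in> pull_spans b (f \<cdot> g) R \<longleftrightarrow> (f \<cdot> g, h) \<in> R"
    if "f \<in> Ar C" "g \<in> Ar C" "Cod C g = Dom C f" "h \<in> Ar C" "Cod C h = b" "Dom C h = Dom C g" for f g h R
    using that Cmp_Ar[of f g] Idn_Ar[OF Dom_Ob[OF that(2)]] Cmp_Idn_Ar[of "f \<cdot> g"]
    by (auto simp: pull_spans_def spans_def)
  show ?thesis
  proof (rule encode_sheaf)
    fix c S R T assume c: "c \<in> Ob C" and S: "S \<in> J c" and R: "R \<in> closed_spans b c"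
      and T: "T \<in> closed_spans b c" and eq: "\<And>f. f \<in> S \<Longrightarrow> pull_spans b f R = pull_spans b f T"
    have sub: "R \<subseteq> T" if R: "R \<in> closed_spans b c" and T: "T \<in> closed_spans b c"
      and eq: "\<And>f. f \<in> S \<Longrightarrow> pull_spans b f R = pull_spans b f T" for R T
    proof (intro subrelI)
      fix f h assume fh: "(f, h) \<in> R"
      note s = spansD[OF closed_spansD(1)[OF R fh]]
      have "locally C J c (\<lambda>f. f \<in> S)"
        using S by (auto simp: locally_def)
      from locally_pull[OF this s(1,2)]
      have "locally C J (Dom C f) (\<lambda>g. (f \<cdot> g, h \<cdot> g) \<in> T)"
      proof (rule locally_mono)
        fix g assume g: "g \<in> Ar C" "Cod C g = Dom C f" and fg: "f \<cdot> g \<in> S"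
        have "(f \<cdot> g, h \<cdot> g) \<in> R"
          using closed_spansD(2)[OF R fh g] .
        then show "(f \<cdot> g, h \<cdot> g) \<in> T"
          using Id_pull[OF s(1) g, of "h \<cdot> g" R] Id_pull[OF s(1) g, of "h \<cdot> g" T] eq[OF fg] s g
            Cmp_Ar[of h g] by simp
      qed (use s in simp)
      then show "(f, h) \<in> T"
        by (rule closed_spansD(3)[OF T closed_spansD(1)[OF R fh]])
    qed
    show "R = T"
      using sub[OF R T eq] sub[OF T R eq[symmetric]] by blast
  next
    fix c S m assume c: "c \<in> Ob C" and S: "S \<in> J c"
      and m: "\<And>f. f \<in> S \<Longrightarrow> m f \<in> closed_spans b (Dom C f)"
      and comp: "\<And>f g. f \<in> S \<Longrightarrow> g \<in> Ar C \<Longrightarrow> Cod C g = Dom C f \<Longrightarrow> m (f \<cdot> g) = pull_spans b g (m f)"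
    define Q where "Q f h g \<longleftrightarrow> f \<cdot> g \<in> S \<and> (Idn C (Dom C g), h \<cdot> g) \<in> m (f \<cdot> g)" for f h g
    define R where "R = {(f, h) \<in> spans b c. locally C J (Dom C f) (Q f h)}"
    have Q_assoc: "Q (f \<cdot> g) (h \<cdot> g) g' \<longleftrightarrow> Q f h (g \<cdot> g')"
      if "(f, h) \<in> spans b c" "g \<in> Ar C" "Cod C g = Dom C f" "g' \<in> Ar C" "Cod C g' = Dom C g" for f h g g'
      using spans_assoc[OF that] Cmp_Ar[OF that(2,4,5)] by (simp add: Q_def)
    have R1: "(f \<cdot> g, h \<cdot> g) \<in> R" if fh: "(f, h) \<in> R" and g: "g \<in> Ar C" "Cod C g = Dom C f" for f h g
    proof -
      have s: "(f, h) \<in> spans b c" and loc: "locally C J (Dom C f) (Q f h)"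
        using fh by (auto simp: R_def)
      have "locally C J (Dom C g) (Q (f \<cdot> g) (h \<cdot> g))"
        by (rule locally_mono[OF locally_pull[OF loc g]]) (use Q_assoc[OF s g] g Dom_Ob in auto)
      then show ?thesis
        using spans_Cmp[OF s g] spansD[OF s] g Cmp_Ar[of f g] by (simp add: R_def)
    qed
    have R2: "(f, h) \<in> R" if s: "(f, h) \<in> spans b c" and loc: "locally C J (Dom C f) (\<lambda>g. (f \<cdot> g, h \<cdot> g) \<in> R)" for f h
    proof -
      note f = spansD[OF s]
      have "locally C J (Dom C f) (Q f h)"
      proof (rule locally_trans[OF loc])
        fix g assume g: "g \<in> Ar C" "Cod C g = Dom C f" and "(f \<cdot> g, h \<cdot> g) \<in> R"
        then have loc': "locally C J (Dom C g) (Q (f \<cdot> g) (h \<cdot> g))"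
          using f Cmp_Ar[of f g] by (simp add: R_def)
        show "locally C J (Dom C g) (\<lambda>g'. Q f h (g \<cdot> g'))"
          by (rule locally_mono[OF loc']) (use Q_assoc[OF s g] g Dom_Ob in auto)
      qed (use f in simp)
      then show ?thesis using s by (simp add: R_def)
    qed
    have "R \<in> closed_spans b c"
      by (rule closed_spansI[OF _ R1 R2]) (auto simp: R_def)
    moreover have "pull_spans b k R = m k" if k: "k \<in> S" for k
    proof -
      note k' = coverD[OF c S k]
      have Q_iff: "Q (k \<cdot> f) h g \<longleftrightarrow> (f \<cdot> g, h \<cdot> g) \<in> m k"
        if s: "(f, h) \<in> spans b (Dom C k)" and g: "g \<in> Ar C" "Cod C g = Dom C f" for f h g
      proof -
        note f = spansD[OF s]
        note fg = Cmp_Ar[OF f(1) g]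
        have kfg: "(k \<cdot> f) \<cdot> g = k \<cdot> (f \<cdot> g)"
          using f g k' by (simp add: Cmp_Ar_assoc)
        have "k \<cdot> (f \<cdot> g) \<in> S" "m (k \<cdot> (f \<cdot> g)) = pull_spans b (f \<cdot> g) (m k)"
          using cover_Cmp[OF c S k, of "f \<cdot> g"] comp[OF k, of "f \<cdot> g"] fg f by auto
        then show ?thesis
          using Id_pull[OF f(1) g, of "h \<cdot> g" "m k"] Cmp_Ar[of h g] f g by (simp add: Q_def kfg)
      qed
      have "(f, h) \<in> pull_spans b k R \<longleftrightarrow> (f, h) \<in> m k" if s: "(f, h) \<in> spans b (Dom C k)" for f h
      proof -
        note f = spansD[OF s]
        have Dkf: "Dom C (k \<cdot> f) = Dom C f"
          using Cmp_Ar[of k f] f k' by simp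
        have "(f, h) \<in> pull_spans b k R \<longleftrightarrow> locally C J (Dom C f) (Q (k \<cdot> f) h)"
          using s spans_post[OF s k'(1)] Dkf k'(2) by (simp add: pull_spans_def R_def)
        also have "\<dots> \<longleftrightarrow> locally C J (Dom C f) (\<lambda>g. (f \<cdot> g, h \<cdot> g) \<in> m k)"
          using Q_iff[OF s] f by (auto elim!: locally_mono)
        also have "\<dots> \<longleftrightarrow> (f, h) \<in> m k"
          using closed_spansD(2,3)[OF m[OF k]] s f by (auto intro: locally_everywhere)
        finally show ?thesis .
      qed
      moreover have "(f, h) \<in> spans b (Dom C k)" if "(f, h) \<in> m k" for f h
        using closed_spansD(1)[OF m[OF k] that] .
      ultimately show ?thesis
        by (auto simp: pull_spans_def)
    qed
    ultimately show "\<exists>R\<in>closed_spans b c. \<forall>k\<in>S. pull_spans b k R = m k"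
      by blast
  qed unfold_locales
qed

lemma a_kernel:
  assumes P: "is_presheaf U C P" and x: "x \<in> Sec P b" and y: "y \<in> Sec P b"
    and eq: "\<eta> P b x = \<eta> P b y"
  shows "locally C J b (\<lambda>v. Res P v x = Res P v y)"
proof -
  have b: "b \<in> Ob C" using Sec_Ob[OF P x] .
  interpret set_presheaf U C "closed_spans b" "pull_spans b"
    by (rule set_presheaf_spans[OF b])
  let ?H = "encode U C (closed_spans b) (pull_spans b)"
  define T where "T c z = {(f, h) \<in> spans b c.
    locally C J (Dom C f) (\<lambda>g. Res P (f \<cdot> g) z = Res P (h \<cdot> g) y)}" for c z
  have T_closed: "T c z \<in> closed_spans b c" if z: "z \<in> Sec P c" for c z
  proof -
    have 1: "(f \<cdot> g, h \<cdot> g) \<in> T c z" if fh: "(f, h) \<in> T c z" and g: "g \<in> Ar C" "Cod C g = Dom C f" for f h g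
    proof -
      have s: "(f, h) \<in> spans b c" and loc: "locally C J (Dom C f) (\<lambda>g. Res P (f \<cdot> g) z = Res P (h \<cdot> g) y)"
        using fh by (auto simp: T_def)
      have "locally C J (Dom C g) (\<lambda>g'. Res P ((f \<cdot> g) \<cdot> g') z = Res P ((h \<cdot> g) \<cdot> g') y)"
        by (rule locally_mono[OF locally_pull[OF loc g]]) (use spans_assoc[OF s g] g Dom_Ob in auto)
      then show ?thesis
        using spans_Cmp[OF s g] spansD[OF s] g Cmp_Ar[of f g] by (simp add: T_def)
    qed
    have 2: "(f, h) \<in> T c z" if s: "(f, h) \<in> spans b c" and loc: "locally C J (Dom C f) (\<lambda>g. (f \<cdot> g, h \<cdot> g) \<in> T c z)" for f h
    proof -
      note f = spansD[OF s]
      have "locally C J (Dom C f) (\<lambda>g. Res P (f \<cdot> g) z = Res P (h \<cdot> g) y)"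
      proof (rule locally_trans[OF loc])
        fix g assume g: "g \<in> Ar C" "Cod C g = Dom C f" and "(f \<cdot> g, h \<cdot> g) \<in> T c z"
        then have loc': "locally C J (Dom C g) (\<lambda>g'. Res P ((f \<cdot> g) \<cdot> g') z = Res P ((h \<cdot> g) \<cdot> g') y)"
          using f Cmp_Ar[of f g] by (simp add: T_def)
        show "locally C J (Dom C g) (\<lambda>g'. Res P (f \<cdot> (g \<cdot> g')) z = Res P (h \<cdot> (g \<cdot> g')) y)"
          by (rule locally_mono[OF loc']) (use spans_assoc[OF s g] g Dom_Ob in auto)
      qed (use f in simp)
      then show ?thesis using s by (simp add: T_def)
    qed
    show ?thesis
      by (rule closed_spansI[OF _ 1 2]) (auto simp: T_def)
  qed
  have T_Res: "T (Dom C k) (Res P k z) = pull_spans b k (T (Cod C k) z)"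
    if k: "k \<in> Ar C" and z: "z \<in> Sec P (Cod C k)" for k z
  proof -
    have "(f, h) \<in> T (Dom C k) (Res P k z) \<longleftrightarrow> (f, h) \<in> pull_spans b k (T (Cod C k) z)"
      if s: "(f, h) \<in> spans b (Dom C k)" for f h
    proof -
      note f = spansD[OF s]
      have "Res P (f \<cdot> g) (Res P k z) = Res P ((k \<cdot> f) \<cdot> g) z" if "g \<in> Ar C" "Cod C g = Dom C f" for g
        using Res_Cmp[OF P k, of "f \<cdot> g" z] Cmp_Ar[OF f(1) that] f k z that by (simp add: Cmp_Ar_assoc)
      then have "locally C J (Dom C f) (\<lambda>g. Res P (f \<cdot> g) (Res P k z) = Res P (h \<cdot> g) y) \<longleftrightarrow>
          locally C J (Dom C f) (\<lambda>g. Res P ((k \<cdot> f) \<cdot> g) z = Res P (h \<cdot> g) y)"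
        using f by (auto elim!: locally_mono)
      then show ?thesis
        using s spans_post[OF s k] Cmp_Ar[of k f] k f by (simp add: T_def pull_spans_def)
    qed
    then show ?thesis
      by (auto simp: T_def pull_spans_def)
  qed
  let ?t = "psh_mor P ?H (\<lambda>c z. enc U (closed_spans b c) (T c z))"
  have t: "?t \<in> hom (presheaf_cat U C) P ?H"
    by (rule psh_mor_hom[OF P encode_presheaf])
      (use enc_Sec Sec_Ob[OF P] T_closed in \<open>auto simp: T_Res Res_encode\<close>)
  note tr = a_transpose(2)[OF t closed_spans_sheaf[OF b]]
  \<comment> \<open>The morphism ?t has a sheaf as target, so it cannot separate x and y.\<close>
  have "ap ?t b x = ap ?t b y"
    using tr[OF x] tr[OF y] eq by simp
  then have TT: "T b x = T b y"
    using enc_eq[OF b T_closed[OF x] T_closed[OF y]] by (simp add: ap_psh_mor x y)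
  have Id: "(Idn C b, Idn C b) \<in> spans b b"
    using Idn_Ar[OF b] by (simp add: spans_def)
  then have "(Idn C b, Idn C b) \<in> T b y"
    using Idn_Ar[OF b] b by (auto simp: T_def intro: locally_everywhere)
  then have "locally C J b (\<lambda>g. Res P (Idn C b \<cdot> g) x = Res P (Idn C b \<cdot> g) y)"
    using Idn_Ar[OF b] by (simp add: TT[symmetric]) (simp add: T_def)
  then show ?thesis
    by (rule locally_mono[OF _ b]) (metis Idn_Cmp_Ar)
qed

end

section \<open>The canonical functor from a site to its sheaves\<close>

context small_site
begin

lemma set_presheaf_hom:
  assumes "c \<in> Ob C"
  shows "set_presheaf U C (\<lambda>b. hom C b c) (\<lambda>f g. g \<cdot> f)"
proof
  show "fits U (hom C b c)" if "b \<in> Ob C" for b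
    using fits_small[OF universe small_hom[OF that assms]] .
qed (use Cmp_Ar in \<open>auto simp: hom_def Cmp_Idn_Ar Cmp_Ar_assoc\<close>)

lemma representable_encode: "representable U C c = encode U C (\<lambda>b. hom C b c) (\<lambda>f g. g \<cdot> f)"
  unfolding representable_def encode_def enc_hom_def dec_hom_def by (rule refl)

lemma representable_presheaf: "c \<in> Ob C \<Longrightarrow> is_presheaf U C (representable U C c)"
  unfolding representable_encode by (rule set_presheaf.encode_presheaf[OF set_presheaf_hom])

lemma enc_hom_Sec:
  assumes "g \<in> Ar C"
  shows "enc_hom U C (Dom C g) (Cod C g) g \<in> Sec (representable U C (Cod C g)) (Dom C g)"
  using set_presheaf.enc_Sec[OF set_presheaf_hom[OF Cod_Ob[OF assms]] Dom_Ob[OF assms]] assms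
  unfolding representable_encode enc_hom_def by (auto simp: hom_def)

lemma dec_enc_hom:
  assumes "g \<in> Ar C"
  shows "dec_hom U C (Dom C g) (Cod C g) (enc_hom U C (Dom C g) (Cod C g) g) = g"
  using inv_into_enc[OF fits_small[OF universe small_hom[OF Dom_Ob[OF assms] Cod_Ob[OF assms]]], of g] assms
  unfolding enc_hom_def dec_hom_def by (auto simp: hom_def)

lemma Sec_representableE:
  assumes "s \<in> Sec (representable U C c) b" "c \<in> Ob C"
  obtains g where "g \<in> Ar C" "Dom C g = b" "Cod C g = c" "s = enc_hom U C (Dom C g) (Cod C g) g"
  using assms(1) that unfolding representable_encode
  by (elim set_presheaf.Sec_encodeE[OF set_presheaf_hom[OF assms(2)]]) (auto simp: hom_def enc_hom_def)

lemma Res_representable: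
  assumes "g \<in> Ar C" "f \<in> Ar C" "Cod C f = Dom C g"
  shows "Res (representable U C (Cod C g)) f (enc_hom U C (Dom C g) (Cod C g) g) =
    enc_hom U C (Dom C (g \<cdot> f)) (Cod C (g \<cdot> f)) (g \<cdot> f)"
  using set_presheaf.Res_encode[OF set_presheaf_hom[OF Cod_Ob[OF assms(1)]] assms(2), of g] assms Cmp_Ar
  unfolding representable_encode enc_hom_def by (auto simp: hom_def)

lemma yoneda_psh_mor:
  "FA (yoneda U C) f = psh_mor (representable U C (Dom C f)) (representable U C (Cod C f))
    (\<lambda>b x. enc_hom U C b (Cod C f) (f \<cdot> dec_hom U C b (Dom C f) x))"
  by (simp add: yoneda_def psh_mor_def)

lemma ap_yoneda:
  assumes "f \<in> Ar C" "g \<in> Ar C" "Cod C g = Dom C f"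
  shows "ap (FA (yoneda U C) f) (Dom C g) (enc_hom U C (Dom C g) (Cod C g) g) =
    enc_hom U C (Dom C (f \<cdot> g)) (Cod C (f \<cdot> g)) (f \<cdot> g)"
  using ap_psh_mor[OF enc_hom_Sec[OF assms(2), unfolded assms(3)]] dec_enc_hom[OF assms(2)] assms Cmp_Ar
  by (simp add: yoneda_psh_mor)

lemma yoneda_hom:
  assumes "f \<in> hom C a b"
  shows "FA (yoneda U C) f \<in> hom (presheaf_cat U C) (representable U C a) (representable U C b)"
proof -
  note f = homD[OF assms]
  have "FA (yoneda U C) f \<in>
      hom (presheaf_cat U C) (representable U C (Dom C f)) (representable U C (Cod C f))"
    unfolding yoneda_psh_mor
  proof (rule psh_mor_hom[OF representable_presheaf[OF Dom_Ob[OF f(1)]] representable_presheaf[OF Cod_Ob[OF f(1)]]])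
    fix c x assume "x \<in> Sec (representable U C (Dom C f)) c"
    then obtain g where g: "g \<in> Ar C" "Dom C g = c" "Cod C g = Dom C f"
      "x = enc_hom U C (Dom C g) (Cod C g) g"
      by (rule Sec_representableE[OF _ Dom_Ob[OF f(1)]])
    then show "enc_hom U C c (Cod C f) (f \<cdot> dec_hom U C c (Dom C f) x) \<in> Sec (representable U C (Cod C f)) c"
      using enc_hom_Sec[of "f \<cdot> g"] dec_enc_hom[OF g(1)] f Cmp_Ar[OF f(1) g(1,3)] by simp
  next
    fix k x assume k: "k \<in> Ar C" and "x \<in> Sec (representable U C (Dom C f)) (Cod C k)"
    then obtain g where g: "g \<in> Ar C" "Dom C g = Cod C k" "Cod C g = Dom C f"
      "x = enc_hom U C (Dom C g) (Cod C g) g"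
      by (auto elim: Sec_representableE[OF _ Dom_Ob[OF f(1)]])
    note gk = Cmp_Ar[OF g(1) k g(2)[symmetric]] and fg = Cmp_Ar[OF f(1) g(1,3)]
    show "enc_hom U C (Dom C k) (Cod C f)
        (f \<cdot> dec_hom U C (Dom C k) (Dom C f) (Res (representable U C (Dom C f)) k x)) =
      Res (representable U C (Cod C f)) k
        (enc_hom U C (Cod C k) (Cod C f) (f \<cdot> dec_hom U C (Cod C k) (Dom C f) x))"
      using Res_representable[OF g(1) k] Res_representable[OF fg(1) k] dec_enc_hom[OF g(1)] dec_enc_hom[OF gk(1)]
        g f gk fg Cmp_Ar[OF fg(1) k] Cmp_Ar_assoc[OF k g(1) f(1)] by simp
  qed
  then show ?thesis using f by simp
qed

lemma yoneda_functor: "cat_functor C (presheaf_cat U C) (yoneda U C)"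
proof -
  interpret P: category "presheaf_cat U C" by (rule presheaf_category)
  have obj: "FO (yoneda U C) c = representable U C c" for c
    by (simp add: yoneda_def)
  show ?thesis
  proof
    fix c assume c: "c \<in> Ob C"
    then show "FO (yoneda U C) c \<in> Ob (presheaf_cat U C)"
      by (simp add: obj sheaf_cat_simps representable_presheaf)
    show "FA (yoneda U C) (Idn C c) = Idn (presheaf_cat U C) (FO (yoneda U C) c)"
      unfolding obj
    proof (rule psh_hom_eqI[OF yoneda_hom[OF Idn_hom[OF c]] psh_Idn_hom[OF representable_presheaf[OF c]]])
      fix b x assume x: "x \<in> Sec (representable U C c) b"
      obtain g where g: "g \<in> Ar C" "Dom C g = b" "Cod C g = c" "x = enc_hom U C (Dom C g) (Cod C g) g"
        by (rule Sec_representableE[OF x c])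
      then show "ap (FA (yoneda U C) (Idn C c)) b x = ap (Idn (presheaf_cat U C) (representable U C c)) b x"
        using ap_yoneda[of "Idn C c" g] Idn_Ar[OF c] Idn_Cmp_Ar[OF g(1)] ap_Idn[OF x] by simp
    qed
  next
    fix f a b g c assume f: "f \<in> hom C a b" and g: "g \<in> hom C b c"
    note f' = homD[OF f] and g' = homD[OF g]
    show "FA (yoneda U C) (g \<cdot> f) = FA (yoneda U C) g \<cdot>\<^bsub>presheaf_cat U C\<^esub> FA (yoneda U C) f"
    proof (rule psh_hom_eqI[OF yoneda_hom[OF Cmp_hom[OF f g]] psh_Cmp_hom[OF yoneda_hom[OF f] yoneda_hom[OF g]]])
      fix e x assume x: "x \<in> Sec (representable U C a) e"
      then obtain k where k: "k \<in> Ar C" "Dom C k = e" "Cod C k = a" "x = enc_hom U C (Dom C k) (Cod C k) k"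
        by (rule Sec_representableE[OF _ hom_Ob(1)[OF f]])
      have fk: "f \<cdot> k \<in> Ar C" "Dom C (f \<cdot> k) = e" "Cod C (f \<cdot> k) = b"
        using Cmp_Ar[of f k] f' k by auto
      show "ap (FA (yoneda U C) (g \<cdot> f)) e x =
          ap (FA (yoneda U C) g \<cdot>\<^bsub>presheaf_cat U C\<^esub> FA (yoneda U C) f) e x"
        using ap_Cmp[OF yoneda_hom[OF f] yoneda_hom[OF g] x] ap_yoneda[of "g \<cdot> f" k] ap_yoneda[of f k]
          ap_yoneda[of g "f \<cdot> k"] k f' g' fk Cmp_Ar[of g f] Cmp_Ar_assoc[OF k(1) f'(1) g'(1)] by simp
    qed
  qed (simp add: obj yoneda_hom)
qed

lemma ell_functor: "cat_functor C (sheaf_cat U C J) (ell U C J)"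
  unfolding ell_def by (rule comp_functor[OF yoneda_functor sheafification_functor])

abbreviation "l \<equiv> FO (ell U C J)"

text \<open>The section of the sheaf associated with an object given by an arrow into that object.\<close>

definition lel :: "'a \<Rightarrow> 'u" where
  "lel g = \<eta> (representable U C (Cod C g)) (Dom C g) (enc_hom U C (Dom C g) (Cod C g) g)"

lemma l_eq: "l c = sheafify (representable U C c)"
  by (simp add: ell_def comp_funct_def yoneda_def)

lemma l_sheaf: "c \<in> Ob C \<Longrightarrow> is_sheaf U C J (l c)"
  unfolding l_eq by (rule a_sheaf[OF representable_presheaf])

lemma l_hom: "f \<in> hom C b c \<Longrightarrow> FA (ell U C J) f \<in> hom (presheaf_cat U C) (l b) (l c)"
  using cat_functor.FA_hom[OF ell_functor] by (auto simp: sheaf_cat_simps)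

lemma lel_Sec: "g \<in> Ar C \<Longrightarrow> lel g \<in> Sec (l (Cod C g)) (Dom C g)"
  unfolding lel_def l_eq
  by (rule ap_Sec[OF unit_hom[OF representable_presheaf[OF Cod_Ob]] enc_hom_Sec])

lemma lel_Res:
  assumes "g \<in> Ar C" "k \<in> Ar C" "Cod C k = Dom C g"
  shows "Res (l (Cod C g)) k (lel g) = lel (g \<cdot> k)"
  unfolding lel_def l_eq
  using ap_Res[OF unit_hom[OF representable_presheaf[OF Cod_Ob[OF assms(1)]]] assms(2),
      of "enc_hom U C (Dom C g) (Cod C g) g"] enc_hom_Sec[OF assms(1)] assms Cmp_Ar[OF assms]
    Res_representable[OF assms]
  by simp

lemma ap_l:
  assumes "f \<in> Ar C" "g \<in> Ar C" "Cod C g = Dom C f"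
  shows "ap (FA (ell U C J) f) (Dom C g) (lel g) = lel (f \<cdot> g)"
proof -
  have f: "f \<in> hom C (Dom C f) (Cod C f)" using assms(1) by (simp add: hom_def)
  show ?thesis
    using ap_a[OF yoneda_hom[OF f] enc_hom_Sec[OF assms(2), unfolded assms(3)]] ap_yoneda[OF assms]
      Cmp_Ar[OF assms] assms(3)
    by (simp add: lel_def ell_def comp_funct_def)
qed

lemma l_generated:
  assumes c: "c \<in> Ob C" and s: "s \<in> Sec (l c) b"
  shows "locally C J b (\<lambda>v. \<exists>g\<in>hom C (Dom C v) c. Res (l c) v s = lel g)"
proof (rule locally_mono[OF a_generated[OF representable_presheaf[OF c] s[unfolded l_eq]]])
  show "b \<in> Ob C" using Sec_Ob[OF sheaf_presheaf[OF l_sheaf[OF c]] s] .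
  fix v assume "\<exists>x\<in>Sec (representable U C c) (Dom C v).
    Res (sheafify (representable U C c)) v s = \<eta> (representable U C c) (Dom C v) x"
  then show "\<exists>g\<in>hom C (Dom C v) c. Res (l c) v s = lel g"
    by (elim bexE Sec_representableE[OF _ c]) (auto simp: lel_def l_eq hom_def)
qed

text \<open>
  The topology need not be subcanonical, so arrows of the site may become equal as sections; what remains of
  their equality on the site is local.
\<close>

lemma l_kernel:
  assumes f: "f \<in> hom C b c" and g: "g \<in> hom C b c" and eq: "lel f = lel g"
  shows "locally C J b (\<lambda>v. f \<cdot> v = g \<cdot> v)"
proof -
  note f' = homD[OF f] and g' = homD[OF g]
  have c: "c \<in> Ob C" and b: "b \<in> Ob C" using hom_Ob[OF f] by auto
  let ?P = "representable U C c"
  have "locally C J b (\<lambda>v. Res ?P v (enc_hom U C b c f) = Res ?P v (enc_hom U C b c g))"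
    using enc_hom_Sec[OF f'(1)] enc_hom_Sec[OF g'(1)] eq f' g'
    by (intro a_kernel[OF representable_presheaf[OF c]]) (auto simp: lel_def)
  then show ?thesis
  proof (rule locally_mono[OF _ b])
    fix v assume v: "v \<in> Ar C" "Cod C v = b" and "Res ?P v (enc_hom U C b c f) = Res ?P v (enc_hom U C b c g)"
    then have "enc_hom U C (Dom C v) c (f \<cdot> v) = enc_hom U C (Dom C v) c (g \<cdot> v)"
      using Res_representable[of f v] Res_representable[of g v] f' g' Cmp_Ar[of f v] Cmp_Ar[of g v] by simp
    then show "f \<cdot> v = g \<cdot> v"
      using dec_enc_hom[of "f \<cdot> v"] dec_enc_hom[of "g \<cdot> v"] f' g' v Cmp_Ar[of f v] Cmp_Ar[of g v] by simp
  qed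
qed

lemma l_yoneda:
  assumes H: "is_sheaf U C J H" and z: "z \<in> Sec H c"
  obtains t where "t \<in> hom (presheaf_cat U C) (l c) H"
    "\<And>g. g \<in> Ar C \<Longrightarrow> Cod C g = c \<Longrightarrow> ap t (Dom C g) (lel g) = Res H g z"
proof -
  note P = sheaf_presheaf[OF H]
  have c: "c \<in> Ob C" using Sec_Ob[OF P z] .
  let ?f = "psh_mor (representable U C c) H (\<lambda>b x. Res H (dec_hom U C b c x) z)"
  have f: "?f \<in> hom (presheaf_cat U C) (representable U C c) H"
  proof (rule psh_mor_hom[OF representable_presheaf[OF c] P])
    fix b x assume "x \<in> Sec (representable U C c) b"
    then obtain g where "g \<in> Ar C" "Dom C g = b" "Cod C g = c" "x = enc_hom U C (Dom C g) (Cod C g) g"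
      by (rule Sec_representableE[OF _ c])
    then show "Res H (dec_hom U C b c x) z \<in> Sec H b"
      using dec_enc_hom Res_Sec[OF P] z by auto
  next
    fix k x assume k: "k \<in> Ar C" and "x \<in> Sec (representable U C c) (Cod C k)"
    then obtain g where g: "g \<in> Ar C" "Dom C g = Cod C k" "Cod C g = c"
      "x = enc_hom U C (Dom C g) (Cod C g) g"
      by (auto elim: Sec_representableE[OF _ c])
    then show "Res H (dec_hom U C (Dom C k) c (Res (representable U C c) k x)) z =
        Res H k (Res H (dec_hom U C (Cod C k) c x) z)"
      using Res_representable[OF g(1) k] dec_enc_hom[OF g(1)] dec_enc_hom[of "g \<cdot> k"] Cmp_Ar[OF g(1) k]
        Res_Cmp[OF P g(1) k] k z by simp
  qed
  note t = a_transpose[OF f H]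
  show thesis
  proof (rule that)
    show "transpose (presheaf_cat U C) (sheaf_cat U C J) incl (representable U C c) H ?f \<in>
        hom (presheaf_cat U C) (l c) H"
      unfolding l_eq by (rule t(1))
    fix g assume g: "g \<in> Ar C" "Cod C g = c"
    show "ap (transpose (presheaf_cat U C) (sheaf_cat U C J) incl (representable U C c) H ?f) (Dom C g) (lel g) =
        Res H g z"
      using t(2)[of "enc_hom U C (Dom C g) c g" "Dom C g"] enc_hom_Sec[OF g(1)] dec_enc_hom[OF g(1)] g(2)
      by (simp add: lel_def ap_psh_mor)
  qed
qed

lemma l_cancel:
  assumes c: "c \<in> Ob C" and H: "is_sheaf U C J H"
    and t: "t \<in> hom (presheaf_cat U C) (l c) H" and t': "t' \<in> hom (presheaf_cat U C) (l c) H"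
    and eq: "ap t c (lel (Idn C c)) = ap t' c (lel (Idn C c))"
  shows "t = t'"
proof (rule a_cancel[OF representable_presheaf[OF c] H t[unfolded l_eq] t'[unfolded l_eq]])
  note I = Idn_Ar[OF c]
  fix b x assume "x \<in> Sec (representable U C c) b"
  then obtain g where g: "g \<in> Ar C" "Dom C g = b" "Cod C g = c" "x = enc_hom U C (Dom C g) (Cod C g) g"
    by (rule Sec_representableE[OF _ c])
  have "lel g = Res (l c) g (lel (Idn C c))"
    using lel_Res[of "Idn C c" g] I g Idn_Cmp_Ar[OF g(1)] by simp
  moreover have "lel (Idn C c) \<in> Sec (l c) (Cod C g)"
    using lel_Sec[OF I(1)] I g by simp
  ultimately have "ap t b (lel g) = ap t' b (lel g)"
    using ap_Res[OF t g(1)] ap_Res[OF t' g(1)] g eq by simp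
  then show "ap t b (\<eta> (representable U C c) b x) = ap t' b (\<eta> (representable U C c) b x)"
    using g by (simp add: lel_def)
qed

lemma lel_eq_Res:
  assumes "f \<in> hom C b c" "g \<in> hom C b c" "lel f = lel g" "is_sheaf U C J H" "z \<in> Sec H c"
  shows "Res H f z = Res H g z"
  by (rule l_yoneda[OF assms(4,5)]) (use assms(1-3) in \<open>metis homD\<close>)

end


section \<open>The inverse image of a comorphism and the unit\<close>

locale comorphism =
  D: small_site U D K + C: small_site U C J + p: cat_functor D C p
  for U :: "'u set set" and D :: "('p, 'b) cat" and K :: "'p \<Rightarrow> 'b set set"
    and C :: "('o, 'a) cat" and J :: "'o \<Rightarrow> 'a set set" and p :: "('p, 'b, 'o, 'a) funct" +
  assumes lift_cover: "d \<in> Ob D \<Longrightarrow> S \<in> J (FO p d) \<Longrightarrow> \<exists>R\<in>K d. FA p ` R \<subseteq> S"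
begin

abbreviation "T \<equiv> FO (C_star U D K p)"
abbreviation "TA \<equiv> FA (C_star U D K p)"
abbreviation "\<theta> E \<equiv> ap (sheafification_unit U D K (FO (precomp D p) E))"

lemma lift_locally:
  assumes d: "d \<in> Ob D" and loc: "locally C J (FO p d) Q"
  shows "locally D K d (\<lambda>v. Q (FA p v))"
proof -
  obtain S where S: "S \<in> J (FO p d)" "\<forall>f\<in>S. Q f"
    using loc by (auto simp: locally_def)
  obtain R where R: "R \<in> K d" "FA p ` R \<subseteq> S"
    using lift_cover[OF d S(1)] by auto
  then have "\<forall>v\<in>R. Q (FA p v)"
    using S(2) by auto
  then show ?thesis
    using R(1) by (auto simp: locally_def)
qed

lemma C_star_functor: "cat_functor (sheaf_cat U C J) (sheaf_cat U D K) (C_star U D K p)"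
proof -
  interpret P: cat_functor "presheaf_cat U C" "presheaf_cat U D" "precomp D p"
    by (rule p.precomp_functor)
  have "cat_functor (sheaf_cat U C J) (presheaf_cat U D) (precomp D p)"
    unfolding cat_functor_def cat_functor_axioms_def
    by (auto simp: sheaf_category presheaf_category sheaf_cat_simps p.precomp_presheaf sheaf_presheaf
        intro: P.FA_hom P.FA_Idn P.FA_Cmp)
  then show ?thesis
    unfolding C_star_def by (rule comp_functor[OF _ D.sheafification_functor])
qed

lemma T_eq: "T E = D.sheafify (FO (precomp D p) E)"
  by (simp add: C_star_def comp_funct_def)

lemma T_sheaf: "is_presheaf U C E \<Longrightarrow> is_sheaf U D K (T E)"
  unfolding T_eq by (rule D.a_sheaf[OF p.precomp_presheaf])

lemma T_hom: "h \<in> hom (presheaf_cat U C) E E' \<Longrightarrow> TA h \<in> hom (presheaf_cat U D) (T E) (T E')"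
  unfolding T_eq by (simp add: C_star_def comp_funct_def D.a_hom p.precomp_hom)

lemma \<theta>_hom: "is_presheaf U C E \<Longrightarrow>
    sheafification_unit U D K (FO (precomp D p) E) \<in> hom (presheaf_cat U D) (FO (precomp D p) E) (T E)"
  unfolding T_eq by (rule D.unit_hom[OF p.precomp_presheaf])

lemma \<theta>_Sec: "is_presheaf U C E \<Longrightarrow> d \<in> Ob D \<Longrightarrow> x \<in> Sec E (FO p d) \<Longrightarrow> \<theta> E d x \<in> Sec (T E) d"
  by (rule ap_Sec[OF \<theta>_hom]) (simp_all add: p.Sec_precomp)

lemma \<theta>_Res:
  "is_presheaf U C E \<Longrightarrow> v \<in> Ar D \<Longrightarrow> x \<in> Sec E (FO p (Cod D v)) \<Longrightarrow>
    Res (T E) v (\<theta> E (Cod D v) x) = \<theta> E (Dom D v) (Res E (FA p v) x)"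
  using ap_Res[OF \<theta>_hom, of E v x] by (simp add: p.Sec_precomp p.Res_precomp D.Cod_Ob)

lemma ap_T:
  "h \<in> hom (presheaf_cat U C) E E' \<Longrightarrow> d \<in> Ob D \<Longrightarrow> x \<in> Sec E (FO p d) \<Longrightarrow>
    ap (TA h) d (\<theta> E d x) = \<theta> E' d (ap h (FO p d) x)"
  using D.ap_a[OF p.precomp_hom, of h E E' x d]
  by (simp add: C_star_def comp_funct_def p.Sec_precomp p.ap_precomp)

lemma T_kernel:
  assumes E: "is_presheaf U C E" and d: "d \<in> Ob D" and x: "x \<in> Sec E (FO p d)" "y \<in> Sec E (FO p d)"
    and eq: "\<theta> E d x = \<theta> E d y"
  shows "locally D K d (\<lambda>v. Res E (FA p v) x = Res E (FA p v) y)"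
proof (rule D.locally_mono)
  show "locally D K d (\<lambda>v. Res (FO (precomp D p) E) v x = Res (FO (precomp D p) E) v y)"
    by (rule D.a_kernel[OF p.precomp_presheaf[OF E]]) (use d x eq in \<open>auto simp: p.Sec_precomp\<close>)
qed (use d in \<open>auto simp: p.Res_precomp\<close>)

abbreviation "eta \<equiv> eta_ob U D K C J p"

lemma hom_action_psh_mor:
  "hom_action U D C p d = psh_mor (representable U D d) (FO (precomp D p) (representable U C (FO p d)))
    (\<lambda>e x. enc_hom U C (FO p e) (FO p d) (FA p (dec_hom U D e d x)))"
  by (simp add: hom_action_def psh_mor_def)

lemma hom_action_hom:
  assumes d: "d \<in> Ob D"
  shows "hom_action U D C p d \<in>
    hom (presheaf_cat U D) (representable U D d) (FO (precomp D p) (representable U C (FO p d)))"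
  unfolding hom_action_psh_mor
proof (rule psh_mor_hom[OF D.representable_presheaf[OF d]
      p.precomp_presheaf[OF C.representable_presheaf[OF p.FO_Ob[OF d]]]])
  fix e x assume "x \<in> Sec (representable U D d) e"
  then obtain g where g: "g \<in> Ar D" "Dom D g = e" "Cod D g = d" "x = enc_hom U D (Dom D g) (Cod D g) g"
    by (rule D.Sec_representableE[OF _ d])
  then show "enc_hom U C (FO p e) (FO p d) (FA p (dec_hom U D e d x)) \<in>
      Sec (FO (precomp D p) (representable U C (FO p d))) e"
    using D.dec_enc_hom[OF g(1)] C.enc_hom_Sec[OF p.FA_Ar(1)[OF g(1)]] p.FA_Ar[OF g(1)] D.Dom_Ob[OF g(1)]
    by (simp add: p.Sec_precomp)
next
  fix k x assume k: "k \<in> Ar D" and "x \<in> Sec (representable U D d) (Cod D k)"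
  then obtain g where g: "g \<in> Ar D" "Dom D g = Cod D k" "Cod D g = d" "x = enc_hom U D (Dom D g) (Cod D g) g"
    by (auto elim: D.Sec_representableE[OF _ d])
  note gk = D.Cmp_Ar[OF g(1) k g(2)[symmetric]] and pg = p.FA_Ar[OF g(1)] and pk = p.FA_Ar[OF k]
  have pgk: "FA p (g \<cdot>\<^bsub>D\<^esub> k) = FA p g \<cdot>\<^bsub>C\<^esub> FA p k"
    by (rule p.FA_Cmp_Ar[OF k g(1) g(2)[symmetric]])
  show "enc_hom U C (FO p (Dom D k)) (FO p d)
      (FA p (dec_hom U D (Dom D k) d (Res (representable U D d) k x))) =
    Res (FO (precomp D p) (representable U C (FO p d))) k
      (enc_hom U C (FO p (Cod D k)) (FO p d) (FA p (dec_hom U D (Cod D k) d x)))"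
    using D.Res_representable[OF g(1) k] D.dec_enc_hom[OF g(1)] D.dec_enc_hom[OF gk(1)]
      C.Res_representable[OF pg(1) pk(1)] C.Cmp_Ar[OF pg(1) pk(1)] g gk pg pk pgk
    by (simp add: p.Res_precomp k)
qed

lemma ap_hom_action:
  assumes "g \<in> Ar D"
  shows "ap (hom_action U D C p (Cod D g)) (Dom D g) (enc_hom U D (Dom D g) (Cod D g) g) =
    enc_hom U C (Dom C (FA p g)) (Cod C (FA p g)) (FA p g)"
  unfolding hom_action_psh_mor
  using ap_psh_mor[OF D.enc_hom_Sec[OF assms]] D.dec_enc_hom[OF assms] p.FA_Ar[OF assms] by simp

lemma unit_pre_hom:
  assumes d: "d \<in> Ob D"
  shows "FA (precomp D p) (sheafification_unit U C J (representable U C (FO p d))) \<in>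
    hom (presheaf_cat U D) (FO (precomp D p) (representable U C (FO p d))) (FO (precomp D p) (C.l (FO p d)))"
  unfolding C.l_eq by (rule p.precomp_hom[OF C.unit_hom[OF C.representable_presheaf[OF p.FO_Ob[OF d]]]])

lemma eta_hom:
  assumes d: "d \<in> Ob D"
  shows "eta d \<in> hom (presheaf_cat U D) (D.l d) (T (C.l (FO p d)))"
  unfolding eta_ob_def D.l_eq T_eq
  by (rule D.a_hom[OF psh_Cmp_hom[OF hom_action_hom[OF d] unit_pre_hom[OF d]]])

lemma ap_eta:
  assumes g: "g \<in> Ar D"
  shows "ap (eta (Cod D g)) (Dom D g) (D.lel g) = \<theta> (C.l (FO p (Cod D g))) (Dom D g) (C.lel (FA p g))"
proof -
  note d = D.Cod_Ob[OF g] and x = D.enc_hom_Sec[OF g]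
  note h = hom_action_hom[OF d] and u = unit_pre_hom[OF d]
  show ?thesis
    using D.ap_a[OF psh_Cmp_hom[OF h u] x] ap_Cmp[OF h u x] ap_hom_action[OF g] p.FA_Ar[OF g] D.Dom_Ob[OF g]
    by (simp add: eta_ob_def D.lel_def C.lel_def p.ap_precomp)
qed

end

section \<open>Pullbacks and terminal objects\<close>

definition pullback :: "('o, 'a) cat \<Rightarrow> 'a \<Rightarrow> 'a \<Rightarrow> 'a \<Rightarrow> 'a \<Rightarrow> bool" where
  "pullback A f g h k \<longleftrightarrow> f \<in> Ar A \<and> g \<in> hom A (Dom A f) (Dom A k) \<and> h \<in> hom A (Cod A f) (Cod A k) \<and>
    k \<in> Ar A \<and> h \<cdot>\<^bsub>A\<^esub> f = k \<cdot>\<^bsub>A\<^esub> g \<and>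
    (\<forall>v f' g'. f' \<in> hom A v (Cod A f) \<longrightarrow> g' \<in> hom A v (Dom A k) \<longrightarrow> h \<cdot>\<^bsub>A\<^esub> f' = k \<cdot>\<^bsub>A\<^esub> g' \<longrightarrow>
      (\<exists>!w. w \<in> hom A v (Dom A f) \<and> f \<cdot>\<^bsub>A\<^esub> w = f' \<and> g \<cdot>\<^bsub>A\<^esub> w = g'))"

lemma pullback_iff:
  assumes "f \<in> hom A v x" "g \<in> hom A v y" "h \<in> hom A x z" "k \<in> hom A y z"
  shows "pullback A f g h k \<longleftrightarrow> h \<cdot>\<^bsub>A\<^esub> f = k \<cdot>\<^bsub>A\<^esub> g \<and>
    (\<forall>v' f' g'. f' \<in> hom A v' x \<longrightarrow> g' \<in> hom A v' y \<longrightarrow> h \<cdot>\<^bsub>A\<^esub> f' = k \<cdot>\<^bsub>A\<^esub> g' \<longrightarrow>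
      (\<exists>!w. w \<in> hom A v' v \<and> f \<cdot>\<^bsub>A\<^esub> w = f' \<and> g \<cdot>\<^bsub>A\<^esub> w = g'))"
  using assms unfolding pullback_def by (auto simp: hom_def)

definition terminal :: "('o, 'a) cat \<Rightarrow> 'o \<Rightarrow> bool" where
  "terminal A v \<longleftrightarrow> v \<in> Ob A \<and> (\<forall>v'\<in>Ob A. \<exists>!w. w \<in> hom A v' v)"

definition empty_cat :: "(nat, nat) cat" where
  "empty_cat = \<lparr>Ob = {}, Ar = {}, Dom = id, Cod = id, Idn = id, Cmp = (\<lambda>g f. g)\<rparr>"

text \<open>The walking cospan, with the objects 0, 1, 2 and the arrows 3 from 0 to 2 and 4 from 1 to 2.\<close>

definition cospan_cat :: "(nat, nat) cat" where
  "cospan_cat = \<lparr>Ob = {0, 1, 2}, Ar = {0, 1, 2, 3, 4},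
    Dom = (\<lambda>u. if u = 3 then 0 else if u = 4 then 1 else u),
    Cod = (\<lambda>u. if u = 3 \<or> u = 4 then 2 else u),
    Idn = id, Cmp = (\<lambda>g f. if f = 3 \<or> f = 4 then f else g)\<rparr>"

lemma cospan_category: "category cospan_cat"
  by unfold_locales (auto simp: cospan_cat_def hom_def)

definition cospan :: "('o, 'a) cat \<Rightarrow> 'a \<Rightarrow> 'a \<Rightarrow> (nat, nat, 'o, 'a) funct" where
  "cospan A h k = \<lparr>FO = (\<lambda>i. if i = 0 then Dom A h else if i = 1 then Dom A k else Cod A h),
    FA = (\<lambda>u. if u = 3 then h else if u = 4 then k else if u = 0 then Idn A (Dom A h)
      else if u = 1 then Idn A (Dom A k) else Idn A (Cod A h))\<rparr>"

lemma cospan_hom_iff: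
  "f \<in> hom cospan_cat a b \<longleftrightarrow>
    f = a \<and> b = a \<and> a \<in> {0, 1, 2} \<or> f = 3 \<and> a = 0 \<and> b = 2 \<or> f = 4 \<and> a = 1 \<and> b = 2"
  by (auto simp: cospan_cat_def hom_def)

lemma cospan_Cmp: "g \<cdot>\<^bsub>cospan_cat\<^esub> f = (if f = 3 \<or> f = 4 then f else g)"
  by (simp add: cospan_cat_def)

lemma (in category) cospan_functor:
  assumes "h \<in> hom C x z" "k \<in> hom C y z"
  shows "cat_functor cospan_cat C (cospan C h k)"
proof -
  interpret I: category cospan_cat by (rule cospan_category)
  note h = homD[OF assms(1)] and k = homD[OF assms(2)]
  have Ob: "x \<in> Ob C" "y \<in> Ob C" "z \<in> Ob C"
    using hom_Ob[OF assms(1)] hom_Ob[OF assms(2)] by auto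
  have Id: "FA (cospan C h k) a = Idn C (FO (cospan C h k) a)" "FO (cospan C h k) a \<in> Ob C"
    if "a \<in> {0, 1, 2}" for a
    using that h k Ob by (auto simp: cospan_def)
  have X_hom: "FA (cospan C h k) f \<in> hom C (FO (cospan C h k) a) (FO (cospan C h k) b)"
    if "f \<in> hom cospan_cat a b" for f a b
    using that Idn_hom[OF Id(2)] Id(1) assms h k unfolding cospan_hom_iff
    by (elim disjE) (auto simp: cospan_def)
  show ?thesis
  proof
    fix f a b g c assume f: "f \<in> hom cospan_cat a b" and g: "g \<in> hom cospan_cat b c"
    show "FA (cospan C h k) (g \<cdot>\<^bsub>cospan_cat\<^esub> f) = FA (cospan C h k) g \<cdot> FA (cospan C h k) f"
    proof (cases "f = a")
      case True
      then have fa: "b = a" "a \<in> {0, 1, 2}" "g \<cdot>\<^bsub>cospan_cat\<^esub> f = g"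
        using f by (auto simp: cospan_hom_iff cospan_Cmp)
      then show ?thesis
        using Cmp_Idn[OF X_hom[OF g]] Id[OF fa(2)] True by simp
    next
      case False
      then have "b = 2" "g = 2" "c = 2" "g \<cdot>\<^bsub>cospan_cat\<^esub> f = f"
        using f g by (auto simp: cospan_hom_iff cospan_Cmp)
      then show ?thesis
        using Idn_Cmp[OF X_hom[OF f]] Id[of 2] by simp
    qed
  next
    fix a assume "a \<in> Ob cospan_cat"
    then have "a \<in> {0, 1, 2}" by (simp add: cospan_cat_def)
    from Id[OF this] show "FO (cospan C h k) a \<in> Ob C"
      "FA (cospan C h k) (Idn cospan_cat a) = Idn C (FO (cospan C h k) a)"
      by (simp_all add: cospan_cat_def)
  qed (rule X_hom)
qed

lemma cone_cospan_iff:
  assumes X: "cat_functor cospan_cat A X"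
  shows "cone A cospan_cat X v t \<longleftrightarrow> t 0 \<in> hom A v (FO X 0) \<and> t 1 \<in> hom A v (FO X 1) \<and>
    t 2 = FA X 3 \<cdot>\<^bsub>A\<^esub> t 0 \<and> t 2 = FA X 4 \<cdot>\<^bsub>A\<^esub> t 1"
proof -
  interpret X: cat_functor cospan_cat A X by fact
  have 3: "FA X 3 \<in> hom A (FO X 0) (FO X 2)" and 4: "FA X 4 \<in> hom A (FO X 1) (FO X 2)"
    using X.FA_hom[of 3 0 2] X.FA_hom[of 4 1 2] by (auto simp: cospan_cat_def hom_def)
  have I: "FA X i = Idn A (FO X i)" if "i \<in> {0, 1, 2}" for i
    using X.FA_Idn[of i] that by (auto simp: cospan_cat_def)
  show ?thesis
  proof
    assume "cone A cospan_cat X v t"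
    then show "t 0 \<in> hom A v (FO X 0) \<and> t 1 \<in> hom A v (FO X 1) \<and>
        t 2 = FA X 3 \<cdot>\<^bsub>A\<^esub> t 0 \<and> t 2 = FA X 4 \<cdot>\<^bsub>A\<^esub> t 1"
      by (auto simp: cone_def cospan_cat_def)
  next
    assume t: "t 0 \<in> hom A v (FO X 0) \<and> t 1 \<in> hom A v (FO X 1) \<and>
        t 2 = FA X 3 \<cdot>\<^bsub>A\<^esub> t 0 \<and> t 2 = FA X 4 \<cdot>\<^bsub>A\<^esub> t 1"
    then have t2: "t 2 \<in> hom A v (FO X 2)"
      using X.D.Cmp_hom[OF _ 3] by auto
    then show "cone A cospan_cat X v t"
      using t I X.D.hom_Ob[OF t2] X.D.Idn_Cmp[of "t 0" v] X.D.Idn_Cmp[of "t 1" v] X.D.Idn_Cmp[OF t2]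
      by (auto simp: cone_def cospan_cat_def)
  qed
qed

text \<open>
  The component of a cone at the apex of the cospan is determined by either of the other two.
\<close>

lemma limit_cone_cospan_iff:
  assumes X: "cat_functor cospan_cat A X"
  shows "limit_cone A cospan_cat X v t \<longleftrightarrow> t 0 \<in> hom A v (FO X 0) \<and> t 1 \<in> hom A v (FO X 1) \<and>
    t 2 = FA X 3 \<cdot>\<^bsub>A\<^esub> t 0 \<and> pullback A (t 0) (t 1) (FA X 3) (FA X 4)"
proof -
  interpret X: cat_functor cospan_cat A X by fact
  have 3: "FA X 3 \<in> hom A (FO X 0) (FO X 2)" and 4: "FA X 4 \<in> hom A (FO X 1) (FO X 2)"
    using X.FA_hom[of 3 0 2] X.FA_hom[of 4 1 2] by (auto simp: cospan_cat_def hom_def)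
  have Ob: "Ob cospan_cat = {0, 1, 2}" by (simp add: cospan_cat_def)
  have *: "(\<exists>!w. w \<in> hom A v' v \<and> (\<forall>i\<in>Ob cospan_cat. t i \<cdot>\<^bsub>A\<^esub> w = t' i)) \<longleftrightarrow>
      (\<exists>!w. w \<in> hom A v' v \<and> t 0 \<cdot>\<^bsub>A\<^esub> w = t' 0 \<and> t 1 \<cdot>\<^bsub>A\<^esub> w = t' 1)"
    if t: "t 0 \<in> hom A v (FO X 0)" "t 2 = FA X 3 \<cdot>\<^bsub>A\<^esub> t 0" and t': "t' 2 = FA X 3 \<cdot>\<^bsub>A\<^esub> t' 0" for v' t'
  proof -
    have "t 2 \<cdot>\<^bsub>A\<^esub> w = t' 2" if "w \<in> hom A v' v" "t 0 \<cdot>\<^bsub>A\<^esub> w = t' 0" for w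
      using X.D.Cmp_assoc[OF that(1) t(1) 3] that(2) t(2) t' by simp
    then have "w \<in> hom A v' v \<and> (\<forall>i\<in>Ob cospan_cat. t i \<cdot>\<^bsub>A\<^esub> w = t' i) \<longleftrightarrow>
      w \<in> hom A v' v \<and> t 0 \<cdot>\<^bsub>A\<^esub> w = t' 0 \<and> t 1 \<cdot>\<^bsub>A\<^esub> w = t' 1" for w
      by (auto simp: Ob)
    then show ?thesis by simp
  qed
  show ?thesis
  proof (cases "t 0 \<in> hom A v (FO X 0) \<and> t 1 \<in> hom A v (FO X 1) \<and> t 2 = FA X 3 \<cdot>\<^bsub>A\<^esub> t 0")
    case False
    then show ?thesis
      unfolding limit_cone_def cone_cospan_iff[OF X] by blast
  next
    case True
    then have t: "t 0 \<in> hom A v (FO X 0)" "t 1 \<in> hom A v (FO X 1)" "t 2 = FA X 3 \<cdot>\<^bsub>A\<^esub> t 0" by auto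
    have "limit_cone A cospan_cat X v t \<longleftrightarrow> FA X 3 \<cdot>\<^bsub>A\<^esub> t 0 = FA X 4 \<cdot>\<^bsub>A\<^esub> t 1 \<and>
        (\<forall>v' (t' :: nat \<Rightarrow> _). t' 0 \<in> hom A v' (FO X 0) \<and> t' 1 \<in> hom A v' (FO X 1) \<and>
          t' 2 = FA X 3 \<cdot>\<^bsub>A\<^esub> t' 0 \<and> t' 2 = FA X 4 \<cdot>\<^bsub>A\<^esub> t' 1 \<longrightarrow>
          (\<exists>!w. w \<in> hom A v' v \<and> t 0 \<cdot>\<^bsub>A\<^esub> w = t' 0 \<and> t 1 \<cdot>\<^bsub>A\<^esub> w = t' 1))"
      unfolding limit_cone_def cone_cospan_iff[OF X] using *[OF t(1,3)] t
      by (simp cong: conj_cong imp_cong)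
    also have "\<dots> \<longleftrightarrow> pullback A (t 0) (t 1) (FA X 3) (FA X 4)"
      unfolding pullback_iff[OF t(1,2) 3 4]
    proof (intro conj_cong refl iffI allI impI)
      fix v' f' g'
      assume H: "\<forall>v' (t' :: nat \<Rightarrow> _). t' 0 \<in> hom A v' (FO X 0) \<and> t' 1 \<in> hom A v' (FO X 1) \<and>
          t' 2 = FA X 3 \<cdot>\<^bsub>A\<^esub> t' 0 \<and> t' 2 = FA X 4 \<cdot>\<^bsub>A\<^esub> t' 1 \<longrightarrow>
          (\<exists>!w. w \<in> hom A v' v \<and> t 0 \<cdot>\<^bsub>A\<^esub> w = t' 0 \<and> t 1 \<cdot>\<^bsub>A\<^esub> w = t' 1)"
        and "f' \<in> hom A v' (FO X 0)" "g' \<in> hom A v' (FO X 1)" "FA X 3 \<cdot>\<^bsub>A\<^esub> f' = FA X 4 \<cdot>\<^bsub>A\<^esub> g'"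
      then show "\<exists>!w. w \<in> hom A v' v \<and> t 0 \<cdot>\<^bsub>A\<^esub> w = f' \<and> t 1 \<cdot>\<^bsub>A\<^esub> w = g'"
        using H[rule_format, of "\<lambda>i. if i = 0 then f' else if i = 1 then g' else FA X 3 \<cdot>\<^bsub>A\<^esub> f'" v'] by simp
    next
      fix v' and t' :: "nat \<Rightarrow> _"
      assume H: "\<forall>v' f' g'. f' \<in> hom A v' (FO X 0) \<longrightarrow> g' \<in> hom A v' (FO X 1) \<longrightarrow>
          FA X 3 \<cdot>\<^bsub>A\<^esub> f' = FA X 4 \<cdot>\<^bsub>A\<^esub> g' \<longrightarrow>
          (\<exists>!w. w \<in> hom A v' v \<and> t 0 \<cdot>\<^bsub>A\<^esub> w = f' \<and> t 1 \<cdot>\<^bsub>A\<^esub> w = g')"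
        and t': "t' 0 \<in> hom A v' (FO X 0) \<and> t' 1 \<in> hom A v' (FO X 1) \<and>
          t' 2 = FA X 3 \<cdot>\<^bsub>A\<^esub> t' 0 \<and> t' 2 = FA X 4 \<cdot>\<^bsub>A\<^esub> t' 1"
      show "\<exists>!w. w \<in> hom A v' v \<and> t 0 \<cdot>\<^bsub>A\<^esub> w = t' 0 \<and> t 1 \<cdot>\<^bsub>A\<^esub> w = t' 1"
        by (rule H[rule_format]) (use t' in auto)
    qed
    finally show ?thesis
      using t by simp
  qed
qed

lemma preserves_pullback:
  assumes T: "cat_functor A B T" and lim: "preserves_finite_limits A B T" and pb: "pullback A f g h k"
  shows "pullback B (FA T f) (FA T g) (FA T h) (FA T k)"
proof -
  interpret T: cat_functor A B T by fact
  define X where "X = cospan A h k"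
  have f: "f \<in> hom A (Dom A f) (Dom A h)" and g: "g \<in> hom A (Dom A f) (Dom A k)"
    and h: "h \<in> hom A (Dom A h) (Cod A h)" and k: "k \<in> hom A (Dom A k) (Cod A h)"
    using pb by (auto simp: pullback_def hom_def)
  have X: "cat_functor cospan_cat A X"
    unfolding X_def by (rule T.C.cospan_functor[OF h k])
  have Xs: "FO X 0 = Dom A h" "FO X 1 = Dom A k" "FA X 3 = h" "FA X 4 = k"
    by (simp_all add: X_def cospan_def)
  define t where "t i = (if i = 0 then f else if i = 1 then g else h \<cdot>\<^bsub>A\<^esub> f)" for i :: nat
  have "limit_cone A cospan_cat X (Dom A f) t"
    unfolding limit_cone_cospan_iff[OF X] Xs using f g pb by (simp add: t_def)
  moreover have "finite (Ob cospan_cat)" "finite (Ar cospan_cat)"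
    by (simp_all add: cospan_cat_def)
  ultimately have "limit_cone B cospan_cat (T \<odot> X) (FO T (Dom A f)) (\<lambda>i. FA T (t i))"
    using lim X unfolding preserves_finite_limits_def by blast
  then show ?thesis
    unfolding limit_cone_cospan_iff[OF comp_functor[OF X T]] by (simp add: t_def comp_funct_def Xs)
qed

lemma preserves_terminal:
  assumes T: "cat_functor A B T" and lim: "preserves_finite_limits A B T" and v: "terminal A v"
  shows "terminal B (FO T v)"
proof -
  interpret T: cat_functor A B T by fact
  interpret I: category empty_cat by unfold_locales (auto simp: empty_cat_def hom_def)
  have iff: "limit_cone E empty_cat X u t \<longleftrightarrow> terminal E u"
    for E :: "('x, 'y) cat" and X :: "(nat, nat, 'x, 'y) funct" and u t
    unfolding limit_cone_def cone_def terminal_def by (auto simp: empty_cat_def)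
  have X: "cat_functor empty_cat A X" for X
    by unfold_locales (auto simp: empty_cat_def hom_def)
  have "limit_cone A empty_cat undefined v undefined"
    using v by (simp add: iff)
  moreover have "finite (Ob empty_cat)" "finite (Ar empty_cat)"
    by (simp_all add: empty_cat_def)
  ultimately have "limit_cone B empty_cat (T \<odot> undefined) (FO T v) (\<lambda>i. FA T (undefined i))"
    using lim X unfolding preserves_finite_limits_def by blast
  then show ?thesis
    by (simp add: iff)
qed


section \<open>Pullbacks of sheaves, section by section\<close>

definition sections_pullback where
  "sections_pullback V X Y f g h k \<longleftrightarrow> (\<forall>c. \<forall>x\<in>Sec X c. \<forall>y\<in>Sec Y c. ap h c x = ap k c y \<longrightarrow>
    (\<exists>!s. s \<in> Sec V c \<and> ap f c s = x \<and> ap g c s = y))"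

context small_site
begin

lemma amalgamation:
  assumes "is_sheaf U C J F" "c \<in> Ob C" "S \<in> J c" "matching_family C F S m"
  shows "\<exists>x\<in>Sec F c. \<forall>f\<in>S. Res F f x = m f"
proof -
  have "\<exists>!x. x \<in> Sec F c \<and> (\<forall>f\<in>S. Res F f x = m f)"
    using assms by (simp add: is_sheaf_def)
  then show ?thesis by blast
qed

context
  fixes X Y Z :: "('o, 'a, 'u) presheaf" and h k :: "('o, 'a, 'u) psh_arr"
  assumes X: "is_sheaf U C J X" and Y: "is_sheaf U C J Y" and Z: "is_sheaf U C J Z"
    and h: "h \<in> hom (presheaf_cat U C) X Z" and k: "k \<in> hom (presheaf_cat U C) Y Z"
begin

definition pairs where
  "pairs c = {(x, y) \<in> Sec X c \<times> Sec Y c. ap h c x = ap k c y}"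

definition pair_res where
  "pair_res f = map_prod (Res X f) (Res Y f)"

lemma set_presheaf_pairs: "set_presheaf U C pairs pair_res"
proof
  note PX = sheaf_presheaf[OF X] and PY = sheaf_presheaf[OF Y]
  fix c assume c: "c \<in> Ob C"
  show "fits U (pairs c)"
    by (rule fits_subset[OF universe fits_Times[OF universe
            fits_member[OF Sec_universe[OF PX c]] fits_member[OF Sec_universe[OF PY c]]]])
      (auto simp: pairs_def)
  show "pair_res (Idn C c) z = z" if "z \<in> pairs c" for z
    using that Res_Idn[OF PX] Res_Idn[OF PY] by (auto simp: pairs_def pair_res_def)
next
  note PX = sheaf_presheaf[OF X] and PY = sheaf_presheaf[OF Y]
  fix f z assume f: "f \<in> Ar C" and "z \<in> pairs (Cod C f)"
  then obtain x y where z: "z = (x, y)" "x \<in> Sec X (Cod C f)" "y \<in> Sec Y (Cod C f)"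
    "ap h (Cod C f) x = ap k (Cod C f) y"
    by (auto simp: pairs_def)
  then show "pair_res f z \<in> pairs (Dom C f)"
    using Res_Sec[OF PX f] Res_Sec[OF PY f] ap_Res[OF h f] ap_Res[OF k f]
    by (auto simp: pairs_def pair_res_def)
  show "pair_res (f \<cdot> g) z = pair_res g (pair_res f z)" if "g \<in> Ar C" "Cod C g = Dom C f" for g
    using Res_Cmp[OF PX f that] Res_Cmp[OF PY f that] z by (simp add: pair_res_def)
qed

interpretation P: set_presheaf U C pairs pair_res by (rule set_presheaf_pairs)

abbreviation "Q \<equiv> encode U C pairs pair_res"

lemma pairs_sheaf: "is_sheaf U C J Q"
proof (rule P.encode_sheaf)
  note PX = sheaf_presheaf[OF X] and PY = sheaf_presheaf[OF Y]
  fix c S z w assume c: "c \<in> Ob C" and S: "S \<in> J c" and z: "z \<in> pairs c" and w: "w \<in> pairs c"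
    and eq: "\<And>f. f \<in> S \<Longrightarrow> pair_res f z = pair_res f w"
  have mem: "fst z \<in> Sec X c" "snd z \<in> Sec Y c" "fst w \<in> Sec X c" "snd w \<in> Sec Y c"
    using z w by (auto simp: pairs_def)
  have eqs: "Res X f (fst z) = Res X f (fst w)" "Res Y f (snd z) = Res Y f (snd w)" if "f \<in> S" for f
    using eq[OF that] by (simp_all add: pair_res_def prod_eq_iff)
  have "locally C J c (\<lambda>f. Res X f (fst z) = Res X f (fst w))"
    "locally C J c (\<lambda>f. Res Y f (snd z) = Res Y f (snd w))"
    unfolding locally_def by (rule bexI[OF _ S], simp add: eqs)+
  then have "fst z = fst w" "snd z = snd w"
    using sheaf_separated[OF X mem(1,3)] sheaf_separated[OF Y mem(2,4)] by auto
  then show "z = w" by (simp add: prod_eq_iff)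
next
  note PX = sheaf_presheaf[OF X] and PY = sheaf_presheaf[OF Y]
  fix c S m assume c: "c \<in> Ob C" and S: "S \<in> J c" and m: "\<And>f. f \<in> S \<Longrightarrow> m f \<in> pairs (Dom C f)"
    and comp: "\<And>f g. f \<in> S \<Longrightarrow> g \<in> Ar C \<Longrightarrow> Cod C g = Dom C f \<Longrightarrow> m (f \<cdot> g) = pair_res g (m f)"
  note SD = coverD[OF c S]
  have "matching_family C X S (\<lambda>f. fst (m f))" "matching_family C Y S (\<lambda>f. snd (m f))"
    using m comp by (auto simp: matching_family_def pairs_def pair_res_def split_beta)
  then have "\<exists>x\<in>Sec X c. \<forall>f\<in>S. Res X f x = fst (m f)" "\<exists>y\<in>Sec Y c. \<forall>f\<in>S. Res Y f y = snd (m f)"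
    by (auto intro: amalgamation[OF X c S] amalgamation[OF Y c S])
  then obtain x y where x: "x \<in> Sec X c" "\<And>f. f \<in> S \<Longrightarrow> Res X f x = fst (m f)"
    and y: "y \<in> Sec Y c" "\<And>f. f \<in> S \<Longrightarrow> Res Y f y = snd (m f)"
    by blast
  have "ap h c x = ap k c y"
  proof (rule sheaf_separated[OF Z ap_Sec[OF h x(1)] ap_Sec[OF k y(1)]])
    show "locally C J c (\<lambda>f. Res Z f (ap h c x) = Res Z f (ap k c y))"
      unfolding locally_def
    proof (intro bexI[OF _ S] ballI)
      fix f assume f: "f \<in> S"
      then have "ap h (Dom C f) (fst (m f)) = ap k (Dom C f) (snd (m f))"
        using m by (auto simp: pairs_def split_beta)
      then show "Res Z f (ap h c x) = Res Z f (ap k c y)"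
        using ap_Res[OF h, of f x] ap_Res[OF k, of f y] SD[OF f] x y f by simp
    qed
  qed
  then show "\<exists>z\<in>pairs c. \<forall>f\<in>S. pair_res f z = m f"
    using x y by (intro bexI[of _ "(x, y)"]) (auto simp: pairs_def pair_res_def)
qed unfold_locales

definition "proj1 = psh_mor Q X (\<lambda>c s. fst (inv_into (pairs c) (enc U (pairs c)) s))"
definition "proj2 = psh_mor Q Y (\<lambda>c s. snd (inv_into (pairs c) (enc U (pairs c)) s))"

lemma proj_enc:
  assumes "c \<in> Ob C" "(x, y) \<in> pairs c"
  shows "ap proj1 c (enc U (pairs c) (x, y)) = x" "ap proj2 c (enc U (pairs c) (x, y)) = y"
  using assms P.enc_Sec[OF assms]
  by (simp_all add: proj1_def proj2_def ap_psh_mor inv_into_enc P.fits)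

lemma proj1_hom: "proj1 \<in> hom (presheaf_cat U C) Q X"
  unfolding proj1_def
proof (rule psh_mor_hom[OF P.encode_presheaf sheaf_presheaf[OF X]])
  show "fst (inv_into (pairs c) (enc U (pairs c)) s) \<in> Sec X c" if s: "s \<in> Sec Q c" for c s
  proof -
    obtain z where "c \<in> Ob C" "z \<in> pairs c" "s = enc U (pairs c) z"
      using s by (rule P.Sec_encodeE)
    then show ?thesis
      by (simp add: inv_into_enc P.fits) (auto simp: pairs_def)
  qed
  fix f s assume f: "f \<in> Ar C" and "s \<in> Sec Q (Cod C f)"
  then obtain z where "z \<in> pairs (Cod C f)" "s = enc U (pairs (Cod C f)) z"
    by (elim P.Sec_encodeE) auto
  then show "fst (inv_into (pairs (Dom C f)) (enc U (pairs (Dom C f))) (Res Q f s)) =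
      Res X f (fst (inv_into (pairs (Cod C f)) (enc U (pairs (Cod C f))) s))"
    using f P.r_mem[OF f] by (simp add: P.Res_encode inv_into_enc P.fits Dom_Ob Cod_Ob) (simp add: pair_res_def)
qed

lemma proj2_hom: "proj2 \<in> hom (presheaf_cat U C) Q Y"
  unfolding proj2_def
proof (rule psh_mor_hom[OF P.encode_presheaf sheaf_presheaf[OF Y]])
  show "snd (inv_into (pairs c) (enc U (pairs c)) s) \<in> Sec Y c" if s: "s \<in> Sec Q c" for c s
  proof -
    obtain z where "c \<in> Ob C" "z \<in> pairs c" "s = enc U (pairs c) z"
      using s by (rule P.Sec_encodeE)
    then show ?thesis
      by (simp add: inv_into_enc P.fits) (auto simp: pairs_def)
  qed
  fix f s assume f: "f \<in> Ar C" and "s \<in> Sec Q (Cod C f)"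
  then obtain z where "z \<in> pairs (Cod C f)" "s = enc U (pairs (Cod C f)) z"
    by (elim P.Sec_encodeE) auto
  then show "snd (inv_into (pairs (Dom C f)) (enc U (pairs (Dom C f))) (Res Q f s)) =
      Res Y f (snd (inv_into (pairs (Cod C f)) (enc U (pairs (Cod C f))) s))"
    using f P.r_mem[OF f] by (simp add: P.Res_encode inv_into_enc P.fits Dom_Ob Cod_Ob) (simp add: pair_res_def)
qed

lemma proj_commute: "h \<cdot>\<^bsub>presheaf_cat U C\<^esub> proj1 = k \<cdot>\<^bsub>presheaf_cat U C\<^esub> proj2"
proof (rule psh_hom_eqI[OF psh_Cmp_hom[OF proj1_hom h] psh_Cmp_hom[OF proj2_hom k]])
  fix c s assume s: "s \<in> Sec Q c"
  then obtain x y where "c \<in> Ob C" "(x, y) \<in> pairs c" "s = enc U (pairs c) (x, y)"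
    by (elim P.Sec_encodeE) auto
  then show "ap (h \<cdot>\<^bsub>presheaf_cat U C\<^esub> proj1) c s = ap (k \<cdot>\<^bsub>presheaf_cat U C\<^esub> proj2) c s"
    using ap_Cmp[OF proj1_hom h s] ap_Cmp[OF proj2_hom k s] proj_enc by (simp add: pairs_def)
qed

lemma sections_pullback_pairs: "sections_pullback Q X Y proj1 proj2 h k"
  unfolding sections_pullback_def
proof (intro allI ballI impI)
  fix c x y assume x: "x \<in> Sec X c" and y: "y \<in> Sec Y c" and "ap h c x = ap k c y"
  then have xy: "(x, y) \<in> pairs c" by (simp add: pairs_def)
  have c: "c \<in> Ob C" using Sec_Ob[OF sheaf_presheaf[OF X] x] .
  show "\<exists>!s. s \<in> Sec Q c \<and> ap proj1 c s = x \<and> ap proj2 c s = y"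
  proof (rule ex1I[of _ "enc U (pairs c) (x, y)"])
    show "enc U (pairs c) (x, y) \<in> Sec Q c \<and> ap proj1 c (enc U (pairs c) (x, y)) = x \<and>
        ap proj2 c (enc U (pairs c) (x, y)) = y"
      using P.enc_Sec[OF c xy] proj_enc[OF c xy] by simp
    fix s assume s: "s \<in> Sec Q c \<and> ap proj1 c s = x \<and> ap proj2 c s = y"
    then obtain z where z: "z \<in> pairs c" "s = enc U (pairs c) z"
      by (auto elim: P.Sec_encodeE)
    then show "s = enc U (pairs c) (x, y)"
      using s proj_enc[OF c, of "fst z" "snd z"] by (cases z) simp
  qed
qed

lemma pullback_of_sections:
  assumes V: "is_sheaf U C J V"
    and f: "f \<in> hom (presheaf_cat U C) V X" and g: "g \<in> hom (presheaf_cat U C) V Y"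
    and comm: "h \<cdot>\<^bsub>presheaf_cat U C\<^esub> f = k \<cdot>\<^bsub>presheaf_cat U C\<^esub> g"
    and pb: "sections_pullback V X Y f g h k"
  shows "pullback (sheaf_cat U C J) f g h k"
proof -
  have f': "f \<in> hom (sheaf_cat U C J) V X" and g': "g \<in> hom (sheaf_cat U C J) V Y"
    and h': "h \<in> hom (sheaf_cat U C J) X Z" and k': "k \<in> hom (sheaf_cat U C J) Y Z"
    using V X Y Z f g h k by (simp_all add: sheaf_cat_simps)
  show ?thesis
    unfolding pullback_iff[OF f' g' h' k']
  proof (intro conjI allI impI)
    show "h \<cdot>\<^bsub>sheaf_cat U C J\<^esub> f = k \<cdot>\<^bsub>sheaf_cat U C J\<^esub> g"
      using comm by (simp add: sheaf_cat_simps)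
    fix V' a b assume a: "a \<in> hom (sheaf_cat U C J) V' X" and b: "b \<in> hom (sheaf_cat U C J) V' Y"
      and eq: "h \<cdot>\<^bsub>sheaf_cat U C J\<^esub> a = k \<cdot>\<^bsub>sheaf_cat U C J\<^esub> b"
    then have V': "is_sheaf U C J V'" and a: "a \<in> hom (presheaf_cat U C) V' X"
      and b: "b \<in> hom (presheaf_cat U C) V' Y"
      and eq: "h \<cdot>\<^bsub>presheaf_cat U C\<^esub> a = k \<cdot>\<^bsub>presheaf_cat U C\<^esub> b"
      by (simp_all add: sheaf_cat_simps)
    note PV' = sheaf_presheaf[OF V'] and PV = sheaf_presheaf[OF V]
    have ex: "\<exists>!t. t \<in> Sec V c \<and> ap f c t = ap a c s \<and> ap g c t = ap b c s" if s: "s \<in> Sec V' c" for c s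
    proof -
      have "ap h c (ap a c s) = ap k c (ap b c s)"
        using eq ap_Cmp[OF a h s] ap_Cmp[OF b k s] by simp
      then show ?thesis
        using pb ap_Sec[OF a s] ap_Sec[OF b s] unfolding sections_pullback_def by blast
    qed
    define \<tau> where "\<tau> c s = (THE t. t \<in> Sec V c \<and> ap f c t = ap a c s \<and> ap g c t = ap b c s)" for c s
    have \<tau>: "\<tau> c s \<in> Sec V c" "ap f c (\<tau> c s) = ap a c s" "ap g c (\<tau> c s) = ap b c s" if "s \<in> Sec V' c" for c s
      using theI'[OF ex[OF that]] by (auto simp: \<tau>_def)
    have \<tau>_eq: "t = \<tau> c s" if "s \<in> Sec V' c" "t \<in> Sec V c" "ap f c t = ap a c s" "ap g c t = ap b c s" for c s t
      using ex[OF that(1)] \<tau>[OF that(1)] that by blast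
    have w: "psh_mor V' V \<tau> \<in> hom (presheaf_cat U C) V' V"
    proof (rule psh_mor_hom[OF PV' PV])
      fix e s assume e: "e \<in> Ar C" and s: "s \<in> Sec V' (Cod C e)"
      show "\<tau> (Dom C e) (Res V' e s) = Res V e (\<tau> (Cod C e) s)"
        by (rule sym, rule \<tau>_eq)
          (use \<tau>[OF s] Res_Sec[OF PV' e s] Res_Sec[OF PV e] ap_Res[OF f e] ap_Res[OF g e] ap_Res[OF a e s]
            ap_Res[OF b e s] in auto)
    qed (rule \<tau>(1))
    show "\<exists>!w. w \<in> hom (sheaf_cat U C J) V' V \<and> f \<cdot>\<^bsub>sheaf_cat U C J\<^esub> w = a \<and> g \<cdot>\<^bsub>sheaf_cat U C J\<^esub> w = b"
    proof (rule ex1I[of _ "psh_mor V' V \<tau>"])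
      have "f \<cdot>\<^bsub>presheaf_cat U C\<^esub> psh_mor V' V \<tau> = a"
        by (rule psh_hom_eqI[OF psh_Cmp_hom[OF w f] a]) (simp add: ap_Cmp[OF w f] ap_psh_mor \<tau>)
      moreover have "g \<cdot>\<^bsub>presheaf_cat U C\<^esub> psh_mor V' V \<tau> = b"
        by (rule psh_hom_eqI[OF psh_Cmp_hom[OF w g] b]) (simp add: ap_Cmp[OF w g] ap_psh_mor \<tau>)
      ultimately show "psh_mor V' V \<tau> \<in> hom (sheaf_cat U C J) V' V \<and>
          f \<cdot>\<^bsub>sheaf_cat U C J\<^esub> psh_mor V' V \<tau> = a \<and> g \<cdot>\<^bsub>sheaf_cat U C J\<^esub> psh_mor V' V \<tau> = b"
        using w V V' by (simp add: sheaf_cat_simps)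
      fix w' assume "w' \<in> hom (sheaf_cat U C J) V' V \<and> f \<cdot>\<^bsub>sheaf_cat U C J\<^esub> w' = a \<and> g \<cdot>\<^bsub>sheaf_cat U C J\<^esub> w' = b"
      then have w': "w' \<in> hom (presheaf_cat U C) V' V"
        and eqs: "f \<cdot>\<^bsub>presheaf_cat U C\<^esub> w' = a" "g \<cdot>\<^bsub>presheaf_cat U C\<^esub> w' = b"
        by (simp_all add: sheaf_cat_simps)
      show "w' = psh_mor V' V \<tau>"
      proof (rule psh_hom_eqI[OF w' w])
        fix c s assume s: "s \<in> Sec V' c"
        show "ap w' c s = ap (psh_mor V' V \<tau>) c s"
          using \<tau>_eq[OF s ap_Sec[OF w' s]] ap_Cmp[OF w' f s] ap_Cmp[OF w' g s] eqs
          by (simp add: ap_psh_mor s)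
      qed
    qed
  qed
qed

text \<open>
  The universal property speaks about morphisms and not about sections, so the given pullback is compared with the
  sheaf of pairs, whose sections are known.
\<close>

lemma sections_of_pullback:
  assumes f: "f \<in> hom (presheaf_cat U C) V X" and g: "g \<in> hom (presheaf_cat U C) V Y"
    and pb: "pullback (sheaf_cat U C J) f g h k"
  shows "sections_pullback V X Y f g h k"
proof -
  have V: "is_sheaf U C J V"
    using pb f by (auto simp: pullback_def sheaf_cat_simps hom_def) (auto simp: presheaf_cat_def sheaf_cat_def full_sub_def)
  have f': "f \<in> hom (sheaf_cat U C J) V X" and g': "g \<in> hom (sheaf_cat U C J) V Y"
    and h': "h \<in> hom (sheaf_cat U C J) X Z" and k': "k \<in> hom (sheaf_cat U C J) Y Z"
    using V X Y Z f g h k by (simp_all add: sheaf_cat_simps)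
  note pb' = pb[unfolded pullback_iff[OF f' g' h' k'], unfolded sheaf_cat_simps]
  have comm: "h \<cdot>\<^bsub>presheaf_cat U C\<^esub> f = k \<cdot>\<^bsub>presheaf_cat U C\<^esub> g" using pb' by blast
  have un: "\<exists>!w. (w \<in> hom (presheaf_cat U C) V' V \<and> is_sheaf U C J V' \<and> is_sheaf U C J V) \<and>
      f \<cdot>\<^bsub>presheaf_cat U C\<^esub> w = a \<and> g \<cdot>\<^bsub>presheaf_cat U C\<^esub> w = b"
    if "a \<in> hom (presheaf_cat U C) V' X" "b \<in> hom (presheaf_cat U C) V' Y" "is_sheaf U C J V'"
      "h \<cdot>\<^bsub>presheaf_cat U C\<^esub> a = k \<cdot>\<^bsub>presheaf_cat U C\<^esub> b" for V' a b
    using pb' that X Y by blast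
  obtain w where w: "w \<in> hom (presheaf_cat U C) Q V"
    and wf: "f \<cdot>\<^bsub>presheaf_cat U C\<^esub> w = proj1" and wg: "g \<cdot>\<^bsub>presheaf_cat U C\<^esub> w = proj2"
    using un[OF proj1_hom proj2_hom pairs_sheaf proj_commute] by blast
  \<comment> \<open>The comparison in the other direction is inverse to w.\<close>
  have mem: "(ap f c s, ap g c s) \<in> pairs c" if s: "s \<in> Sec V c" for c s
    using ap_Sec[OF f s] ap_Sec[OF g s] ap_Cmp[OF f h s] ap_Cmp[OF g k s] comm by (simp add: pairs_def)
  let ?u = "psh_mor V Q (\<lambda>c s. enc U (pairs c) (ap f c s, ap g c s))"
  have Ob: "c \<in> Ob C" if "s \<in> Sec V c" for c s
    using Sec_Ob[OF sheaf_presheaf[OF V] that] .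
  have u: "?u \<in> hom (presheaf_cat U C) V Q"
  proof (rule psh_mor_hom[OF sheaf_presheaf[OF V] P.encode_presheaf])
    show "enc U (pairs c) (ap f c s, ap g c s) \<in> Sec Q c" if "s \<in> Sec V c" for c s
      using P.enc_Sec[OF Ob[OF that] mem[OF that]] .
    fix e s assume e: "e \<in> Ar C" and s: "s \<in> Sec V (Cod C e)"
    then show "enc U (pairs (Dom C e)) (ap f (Dom C e) (Res V e s), ap g (Dom C e) (Res V e s)) =
        Res Q e (enc U (pairs (Cod C e)) (ap f (Cod C e) s, ap g (Cod C e) s))"
      using P.Res_encode[OF e mem[OF s]] ap_Res[OF f e s] ap_Res[OF g e s] by (simp add: pair_res_def)
  qed
  have ap_u: "ap ?u c s = enc U (pairs c) (ap f c s, ap g c s)" if "s \<in> Sec V c" for c s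
    using that by (rule ap_psh_mor)
  have wu: "w \<cdot>\<^bsub>presheaf_cat U C\<^esub> ?u \<in> hom (presheaf_cat U C) V V"
    by (rule psh_Cmp_hom[OF u w])
  have w_proj: "ap f c (ap w c q) = ap proj1 c q" "ap g c (ap w c q) = ap proj2 c q" if "q \<in> Sec Q c" for c q
    using ap_Cmp[OF w f that] ap_Cmp[OF w g that] wf wg by simp_all
  have "f \<cdot>\<^bsub>presheaf_cat U C\<^esub> (w \<cdot>\<^bsub>presheaf_cat U C\<^esub> ?u) = f"
  proof (rule psh_hom_eqI[OF psh_Cmp_hom[OF wu f] f])
    fix c s assume s: "s \<in> Sec V c"
    show "ap (f \<cdot>\<^bsub>presheaf_cat U C\<^esub> (w \<cdot>\<^bsub>presheaf_cat U C\<^esub> ?u)) c s = ap f c s"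
      using ap_Cmp[OF wu f s] ap_Cmp[OF u w s] ap_u[OF s] w_proj(1)[OF ap_Sec[OF u s]] proj_enc(1)[OF Ob[OF s] mem[OF s]]
      by simp
  qed
  moreover have "g \<cdot>\<^bsub>presheaf_cat U C\<^esub> (w \<cdot>\<^bsub>presheaf_cat U C\<^esub> ?u) = g"
  proof (rule psh_hom_eqI[OF psh_Cmp_hom[OF wu g] g])
    fix c s assume s: "s \<in> Sec V c"
    show "ap (g \<cdot>\<^bsub>presheaf_cat U C\<^esub> (w \<cdot>\<^bsub>presheaf_cat U C\<^esub> ?u)) c s = ap g c s"
      using ap_Cmp[OF wu g s] ap_Cmp[OF u w s] ap_u[OF s] w_proj(2)[OF ap_Sec[OF u s]] proj_enc(2)[OF Ob[OF s] mem[OF s]]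
      by simp
  qed
  moreover have "f \<cdot>\<^bsub>presheaf_cat U C\<^esub> Idn (presheaf_cat U C) V = f"
    "g \<cdot>\<^bsub>presheaf_cat U C\<^esub> Idn (presheaf_cat U C) V = g"
    using category.Cmp_Idn[OF presheaf_category f] category.Cmp_Idn[OF presheaf_category g] .
  ultimately have id: "w \<cdot>\<^bsub>presheaf_cat U C\<^esub> ?u = Idn (presheaf_cat U C) V"
    using un[OF f g V comm] wu psh_Idn_hom[OF sheaf_presheaf[OF V]] V by blast
  have s_eq: "s = ap w c (enc U (pairs c) (ap f c s, ap g c s))" if s: "s \<in> Sec V c" for c s
    using ap_Cmp[OF u w s] id ap_Idn[OF s, of U C] ap_u[OF s] by simp
  show ?thesis
    unfolding sections_pullback_def
  proof (intro allI ballI impI)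
    fix c x y assume x: "x \<in> Sec X c" and y: "y \<in> Sec Y c" and "ap h c x = ap k c y"
    then have xy: "(x, y) \<in> pairs c" by (simp add: pairs_def)
    have c: "c \<in> Ob C" using Sec_Ob[OF sheaf_presheaf[OF X] x] .
    show "\<exists>!s. s \<in> Sec V c \<and> ap f c s = x \<and> ap g c s = y"
    proof (rule ex1I[of _ "ap w c (enc U (pairs c) (x, y))"])
      show "ap w c (enc U (pairs c) (x, y)) \<in> Sec V c \<and> ap f c (ap w c (enc U (pairs c) (x, y))) = x \<and>
          ap g c (ap w c (enc U (pairs c) (x, y))) = y"
        using w_proj[OF P.enc_Sec[OF c xy]] proj_enc[OF c xy] ap_Sec[OF w P.enc_Sec[OF c xy]] by simp
      show "s = ap w c (enc U (pairs c) (x, y))" if "s \<in> Sec V c \<and> ap f c s = x \<and> ap g c s = y" for s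
        using s_eq[of s c] that by simp
    qed
  qed
qed

lemma pullback_ex:
  "\<exists>V f g. is_sheaf U C J V \<and> f \<in> hom (presheaf_cat U C) V X \<and> g \<in> hom (presheaf_cat U C) V Y \<and>
    pullback (sheaf_cat U C J) f g h k"
  using pairs_sheaf proj1_hom proj2_hom
    pullback_of_sections[OF pairs_sheaf proj1_hom proj2_hom proj_commute sections_pullback_pairs]
  by blast

end

end


section \<open>Cartesian arrows of a comma category\<close>

text \<open>
  Applied below to the lifts of a given base arrow in a comma category, which correspond to their first components.
\<close>

lemma ex1_param:
  assumes "\<And>k. P k \<longleftrightarrow> (\<exists>w. k = c w \<and> Q w)" "inj c"
  shows "(\<exists>!k. P k) \<longleftrightarrow> (\<exists>!w. Q w)"
  using assms(1) injD[OF assms(2)] by metis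

locale comma = T: cat_functor B A T
  for A :: "('o, 'a) cat" and B :: "('p, 'b) cat" and T :: "('p, 'b, 'o, 'a) funct"
begin

lemma comma_simps:
  "(F, E, \<alpha>) \<in> Ob (comma_cat A B T) \<longleftrightarrow> F \<in> Ob A \<and> E \<in> Ob B \<and> \<alpha> \<in> hom A F (FO T E)"
  "(y, z, g', h') \<cdot>\<^bsub>comma_cat A B T\<^esub> (x, y', g, h) = (x, z, g' \<cdot>\<^bsub>A\<^esub> g, h' \<cdot>\<^bsub>B\<^esub> h)"
  "Idn (comma_cat A B T) (F, E, \<alpha>) = ((F, E, \<alpha>), (F, E, \<alpha>), Idn A F, Idn B E)"
  "Dom (comma_cat A B T) (x, y, g, h) = x" "Cod (comma_cat A B T) (x, y, g, h) = y"
  by (auto simp: comma_cat_def Let_def)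

lemma comma_proj_simps: "FO comma_proj (F, E, \<alpha>) = E" "FA comma_proj (x, y, g, h) = h"
  by (auto simp: comma_proj_def)

lemma comma_Ar_iff:
  "((F, E, \<alpha>), (F', E', \<alpha>'), g, h) \<in> Ar (comma_cat A B T) \<longleftrightarrow>
    \<alpha> \<in> hom A F (FO T E) \<and> \<alpha>' \<in> hom A F' (FO T E') \<and> g \<in> hom A F F' \<and> h \<in> hom B E E' \<and>
    \<alpha>' \<cdot>\<^bsub>A\<^esub> g = FA T h \<cdot>\<^bsub>A\<^esub> \<alpha>"
  using T.D.hom_Ob T.C.hom_Ob by (auto simp: comma_cat_def Let_def)

lemma comma_hom_iff:
  "m \<in> hom (comma_cat A B T) (F, E, \<alpha>) (F', E', \<alpha>') \<longleftrightarrow>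
    (\<exists>g h. m = ((F, E, \<alpha>), (F', E', \<alpha>'), g, h) \<and>
      ((F, E, \<alpha>), (F', E', \<alpha>'), g, h) \<in> Ar (comma_cat A B T))"
  by (cases m) (auto simp: hom_def comma_simps)

lemma comma_ArE:
  assumes "m \<in> Ar (comma_cat A B T)"
  obtains F E \<alpha> F' E' \<alpha>' g h where "m = ((F, E, \<alpha>), (F', E', \<alpha>'), g, h)"
    "\<alpha> \<in> hom A F (FO T E)" "\<alpha>' \<in> hom A F' (FO T E')" "g \<in> hom A F F'" "h \<in> hom B E E'"
    "\<alpha>' \<cdot>\<^bsub>A\<^esub> g = FA T h \<cdot>\<^bsub>A\<^esub> \<alpha>"
proof -
  obtain F E \<alpha> F' E' \<alpha>' g h where m: "m = ((F, E, \<alpha>), (F', E', \<alpha>'), g, h)"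
    by (metis prod.collapse)
  then show thesis
    using that assms by (simp add: comma_Ar_iff)
qed

lemma comma_Cmp:
  assumes m: "((F, E, \<alpha>), (F', E', \<alpha>'), g, h) \<in> Ar (comma_cat A B T)"
    and n: "((F', E', \<alpha>'), (F'', E'', \<alpha>''), g', h') \<in> Ar (comma_cat A B T)"
  shows "((F, E, \<alpha>), (F'', E'', \<alpha>''), g' \<cdot>\<^bsub>A\<^esub> g, h' \<cdot>\<^bsub>B\<^esub> h) \<in> Ar (comma_cat A B T)"
proof -
  note m = m[unfolded comma_Ar_iff] and n = n[unfolded comma_Ar_iff]
  have \<alpha>: "\<alpha> \<in> hom A F (FO T E)" "\<alpha>' \<in> hom A F' (FO T E')" "\<alpha>'' \<in> hom A F'' (FO T E'')"
    and g: "g \<in> hom A F F'" "g' \<in> hom A F' F''" and h: "h \<in> hom B E E'" "h' \<in> hom B E' E''"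
    and eq: "\<alpha>' \<cdot>\<^bsub>A\<^esub> g = FA T h \<cdot>\<^bsub>A\<^esub> \<alpha>" "\<alpha>'' \<cdot>\<^bsub>A\<^esub> g' = FA T h' \<cdot>\<^bsub>A\<^esub> \<alpha>'"
    using m n by auto
  have "\<alpha>'' \<cdot>\<^bsub>A\<^esub> (g' \<cdot>\<^bsub>A\<^esub> g) = FA T h' \<cdot>\<^bsub>A\<^esub> (\<alpha>' \<cdot>\<^bsub>A\<^esub> g)"
    using T.D.Cmp_assoc[OF g \<alpha>(3)] T.D.Cmp_assoc[OF g(1) \<alpha>(2) T.FA_hom[OF h(2)]] eq(2) by simp
  also have "\<dots> = FA T (h' \<cdot>\<^bsub>B\<^esub> h) \<cdot>\<^bsub>A\<^esub> \<alpha>"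
    using T.D.Cmp_assoc[OF \<alpha>(1) T.FA_hom[OF h(1)] T.FA_hom[OF h(2)]] T.FA_Cmp[OF h] eq(1) by simp
  finally show ?thesis
    using \<alpha> T.D.Cmp_hom[OF g] T.C.Cmp_hom[OF h] by (simp add: comma_Ar_iff)
qed

lemma comma_category: "category (comma_cat A B T)"
proof
  fix m assume "m \<in> Ar (comma_cat A B T)"
  then show "Dom (comma_cat A B T) m \<in> Ob (comma_cat A B T)" "Cod (comma_cat A B T) m \<in> Ob (comma_cat A B T)"
    by (auto simp: comma_cat_def Let_def)
next
  fix x assume x: "x \<in> Ob (comma_cat A B T)"
  obtain F E \<alpha> where F: "x = (F, E, \<alpha>)" by (metis prod.collapse)
  then show "Idn (comma_cat A B T) x \<in> hom (comma_cat A B T) x x"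
    using x T.D.Cmp_Idn T.D.Idn_Cmp T.FA_Idn T.D.Idn_hom T.C.Idn_hom
    by (auto simp: comma_simps comma_hom_iff comma_Ar_iff)
next
  fix m x y n z assume "m \<in> hom (comma_cat A B T) x y" "n \<in> hom (comma_cat A B T) y z"
  then show "n \<cdot>\<^bsub>comma_cat A B T\<^esub> m \<in> hom (comma_cat A B T) x z"
    by (cases x; cases y; cases z) (auto simp: comma_hom_iff comma_simps intro: comma_Cmp)
next
  fix m x y assume "m \<in> hom (comma_cat A B T) x y"
  then show "m \<cdot>\<^bsub>comma_cat A B T\<^esub> Idn (comma_cat A B T) x = m"
    by (cases x; cases y) (auto simp: comma_hom_iff comma_simps comma_Ar_iff T.D.Cmp_Idn T.C.Cmp_Idn)
next
  fix m x y assume "m \<in> hom (comma_cat A B T) x y"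
  then show "Idn (comma_cat A B T) y \<cdot>\<^bsub>comma_cat A B T\<^esub> m = m"
    by (cases x; cases y) (auto simp: comma_hom_iff comma_simps comma_Ar_iff T.D.Idn_Cmp T.C.Idn_Cmp)
next
  fix m x y n z q w
  assume "m \<in> hom (comma_cat A B T) x y" "n \<in> hom (comma_cat A B T) y z" "q \<in> hom (comma_cat A B T) z w"
  then show "q \<cdot>\<^bsub>comma_cat A B T\<^esub> n \<cdot>\<^bsub>comma_cat A B T\<^esub> m = q \<cdot>\<^bsub>comma_cat A B T\<^esub> (n \<cdot>\<^bsub>comma_cat A B T\<^esub> m)"
    by (cases x; cases y; cases z; cases w)
      (auto simp: comma_hom_iff comma_simps comma_Ar_iff T.D.Cmp_assoc T.C.Cmp_assoc)
qed

lemma comma_proj_functor: "cat_functor (comma_cat A B T) B comma_proj"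
proof -
  interpret X: category "comma_cat A B T" by (rule comma_category)
  show ?thesis
  proof
    fix x assume "x \<in> Ob (comma_cat A B T)"
    then show "FO comma_proj x \<in> Ob B"
      "FA comma_proj (Idn (comma_cat A B T) x) = Idn B (FO comma_proj x)"
      by (cases x; simp add: comma_simps comma_proj_simps)+
  next
    fix m x y assume "m \<in> hom (comma_cat A B T) x y"
    then show "FA comma_proj m \<in> hom B (FO comma_proj x) (FO comma_proj y)"
      by (cases x; cases y) (auto simp: comma_hom_iff comma_Ar_iff comma_proj_simps)
  next
    fix m x y n z assume "m \<in> hom (comma_cat A B T) x y" "n \<in> hom (comma_cat A B T) y z"
    then show "FA comma_proj (n \<cdot>\<^bsub>comma_cat A B T\<^esub> m) = FA comma_proj n \<cdot>\<^bsub>B\<^esub> FA comma_proj m"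
      by (cases x; cases y; cases z) (auto simp: comma_hom_iff comma_proj_simps comma_simps)
  qed
qed

text \<open>
  Testing cartesianness against arrows over an identity of the base gives the pullback property; for
  the converse, an arrow over h k is one over h after composing its structure morphism
  with the image of k.
\<close>

lemma cartesian_iff_pullback:
  assumes m: "((F, E, \<alpha>), (F', E', \<alpha>'), g, h) \<in> Ar (comma_cat A B T)"
  shows "cartesian (comma_cat A B T) B comma_proj ((F, E, \<alpha>), (F', E', \<alpha>'), g, h) \<longleftrightarrow>
    pullback A g \<alpha> \<alpha>' (FA T h)"
proof -
  have \<alpha>: "\<alpha> \<in> hom A F (FO T E)" "\<alpha>' \<in> hom A F' (FO T E')"
    and g: "g \<in> hom A F F'" and h: "h \<in> hom B E E'" and eq: "\<alpha>' \<cdot>\<^bsub>A\<^esub> g = FA T h \<cdot>\<^bsub>A\<^esub> \<alpha>"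
    using m by (auto simp: comma_Ar_iff)
  note Th = T.FA_hom[OF h]
  have E: "E \<in> Ob B" using T.C.hom_Ob[OF h] by simp
  show ?thesis
    unfolding pullback_iff[OF g \<alpha>(1) \<alpha>(2) Th]
  proof (intro iffI conjI allI impI)
    assume cart: "cartesian (comma_cat A B T) B comma_proj ((F, E, \<alpha>), (F', E', \<alpha>'), g, h)"
    fix V a b assume a: "a \<in> hom A V F'" and b: "b \<in> hom A V (FO T E)"
      and ab: "\<alpha>' \<cdot>\<^bsub>A\<^esub> a = FA T h \<cdot>\<^bsub>A\<^esub> b"
    let ?n = "((V, E, b), (F', E', \<alpha>'), a, h)"
    have n: "?n \<in> Ar (comma_cat A B T)"
      using a b ab h \<alpha> by (simp add: comma_Ar_iff)
    have "\<exists>!k. k \<in> hom (comma_cat A B T) (V, E, b) (F, E, \<alpha>) \<and> FA comma_proj k = Idn B E \<and>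
        ((F, E, \<alpha>), (F', E', \<alpha>'), g, h) \<cdot>\<^bsub>comma_cat A B T\<^esub> k = ?n"
      using conjunct2[OF cart[unfolded cartesian_def], rule_format, OF n, of "Idn B E"]
        T.C.Idn_hom[OF E] T.C.Cmp_Idn[OF h]
      by (simp add: comma_simps comma_proj_simps del: split_paired_Ex)
    moreover have iff: "(k \<in> hom (comma_cat A B T) (V, E, b) (F, E, \<alpha>) \<and> FA comma_proj k = Idn B E \<and>
        ((F, E, \<alpha>), (F', E', \<alpha>'), g, h) \<cdot>\<^bsub>comma_cat A B T\<^esub> k = ?n) \<longleftrightarrow>
        (\<exists>w. k = ((V, E, b), (F, E, \<alpha>), w, Idn B E) \<and> w \<in> hom A V F \<and> g \<cdot>\<^bsub>A\<^esub> w = a \<and> \<alpha> \<cdot>\<^bsub>A\<^esub> w = b)" for k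
      using \<alpha> b T.D.Idn_Cmp[OF b] T.FA_Idn[OF E] T.C.Idn_hom[OF E] T.C.Cmp_Idn[OF h]
      by (auto simp: comma_hom_iff comma_Ar_iff comma_simps comma_proj_simps)
    ultimately show "\<exists>!w. w \<in> hom A V F \<and> g \<cdot>\<^bsub>A\<^esub> w = a \<and> \<alpha> \<cdot>\<^bsub>A\<^esub> w = b"
      using ex1_param[OF iff] by (simp add: inj_def)
  next
    assume pb: "\<alpha>' \<cdot>\<^bsub>A\<^esub> g = FA T h \<cdot>\<^bsub>A\<^esub> \<alpha> \<and> (\<forall>V a b. a \<in> hom A V F' \<longrightarrow> b \<in> hom A V (FO T E) \<longrightarrow>
      \<alpha>' \<cdot>\<^bsub>A\<^esub> a = FA T h \<cdot>\<^bsub>A\<^esub> b \<longrightarrow> (\<exists>!w. w \<in> hom A V F \<and> g \<cdot>\<^bsub>A\<^esub> w = a \<and> \<alpha> \<cdot>\<^bsub>A\<^esub> w = b))"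
    show "cartesian (comma_cat A B T) B comma_proj ((F, E, \<alpha>), (F', E', \<alpha>'), g, h)"
      unfolding cartesian_def
    proof (intro conjI ballI impI)
      fix n k
      assume "n \<in> Ar (comma_cat A B T)"
        "Cod (comma_cat A B T) n = Cod (comma_cat A B T) ((F, E, \<alpha>), (F', E', \<alpha>'), g, h)"
        and k: "k \<in> hom B (FO comma_proj (Dom (comma_cat A B T) n))
          (FO comma_proj (Dom (comma_cat A B T) ((F, E, \<alpha>), (F', E', \<alpha>'), g, h)))"
        and hk: "FA comma_proj ((F, E, \<alpha>), (F', E', \<alpha>'), g, h) \<cdot>\<^bsub>B\<^esub> k = FA comma_proj n"
      then obtain V Y \<beta> a c where n: "n = ((V, Y, \<beta>), (F', E', \<alpha>'), a, c)"
        and \<beta>: "\<beta> \<in> hom A V (FO T Y)" and a: "a \<in> hom A V F'" and c: "c \<in> hom B Y E'"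
        and n_eq: "\<alpha>' \<cdot>\<^bsub>A\<^esub> a = FA T c \<cdot>\<^bsub>A\<^esub> \<beta>"
        by (elim comma_ArE) (auto simp: comma_simps)
      have k: "k \<in> hom B Y E" and hk: "h \<cdot>\<^bsub>B\<^esub> k = c"
        using k hk by (simp_all add: n comma_simps comma_proj_simps)
      note Tk = T.FA_hom[OF k]
      have b: "FA T k \<cdot>\<^bsub>A\<^esub> \<beta> \<in> hom A V (FO T E)"
        by (rule T.D.Cmp_hom[OF \<beta> Tk])
      have "\<alpha>' \<cdot>\<^bsub>A\<^esub> a = FA T h \<cdot>\<^bsub>A\<^esub> (FA T k \<cdot>\<^bsub>A\<^esub> \<beta>)"
        using n_eq T.FA_Cmp[OF k h] hk T.D.Cmp_assoc[OF \<beta> Tk Th] by simp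
      then have ex: "\<exists>!w. w \<in> hom A V F \<and> g \<cdot>\<^bsub>A\<^esub> w = a \<and> \<alpha> \<cdot>\<^bsub>A\<^esub> w = FA T k \<cdot>\<^bsub>A\<^esub> \<beta>"
        using pb a b by blast
      have iff: "(q \<in> hom (comma_cat A B T) (V, Y, \<beta>) (F, E, \<alpha>) \<and> FA comma_proj q = k \<and>
          ((F, E, \<alpha>), (F', E', \<alpha>'), g, h) \<cdot>\<^bsub>comma_cat A B T\<^esub> q = n) \<longleftrightarrow>
          (\<exists>w. q = ((V, Y, \<beta>), (F, E, \<alpha>), w, k) \<and> w \<in> hom A V F \<and> g \<cdot>\<^bsub>A\<^esub> w = a \<and>
            \<alpha> \<cdot>\<^bsub>A\<^esub> w = FA T k \<cdot>\<^bsub>A\<^esub> \<beta>)" for q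
        using \<alpha> \<beta> k hk by (auto simp: comma_hom_iff comma_Ar_iff comma_simps comma_proj_simps n)
      then show "\<exists>!q. q \<in> hom (comma_cat A B T) (Dom (comma_cat A B T) n)
          (Dom (comma_cat A B T) ((F, E, \<alpha>), (F', E', \<alpha>'), g, h)) \<and> FA comma_proj q = k \<and>
          ((F, E, \<alpha>), (F', E', \<alpha>'), g, h) \<cdot>\<^bsub>comma_cat A B T\<^esub> q = n"
        using ex ex1_param[OF iff] by (simp add: n comma_simps inj_def)
    qed (rule m)
  qed (rule eq)
qed

lemma comma_fibration:
  assumes pb: "\<And>x y z h k. h \<in> hom A x z \<Longrightarrow> k \<in> hom A y z \<Longrightarrow>
    \<exists>v f g. f \<in> hom A v x \<and> g \<in> hom A v y \<and> pullback A f g h k"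
  shows "fibration (comma_cat A B T) B comma_proj"
  unfolding fibration_def
proof (intro conjI ballI impI comma_proj_functor)
  fix x h assume x: "x \<in> Ob (comma_cat A B T)" and h: "h \<in> Ar B" "Cod B h = FO comma_proj x"
  obtain F' E' \<alpha>' where x_eq: "x = (F', E', \<alpha>')" by (metis prod.collapse)
  then have \<alpha>': "\<alpha>' \<in> hom A F' (FO T E')" and h: "h \<in> hom B (Dom B h) E'"
    using x h by (auto simp: comma_simps comma_proj_simps hom_def)
  obtain v g \<alpha> where g: "g \<in> hom A v F'" and \<alpha>: "\<alpha> \<in> hom A v (FO T (Dom B h))"
    and p: "pullback A g \<alpha> \<alpha>' (FA T h)"
    using pb[OF \<alpha>' T.FA_hom[OF h]] by blast
  let ?m = "((v, Dom B h, \<alpha>), (F', E', \<alpha>'), g, h)"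
  have m: "?m \<in> Ar (comma_cat A B T)"
    using \<alpha> \<alpha>' g h p by (simp add: comma_Ar_iff pullback_def)
  then have "cartesian (comma_cat A B T) B comma_proj ?m"
    using p by (simp add: cartesian_iff_pullback)
  then show "\<exists>m. cartesian (comma_cat A B T) B comma_proj m \<and> Cod (comma_cat A B T) m = x \<and> FA comma_proj m = h"
    using x_eq by (intro exI[of _ ?m]) (simp add: comma_simps comma_proj_simps)
qed

end

section \<open>The inverse image along a continuous functor\<close>

context continuous_site
begin

sublocale S: has_left_adjoint "sheaf_cat U D' K'" "sheaf_cat U D K" "precomp D A"
proof -
  interpret cat_functor "sheaf_cat U D' K'" "sheaf_cat U D K" "precomp D A"
    by (rule precomp_sheaf_functor)
  have "\<exists>bu. universal_arrow (sheaf_cat U D K) (sheaf_cat U D' K') (precomp D A) F bu"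
    if "is_sheaf U D K F" for F
    using universal_arrow_ex[OF sheaf_presheaf[OF that]]
    by (simp add: universal_arrow_sheaf_iff[OF that continuous] del: split_paired_Ex)
  then show "has_left_adjoint (sheaf_cat U D' K') (sheaf_cat U D K) (precomp D A)"
    by unfold_locales (simp add: sheaf_cat_simps del: split_paired_Ex)
qed

abbreviation "S \<equiv> FO (Sh_star U D K D' K' A)"
abbreviation "SA \<equiv> FA (Sh_star U D K D' K' A)"
abbreviation "\<sigma> F \<equiv> ap (adj_unit (sheaf_cat U D K) (sheaf_cat U D' K') (precomp D A) F)"

lemma S_functor: "cat_functor (sheaf_cat U D K) (sheaf_cat U D' K') (Sh_star U D K D' K' A)"
  unfolding Sh_star_def by (rule S.left_adjoint_functor)

lemma S_eq: "S F = S.L F"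
  by (simp add: Sh_star_def S.left_adjoint_simps)

lemma S_sheaf: "is_sheaf U D K F \<Longrightarrow> is_sheaf U D' K' (S F)"
  using S.L_Ob[of F] by (simp add: S_eq sheaf_cat_simps)

lemma \<sigma>_hom: "is_sheaf U D K F \<Longrightarrow>
    adj_unit (sheaf_cat U D K) (sheaf_cat U D' K') (precomp D A) F \<in>
      hom (presheaf_cat U D) F (FO (precomp D A) (S F))"
  using S.unit_hom[of F] by (simp add: S_eq sheaf_cat_simps)

lemma \<sigma>_Sec:
  assumes "is_sheaf U D K F" "x \<in> Sec F d"
  shows "\<sigma> F d x \<in> Sec (S F) (FO A d)"
  using ap_Sec[OF \<sigma>_hom[OF assms(1)] assms(2)] A.Sec_precompD[of "\<sigma> F d x" "S F" d] by simp

lemma \<sigma>_Res: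
  assumes "is_sheaf U D K F" "v \<in> Ar D" "x \<in> Sec F (Cod D v)"
  shows "Res (S F) (FA A v) (\<sigma> F (Cod D v) x) = \<sigma> F (Dom D v) (Res F v x)"
  using ap_Res[OF \<sigma>_hom[OF assms(1)] assms(2,3)] by (simp add: A.Res_precomp assms(2))

lemma S_hom:
  assumes g: "g \<in> hom (presheaf_cat U D) F G" and F: "is_sheaf U D K F" and G: "is_sheaf U D K G"
  shows "SA g \<in> hom (presheaf_cat U D') (S F) (S G)"
  using cat_functor.FA_hom[OF S_functor, of g F G] assms by (simp add: sheaf_cat_simps)

lemma ap_S:
  assumes g: "g \<in> hom (presheaf_cat U D) F G" and F: "is_sheaf U D K F" and G: "is_sheaf U D K G"
    and x: "x \<in> Sec F d"
  shows "ap (SA g) (FO A d) (\<sigma> F d x) = \<sigma> G d (ap g d x)"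
proof -
  have g': "g \<in> hom (sheaf_cat U D K) F G" using g F G by (simp add: sheaf_cat_simps)
  show ?thesis
    using S.left_adjoint_unit[OF g'] ap_Cmp[OF \<sigma>_hom[OF F] A.precomp_hom[OF S_hom[OF g F G]] x]
      ap_Cmp[OF g \<sigma>_hom[OF G] x] Sec_Ob[OF sheaf_presheaf[OF F] x]
    by (simp add: Sh_star_def sheaf_cat_simps A.ap_precomp)
qed

lemma S_transpose:
  assumes f: "f \<in> hom (presheaf_cat U D) F (FO (precomp D A) H)"
    and F: "is_sheaf U D K F" and H: "is_sheaf U D' K' H"
  defines "g \<equiv> transpose (sheaf_cat U D K) (sheaf_cat U D' K') (precomp D A) F H f"
  shows "g \<in> hom (presheaf_cat U D') (S F) H"
    and "x \<in> Sec F d \<Longrightarrow> ap g (FO A d) (\<sigma> F d x) = ap f d x"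
proof -
  note * = S.transpose[of F H f, unfolded sheaf_cat_simps, OF F H conjI[OF f conjI[OF F continuous[OF H]]]]
  show g: "g \<in> hom (presheaf_cat U D') (S F) H"
    using *(1) by (simp add: S_eq g_def)
  show "ap g (FO A d) (\<sigma> F d x) = ap f d x" if x: "x \<in> Sec F d"
    using ap_Cmp[OF \<sigma>_hom[OF F] A.precomp_hom[OF g] x] *(2) Sec_Ob[OF sheaf_presheaf[OF F] x]
    by (simp add: g_def[symmetric] A.ap_precomp)
qed

lemma S_cancel:
  assumes F: "is_sheaf U D K F" and H: "is_sheaf U D' K' H"
    and f: "f \<in> hom (presheaf_cat U D') (S F) H" and g: "g \<in> hom (presheaf_cat U D') (S F) H"
    and eq: "\<And>d x. x \<in> Sec F d \<Longrightarrow> ap f (FO A d) (\<sigma> F d x) = ap g (FO A d) (\<sigma> F d x)"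
  shows "f = g"
proof (rule S.unit_cancel[of F f H g])
  note f' = A.precomp_hom[OF f] and g' = A.precomp_hom[OF g]
  show "FA (precomp D A) f \<cdot>\<^bsub>sheaf_cat U D K\<^esub> S.u F = FA (precomp D A) g \<cdot>\<^bsub>sheaf_cat U D K\<^esub> S.u F"
    unfolding sheaf_cat_simps
    by (rule psh_hom_eqI[OF psh_Cmp_hom[OF \<sigma>_hom[OF F] f'] psh_Cmp_hom[OF \<sigma>_hom[OF F] g']])
      (simp add: ap_Cmp[OF \<sigma>_hom[OF F] f'] ap_Cmp[OF \<sigma>_hom[OF F] g'] A.ap_precomp
        Sec_Ob[OF sheaf_presheaf[OF F]] eq)
qed (use F H f g S_sheaf[OF F] in \<open>simp_all add: sheaf_cat_simps S_eq\<close>)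

lemma S_generated:
  assumes F: "is_sheaf U D K F"
    and gen: "\<And>d x. x \<in> Sec F d \<Longrightarrow> locally D K d (\<lambda>v. Res F v x \<in> P (Dom D v))"
    and P: "\<And>d. P d \<subseteq> Sec F d" and s: "s \<in> Sec (S F) e"
  shows "locally D' K' e (\<lambda>v. \<exists>d x w. x \<in> P d \<and> w \<in> hom D' (Dom D' v) (FO A d) \<and>
    Res (S F) v s = Res (S F) w (\<sigma> F d x))"
proof (rule universal_generated[OF _ sheaf_presheaf[OF F] gen P s])
  show "universal_arrow (presheaf_cat U D) (sheaf_cat U D' K') (precomp D A) F (S F, S.u F)"
    using S.adj_universal[of F] F by (simp add: universal_arrow_sheaf_iff[OF F continuous] S_eq sheaf_cat_simps)
qed

text \<open>
  The inverse image of the sheaf associated with d is the one associated with A d, as both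
  represent the sections over A d of a sheaf on the target.
\<close>

lemma S_ell_iso_ex:
  assumes d: "d \<in> Ob D"
  shows "\<exists>c ci. c \<in> hom (presheaf_cat U D') (D'.l (FO A d)) (S (D.l d)) \<and>
    ci \<in> hom (presheaf_cat U D') (S (D.l d)) (D'.l (FO A d)) \<and>
    (\<forall>g\<in>Ar D'. Cod D' g = FO A d \<longrightarrow>
      ap c (Dom D' g) (D'.lel g) = Res (S (D.l d)) g (\<sigma> (D.l d) d (D.lel (Idn D d)))) \<and>
    (\<forall>v\<in>Ar D. Cod D v = d \<longrightarrow> ap ci (FO A (Dom D v)) (\<sigma> (D.l d) (Dom D v) (D.lel v)) = D'.lel (FA A v)) \<and>
    c \<cdot>\<^bsub>presheaf_cat U D'\<^esub> ci = Idn (presheaf_cat U D') (S (D.l d)) \<and>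
    ci \<cdot>\<^bsub>presheaf_cat U D'\<^esub> c = Idn (presheaf_cat U D') (D'.l (FO A d))"
proof -
  note Ad = A.FO_Ob[OF d]
  note ld = D.l_sheaf[OF d] and lAd = D'.l_sheaf[OF Ad] and I = D.Idn_Ar[OF d] and I' = D'.Idn_Ar[OF Ad]
  have id_Sec: "D.lel (Idn D d) \<in> Sec (D.l d) d"
    using D.lel_Sec[OF I(1)] I by simp
  note one = \<sigma>_Sec[OF ld id_Sec]
  obtain c where c: "c \<in> hom (presheaf_cat U D') (D'.l (FO A d)) (S (D.l d))"
    "\<And>g. g \<in> Ar D' \<Longrightarrow> Cod D' g = FO A d \<Longrightarrow>
      ap c (Dom D' g) (D'.lel g) = Res (S (D.l d)) g (\<sigma> (D.l d) d (D.lel (Idn D d)))"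
    by (rule D'.l_yoneda[OF S_sheaf[OF ld] one]) (rule that, assumption, blast)
  have "D'.lel (Idn D' (FO A d)) \<in> Sec (FO (precomp D A) (D'.l (FO A d))) d"
    using D'.lel_Sec[OF I'(1)] I' d by (simp add: A.Sec_precomp)
  then obtain t where t: "t \<in> hom (presheaf_cat U D) (D.l d) (FO (precomp D A) (D'.l (FO A d)))"
    "\<And>v. v \<in> Ar D \<Longrightarrow> Cod D v = d \<Longrightarrow> ap t (Dom D v) (D.lel v) =
      Res (FO (precomp D A) (D'.l (FO A d))) v (D'.lel (Idn D' (FO A d)))"
    by (rule D.l_yoneda[OF continuous[OF lAd]]) (rule that, assumption, blast)
  define ci where "ci = transpose (sheaf_cat U D K) (sheaf_cat U D' K') (precomp D A) (D.l d) (D'.l (FO A d)) t"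
  note ci = S_transpose[OF t(1) ld lAd, folded ci_def]
  have ci_lel: "ap ci (FO A (Dom D v)) (\<sigma> (D.l d) (Dom D v) (D.lel v)) = D'.lel (FA A v)"
    if v: "v \<in> Ar D" "Cod D v = d" for v
  proof -
    have "Res (D'.l (FO A d)) (FA A v) (D'.lel (Idn D' (FO A d))) = D'.lel (FA A v)"
      using D'.lel_Res[OF I'(1), of "FA A v"] A.FA_Ar[OF v(1)] v I' D'.Idn_Cmp_Ar[of "FA A v"] by simp
    then show ?thesis
      using ci(2)[of "D.lel v" "Dom D v"] D.lel_Sec[OF v(1)] t(2)[OF v] v by (simp add: A.Res_precomp)
  qed
  have ci_one: "ap ci (FO A d) (\<sigma> (D.l d) d (D.lel (Idn D d))) = D'.lel (Idn D' (FO A d))"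
    using ci_lel[OF I(1,3)] I A.FA_Idn[OF d] by simp
  have c_one: "ap c (FO A d) (D'.lel (Idn D' (FO A d))) = \<sigma> (D.l d) d (D.lel (Idn D d))"
    using c(2)[OF I'(1,3)] I' Res_Idn[OF sheaf_presheaf[OF S_sheaf[OF ld]] one] by simp
  have lel1: "D'.lel (Idn D' (FO A d)) \<in> Sec (D'.l (FO A d)) (FO A d)"
    using D'.lel_Sec[OF I'(1)] I' by simp
  have "ci \<cdot>\<^bsub>presheaf_cat U D'\<^esub> c = Idn (presheaf_cat U D') (D'.l (FO A d))"
    by (rule D'.l_cancel[OF Ad lAd psh_Cmp_hom[OF c(1) ci(1)] psh_Idn_hom[OF sheaf_presheaf[OF lAd]]])
      (simp add: ap_Cmp[OF c(1) ci(1) lel1] ap_Idn[OF lel1] c_one ci_one)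
  moreover have "c \<cdot>\<^bsub>presheaf_cat U D'\<^esub> ci = Idn (presheaf_cat U D') (S (D.l d))"
  proof (rule S_cancel[OF ld S_sheaf[OF ld] psh_Cmp_hom[OF ci(1) c(1)]
        psh_Idn_hom[OF sheaf_presheaf[OF S_sheaf[OF ld]]]])
    let ?G = "FO (precomp D A) (S (D.l d))"
    note G = continuous[OF S_sheaf[OF ld]]
    let ?f = "FA (precomp D A) (c \<cdot>\<^bsub>presheaf_cat U D'\<^esub> ci) \<cdot>\<^bsub>presheaf_cat U D\<^esub> S.u (D.l d)"
    note f = A.precomp_hom[OF psh_Cmp_hom[OF ci(1) c(1)]]
    have "?f = S.u (D.l d)"
    proof (rule D.l_cancel[OF d G psh_Cmp_hom[OF \<sigma>_hom[OF ld] f] \<sigma>_hom[OF ld]])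
      show "ap ?f d (D.lel (Idn D d)) = \<sigma> (D.l d) d (D.lel (Idn D d))"
        using ap_Cmp[OF \<sigma>_hom[OF ld] f id_Sec] ap_Cmp[OF ci(1) c(1) one] ci_one c_one d
        by (simp add: A.ap_precomp)
    qed
    then show "ap (c \<cdot>\<^bsub>presheaf_cat U D'\<^esub> ci) (FO A e) (\<sigma> (D.l d) e x) =
        ap (Idn (presheaf_cat U D') (S (D.l d))) (FO A e) (\<sigma> (D.l d) e x)"
      if x: "x \<in> Sec (D.l d) e" for e x
      using ap_Cmp[OF \<sigma>_hom[OF ld] f x] ap_Idn[OF \<sigma>_Sec[OF ld x]] Sec_Ob[OF sheaf_presheaf[OF ld] x]
      by (simp add: A.ap_precomp)
  qed
  ultimately show ?thesis
    using c ci(1) ci_lel by blast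
qed

end

section \<open>Flatness of a morphism of sites\<close>

context small_site
begin

definition one :: "('o, 'a, 'u) presheaf" where
  "one = encode U C (\<lambda>_. {()}) (\<lambda>_ x. x)"

lemma set_presheaf_one: "set_presheaf U C (\<lambda>_. {()}) (\<lambda>_ x. x)"
proof
  show "fits U {()}"
    by (rule fits_inj[OF universe fits_bool[OF universe], where f = "\<lambda>_. True"]) auto
qed auto

lemma one_sheaf: "is_sheaf U C J one"
  unfolding one_def by (rule set_presheaf.encode_sheaf[OF set_presheaf_one]) (auto, unfold_locales)

lemma one_Sec: "c \<in> Ob C \<Longrightarrow> \<exists>s. Sec one c = {s}"
  unfolding one_def using set_presheaf.Sec_encode[OF set_presheaf_one] by auto

lemma one_terminal: "terminal (sheaf_cat U C J) one"
  unfolding terminal_def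
proof (intro conjI ballI)
  show "one \<in> Ob (sheaf_cat U C J)" by (simp add: sheaf_cat_simps one_sheaf)
  fix F assume "F \<in> Ob (sheaf_cat U C J)"
  then have F: "is_sheaf U C J F" by (simp add: sheaf_cat_simps)
  note PF = sheaf_presheaf[OF F] and P1 = sheaf_presheaf[OF one_sheaf]
  obtain s where s: "\<And>c. c \<in> Ob C \<Longrightarrow> Sec one c = {s c}"
    using one_Sec by metis
  have m: "psh_mor F one (\<lambda>c x. s c) \<in> hom (presheaf_cat U C) F one"
    by (rule psh_mor_hom[OF PF P1])
      (use s Sec_Ob[OF PF] Res_Sec[OF P1] Dom_Ob Cod_Ob in auto)
  show "\<exists>!w. w \<in> hom (sheaf_cat U C J) F one"
  proof (rule ex1I)
    show "psh_mor F one (\<lambda>c x. s c) \<in> hom (sheaf_cat U C J) F one"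
      using m F one_sheaf by (simp add: sheaf_cat_simps)
    fix w assume "w \<in> hom (sheaf_cat U C J) F one"
    then have w: "w \<in> hom (presheaf_cat U C) F one" by (simp add: sheaf_cat_simps)
    show "w = psh_mor F one (\<lambda>c x. s c)"
      by (rule psh_hom_eqI[OF w m]) (use ap_Sec[OF w] ap_Sec[OF m] s Sec_Ob[OF PF] in fastforce)
  qed
qed

lemma terminal_map:
  assumes v: "terminal (sheaf_cat U C J) V" and F: "is_sheaf U C J F"
  shows "\<exists>!w. w \<in> hom (presheaf_cat U C) F V"
proof -
  have V: "is_sheaf U C J V" using v by (simp add: terminal_def sheaf_cat_simps)
  have "\<exists>!w. w \<in> hom (sheaf_cat U C J) F V"
    using v F by (simp add: terminal_def sheaf_cat_simps(5))
  moreover have "w \<in> hom (sheaf_cat U C J) F V \<longleftrightarrow> w \<in> hom (presheaf_cat U C) F V" for w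
    using V F by (simp add: sheaf_cat_simps)
  ultimately show ?thesis by simp
qed

lemma terminal_Sec:
  assumes v: "terminal (sheaf_cat U C J) V" and c: "c \<in> Ob C"
  shows "\<exists>s. Sec V c = {s}"
proof -
  have V: "is_sheaf U C J V" using v by (simp add: terminal_def sheaf_cat_simps)
  obtain w where w: "w \<in> hom (presheaf_cat U C) one V"
    using terminal_map[OF v one_sheaf] by (rule ex1_implies_ex[THEN exE])
  obtain s0 where s0: "Sec one c = {s0}" using one_Sec[OF c] by blast
  have "s = s'" if s: "s \<in> Sec V c" and s': "s' \<in> Sec V c" for s s'
  proof -
    obtain t where t: "t \<in> hom (presheaf_cat U C) (l c) V"
      "\<And>g. g \<in> Ar C \<Longrightarrow> Cod C g = c \<Longrightarrow> ap t (Dom C g) (lel g) = Res V g s"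
      by (rule l_yoneda[OF V s]) (rule that, assumption, blast)
    obtain t' where t': "t' \<in> hom (presheaf_cat U C) (l c) V"
      "\<And>g. g \<in> Ar C \<Longrightarrow> Cod C g = c \<Longrightarrow> ap t' (Dom C g) (lel g) = Res V g s'"
      by (rule l_yoneda[OF V s']) (rule that, assumption, blast)
    have "t = t'"
      by (rule ex1E[OF terminal_map[OF v l_sheaf[OF c]]]) (use t(1) t'(1) in metis)
    then have "Res V (Idn C c) s = Res V (Idn C c) s'"
      using t(2)[OF Idn_Ar(1,3)[OF c]] t'(2)[OF Idn_Ar(1,3)[OF c]] Idn_Ar(2)[OF c] by simp
    then show ?thesis
      using Res_Idn[OF sheaf_presheaf[OF V]] s s' by simp
  qed
  moreover have "ap w c s0 \<in> Sec V c" using ap_Sec[OF w] s0 by simp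
  ultimately show ?thesis by blast
qed

end

locale site_morphism = continuous_site +
  assumes finite_limits: "preserves_finite_limits (sheaf_cat U D K) (sheaf_cat U D' K') (Sh_star U D K D' K' A)"
begin

lemma S_one_Sec: "e \<in> Ob D' \<Longrightarrow> \<exists>s. Sec (S D.one) e = {s}"
  by (rule D'.terminal_Sec[OF preserves_terminal[OF S_functor finite_limits D.one_terminal]])

text \<open>
  The inverse image of the terminal sheaf is terminal, so it has a section over e, and this section is
  locally generated over objects A d.
\<close>

lemma locally_maps_to_image:
  assumes e: "e \<in> Ob D'"
  shows "locally D' K' e (\<lambda>v. \<exists>d\<in>Ob D. \<exists>w. w \<in> hom D' (Dom D' v) (FO A d))"
proof -
  obtain s where s: "s \<in> Sec (S D.one) e" using S_one_Sec[OF e] by blast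
  note P = sheaf_presheaf[OF D.one_sheaf]
  have "locally D' K' e (\<lambda>v. \<exists>d x w. x \<in> Sec D.one d \<and> w \<in> hom D' (Dom D' v) (FO A d) \<and>
    Res (S D.one) v s = Res (S D.one) w (\<sigma> D.one d x))"
    by (rule S_generated[where P = "Sec D.one", OF D.one_sheaf _ order_refl s])
      (auto intro: D.locally_everywhere Res_Sec[OF P] Sec_Ob[OF P])
  then show ?thesis
    by (rule D'.locally_mono[OF _ e]) (use Sec_Ob[OF P] in blast)
qed

text \<open>
  A pair of arrows into A d1 and A d2 is a section of the inverse image of the product of the
  sheaves of d1 and d2, since this product is preserved; and the product is generated by the
  pairs of arrows of the source site.
\<close>

lemma locally_common_refinement:
  assumes w1: "w1 \<in> hom D' e (FO A d1)" and w2: "w2 \<in> hom D' e (FO A d2)"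
    and d1: "d1 \<in> Ob D" and d2: "d2 \<in> Ob D"
  shows "locally D' K' e (\<lambda>v. \<exists>d w u1 u2. w \<in> hom D' (Dom D' v) (FO A d) \<and>
    u1 \<in> hom D d d1 \<and> u2 \<in> hom D d d2 \<and>
    FA A u1 \<cdot>\<^bsub>D'\<^esub> w = w1 \<cdot>\<^bsub>D'\<^esub> v \<and> FA A u2 \<cdot>\<^bsub>D'\<^esub> w = w2 \<cdot>\<^bsub>D'\<^esub> v)"
proof -
  have e: "e \<in> Ob D'" using D'.hom_Ob[OF w1] by simp
  note l1 = D.l_sheaf[OF d1] and l2 = D.l_sheaf[OF d2]
  note trm = D.one_terminal
  obtain h k where h: "h \<in> hom (presheaf_cat U D) (D.l d1) D.one" and k: "k \<in> hom (presheaf_cat U D) (D.l d2) D.one"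
    using D.terminal_map[OF trm l1] D.terminal_map[OF trm l2] by (meson ex1_implies_ex)
  obtain V f g where V: "is_sheaf U D K V" and f: "f \<in> hom (presheaf_cat U D) V (D.l d1)"
    and g: "g \<in> hom (presheaf_cat U D) V (D.l d2)" and pb: "pullback (sheaf_cat U D K) f g h k"
    using D.pullback_ex[OF l1 l2 D.one_sheaf h k] by blast
  note PV = sheaf_presheaf[OF V]
  note Sl1 = S_sheaf[OF l1] and Sl2 = S_sheaf[OF l2] and SV = S_sheaf[OF V] and PSV = sheaf_presheaf[OF S_sheaf[OF V]]
  note Sf = S_hom[OF f V l1] and Sg = S_hom[OF g V l2]
  have Spb: "sections_pullback (S V) (S (D.l d1)) (S (D.l d2)) (SA f) (SA g) (SA h) (SA k)"
    by (rule D'.sections_of_pullback[OF Sl1 Sl2 S_sheaf[OF D.one_sheaf] S_hom[OF h l1 D.one_sheaf]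
          S_hom[OF k l2 D.one_sheaf] Sf Sg preserves_pullback[OF S_functor finite_limits pb]])
  obtain c1 i1 where c1: "c1 \<in> hom (presheaf_cat U D') (D'.l (FO A d1)) (S (D.l d1))"
    and i1: "i1 \<in> hom (presheaf_cat U D') (S (D.l d1)) (D'.l (FO A d1))"
    and i1_lel: "\<forall>v\<in>Ar D. Cod D v = d1 \<longrightarrow> ap i1 (FO A (Dom D v)) (\<sigma> (D.l d1) (Dom D v) (D.lel v)) = D'.lel (FA A v)"
    and ic1: "i1 \<cdot>\<^bsub>presheaf_cat U D'\<^esub> c1 = Idn (presheaf_cat U D') (D'.l (FO A d1))"
    using S_ell_iso_ex[OF d1] by blast
  obtain c2 i2 where c2: "c2 \<in> hom (presheaf_cat U D') (D'.l (FO A d2)) (S (D.l d2))"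
    and i2: "i2 \<in> hom (presheaf_cat U D') (S (D.l d2)) (D'.l (FO A d2))"
    and i2_lel: "\<forall>v\<in>Ar D. Cod D v = d2 \<longrightarrow> ap i2 (FO A (Dom D v)) (\<sigma> (D.l d2) (Dom D v) (D.lel v)) = D'.lel (FA A v)"
    and ic2: "i2 \<cdot>\<^bsub>presheaf_cat U D'\<^esub> c2 = Idn (presheaf_cat U D') (D'.l (FO A d2))"
    using S_ell_iso_ex[OF d2] by blast
  note w1' = homD[OF w1] and w2' = homD[OF w2]
  have lw1: "D'.lel w1 \<in> Sec (D'.l (FO A d1)) e" and lw2: "D'.lel w2 \<in> Sec (D'.l (FO A d2)) e"
    using D'.lel_Sec[OF w1'(1)] D'.lel_Sec[OF w2'(1)] w1' w2' by simp_all
  define s1 where "s1 = ap c1 e (D'.lel w1)"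
  define s2 where "s2 = ap c2 e (D'.lel w2)"
  have s1: "s1 \<in> Sec (S (D.l d1)) e" "ap i1 e s1 = D'.lel w1"
    using ap_Sec[OF c1 lw1] ap_Cmp[OF c1 i1 lw1] ic1 ap_Idn[OF lw1] by (simp_all add: s1_def)
  have s2: "s2 \<in> Sec (S (D.l d2)) e" "ap i2 e s2 = D'.lel w2"
    using ap_Sec[OF c2 lw2] ap_Cmp[OF c2 i2 lw2] ic2 ap_Idn[OF lw2] by (simp_all add: s2_def)
  have "ap (SA h) e s1 = ap (SA k) e s2"
    using S_one_Sec[OF e] ap_Sec[OF S_hom[OF h l1 D.one_sheaf] s1(1)] ap_Sec[OF S_hom[OF k l2 D.one_sheaf] s2(1)]
    by auto
  then obtain q where q: "q \<in> Sec (S V) e" "ap (SA f) e q = s1" "ap (SA g) e q = s2"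
    using Spb s1(1) s2(1) unfolding sections_pullback_def by blast
  \<comment> \<open>The generators of the product given by pairs of arrows.\<close>
  define P where "P d = {x \<in> Sec V d. (\<exists>u1\<in>hom D d d1. ap f d x = D.lel u1) \<and> (\<exists>u2\<in>hom D d d2. ap g d x = D.lel u2)}" for d
  have gen: "locally D K d (\<lambda>v. Res V v x \<in> P (Dom D v))" if x: "x \<in> Sec V d" for d x
  proof -
    have d: "d \<in> Ob D" using Sec_Ob[OF PV x] .
    note fx = ap_Sec[OF f x] and gx = ap_Sec[OF g x]
    have "locally D K d (\<lambda>v. (\<exists>u\<in>hom D (Dom D v) d1. Res (D.l d1) v (ap f d x) = D.lel u) \<and>
        (\<exists>u\<in>hom D (Dom D v) d2. Res (D.l d2) v (ap g d x) = D.lel u))"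
    proof (rule D.locally_conj[OF D.l_generated[OF d1 fx] D.l_generated[OF d2 gx] d])
      fix v v' assume v: "v \<in> Ar D" "Cod D v = d" and ex: "\<exists>u\<in>hom D (Dom D v) d1. Res (D.l d1) v (ap f d x) = D.lel u"
        and v': "v' \<in> Ar D" "Cod D v' = Dom D v"
      obtain u where u: "u \<in> hom D (Dom D v) d1" "Res (D.l d1) v (ap f d x) = D.lel u" using ex by blast
      note u' = homD[OF u(1)]
      have "Res (D.l d1) (v \<cdot>\<^bsub>D\<^esub> v') (ap f d x) = D.lel (u \<cdot>\<^bsub>D\<^esub> v')"
        using Res_Cmp[OF sheaf_presheaf[OF l1] v(1) v'] fx v(2) u(2) D.lel_Res[OF u'(1) v'(1)] u' v'(2) by simp
      moreover have "u \<cdot>\<^bsub>D\<^esub> v' \<in> hom D (Dom D (v \<cdot>\<^bsub>D\<^esub> v')) d1"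
        using D.Cmp_Ar[OF u'(1) v'(1)] D.Cmp_Ar[OF v(1) v'] u' v' by (auto simp: hom_def)
      ultimately show "\<exists>u\<in>hom D (Dom D (v \<cdot>\<^bsub>D\<^esub> v')) d1. Res (D.l d1) (v \<cdot>\<^bsub>D\<^esub> v') (ap f d x) = D.lel u"
        by blast
    qed
    then show ?thesis
      by (rule D.locally_mono[OF _ d])
        (use x Res_Sec[OF PV] ap_Res[OF f] ap_Res[OF g] in \<open>auto simp: P_def\<close>)
  qed
  have "locally D' K' e (\<lambda>v. \<exists>d x w. x \<in> P d \<and> w \<in> hom D' (Dom D' v) (FO A d) \<and>
    Res (S V) v q = Res (S V) w (\<sigma> V d x))"
    by (rule S_generated[where P = P, OF V gen _ q(1)]) (auto simp: P_def)
  then show ?thesis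
  proof (rule D'.locally_trans[OF _ e])
    fix v assume v: "v \<in> Ar D'" "Cod D' v = e"
      and "\<exists>d x w. x \<in> P d \<and> w \<in> hom D' (Dom D' v) (FO A d) \<and> Res (S V) v q = Res (S V) w (\<sigma> V d x)"
    then obtain d x w u1 u2 where x: "x \<in> Sec V d" and u1: "u1 \<in> hom D d d1" "ap f d x = D.lel u1"
      and u2: "u2 \<in> hom D d d2" "ap g d x = D.lel u2"
      and w: "w \<in> hom D' (Dom D' v) (FO A d)" and eq: "Res (S V) v q = Res (S V) w (\<sigma> V d x)"
      by (auto simp: P_def)
    note w' = homD[OF w] and vx = \<sigma>_Sec[OF V x]
    have dv: "Dom D' v \<in> Ob D'" using D'.Dom_Ob[OF v(1)] .
    have loc: "locally D' K' (Dom D' v) (\<lambda>g. (wi \<cdot>\<^bsub>D'\<^esub> v) \<cdot>\<^bsub>D'\<^esub> g = (FA A u \<cdot>\<^bsub>D'\<^esub> w) \<cdot>\<^bsub>D'\<^esub> g)"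
      if t: "t \<in> hom (presheaf_cat U D) V (D.l di)" and di: "di \<in> Ob D" and wi: "wi \<in> hom D' e (FO A di)"
        and i: "i \<in> hom (presheaf_cat U D') (S (D.l di)) (D'.l (FO A di))"
        and i_lel: "\<forall>v\<in>Ar D. Cod D v = di \<longrightarrow> ap i (FO A (Dom D v)) (\<sigma> (D.l di) (Dom D v) (D.lel v)) = D'.lel (FA A v)"
        and u: "u \<in> hom D d di" "ap t d x = D.lel u" and q': "ap i e (ap (SA t) e q) = D'.lel wi"
      for t di wi i u
    proof (rule D'.l_kernel)
      note St = S_hom[OF t V D.l_sheaf[OF di]] and u' = homD[OF u(1)] and wi' = homD[OF wi]
      note Au = A.FA_Ar[OF u'(1)]
      show wiv: "wi \<cdot>\<^bsub>D'\<^esub> v \<in> hom D' (Dom D' v) (FO A di)"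
        using D'.Cmp_Ar[OF wi'(1) v(1)] wi' v by (auto simp: hom_def)
      show Auw: "FA A u \<cdot>\<^bsub>D'\<^esub> w \<in> hom D' (Dom D' v) (FO A di)"
        using D'.Cmp_hom[OF w A.FA_hom[OF u(1)]] .
      have "D'.lel (wi \<cdot>\<^bsub>D'\<^esub> v) = Res (D'.l (FO A di)) v (ap i e (ap (SA t) e q))"
        using D'.lel_Res[OF wi'(1) v(1)] v(2) wi' q' by simp
      also have "\<dots> = ap i (Dom D' v) (ap (SA t) (Dom D' v) (Res (S V) v q))"
        using ap_Res[OF St v(1)] ap_Res[OF i v(1)] ap_Sec[OF St] q(1) v(2) by simp
      also have "\<dots> = ap i (Dom D' w) (ap (SA t) (Dom D' w) (Res (S V) w (\<sigma> V d x)))"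
        using eq w'(2) by simp
      also have "\<dots> = Res (D'.l (FO A di)) w (ap i (FO A d) (ap (SA t) (FO A d) (\<sigma> V d x)))"
        using ap_Res[OF St w'(1)] ap_Res[OF i w'(1)] ap_Sec[OF St vx] vx w'(3) by simp
      also have "ap i (FO A d) (ap (SA t) (FO A d) (\<sigma> V d x)) = D'.lel (FA A u)"
        using ap_S[OF t V D.l_sheaf[OF di] x] u(2) i_lel u' by auto
      also have "Res (D'.l (FO A di)) w (D'.lel (FA A u)) = D'.lel (FA A u \<cdot>\<^bsub>D'\<^esub> w)"
        using D'.lel_Res[OF Au(1) w'(1)] Au u' w' by simp
      finally show "D'.lel (wi \<cdot>\<^bsub>D'\<^esub> v) = D'.lel (FA A u \<cdot>\<^bsub>D'\<^esub> w)" .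
    qed
    have loc1: "locally D' K' (Dom D' v) (\<lambda>g. (w1 \<cdot>\<^bsub>D'\<^esub> v) \<cdot>\<^bsub>D'\<^esub> g = (FA A u1 \<cdot>\<^bsub>D'\<^esub> w) \<cdot>\<^bsub>D'\<^esub> g)"
      by (rule loc[OF f d1 w1 i1 i1_lel u1]) (simp add: q s1)
    have loc2: "locally D' K' (Dom D' v) (\<lambda>g. (w2 \<cdot>\<^bsub>D'\<^esub> v) \<cdot>\<^bsub>D'\<^esub> g = (FA A u2 \<cdot>\<^bsub>D'\<^esub> w) \<cdot>\<^bsub>D'\<^esub> g)"
      by (rule loc[OF g d2 w2 i2 i2_lel u2]) (simp add: q s2)
    have Aw1: "FA A u1 \<in> Ar D'" "Cod D' w = Dom D' (FA A u1)" and Aw2: "FA A u2 \<in> Ar D'" "Cod D' w = Dom D' (FA A u2)"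
      using homD[OF A.FA_hom[OF u1(1)]] homD[OF A.FA_hom[OF u2(1)]] w'(3) by simp_all
    show "locally D' K' (Dom D' v) (\<lambda>g. \<exists>d w u1 u2. w \<in> hom D' (Dom D' (v \<cdot>\<^bsub>D'\<^esub> g)) (FO A d) \<and>
      u1 \<in> hom D d d1 \<and> u2 \<in> hom D d d2 \<and>
      FA A u1 \<cdot>\<^bsub>D'\<^esub> w = w1 \<cdot>\<^bsub>D'\<^esub> (v \<cdot>\<^bsub>D'\<^esub> g) \<and> FA A u2 \<cdot>\<^bsub>D'\<^esub> w = w2 \<cdot>\<^bsub>D'\<^esub> (v \<cdot>\<^bsub>D'\<^esub> g))"
    proof (rule D'.locally_mono[OF D'.locally_conj[OF loc1 loc2 dv] dv])
      fix g assume g: "g \<in> Ar D'" "Cod D' g = Dom D' v"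
        and eqs: "(w1 \<cdot>\<^bsub>D'\<^esub> v) \<cdot>\<^bsub>D'\<^esub> g = (FA A u1 \<cdot>\<^bsub>D'\<^esub> w) \<cdot>\<^bsub>D'\<^esub> g \<and>
          (w2 \<cdot>\<^bsub>D'\<^esub> v) \<cdot>\<^bsub>D'\<^esub> g = (FA A u2 \<cdot>\<^bsub>D'\<^esub> w) \<cdot>\<^bsub>D'\<^esub> g"
      have "w \<cdot>\<^bsub>D'\<^esub> g \<in> hom D' (Dom D' (v \<cdot>\<^bsub>D'\<^esub> g)) (FO A d)"
        using D'.Cmp_Ar[OF w'(1) g(1)] D'.Cmp_Ar[OF v(1) g] g w' by (auto simp: hom_def)
      moreover have "FA A u1 \<cdot>\<^bsub>D'\<^esub> (w \<cdot>\<^bsub>D'\<^esub> g) = w1 \<cdot>\<^bsub>D'\<^esub> (v \<cdot>\<^bsub>D'\<^esub> g)"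
        using eqs D'.Cmp_Ar_assoc[OF g(1) w'(1) Aw1(1)] D'.Cmp_Ar_assoc[OF g(1) v(1) w1'(1)] g w' v w1' Aw1(2)
        by simp
      moreover have "FA A u2 \<cdot>\<^bsub>D'\<^esub> (w \<cdot>\<^bsub>D'\<^esub> g) = w2 \<cdot>\<^bsub>D'\<^esub> (v \<cdot>\<^bsub>D'\<^esub> g)"
        using eqs D'.Cmp_Ar_assoc[OF g(1) w'(1) Aw2(1)] D'.Cmp_Ar_assoc[OF g(1) v(1) w2'(1)] g w' v w2' Aw2(2)
        by simp
      ultimately show "\<exists>d w u1 u2. w \<in> hom D' (Dom D' (v \<cdot>\<^bsub>D'\<^esub> g)) (FO A d) \<and>
        u1 \<in> hom D d d1 \<and> u2 \<in> hom D d d2 \<and>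
        FA A u1 \<cdot>\<^bsub>D'\<^esub> w = w1 \<cdot>\<^bsub>D'\<^esub> (v \<cdot>\<^bsub>D'\<^esub> g) \<and> FA A u2 \<cdot>\<^bsub>D'\<^esub> w = w2 \<cdot>\<^bsub>D'\<^esub> (v \<cdot>\<^bsub>D'\<^esub> g)"
        using u1(1) u2(1) by blast
    next
      fix f g assume f: "f \<in> Ar D'" "Cod D' f = Dom D' v"
        and eq: "(w1 \<cdot>\<^bsub>D'\<^esub> v) \<cdot>\<^bsub>D'\<^esub> f = (FA A u1 \<cdot>\<^bsub>D'\<^esub> w) \<cdot>\<^bsub>D'\<^esub> f"
        and g: "g \<in> Ar D'" "Cod D' g = Dom D' f"
      have c1: "w1 \<cdot>\<^bsub>D'\<^esub> v \<in> Ar D'" "Dom D' (w1 \<cdot>\<^bsub>D'\<^esub> v) = Dom D' v"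
        and c2: "FA A u1 \<cdot>\<^bsub>D'\<^esub> w \<in> Ar D'" "Dom D' (FA A u1 \<cdot>\<^bsub>D'\<^esub> w) = Dom D' v"
        using D'.Cmp_Ar[OF w1'(1) v(1)] D'.Cmp_Ar[OF Aw1(1) w'(1) Aw1(2)] w1' v w' by auto
      show "(w1 \<cdot>\<^bsub>D'\<^esub> v) \<cdot>\<^bsub>D'\<^esub> (f \<cdot>\<^bsub>D'\<^esub> g) = (FA A u1 \<cdot>\<^bsub>D'\<^esub> w) \<cdot>\<^bsub>D'\<^esub> (f \<cdot>\<^bsub>D'\<^esub> g)"
        using D'.Cmp_Ar_assoc[OF g(1) f(1) c1(1)] D'.Cmp_Ar_assoc[OF g(1) f(1) c2(1)] f g c1 c2 eq by simp
    qed
  qed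
qed

end

section \<open>Isomorphisms and pullbacks\<close>

lemma isoE:
  assumes "iso A i" "i \<in> hom A a b"
  obtains j where "j \<in> hom A b a" "j \<cdot>\<^bsub>A\<^esub> i = Idn A a" "i \<cdot>\<^bsub>A\<^esub> j = Idn A b"
  using assms by (auto simp: iso_def hom_def)

lemma isoI:
  assumes "i \<in> hom A a b" "j \<in> hom A b a" "j \<cdot>\<^bsub>A\<^esub> i = Idn A a" "i \<cdot>\<^bsub>A\<^esub> j = Idn A b"
  shows "iso A i"
  using assms by (auto simp: iso_def hom_def)

context category
begin

lemma iso_Cmp_cancel:
  assumes "iso C i" "i \<in> hom C a b" "u \<in> hom C c a" "u' \<in> hom C c a" "i \<cdot> u = i \<cdot> u'"
  shows "u = u'"
proof -
  obtain j where j: "j \<in> hom C b a" "j \<cdot> i = Idn C a"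
    using isoE[OF assms(1,2)] by blast
  have "u = j \<cdot> (i \<cdot> u)" "u' = j \<cdot> (i \<cdot> u')"
    using Cmp_assoc[OF assms(3,2) j(1)] Cmp_assoc[OF assms(4,2) j(1)] j(2) Idn_Cmp[OF assms(3)] Idn_Cmp[OF assms(4)]
    by simp_all
  then show ?thesis using assms(5) by simp
qed

lemma pullback_iso:
  assumes pb: "pullback C f g h k"
    and f: "f \<in> hom C v x" and g: "g \<in> hom C v y" and h: "h \<in> hom C x z" and k: "k \<in> hom C y z"
    and f1: "f1 \<in> hom C v1 x1" and g1: "g1 \<in> hom C v1 y1" and h1: "h1 \<in> hom C x1 z1" and k1: "k1 \<in> hom C y1 z1"
    and v: "iso C cv" "cv \<in> hom C v1 v" and x: "iso C cx" "cx \<in> hom C x1 x"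
    and y: "iso C cy" "cy \<in> hom C y1 y" and z: "iso C cz" "cz \<in> hom C z1 z"
    and eq: "f \<cdot> cv = cx \<cdot> f1" "g \<cdot> cv = cy \<cdot> g1" "h \<cdot> cx = cz \<cdot> h1" "k \<cdot> cy = cz \<cdot> k1"
  shows "pullback C f1 g1 h1 k1"
  unfolding pullback_iff[OF f1 g1 h1 k1]
proof (intro conjI allI impI)
  note pb' = pb[unfolded pullback_iff[OF f g h k]]
  have push: "cz \<cdot> (h1 \<cdot> a) = h \<cdot> (cx \<cdot> a)" if "a \<in> hom C c x1" for a c
    using Cmp_assoc[OF that h1 z(2)] Cmp_assoc[OF that x(2) h] eq(3) by simp
  have push': "cz \<cdot> (k1 \<cdot> a) = k \<cdot> (cy \<cdot> a)" if "a \<in> hom C c y1" for a c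
    using Cmp_assoc[OF that k1 z(2)] Cmp_assoc[OF that y(2) k] eq(4) by simp
  show "h1 \<cdot> f1 = k1 \<cdot> g1"
  proof (rule iso_Cmp_cancel[OF z Cmp_hom[OF f1 h1] Cmp_hom[OF g1 k1]])
    show "cz \<cdot> (h1 \<cdot> f1) = cz \<cdot> (k1 \<cdot> g1)"
      unfolding push[OF f1] push'[OF g1] eq(1,2)[symmetric]
      using Cmp_assoc[OF v(2) f h] Cmp_assoc[OF v(2) g k] pb' by simp
  qed
  fix c a b assume a: "a \<in> hom C c x1" and b: "b \<in> hom C c y1" and ab: "h1 \<cdot> a = k1 \<cdot> b"
  obtain j where j: "j \<in> hom C v v1" "j \<cdot> cv = Idn C v1" "cv \<cdot> j = Idn C v"
    using isoE[OF v] by blast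
  have "h \<cdot> (cx \<cdot> a) = k \<cdot> (cy \<cdot> b)"
    using push[OF a] push'[OF b] ab by simp
  then have ex: "\<exists>!w. w \<in> hom C c v \<and> f \<cdot> w = cx \<cdot> a \<and> g \<cdot> w = cy \<cdot> b"
    using pb' Cmp_hom[OF a x(2)] Cmp_hom[OF b y(2)] by blast
  then obtain w where w: "w \<in> hom C c v" "f \<cdot> w = cx \<cdot> a" "g \<cdot> w = cy \<cdot> b" by blast
  have cvj: "cv \<cdot> (j \<cdot> w) = w"
    using Cmp_assoc[OF w(1) j(1) v(2)] j(3) Idn_Cmp[OF w(1)] by simp
  note jw = Cmp_hom[OF w(1) j(1)]
  have equiv: "f1 \<cdot> u = a \<longleftrightarrow> f \<cdot> (cv \<cdot> u) = cx \<cdot> a" "g1 \<cdot> u = b \<longleftrightarrow> g \<cdot> (cv \<cdot> u) = cy \<cdot> b"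
    if u: "u \<in> hom C c v1" for u
    using Cmp_assoc[OF u v(2) f] Cmp_assoc[OF u f1 x(2)] eq(1) iso_Cmp_cancel[OF x Cmp_hom[OF u f1] a]
      Cmp_assoc[OF u v(2) g] Cmp_assoc[OF u g1 y(2)] eq(2) iso_Cmp_cancel[OF y Cmp_hom[OF u g1] b] by auto
  show "\<exists>!w. w \<in> hom C c v1 \<and> f1 \<cdot> w = a \<and> g1 \<cdot> w = b"
  proof (rule ex1I[of _ "j \<cdot> w"])
    show "j \<cdot> w \<in> hom C c v1 \<and> f1 \<cdot> (j \<cdot> w) = a \<and> g1 \<cdot> (j \<cdot> w) = b"
      using jw equiv[OF jw] cvj w by simp
    fix u assume u: "u \<in> hom C c v1 \<and> f1 \<cdot> u = a \<and> g1 \<cdot> u = b"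
    then have "cv \<cdot> u = w"
      using ex w equiv[of u] Cmp_hom[OF _ v(2), of u c] by blast
    then show "u = j \<cdot> w"
      using iso_Cmp_cancel[OF v _ jw, of u] u cvj by simp
  qed
qed

end


section \<open>Locally cartesian arrows\<close>

context comorphism
begin

sublocale glue: comma "sheaf_cat U D K" "sheaf_cat U C J" "C_star U D K p"
  unfolding comma_def by (rule C_star_functor)

lemma l_p_sheaf: "d \<in> Ob D \<Longrightarrow> is_sheaf U C J (C.l (FO p d))"
  by (rule C.l_sheaf[OF p.FO_Ob])

lemma T_l_sheaf: "d \<in> Ob D \<Longrightarrow> is_sheaf U D K (T (C.l (FO p d)))"
  by (rule T_sheaf[OF sheaf_presheaf[OF l_p_sheaf]])

lemma T_l_hom: "f \<in> hom D d e \<Longrightarrow>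
    TA (FA (ell U C J) (FA p f)) \<in> hom (presheaf_cat U D) (T (C.l (FO p d))) (T (C.l (FO p e)))"
  by (rule T_hom[OF C.l_hom[OF p.FA_hom]])

lemma ap_eta_Idn:
  assumes d: "d \<in> Ob D"
  shows "ap (eta d) d (D.lel (Idn D d)) = \<theta> (C.l (FO p d)) d (C.lel (Idn C (FO p d)))"
  using ap_eta[OF D.Idn_Ar(1)[OF d]] D.Idn_Ar[OF d] p.FA_Idn[OF d] by simp

lemma ap_T_l:
  assumes f: "f \<in> hom D d e" and b: "b \<in> Ob D" and h: "h \<in> hom C (FO p b) (FO p d)"
  shows "ap (TA (FA (ell U C J) (FA p f))) b (\<theta> (C.l (FO p d)) b (C.lel h)) =
    \<theta> (C.l (FO p e)) b (C.lel (FA p f \<cdot>\<^bsub>C\<^esub> h))"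
  using ap_T[OF C.l_hom[OF p.FA_hom[OF f]] b, of "C.lel h"] C.lel_Sec[OF homD(1)[OF h]] homD[OF h]
    C.ap_l[of "FA p f" h] homD[OF p.FA_hom[OF f]] by simp

lemma eta_natural:
  assumes f: "f \<in> hom D d e"
  shows "eta e \<cdot>\<^bsub>presheaf_cat U D\<^esub> FA (ell U D K) f = TA (FA (ell U C J) (FA p f)) \<cdot>\<^bsub>presheaf_cat U D\<^esub> eta d"
proof -
  note f' = homD[OF f]
  have d: "d \<in> Ob D" and e: "e \<in> Ob D" using D.hom_Ob[OF f] by auto
  note I = D.Idn_Ar[OF d]
  have x: "D.lel (Idn D d) \<in> Sec (D.l d) d" using D.lel_Sec[OF I(1)] I by simp
  show ?thesis
  proof (rule D.l_cancel[OF d T_l_sheaf[OF e] psh_Cmp_hom[OF D.l_hom[OF f] eta_hom[OF e]]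
        psh_Cmp_hom[OF eta_hom[OF d] T_l_hom[OF f]]])
    have "ap (FA (ell U D K) f) d (D.lel (Idn D d)) = D.lel f"
      using D.ap_l[OF f'(1) I(1)] I f' D.Cmp_Idn[OF f] by simp
    then show "ap (eta e \<cdot>\<^bsub>presheaf_cat U D\<^esub> FA (ell U D K) f) d (D.lel (Idn D d)) =
        ap (TA (FA (ell U C J) (FA p f)) \<cdot>\<^bsub>presheaf_cat U D\<^esub> eta d) d (D.lel (Idn D d))"
      using ap_Cmp[OF D.l_hom[OF f] eta_hom[OF e] x] ap_Cmp[OF eta_hom[OF d] T_l_hom[OF f] x]
        ap_eta[OF f'(1)] f' ap_eta_Idn[OF d] ap_T_l[OF f d C.Idn_hom[OF p.FO_Ob[OF d]]]
        C.Cmp_Idn[OF p.FA_hom[OF f]] by simp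
  qed
qed

lemma eta_Ar:
  assumes f: "f \<in> hom D d e"
  shows "FA (eta_functor U D K C J p) f = ((D.l d, C.l (FO p d), eta d), (D.l e, C.l (FO p e), eta e),
      FA (ell U D K) f, FA (ell U C J) (FA p f))"
    and "((D.l d, C.l (FO p d), eta d), (D.l e, C.l (FO p e), eta e), FA (ell U D K) f, FA (ell U C J) (FA p f)) \<in>
      Ar (gluing U D K C J p)"
proof -
  have d: "d \<in> Ob D" and e: "e \<in> Ob D" using D.hom_Ob[OF f] by auto
  show "FA (eta_functor U D K C J p) f = ((D.l d, C.l (FO p d), eta d), (D.l e, C.l (FO p e), eta e),
      FA (ell U D K) f, FA (ell U C J) (FA p f))"
    using homD[OF f] by (simp add: eta_functor_def Let_def)
  show "((D.l d, C.l (FO p d), eta d), (D.l e, C.l (FO p e), eta e), FA (ell U D K) f, FA (ell U C J) (FA p f)) \<in>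
      Ar (gluing U D K C J p)"
    unfolding gluing_def glue.comma_Ar_iff
    using eta_hom[OF d] eta_hom[OF e] D.l_hom[OF f] C.l_hom[OF p.FA_hom[OF f]] eta_natural[OF f]
      D.l_sheaf[OF d] D.l_sheaf[OF e] l_p_sheaf[OF d] l_p_sheaf[OF e] T_l_sheaf[OF d] T_l_sheaf[OF e]
    by (simp add: sheaf_cat_simps)
qed

lemma locally_cartesian_iff:
  assumes f: "f \<in> hom D d e"
  shows "locally_cartesian U D K C J p f \<longleftrightarrow>
    pullback (sheaf_cat U D K) (FA (ell U D K) f) (eta d) (eta e) (TA (FA (ell U C J) (FA p f)))"
  unfolding locally_cartesian_def eta_Ar(1)[OF f] gluing_def
    glue.cartesian_iff_pullback[OF eta_Ar(2)[OF f, unfolded gluing_def]]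
  using homD[OF f] by simp

text \<open>
  The lifting property of a locally cartesian arrow holds locally on the site. The lift
  lies over h only up to the sections of sheaves on the base, as the topology of the base need
  not separate its arrows.
\<close>

lemma locally_cartesian_lift:
  assumes lc: "locally_cartesian U D K C J p m" and m: "m \<in> hom D d e"
    and v: "v \<in> hom D b e" and h: "h \<in> hom C (FO p b) (FO p d)"
    and eq: "FA p m \<cdot>\<^bsub>C\<^esub> h = FA p v"
  shows "locally D K b (\<lambda>g. \<exists>w\<in>hom D (Dom D g) d. m \<cdot>\<^bsub>D\<^esub> w = v \<cdot>\<^bsub>D\<^esub> g \<and>
    (\<forall>E z. is_sheaf U C J E \<longrightarrow> z \<in> Sec E (FO p d) \<longrightarrow> Res E (FA p w) z = Res E (h \<cdot>\<^bsub>C\<^esub> FA p g) z))"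
proof -
  have b: "b \<in> Ob D" and d: "d \<in> Ob D" and e: "e \<in> Ob D"
    using D.hom_Ob[OF v] D.hom_Ob[OF m] by auto
  note m' = homD[OF m] and v' = homD[OF v] and h' = homD[OF h]
  let ?L = "C.l (FO p d)"
  note L = l_p_sheaf[OF d] and PL = sheaf_presheaf[OF l_p_sheaf[OF d]]
  have lh: "C.lel h \<in> Sec ?L (FO p b)" using C.lel_Sec[OF h'(1)] h' by simp
  have lv: "D.lel v \<in> Sec (D.l e) b" using D.lel_Sec[OF v'(1)] v' by simp
  have pb: "sections_pullback (D.l d) (D.l e) (T ?L) (FA (ell U D K) m) (eta d) (eta e) (TA (FA (ell U C J) (FA p m)))"
    by (rule D.sections_of_pullback[OF D.l_sheaf[OF e] T_l_sheaf[OF d] T_l_sheaf[OF e] eta_hom[OF e] T_l_hom[OF m]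
          D.l_hom[OF m] eta_hom[OF d] lc[unfolded locally_cartesian_iff[OF m]]])
  have "ap (eta e) b (D.lel v) = ap (TA (FA (ell U C J) (FA p m))) b (\<theta> ?L b (C.lel h))"
    using ap_eta[OF v'(1)] v' ap_T_l[OF m b h] eq by simp
  then obtain s where s: "s \<in> Sec (D.l d) b" "ap (FA (ell U D K) m) b s = D.lel v" "ap (eta d) b s = \<theta> ?L b (C.lel h)"
    using pb lv \<theta>_Sec[OF PL b lh] unfolding sections_pullback_def by blast
  show ?thesis
  proof (rule D.locally_trans[OF D.l_generated[OF d s(1)] b])
    fix g assume g: "g \<in> Ar D" "Cod D g = b" and "\<exists>w\<in>hom D (Dom D g) d. Res (D.l d) g s = D.lel w"
    then obtain w where w: "w \<in> hom D (Dom D g) d" and ws: "Res (D.l d) g s = D.lel w" by blast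
    note w' = homD[OF w]
    have gb: "Dom D g \<in> Ob D" using D.Dom_Ob[OF g(1)] .
    note mw = D.Cmp_hom[OF w m]
    have vg: "v \<cdot>\<^bsub>D\<^esub> g \<in> hom D (Dom D g) e"
      using D.Cmp_Ar[OF v'(1) g(1)] g v' by (auto simp: hom_def)
    have pg: "FA p g \<in> hom C (FO p (Dom D g)) (FO p b)" using p.FA_Ar[OF g(1)] g by (simp add: hom_def)
    note hg = C.Cmp_hom[OF pg h]
    have "D.lel (m \<cdot>\<^bsub>D\<^esub> w) = ap (FA (ell U D K) m) (Dom D g) (Res (D.l d) g s)"
      using D.ap_l[OF m'(1) w'(1)] w' m' ws by simp
    also have "\<dots> = D.lel (v \<cdot>\<^bsub>D\<^esub> g)"
      using ap_Res[OF D.l_hom[OF m] g(1), of s] s g D.lel_Res[OF v'(1) g(1)] v' by simp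
    finally have loc1: "locally D K (Dom D g) (\<lambda>k. (m \<cdot>\<^bsub>D\<^esub> w) \<cdot>\<^bsub>D\<^esub> k = (v \<cdot>\<^bsub>D\<^esub> g) \<cdot>\<^bsub>D\<^esub> k)"
      by (rule D.l_kernel[OF mw vg])
    have "\<theta> ?L (Dom D g) (C.lel (FA p w)) = ap (eta d) (Dom D g) (Res (D.l d) g s)"
      using ap_eta[OF w'(1)] w' ws by simp
    also have "\<dots> = Res (T ?L) g (\<theta> ?L b (C.lel h))"
      using ap_Res[OF eta_hom[OF d] g(1), of s] s g by simp
    also have "\<dots> = \<theta> ?L (Dom D g) (C.lel (h \<cdot>\<^bsub>C\<^esub> FA p g))"
      using \<theta>_Res[OF PL g(1), of "C.lel h"] lh g C.lel_Res[OF h'(1), of "FA p g"] homD[OF pg] h' by simp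
    finally have \<theta>eq: "\<theta> ?L (Dom D g) (C.lel (FA p w)) = \<theta> ?L (Dom D g) (C.lel (h \<cdot>\<^bsub>C\<^esub> FA p g))" .
    have pw: "FA p w \<in> hom C (FO p (Dom D g)) (FO p d)" using p.FA_hom[OF w] .
    have loc2: "locally D K (Dom D g) (\<lambda>k. Res ?L (FA p k) (C.lel (FA p w)) = Res ?L (FA p k) (C.lel (h \<cdot>\<^bsub>C\<^esub> FA p g)))"
      by (rule T_kernel[OF PL gb _ _ \<theta>eq])
        (use C.lel_Sec[OF homD(1)[OF pw]] C.lel_Sec[OF homD(1)[OF hg]] homD[OF pw] homD[OF hg] in auto)
    show "locally D K (Dom D g) (\<lambda>k. \<exists>w\<in>hom D (Dom D (g \<cdot>\<^bsub>D\<^esub> k)) d. m \<cdot>\<^bsub>D\<^esub> w = v \<cdot>\<^bsub>D\<^esub> (g \<cdot>\<^bsub>D\<^esub> k) \<and>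
      (\<forall>E z. is_sheaf U C J E \<longrightarrow> z \<in> Sec E (FO p d) \<longrightarrow>
        Res E (FA p w) z = Res E (h \<cdot>\<^bsub>C\<^esub> FA p (g \<cdot>\<^bsub>D\<^esub> k)) z))"
    proof (rule D.locally_mono[OF D.locally_conj[OF loc1 loc2 gb] gb])
      fix k assume k: "k \<in> Ar D" "Cod D k = Dom D g"
        and eqs: "(m \<cdot>\<^bsub>D\<^esub> w) \<cdot>\<^bsub>D\<^esub> k = (v \<cdot>\<^bsub>D\<^esub> g) \<cdot>\<^bsub>D\<^esub> k \<and>
          Res ?L (FA p k) (C.lel (FA p w)) = Res ?L (FA p k) (C.lel (h \<cdot>\<^bsub>C\<^esub> FA p g))"
      have k': "k \<in> hom D (Dom D k) (Dom D g)" using k by (simp add: hom_def)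
      note gk = D.Cmp_Ar[OF g(1) k] and pk = p.FA_hom[OF k'] and wk = D.Cmp_hom[OF k' w]
      have 1: "m \<cdot>\<^bsub>D\<^esub> (w \<cdot>\<^bsub>D\<^esub> k) = v \<cdot>\<^bsub>D\<^esub> (g \<cdot>\<^bsub>D\<^esub> k)"
        using eqs D.Cmp_assoc[OF k' w m] D.Cmp_Ar_assoc[OF k(1) g(1) v'(1)] k g v' by simp
      have pgk: "FA p (g \<cdot>\<^bsub>D\<^esub> k) = FA p g \<cdot>\<^bsub>C\<^esub> FA p k" and pwk: "FA p (w \<cdot>\<^bsub>D\<^esub> k) = FA p w \<cdot>\<^bsub>C\<^esub> FA p k"
        using p.FA_Cmp_Ar[OF k(1) g(1) k(2)] p.FA_Cmp[OF k' w] by simp_all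
      have lel_eq: "C.lel (FA p w \<cdot>\<^bsub>C\<^esub> FA p k) = C.lel ((h \<cdot>\<^bsub>C\<^esub> FA p g) \<cdot>\<^bsub>C\<^esub> FA p k)"
        using eqs C.lel_Res[of "FA p w" "FA p k"] C.lel_Res[of "h \<cdot>\<^bsub>C\<^esub> FA p g" "FA p k"]
          homD[OF pw] homD[OF hg] homD[OF pk] by simp
      have 2: "Res E (FA p (w \<cdot>\<^bsub>D\<^esub> k)) z = Res E (h \<cdot>\<^bsub>C\<^esub> FA p (g \<cdot>\<^bsub>D\<^esub> k)) z"
        if "is_sheaf U C J E" "z \<in> Sec E (FO p d)" for E z
        using C.lel_eq_Res[OF C.Cmp_hom[OF pk pw] C.Cmp_hom[OF pk hg] lel_eq that] C.Cmp_assoc[OF pk pg h]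
        by (simp add: pgk pwk)
      show "\<exists>w\<in>hom D (Dom D (g \<cdot>\<^bsub>D\<^esub> k)) d. m \<cdot>\<^bsub>D\<^esub> w = v \<cdot>\<^bsub>D\<^esub> (g \<cdot>\<^bsub>D\<^esub> k) \<and>
        (\<forall>E z. is_sheaf U C J E \<longrightarrow> z \<in> Sec E (FO p d) \<longrightarrow>
          Res E (FA p w) z = Res E (h \<cdot>\<^bsub>C\<^esub> FA p (g \<cdot>\<^bsub>D\<^esub> k)) z)"
        using 1 2 wk gk(2) by (intro bexI[of _ "w \<cdot>\<^bsub>D\<^esub> k"]) auto
    next
      fix k k2 assume k: "k \<in> Ar D" "Cod D k = Dom D g" and eq: "(m \<cdot>\<^bsub>D\<^esub> w) \<cdot>\<^bsub>D\<^esub> k = (v \<cdot>\<^bsub>D\<^esub> g) \<cdot>\<^bsub>D\<^esub> k"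
        and k2: "k2 \<in> Ar D" "Cod D k2 = Dom D k"
      show "(m \<cdot>\<^bsub>D\<^esub> w) \<cdot>\<^bsub>D\<^esub> (k \<cdot>\<^bsub>D\<^esub> k2) = (v \<cdot>\<^bsub>D\<^esub> g) \<cdot>\<^bsub>D\<^esub> (k \<cdot>\<^bsub>D\<^esub> k2)"
        using D.Cmp_Ar_assoc[OF k2(1) k(1) homD(1)[OF mw]] D.Cmp_Ar_assoc[OF k2(1) k(1) homD(1)[OF vg]]
          homD[OF mw] homD[OF vg] k k2 eq by simp
    qed
  qed
qed

lemma gluing_fibration: "fibration (gluing U D K C J p) (sheaf_cat U C J) comma_proj"
  unfolding gluing_def
proof (rule glue.comma_fibration)
  fix x y z h k assume "h \<in> hom (sheaf_cat U D K) x z" "k \<in> hom (sheaf_cat U D K) y z"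
  then have sh: "is_sheaf U D K x" "is_sheaf U D K y" "is_sheaf U D K z"
    and hk: "h \<in> hom (presheaf_cat U D) x z" "k \<in> hom (presheaf_cat U D) y z"
    by (simp_all add: sheaf_cat_simps)
  from D.pullback_ex[OF sh hk] obtain v f g where "is_sheaf U D K v"
    "f \<in> hom (presheaf_cat U D) v x" "g \<in> hom (presheaf_cat U D) v y" "pullback (sheaf_cat U D K) f g h k"
    by (elim exE conjE)
  then have "f \<in> hom (sheaf_cat U D K) v x" "g \<in> hom (sheaf_cat U D K) v y" "pullback (sheaf_cat U D K) f g h k"
    using sh by (simp_all add: sheaf_cat_simps)
  then show "\<exists>v f g. f \<in> hom (sheaf_cat U D K) v x \<and> g \<in> hom (sheaf_cat U D K) v y \<and>
      pullback (sheaf_cat U D K) f g h k"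
    by (intro exI conjI)
qed

end

section \<open>The comparison transformation\<close>

locale site_triangle =
  site_morphism U D K D' K' A + C: small_site U C J + p: comorphism U D K C J p + p': comorphism U D' K' C J p'
  for U :: "'u set set" and C :: "('o, 'a) cat" and J :: "'o \<Rightarrow> 'a set set"
    and D :: "('p, 'b) cat" and K :: "'p \<Rightarrow> 'b set set"
    and D' :: "('q, 'c) cat" and K' :: "'q \<Rightarrow> 'c set set"
    and p :: "('p, 'b, 'o, 'a) funct" and p' :: "('q, 'c, 'o, 'a) funct"
    and A :: "('p, 'b, 'q, 'c) funct" and \<phi> :: "'p \<Rightarrow> 'a" +
  assumes \<phi>: "nat_iso D C (p' \<odot> A) p \<phi>"
begin

lemma \<phi>_hom: "d \<in> Ob D \<Longrightarrow> \<phi> d \<in> hom C (FO p' (FO A d)) (FO p d)"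
  and \<phi>_iso: "d \<in> Ob D \<Longrightarrow> iso C (\<phi> d)"
  using \<phi> by (auto simp: nat_iso_def nat_trans_def comp_funct_def)

lemma \<phi>_natural:
  assumes "f \<in> hom D d e"
  shows "\<phi> e \<cdot>\<^bsub>C\<^esub> FA p' (FA A f) = FA p f \<cdot>\<^bsub>C\<^esub> \<phi> d"
  using \<phi> homD[OF assms] by (auto simp: nat_iso_def nat_trans_def comp_funct_def)

text \<open>The presheaf morphism from E p to T' E A that is transposed twice to get the comparison at E.\<close>

definition pre_comparison :: "('o, 'a, 'u) presheaf \<Rightarrow> ('p, 'b, 'u) psh_arr" where
  "pre_comparison E = FA (precomp D A) (sheafification_unit U D' K' (FO (precomp D' p') E))
    \<cdot>\<^bsub>presheaf_cat U D\<^esub> phi_psh D D' A p p' \<phi> E"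

lemma phi_psh_mor:
  "phi_psh D D' A p p' \<phi> E = psh_mor (FO (precomp D p) E) (FO (precomp D A) (FO (precomp D' p') E))
    (\<lambda>d x. Res E (\<phi> d) x)"
  by (simp add: phi_psh_def psh_mor_def)

lemma phi_psh_hom:
  assumes E: "is_presheaf U C E"
  shows "phi_psh D D' A p p' \<phi> E \<in>
    hom (presheaf_cat U D) (FO (precomp D p) E) (FO (precomp D A) (FO (precomp D' p') E))"
  unfolding phi_psh_mor
proof (rule psh_mor_hom[OF p.p.precomp_presheaf[OF E] A.precomp_presheaf[OF p'.p.precomp_presheaf[OF E]]])
  fix d x assume "x \<in> Sec (FO (precomp D p) E) d"
  then have d: "d \<in> Ob D" and x: "x \<in> Sec E (FO p d)"
    by (auto dest!: p.p.Sec_precompD)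
  show "Res E (\<phi> d) x \<in> Sec (FO (precomp D A) (FO (precomp D' p') E)) d"
    using Res_Sec[OF E homD(1)[OF \<phi>_hom[OF d]]] x homD[OF \<phi>_hom[OF d]] A.FO_Ob[OF d] d
    by (simp add: A.Sec_precomp p'.p.Sec_precomp)
next
  fix k x assume k: "k \<in> Ar D" and x: "x \<in> Sec (FO (precomp D p) E) (Cod D k)"
  have k': "k \<in> hom D (Dom D k) (Cod D k)" using k by (simp add: hom_def)
  have x: "x \<in> Sec E (FO p (Cod D k))" using p.p.Sec_precompD[OF x] by simp
  note c = homD[OF \<phi>_hom[OF D.Cod_Ob[OF k]]] and b = homD[OF \<phi>_hom[OF D.Dom_Ob[OF k]]]
    and pk = homD[OF p.p.FA_hom[OF k']] and Ak = homD[OF p'.p.FA_hom[OF A.FA_hom[OF k']]]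
  show "Res E (\<phi> (Dom D k)) (Res (FO (precomp D p) E) k x) =
      Res (FO (precomp D A) (FO (precomp D' p') E)) k (Res E (\<phi> (Cod D k)) x)"
    using Res_Cmp[OF E pk(1) b(1), of x] Res_Cmp[OF E c(1) Ak(1), of x] x \<phi>_natural[OF k'] pk b c Ak
      A.FA_Ar[OF k]
    by (simp add: p.p.Res_precomp A.Res_precomp p'.p.Res_precomp k)
qed

lemma \<theta>'_pre_hom:
  assumes E: "is_presheaf U C E"
  shows "FA (precomp D A) (sheafification_unit U D' K' (FO (precomp D' p') E)) \<in>
    hom (presheaf_cat U D) (FO (precomp D A) (FO (precomp D' p') E)) (FO (precomp D A) (p'.T E))"
  by (rule A.precomp_hom[OF p'.\<theta>_hom[OF E]])

lemma pre_comparison_hom: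
  "is_presheaf U C E \<Longrightarrow>
    pre_comparison E \<in> hom (presheaf_cat U D) (FO (precomp D p) E) (FO (precomp D A) (p'.T E))"
  unfolding pre_comparison_def by (rule psh_Cmp_hom[OF phi_psh_hom \<theta>'_pre_hom])

lemma \<phi>_Sec:
  assumes E: "is_presheaf U C E" and d: "d \<in> Ob D" and x: "x \<in> Sec E (FO p d)"
  shows "Res E (\<phi> d) x \<in> Sec E (FO p' (FO A d))"
  using Res_Sec[OF E homD(1)[OF \<phi>_hom[OF d]]] x homD[OF \<phi>_hom[OF d]] by simp

lemma ap_pre_comparison:
  assumes E: "is_presheaf U C E" and d: "d \<in> Ob D" and x: "x \<in> Sec E (FO p d)"
  shows "ap (pre_comparison E) d x = p'.\<theta> E (FO A d) (Res E (\<phi> d) x)"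
proof -
  have x': "x \<in> Sec (FO (precomp D p) E) d" using x d by (simp add: p.p.Sec_precomp)
  show ?thesis
    using ap_Cmp[OF phi_psh_hom[OF E] \<theta>'_pre_hom[OF E] x'] ap_psh_mor[OF x'] d
    by (simp add: pre_comparison_def A.ap_precomp phi_psh_mor)
qed

abbreviation "pt \<equiv> phi_tilde U D K D' K' A p p' \<phi>"

text \<open>
  The functor S T is a composite of left adjoints: a morphism out of S T E is determined by, and can be
  prescribed through, its values on the sections of E p.
\<close>

lemma ST_cancel:
  assumes E: "is_presheaf U C E" and H: "is_sheaf U D' K' H"
    and f: "f \<in> hom (presheaf_cat U D') (S (p.T E)) H" and g: "g \<in> hom (presheaf_cat U D') (S (p.T E)) H"
    and eq: "\<And>d x. d \<in> Ob D \<Longrightarrow> x \<in> Sec E (FO p d) \<Longrightarrow>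
      ap f (FO A d) (\<sigma> (p.T E) d (p.\<theta> E d x)) = ap g (FO A d) (\<sigma> (p.T E) d (p.\<theta> E d x))"
  shows "f = g"
proof (rule S_cancel[OF p.T_sheaf[OF E] H f g])
  note TE = p.T_sheaf[OF E] and AH = continuous[OF H]
  let ?f = "FA (precomp D A) f \<cdot>\<^bsub>presheaf_cat U D\<^esub> S.u (p.T E)"
  let ?g = "FA (precomp D A) g \<cdot>\<^bsub>presheaf_cat U D\<^esub> S.u (p.T E)"
  note f' = A.precomp_hom[OF f] and g' = A.precomp_hom[OF g] and u = \<sigma>_hom[OF TE]
  have "?f = ?g"
  proof (rule D.a_cancel[OF p.p.precomp_presheaf[OF E] AH])
    show "?f \<in> hom (presheaf_cat U D) (D.sheafify (FO (precomp D p) E)) (FO (precomp D A) H)"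
      "?g \<in> hom (presheaf_cat U D) (D.sheafify (FO (precomp D p) E)) (FO (precomp D A) H)"
      using psh_Cmp_hom[OF u f'] psh_Cmp_hom[OF u g'] by (simp_all add: p.T_eq)
    fix d x assume "x \<in> Sec (FO (precomp D p) E) d"
    then have d: "d \<in> Ob D" and x: "x \<in> Sec E (FO p d)"
      by (auto dest!: p.p.Sec_precompD)
    note \<theta>x = p.\<theta>_Sec[OF E d x]
    show "ap ?f d (p.\<theta> E d x) = ap ?g d (p.\<theta> E d x)"
      using ap_Cmp[OF u f' \<theta>x] ap_Cmp[OF u g' \<theta>x] eq[OF d x] d by (simp add: A.ap_precomp)
  qed
  then show "ap f (FO A d) (\<sigma> (p.T E) d x) = ap g (FO A d) (\<sigma> (p.T E) d x)" if x: "x \<in> Sec (p.T E) d" for d x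
    using ap_Cmp[OF u f' x] ap_Cmp[OF u g' x] Sec_Ob[OF sheaf_presheaf[OF TE] x] by (simp add: A.ap_precomp)
qed

lemma ST_extend:
  assumes E: "is_presheaf U C E" and H: "is_sheaf U D' K' H"
    and v: "v \<in> hom (presheaf_cat U D) (FO (precomp D p) E) (FO (precomp D A) H)"
  defines "g \<equiv> transpose (sheaf_cat U D K) (sheaf_cat U D' K') (precomp D A) (p.T E) H
    (transpose (presheaf_cat U D) (sheaf_cat U D K) incl (FO (precomp D p) E) (FO (precomp D A) H) v)"
  shows "g \<in> hom (presheaf_cat U D') (S (p.T E)) H"
    and "d \<in> Ob D \<Longrightarrow> x \<in> Sec E (FO p d) \<Longrightarrow> ap g (FO A d) (\<sigma> (p.T E) d (p.\<theta> E d x)) = ap v d x"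
proof -
  note t = D.a_transpose[OF v continuous[OF H], folded p.T_eq]
  note st = S_transpose[OF t(1) p.T_sheaf[OF E] H, folded g_def]
  show "g \<in> hom (presheaf_cat U D') (S (p.T E)) H" by (rule st(1))
  show "ap g (FO A d) (\<sigma> (p.T E) d (p.\<theta> E d x)) = ap v d x" if "d \<in> Ob D" "x \<in> Sec E (FO p d)"
    using st(2)[OF p.\<theta>_Sec[OF E that]] t(2)[of x d] that by (simp add: p.p.Sec_precomp)
qed

lemma phi_tilde_eq:
  "pt E = transpose (sheaf_cat U D K) (sheaf_cat U D' K') (precomp D A) (p.T E) (p'.T E)
    (transpose (presheaf_cat U D) (sheaf_cat U D K) incl (FO (precomp D p) E) (FO (precomp D A) (p'.T E))
      (pre_comparison E))"
  by (simp add: phi_tilde_def Let_def pre_comparison_def)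

lemma phi_tilde_hom: "is_presheaf U C E \<Longrightarrow> pt E \<in> hom (presheaf_cat U D') (S (p.T E)) (p'.T E)"
  unfolding phi_tilde_eq by (rule ST_extend(1)[OF _ p'.T_sheaf pre_comparison_hom])

lemma ap_phi_tilde:
  "is_presheaf U C E \<Longrightarrow> d \<in> Ob D \<Longrightarrow> x \<in> Sec E (FO p d) \<Longrightarrow>
    ap (pt E) (FO A d) (\<sigma> (p.T E) d (p.\<theta> E d x)) = p'.\<theta> E (FO A d) (Res E (\<phi> d) x)"
  unfolding phi_tilde_eq
  using ST_extend(2)[OF _ p'.T_sheaf pre_comparison_hom] ap_pre_comparison by simp

lemma ST_hom:
  assumes h: "h \<in> hom (presheaf_cat U C) E E'"
  shows "SA (p.TA h) \<in> hom (presheaf_cat U D') (S (p.T E)) (S (p.T E'))"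
  by (rule S_hom[OF p.T_hom[OF h] p.T_sheaf p.T_sheaf]) (use psh_hom_presheaf[OF h] in auto)

lemma phi_tilde_natural:
  assumes h: "h \<in> hom (presheaf_cat U C) E E'"
  shows "pt E' \<cdot>\<^bsub>presheaf_cat U D'\<^esub> SA (p.TA h) = p'.TA h \<cdot>\<^bsub>presheaf_cat U D'\<^esub> pt E"
proof -
  note E = psh_hom_presheaf[OF h]
  note TE = p.T_sheaf[OF E(1)] and TE' = p.T_sheaf[OF E(2)]
  note h1 = ST_hom[OF h] and h2 = phi_tilde_hom[OF E(2)] and h3 = phi_tilde_hom[OF E(1)] and h4 = p'.T_hom[OF h]
  show ?thesis
  proof (rule ST_cancel[OF E(1) p'.T_sheaf[OF E(2)] psh_Cmp_hom[OF h1 h2] psh_Cmp_hom[OF h3 h4]])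
    fix d x assume d: "d \<in> Ob D" and x: "x \<in> Sec E (FO p d)"
    note \<theta>x = p.\<theta>_Sec[OF E(1) d x] and s = \<sigma>_Sec[OF TE p.\<theta>_Sec[OF E(1) d x]]
    have hx: "ap h (FO p d) x \<in> Sec E' (FO p d)" using ap_Sec[OF h x] .
    have "ap h (FO p' (FO A d)) (Res E (\<phi> d) x) = Res E' (\<phi> d) (ap h (FO p d) x)"
      using ap_Res[OF h homD(1)[OF \<phi>_hom[OF d]], of x] homD[OF \<phi>_hom[OF d]] x by simp
    then show "ap (pt E' \<cdot>\<^bsub>presheaf_cat U D'\<^esub> SA (p.TA h)) (FO A d) (\<sigma> (p.T E) d (p.\<theta> E d x)) =
        ap (p'.TA h \<cdot>\<^bsub>presheaf_cat U D'\<^esub> pt E) (FO A d) (\<sigma> (p.T E) d (p.\<theta> E d x))"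
      using ap_Cmp[OF h1 h2 s] ap_Cmp[OF h3 h4 s] ap_S[OF p.T_hom[OF h] TE TE' \<theta>x] p.ap_T[OF h d x]
        ap_phi_tilde[OF E(2) d hx] ap_phi_tilde[OF E(1) d x] p'.ap_T[OF h A.FO_Ob[OF d] \<phi>_Sec[OF E(1) d x]]
      by simp
  qed
qed

lemma phi_tilde_nat_trans:
  "nat_trans (sheaf_cat U C J) (sheaf_cat U D' K')
    (Sh_star U D K D' K' A \<odot> C_star U D K p) (C_star U D' K' p') pt"
  unfolding nat_trans_def
proof (intro conjI ballI)
  show "cat_functor (sheaf_cat U C J) (sheaf_cat U D' K') (Sh_star U D K D' K' A \<odot> C_star U D K p)"
    by (rule comp_functor[OF p.C_star_functor S_functor])
  show "cat_functor (sheaf_cat U C J) (sheaf_cat U D' K') (C_star U D' K' p')"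
    by (rule p'.C_star_functor)
  fix E assume "E \<in> Ob (sheaf_cat U C J)"
  then have E: "is_presheaf U C E" by (simp add: sheaf_cat_simps sheaf_presheaf)
  show "pt E \<in> hom (sheaf_cat U D' K') (FO (Sh_star U D K D' K' A \<odot> C_star U D K p) E) (FO (C_star U D' K' p') E)"
    using phi_tilde_hom[OF E] S_sheaf[OF p.T_sheaf[OF E]] p'.T_sheaf[OF E] by (simp add: sheaf_cat_simps comp_funct_def)
next
  fix h assume "h \<in> Ar (sheaf_cat U C J)"
  then have "h \<in> hom (sheaf_cat U C J) (Dom (presheaf_cat U C) h) (Cod (presheaf_cat U C) h)"
    by (simp add: hom_def sheaf_cat_simps)
  then have "h \<in> hom (presheaf_cat U C) (Dom (presheaf_cat U C) h) (Cod (presheaf_cat U C) h)"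
    by (simp add: sheaf_cat_simps)
  from phi_tilde_natural[OF this]
  show "pt (Cod (sheaf_cat U C J) h) \<cdot>\<^bsub>sheaf_cat U D' K'\<^esub> FA (Sh_star U D K D' K' A \<odot> C_star U D K p) h =
      FA (C_star U D' K' p') h \<cdot>\<^bsub>sheaf_cat U D' K'\<^esub> pt (Dom (sheaf_cat U C J) h)"
    by (simp add: sheaf_cat_simps comp_funct_def)
qed

lemma relative_toposes_iff:
  "morphism_of_relative_toposes U D K D' K' C J A p p' \<phi> \<longleftrightarrow>
    (\<forall>E. is_sheaf U C J E \<longrightarrow> iso (sheaf_cat U D' K') (pt E))"
  using phi_tilde_nat_trans by (auto simp: morphism_of_relative_toposes_def nat_iso_def sheaf_cat_simps)


section \<open>The extension to the comma categories\<close>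

abbreviation "ext \<equiv> eta_extension U D K D' K' A p p' \<phi>"
abbreviation "Sh' \<equiv> sheaf_cat U D' K'"

lemma ext_simps:
  "FO ext (F, E, \<alpha>) = (S F, E, pt E \<cdot>\<^bsub>Sh'\<^esub> SA \<alpha>)"
  "FA ext (x, y, g, h) = (FO ext x, FO ext y, SA g, h)"
  by (simp_all add: eta_extension_def Let_def)

interpretation S': cat_functor "sheaf_cat U D K" Sh' "Sh_star U D K D' K' A"
  by (rule S_functor)

lemma pt_hom: "E \<in> Ob (sheaf_cat U C J) \<Longrightarrow> pt E \<in> hom Sh' (S (p.T E)) (p'.T E)"
  using phi_tilde_nat_trans by (simp add: nat_trans_def comp_funct_def)

lemma pt_natural:
  "h \<in> hom (sheaf_cat U C J) E E' \<Longrightarrow> pt E' \<cdot>\<^bsub>Sh'\<^esub> SA (p.TA h) = p'.TA h \<cdot>\<^bsub>Sh'\<^esub> pt E"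
  using phi_tilde_natural by (simp add: sheaf_cat_simps)

lemma ext_Ob:
  assumes "\<alpha> \<in> hom (sheaf_cat U D K) F (p.T E)" "E \<in> Ob (sheaf_cat U C J)"
  shows "pt E \<cdot>\<^bsub>Sh'\<^esub> SA \<alpha> \<in> hom Sh' (S F) (p'.T E)"
  by (rule D'.Sh.Cmp_hom[OF S'.FA_hom[OF assms(1)] pt_hom[OF assms(2)]])

lemma ext_Ar:
  assumes m: "((F, E, \<alpha>), (F', E', \<alpha>'), g, h) \<in> Ar (gluing U D K C J p)"
  shows "FA ext ((F, E, \<alpha>), (F', E', \<alpha>'), g, h) \<in> Ar (gluing U D' K' C J p')"
proof -
  note m = m[unfolded gluing_def p.glue.comma_Ar_iff]
  have \<alpha>: "\<alpha> \<in> hom (sheaf_cat U D K) F (p.T E)" and \<alpha>': "\<alpha>' \<in> hom (sheaf_cat U D K) F' (p.T E')"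
    and g: "g \<in> hom (sheaf_cat U D K) F F'" and h: "h \<in> hom (sheaf_cat U C J) E E'"
    and eq: "\<alpha>' \<cdot>\<^bsub>sheaf_cat U D K\<^esub> g = p.TA h \<cdot>\<^bsub>sheaf_cat U D K\<^esub> \<alpha>"
    using m by auto
  note E = category.hom_Ob[OF sheaf_category h]
  note Th = p.glue.T.FA_hom[OF h] and Th' = p'.glue.T.FA_hom[OF h]
  have "(pt E' \<cdot>\<^bsub>Sh'\<^esub> SA \<alpha>') \<cdot>\<^bsub>Sh'\<^esub> SA g = pt E' \<cdot>\<^bsub>Sh'\<^esub> SA (\<alpha>' \<cdot>\<^bsub>sheaf_cat U D K\<^esub> g)"
    using D'.Sh.Cmp_assoc[OF S'.FA_hom[OF g] S'.FA_hom[OF \<alpha>'] pt_hom[OF E(2)]] S'.FA_Cmp[OF g \<alpha>'] by simp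
  also have "\<dots> = (pt E' \<cdot>\<^bsub>Sh'\<^esub> SA (p.TA h)) \<cdot>\<^bsub>Sh'\<^esub> SA \<alpha>"
    using D'.Sh.Cmp_assoc[OF S'.FA_hom[OF \<alpha>] S'.FA_hom[OF Th] pt_hom[OF E(2)]] S'.FA_Cmp[OF \<alpha> Th] eq by simp
  also have "\<dots> = p'.TA h \<cdot>\<^bsub>Sh'\<^esub> (pt E \<cdot>\<^bsub>Sh'\<^esub> SA \<alpha>)"
    unfolding pt_natural[OF h] by (rule D'.Sh.Cmp_assoc[OF S'.FA_hom[OF \<alpha>] pt_hom[OF E(1)] Th'])
  finally show ?thesis
    unfolding gluing_def ext_simps p'.glue.comma_Ar_iff
    using ext_Ob[OF \<alpha> E(1)] ext_Ob[OF \<alpha>' E(2)] S'.FA_hom[OF g] h by blast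
qed

lemma ext_functor: "cat_functor (gluing U D K C J p) (gluing U D' K' C J p') ext"
proof -
  interpret G: category "gluing U D K C J p"
    unfolding gluing_def by (rule p.glue.comma_category)
  interpret G': category "gluing U D' K' C J p'"
    unfolding gluing_def by (rule p'.glue.comma_category)
  show ?thesis
  proof
    fix x assume x: "x \<in> Ob (gluing U D K C J p)"
    obtain F E \<alpha> where x_eq: "x = (F, E, \<alpha>)" by (metis prod.collapse)
    have F: "F \<in> Ob (sheaf_cat U D K)" and E: "E \<in> Ob (sheaf_cat U C J)" and \<alpha>: "\<alpha> \<in> hom (sheaf_cat U D K) F (p.T E)"
      using x by (simp_all add: x_eq gluing_def p.glue.comma_simps)
    show "FO ext x \<in> Ob (gluing U D' K' C J p')"
      using S'.FO_Ob[OF F] E ext_Ob[OF \<alpha> E] by (simp add: x_eq gluing_def p'.glue.comma_simps ext_simps)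
    show "FA ext (Idn (gluing U D K C J p) x) = Idn (gluing U D' K' C J p') (FO ext x)"
      using S'.FA_Idn[OF F] by (simp add: x_eq gluing_def p.glue.comma_simps p'.glue.comma_simps ext_simps)
  next
    fix m x y assume m: "m \<in> hom (gluing U D K C J p) x y"
    then obtain F E \<alpha> F' E' \<alpha>' g h where *: "x = (F, E, \<alpha>)" "y = (F', E', \<alpha>')"
      "m = ((F, E, \<alpha>), (F', E', \<alpha>'), g, h)" "((F, E, \<alpha>), (F', E', \<alpha>'), g, h) \<in> Ar (gluing U D K C J p)"
      by (cases x; cases y) (auto simp: gluing_def p.glue.comma_hom_iff)
    show "FA ext m \<in> hom (gluing U D' K' C J p') (FO ext x) (FO ext y)"
      using ext_Ar[OF *(4)] *(1-3) by (simp add: gluing_def p'.glue.comma_hom_iff ext_simps)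
  next
    fix m x y n z assume "m \<in> hom (gluing U D K C J p) x y" "n \<in> hom (gluing U D K C J p) y z"
    then obtain g h g' h' where *: "m = (x, y, g, h)" "n = (y, z, g', h')"
      "m \<in> Ar (gluing U D K C J p)" "n \<in> Ar (gluing U D K C J p)"
      by (cases m; cases n) (auto simp: hom_def gluing_def p.glue.comma_simps)
    obtain F E \<alpha> F' E' \<alpha>' F'' E'' \<alpha>'' where xyz: "x = (F, E, \<alpha>)" "y = (F', E', \<alpha>')" "z = (F'', E'', \<alpha>'')"
      by (metis prod.collapse)
    have "g \<in> hom (sheaf_cat U D K) F F'" "g' \<in> hom (sheaf_cat U D K) F' F''"
      using *(3,4) by (simp_all add: *(1,2) xyz gluing_def p.glue.comma_Ar_iff)
    from S'.FA_Cmp[OF this]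
    show "FA ext (n \<cdot>\<^bsub>gluing U D K C J p\<^esub> m) = FA ext n \<cdot>\<^bsub>gluing U D' K' C J p'\<^esub> FA ext m"
      by (simp add: *(1,2) gluing_def p.glue.comma_simps p'.glue.comma_simps ext_simps)
  qed
qed

lemma ext_over_base:
  "\<exists>t. nat_iso (gluing U D K C J p) (sheaf_cat U C J) (comma_proj \<odot> ext) comma_proj t"
proof -
  have P: "cat_functor (gluing U D K C J p) (sheaf_cat U C J) comma_proj"
    "cat_functor (gluing U D' K' C J p') (sheaf_cat U C J) comma_proj"
    unfolding gluing_def by (rule p.glue.comma_proj_functor p'.glue.comma_proj_functor)+
  interpret P: cat_functor "gluing U D K C J p" "sheaf_cat U C J" comma_proj by (rule P(1))
  have eq: "FO (comma_proj \<odot> ext :: (_, _, _, ('o, 'a, 'u) psh_arr) funct) x = fst (snd x)"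
    "FA (comma_proj \<odot> ext) m = FA comma_proj m"
    for x :: "(('p, 'b, 'u) presheaf, ('p, 'b, 'u) psh_arr, ('o, 'a, 'u) presheaf) comma_ob" and m
    by (cases x; cases m; simp add: comp_funct_def ext_simps p.glue.comma_proj_simps p'.glue.comma_proj_simps)+
  have base: "FO comma_proj x = fst (snd x)"
    for x :: "(('p, 'b, 'u) presheaf, ('p, 'b, 'u) psh_arr, ('o, 'a, 'u) presheaf) comma_ob"
    by (simp add: comma_proj_def split_beta)
  let ?t = "\<lambda>x :: (('p, 'b, 'u) presheaf, ('p, 'b, 'u) psh_arr, ('o, 'a, 'u) presheaf) comma_ob.
    Idn (sheaf_cat U C J) (fst (snd x))"
  have hom: "?t x \<in> hom (sheaf_cat U C J) (fst (snd x)) (fst (snd x))" if "x \<in> Ob (gluing U D K C J p)" for x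
    using C.Sh.Idn_hom[OF P.FO_Ob[OF that]] by (simp add: base)
  have "iso (sheaf_cat U C J) (?t x)" if "x \<in> Ob (gluing U D K C J p)" for x
    using hom[OF that] C.Sh.Idn_Cmp[OF hom[OF that]] by (intro isoI) auto
  moreover have "?t (Cod (gluing U D K C J p) m) \<cdot>\<^bsub>sheaf_cat U C J\<^esub> FA comma_proj m =
      FA comma_proj m \<cdot>\<^bsub>sheaf_cat U C J\<^esub> ?t (Dom (gluing U D K C J p) m)" if "m \<in> Ar (gluing U D K C J p)" for m
    using P.FA_Ar[OF that] C.Sh.Idn_Cmp_Ar[of "FA comma_proj m"] C.Sh.Cmp_Idn_Ar[of "FA comma_proj m"] by (simp add: base)
  ultimately have "nat_iso (gluing U D K C J p) (sheaf_cat U C J) (comma_proj \<odot> ext) comma_proj ?t"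
    unfolding nat_iso_def nat_trans_def
    using P comp_functor[OF ext_functor P(2)] hom by (simp add: eq base)
  then show ?thesis by blast
qed

lemma fibrations_iff:
  "morphism_of_fibrations (gluing U D K C J p) comma_proj (gluing U D' K' C J p') comma_proj (sheaf_cat U C J) ext \<longleftrightarrow>
    (\<forall>m. cartesian (gluing U D K C J p) (sheaf_cat U C J) comma_proj m \<longrightarrow>
      cartesian (gluing U D' K' C J p') (sheaf_cat U C J) comma_proj (FA ext m))"
  unfolding morphism_of_fibrations_def
  using p.gluing_fibration p'.gluing_fibration ext_functor ext_over_base by blast

text \<open>
  Cartesian arrows are pullback squares. The inverse image along A preserves them, and an
  invertible comparison identifies its value on such a square with the image under the extension.
\<close>

lemma ext_cartesian:
  assumes iso: "\<And>E. is_sheaf U C J E \<Longrightarrow> iso Sh' (pt E)"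
    and cart: "cartesian (gluing U D K C J p) (sheaf_cat U C J) comma_proj m"
  shows "cartesian (gluing U D' K' C J p') (sheaf_cat U C J) comma_proj (FA ext m)"
proof -
  have m: "m \<in> Ar (gluing U D K C J p)" using cart by (simp add: cartesian_def)
  obtain F E \<alpha> F' E' \<alpha>' g h where m_eq: "m = ((F, E, \<alpha>), (F', E', \<alpha>'), g, h)"
    and \<alpha>: "\<alpha> \<in> hom (sheaf_cat U D K) F (p.T E)" and \<alpha>': "\<alpha>' \<in> hom (sheaf_cat U D K) F' (p.T E')"
    and g: "g \<in> hom (sheaf_cat U D K) F F'" and h: "h \<in> hom (sheaf_cat U C J) E E'"
    using m unfolding gluing_def by (rule p.glue.comma_ArE)
  note E = category.hom_Ob[OF sheaf_category h]
  have isos: "iso Sh' (pt E)" "iso Sh' (pt E')"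
    using iso E by (simp_all add: sheaf_cat_simps)
  note ptE = pt_hom[OF E(1)] and ptE' = pt_hom[OF E(2)]
  note Sg = S'.FA_hom[OF g] and S\<alpha> = S'.FA_hom[OF \<alpha>] and S\<alpha>' = S'.FA_hom[OF \<alpha>']
    and STh = S'.FA_hom[OF p.glue.T.FA_hom[OF h]] and Th' = p'.glue.T.FA_hom[OF h]
  have "pullback (sheaf_cat U D K) g \<alpha> \<alpha>' (p.TA h)"
    using cart m unfolding m_eq gluing_def by (simp add: p.glue.cartesian_iff_pullback)
  then have pb: "pullback Sh' (SA g) (SA \<alpha>) (SA \<alpha>') (SA (p.TA h))"
    by (rule preserves_pullback[OF S_functor finite_limits])
  obtain i where i: "i \<in> hom Sh' (p'.T E) (S (p.T E))" "i \<cdot>\<^bsub>Sh'\<^esub> pt E = Idn Sh' (S (p.T E))" "pt E \<cdot>\<^bsub>Sh'\<^esub> i = Idn Sh' (p'.T E)"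
    using isoE[OF isos(1) ptE] by blast
  obtain i' where i': "i' \<in> hom Sh' (p'.T E') (S (p.T E'))" "i' \<cdot>\<^bsub>Sh'\<^esub> pt E' = Idn Sh' (S (p.T E'))" "pt E' \<cdot>\<^bsub>Sh'\<^esub> i' = Idn Sh' (p'.T E')"
    using isoE[OF isos(2) ptE'] by blast
  have Id: "iso Sh' (Idn Sh' x)" "Idn Sh' x \<in> hom Sh' x x" if "x \<in> Ob Sh'" for x
    using D'.Sh.Idn_hom[OF that] D'.Sh.Idn_Cmp[OF D'.Sh.Idn_hom[OF that]] by (auto intro: isoI)
  note Ob = D'.Sh.hom_Ob[OF Sg]
  have "pullback Sh' (SA g) (pt E \<cdot>\<^bsub>Sh'\<^esub> SA \<alpha>) (pt E' \<cdot>\<^bsub>Sh'\<^esub> SA \<alpha>') (p'.TA h)"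
  proof (rule D'.Sh.pullback_iso[OF pb Sg S\<alpha> S\<alpha>' STh Sg ext_Ob[OF \<alpha> E(1)] ext_Ob[OF \<alpha>' E(2)] Th'
        Id[OF Ob(1)] Id[OF Ob(2)] isoI[OF i(1) ptE i(3,2)] i(1) isoI[OF i'(1) ptE' i'(3,2)] i'(1)])
    show "SA g \<cdot>\<^bsub>Sh'\<^esub> Idn Sh' (S F) = Idn Sh' (S F') \<cdot>\<^bsub>Sh'\<^esub> SA g"
      using D'.Sh.Cmp_Idn[OF Sg] D'.Sh.Idn_Cmp[OF Sg] by simp
    show "SA \<alpha> \<cdot>\<^bsub>Sh'\<^esub> Idn Sh' (S F) = i \<cdot>\<^bsub>Sh'\<^esub> (pt E \<cdot>\<^bsub>Sh'\<^esub> SA \<alpha>)"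
      using D'.Sh.Cmp_Idn[OF S\<alpha>] D'.Sh.Cmp_assoc[OF S\<alpha> ptE i(1)] i(2) D'.Sh.Idn_Cmp[OF S\<alpha>] by simp
    show "SA \<alpha>' \<cdot>\<^bsub>Sh'\<^esub> Idn Sh' (S F') = i' \<cdot>\<^bsub>Sh'\<^esub> (pt E' \<cdot>\<^bsub>Sh'\<^esub> SA \<alpha>')"
      using D'.Sh.Cmp_Idn[OF S\<alpha>'] D'.Sh.Cmp_assoc[OF S\<alpha>' ptE' i'(1)] i'(2) D'.Sh.Idn_Cmp[OF S\<alpha>'] by simp
    have "i' \<cdot>\<^bsub>Sh'\<^esub> p'.TA h = i' \<cdot>\<^bsub>Sh'\<^esub> ((p'.TA h \<cdot>\<^bsub>Sh'\<^esub> pt E) \<cdot>\<^bsub>Sh'\<^esub> i)"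
      using D'.Sh.Cmp_assoc[OF i(1) ptE Th'] i(3) D'.Sh.Cmp_Idn[OF Th'] by simp
    also have "\<dots> = (i' \<cdot>\<^bsub>Sh'\<^esub> pt E') \<cdot>\<^bsub>Sh'\<^esub> (SA (p.TA h) \<cdot>\<^bsub>Sh'\<^esub> i)"
      using pt_natural[OF h] D'.Sh.Cmp_assoc[OF i(1) STh ptE'] D'.Sh.Cmp_assoc[OF D'.Sh.Cmp_hom[OF i(1) STh] ptE' i'(1)] by simp
    also have "\<dots> = SA (p.TA h) \<cdot>\<^bsub>Sh'\<^esub> i"
      using i'(2) D'.Sh.Idn_Cmp[OF D'.Sh.Cmp_hom[OF i(1) STh]] by simp
    finally show "SA (p.TA h) \<cdot>\<^bsub>Sh'\<^esub> i = i' \<cdot>\<^bsub>Sh'\<^esub> p'.TA h" by simp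
  qed
  then show ?thesis
    using ext_Ar[OF m[unfolded m_eq]] unfolding m_eq ext_simps gluing_def
    by (simp add: p'.glue.cartesian_iff_pullback)
qed

text \<open>
  The extension of the unit at d is the unit at A d, up to the isomorphism c and the isomorphism induced by
  \<open>\<phi> d\<close>: a morphism out of the sheaf of A d is determined by its value on the identity, and on both
  sides this value is the section given by \<open>\<phi> d\<close>.
\<close>

lemma ext_eta:
  assumes d: "d \<in> Ob D"
    and c: "c \<in> hom (presheaf_cat U D') (D'.l (FO A d)) (S (D.l d))"
    and c_one: "ap c (FO A d) (D'.lel (Idn D' (FO A d))) = \<sigma> (D.l d) d (D.lel (Idn D d))"
  shows "(pt (C.l (FO p d)) \<cdot>\<^bsub>Sh'\<^esub> SA (p.eta d)) \<cdot>\<^bsub>Sh'\<^esub> c =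
    p'.TA (FA (ell U C J) (\<phi> d)) \<cdot>\<^bsub>Sh'\<^esub> p'.eta (FO A d)"
proof -
  let ?L = "C.l (FO p d)"
  note Ad = A.FO_Ob[OF d] and pd = p.p.FO_Ob[OF d] and \<phi>d = \<phi>_hom[OF d]
  note L = p.l_p_sheaf[OF d] and PL = sheaf_presheaf[OF p.l_p_sheaf[OF d]]
  note TL = p.T_l_sheaf[OF d] and ld = D.l_sheaf[OF d] and T'L = p'.T_sheaf[OF PL]
  note Seta = S_hom[OF p.eta_hom[OF d] ld TL] and ptL = phi_tilde_hom[OF PL]
  note eta' = p'.eta_hom[OF Ad] and l\<phi> = C.l_hom[OF \<phi>d] and T\<phi> = p'.T_hom[OF C.l_hom[OF \<phi>d]]
  note I = D.Idn_Ar[OF d] and I' = D'.Idn_Ar[OF Ad] and IC = C.Idn_Ar[OF pd] and IC' = C.Idn_Ar[OF p'.p.FO_Ob[OF Ad]]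
  have x: "D'.lel (Idn D' (FO A d)) \<in> Sec (D'.l (FO A d)) (FO A d)"
    using D'.lel_Sec[OF I'(1)] I' by simp
  have y: "D.lel (Idn D d) \<in> Sec (D.l d) d" using D.lel_Sec[OF I(1)] I by simp
  have z: "C.lel (Idn C (FO p d)) \<in> Sec ?L (FO p d)" using C.lel_Sec[OF IC(1)] IC by simp
  have z': "C.lel (Idn C (FO p' (FO A d))) \<in> Sec (C.l (FO p' (FO A d))) (FO p' (FO A d))"
    using C.lel_Sec[OF IC'(1)] IC' by simp
  note cS = psh_Cmp_hom[OF c psh_Cmp_hom[OF Seta ptL]]
  have "(pt ?L \<cdot>\<^bsub>presheaf_cat U D'\<^esub> SA (p.eta d)) \<cdot>\<^bsub>presheaf_cat U D'\<^esub> c =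
    p'.TA (FA (ell U C J) (\<phi> d)) \<cdot>\<^bsub>presheaf_cat U D'\<^esub> p'.eta (FO A d)"
  proof (rule D'.l_cancel[OF Ad T'L cS psh_Cmp_hom[OF eta' T\<phi>]])
    have "ap ((pt ?L \<cdot>\<^bsub>presheaf_cat U D'\<^esub> SA (p.eta d)) \<cdot>\<^bsub>presheaf_cat U D'\<^esub> c) (FO A d) (D'.lel (Idn D' (FO A d))) =
        ap (pt ?L) (FO A d) (\<sigma> (p.T ?L) d (p.\<theta> ?L d (C.lel (Idn C (FO p d)))))"
      using ap_Cmp[OF c psh_Cmp_hom[OF Seta ptL] x] ap_Cmp[OF Seta ptL \<sigma>_Sec[OF ld y]] c_one
        ap_S[OF p.eta_hom[OF d] ld TL y] p.ap_eta_Idn[OF d] by simp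
    also have "\<dots> = p'.\<theta> ?L (FO A d) (C.lel (\<phi> d))"
      using ap_phi_tilde[OF PL d z] C.lel_Res[OF IC(1), of "\<phi> d"] IC homD[OF \<phi>d] C.Idn_Cmp[OF \<phi>d] by simp
    also have "\<dots> = p'.\<theta> ?L (FO A d) (ap (FA (ell U C J) (\<phi> d)) (FO p' (FO A d)) (C.lel (Idn C (FO p' (FO A d)))))"
      using C.ap_l[OF homD(1)[OF \<phi>d] IC'(1)] IC' homD[OF \<phi>d] C.Cmp_Idn[OF \<phi>d] by simp
    also have "\<dots> = ap (p'.TA (FA (ell U C J) (\<phi> d)) \<cdot>\<^bsub>presheaf_cat U D'\<^esub> p'.eta (FO A d)) (FO A d) (D'.lel (Idn D' (FO A d)))"
      using ap_Cmp[OF eta' T\<phi> x] p'.ap_eta_Idn[OF Ad] p'.ap_T[OF l\<phi> Ad z'] by simp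
    finally show "ap ((pt ?L \<cdot>\<^bsub>presheaf_cat U D'\<^esub> SA (p.eta d)) \<cdot>\<^bsub>presheaf_cat U D'\<^esub> c) (FO A d) (D'.lel (Idn D' (FO A d))) =
        ap (p'.TA (FA (ell U C J) (\<phi> d)) \<cdot>\<^bsub>presheaf_cat U D'\<^esub> p'.eta (FO A d)) (FO A d) (D'.lel (Idn D' (FO A d)))" .
  qed
  then show ?thesis by (simp add: sheaf_cat_simps)
qed

lemma S_ell_iso:
  assumes d: "d \<in> Ob D"
  obtains c where "c \<in> hom (presheaf_cat U D') (D'.l (FO A d)) (S (D.l d))" "iso Sh' c"
    "ap c (FO A d) (D'.lel (Idn D' (FO A d))) = \<sigma> (D.l d) d (D.lel (Idn D d))"
proof -
  note ld = D.l_sheaf[OF d] and Ad = A.FO_Ob[OF d]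
  obtain c ci where c: "c \<in> hom (presheaf_cat U D') (D'.l (FO A d)) (S (D.l d))"
    and ci: "ci \<in> hom (presheaf_cat U D') (S (D.l d)) (D'.l (FO A d))"
    and c_lel: "\<forall>g\<in>Ar D'. Cod D' g = FO A d \<longrightarrow>
      ap c (Dom D' g) (D'.lel g) = Res (S (D.l d)) g (\<sigma> (D.l d) d (D.lel (Idn D d)))"
    and inv: "c \<cdot>\<^bsub>presheaf_cat U D'\<^esub> ci = Idn (presheaf_cat U D') (S (D.l d))"
    "ci \<cdot>\<^bsub>presheaf_cat U D'\<^esub> c = Idn (presheaf_cat U D') (D'.l (FO A d))"
    using S_ell_iso_ex[OF d] by blast
  have "iso Sh' c"
    by (rule isoI[of _ _ "D'.l (FO A d)" "S (D.l d)" ci])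
      (use c ci inv S_sheaf[OF ld] D'.l_sheaf[OF Ad] in \<open>simp_all add: sheaf_cat_simps\<close>)
  moreover have "D.lel (Idn D d) \<in> Sec (D.l d) d"
    using D.lel_Sec[OF D.Idn_Ar(1)[OF d]] D.Idn_Ar[OF d] by simp
  then have "ap c (FO A d) (D'.lel (Idn D' (FO A d))) = \<sigma> (D.l d) d (D.lel (Idn D d))"
    using c_lel[rule_format, OF D'.Idn_Ar(1,3)[OF Ad]] D'.Idn_Ar[OF Ad]
      Res_Idn[OF sheaf_presheaf[OF S_sheaf[OF ld]] \<sigma>_Sec[OF ld]] by simp
  ultimately show thesis using that c by blast
qed

lemma S_ell_iso_natural:
  assumes f: "f \<in> hom D d e"
    and c: "c \<in> hom (presheaf_cat U D') (D'.l (FO A d)) (S (D.l d))"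
    and c_one: "ap c (FO A d) (D'.lel (Idn D' (FO A d))) = \<sigma> (D.l d) d (D.lel (Idn D d))"
    and b: "b \<in> hom (presheaf_cat U D') (D'.l (FO A e)) (S (D.l e))"
    and b_one: "ap b (FO A e) (D'.lel (Idn D' (FO A e))) = \<sigma> (D.l e) e (D.lel (Idn D e))"
  shows "SA (FA (ell U D K) f) \<cdot>\<^bsub>Sh'\<^esub> c = b \<cdot>\<^bsub>Sh'\<^esub> FA (ell U D' K') (FA A f)"
proof -
  have d: "d \<in> Ob D" and e: "e \<in> Ob D" using D.hom_Ob[OF f] by auto
  note f' = homD[OF f] and Af = A.FA_hom[OF f] and Ad = A.FO_Ob[OF d] and Ae = A.FO_Ob[OF e]
  note ld = D.l_sheaf[OF d] and le = D.l_sheaf[OF e]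
  note Slf = S_hom[OF D.l_hom[OF f] ld le] and lAf = D'.l_hom[OF Af]
  note I = D.Idn_Ar[OF d] and I' = D'.Idn_Ar[OF Ad] and Ie = D.Idn_Ar[OF e] and Ie' = D'.Idn_Ar[OF Ae]
  have x: "D'.lel (Idn D' (FO A d)) \<in> Sec (D'.l (FO A d)) (FO A d)"
    using D'.lel_Sec[OF I'(1)] I' by simp
  have y: "D.lel (Idn D d) \<in> Sec (D.l d) d" using D.lel_Sec[OF I(1)] I by simp
  have xe: "D'.lel (Idn D' (FO A e)) \<in> Sec (D'.l (FO A e)) (FO A e)"
    using D'.lel_Sec[OF Ie'(1)] Ie' by simp
  have ye: "D.lel (Idn D e) \<in> Sec (D.l e) e" using D.lel_Sec[OF Ie(1)] Ie by simp
  have "SA (FA (ell U D K) f) \<cdot>\<^bsub>presheaf_cat U D'\<^esub> c = b \<cdot>\<^bsub>presheaf_cat U D'\<^esub> FA (ell U D' K') (FA A f)"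
  proof (rule D'.l_cancel[OF Ad S_sheaf[OF le] psh_Cmp_hom[OF c Slf] psh_Cmp_hom[OF lAf b]])
    have "ap (SA (FA (ell U D K) f) \<cdot>\<^bsub>presheaf_cat U D'\<^esub> c) (FO A d) (D'.lel (Idn D' (FO A d))) =
        \<sigma> (D.l e) d (D.lel f)"
      using ap_Cmp[OF c Slf x] c_one ap_S[OF D.l_hom[OF f] ld le y] D.ap_l[OF f'(1) I(1)] I f' D.Cmp_Idn[OF f]
      by simp
    also have "\<dots> = Res (S (D.l e)) (FA A f) (\<sigma> (D.l e) e (D.lel (Idn D e)))"
      using \<sigma>_Res[OF le f'(1), of "D.lel (Idn D e)"] ye f' D.lel_Res[OF Ie(1) f'(1)] Ie D.Idn_Cmp[OF f] by simp
    also have "\<dots> = ap b (FO A d) (Res (D'.l (FO A e)) (FA A f) (D'.lel (Idn D' (FO A e))))"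
      using ap_Res[OF b homD(1)[OF Af]] xe homD[OF Af] b_one by simp
    also have "\<dots> = ap (b \<cdot>\<^bsub>presheaf_cat U D'\<^esub> FA (ell U D' K') (FA A f)) (FO A d) (D'.lel (Idn D' (FO A d)))"
      using ap_Cmp[OF lAf b x] D'.ap_l[OF homD(1)[OF Af] I'(1)] D'.lel_Res[OF Ie'(1) homD(1)[OF Af]]
        I' Ie' homD[OF Af] D'.Cmp_Idn[OF Af] D'.Idn_Cmp[OF Af] by simp
    finally show "ap (SA (FA (ell U D K) f) \<cdot>\<^bsub>presheaf_cat U D'\<^esub> c) (FO A d) (D'.lel (Idn D' (FO A d))) =
        ap (b \<cdot>\<^bsub>presheaf_cat U D'\<^esub> FA (ell U D' K') (FA A f)) (FO A d) (D'.lel (Idn D' (FO A d)))" .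
  qed
  then show ?thesis by (simp add: sheaf_cat_simps)
qed

lemma locally_cartesian_image:
  assumes ext: "\<And>m. cartesian (gluing U D K C J p) (sheaf_cat U C J) comma_proj m \<Longrightarrow>
      cartesian (gluing U D' K' C J p') (sheaf_cat U C J) comma_proj (FA ext m)"
    and f: "locally_cartesian U D K C J p f"
  shows "locally_cartesian U D' K' C J p' (FA A f)"
proof -
  define d e where "d = Dom D f" and "e = Cod D f"
  have fh: "f \<in> hom D d e"
    using f by (simp add: locally_cartesian_def hom_def d_def e_def)
  have d: "d \<in> Ob D" and e: "e \<in> Ob D" using D.hom_Ob[OF fh] by auto
  note Ad = A.FO_Ob[OF d] and Ae = A.FO_Ob[OF e] and Af = A.FA_hom[OF fh]
  let ?L = "\<lambda>d. C.l (FO p d)" and ?lpf = "FA (ell U C J) (FA p f)"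
  have Ld: "?L d \<in> Ob (sheaf_cat U C J)" and Le: "?L e \<in> Ob (sheaf_cat U C J)"
    using p.l_p_sheaf[OF d] p.l_p_sheaf[OF e] by (simp_all add: sheaf_cat_simps)
  interpret L: cat_functor C "sheaf_cat U C J" "ell U C J" by (rule C.ell_functor)
  note eta_Ar = p.eta_Ar[OF fh]
  have "cartesian (gluing U D' K' C J p') (sheaf_cat U C J) comma_proj (FA ext (FA (eta_functor U D K C J p) f))"
    by (rule ext) (use f in \<open>simp add: locally_cartesian_def\<close>)
  then have pb: "pullback Sh' (SA (FA (ell U D K) f)) (pt (?L d) \<cdot>\<^bsub>Sh'\<^esub> SA (p.eta d))
      (pt (?L e) \<cdot>\<^bsub>Sh'\<^esub> SA (p.eta e)) (p'.TA ?lpf)"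
    using ext_Ar[OF eta_Ar(2)] unfolding eta_Ar(1) ext_simps gluing_def
    by (simp add: p'.glue.cartesian_iff_pullback)
  have eta: "p.eta d \<in> hom (sheaf_cat U D K) (D.l d) (p.T (?L d))" if "d \<in> Ob D" for d
    using p.eta_hom[OF that] D.l_sheaf[OF that] p.T_l_sheaf[OF that] by (simp add: sheaf_cat_simps)
  have eta': "p'.eta d \<in> hom Sh' (D'.l d) (p'.T (C.l (FO p' d)))" if "d \<in> Ob D'" for d
    using p'.eta_hom[OF that] D'.l_sheaf[OF that] p'.T_l_sheaf[OF that] by (simp add: sheaf_cat_simps)
  have h1: "SA (FA (ell U D K) f) \<in> hom Sh' (S (D.l d)) (S (D.l e))"
    using S'.FA_hom[of "FA (ell U D K) f"] D.l_hom[OF fh] D.l_sheaf[OF d] D.l_sheaf[OF e] by (simp add: sheaf_cat_simps)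
  have h5: "FA (ell U D' K') (FA A f) \<in> hom Sh' (D'.l (FO A d)) (D'.l (FO A e))"
    using D'.l_hom[OF Af] D'.l_sheaf[OF Ad] D'.l_sheaf[OF Ae] by (simp add: sheaf_cat_simps)
  note lpf = L.FA_hom[OF p.p.FA_hom[OF fh]] and lp'f = L.FA_hom[OF p'.p.FA_hom[OF Af]]
  have T\<phi>: "p'.TA (FA (ell U C J) (\<phi> d)) \<in> hom Sh' (p'.T (C.l (FO p' (FO A d)))) (p'.T (?L d))"
    "iso Sh' (p'.TA (FA (ell U C J) (\<phi> d)))" if "d \<in> Ob D" for d
    using p'.glue.T.FA_hom[OF L.FA_hom[OF \<phi>_hom[OF that]]] p'.glue.T.iso_image[OF L.iso_image[OF \<phi>_iso[OF that]]] .
  obtain c where c: "c \<in> hom (presheaf_cat U D') (D'.l (FO A d)) (S (D.l d))" "iso Sh' c"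
    "ap c (FO A d) (D'.lel (Idn D' (FO A d))) = \<sigma> (D.l d) d (D.lel (Idn D d))"
    by (rule S_ell_iso[OF d])
  obtain b where b: "b \<in> hom (presheaf_cat U D') (D'.l (FO A e)) (S (D.l e))" "iso Sh' b"
    "ap b (FO A e) (D'.lel (Idn D' (FO A e))) = \<sigma> (D.l e) e (D.lel (Idn D e))"
    by (rule S_ell_iso[OF e])
  have c': "c \<in> hom Sh' (D'.l (FO A d)) (S (D.l d))" and b': "b \<in> hom Sh' (D'.l (FO A e)) (S (D.l e))"
    using c(1) b(1) D'.l_sheaf[OF Ad] D'.l_sheaf[OF Ae] S_sheaf[OF D.l_sheaf[OF d]] S_sheaf[OF D.l_sheaf[OF e]]
    by (simp_all add: sheaf_cat_simps)
  have "pullback Sh' (FA (ell U D' K') (FA A f)) (p'.eta (FO A d)) (p'.eta (FO A e))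
      (p'.TA (FA (ell U C J) (FA p' (FA A f))))"
  proof (rule D'.Sh.pullback_iso[OF pb h1 ext_Ob[OF eta[OF d] Ld] ext_Ob[OF eta[OF e] Le] p'.glue.T.FA_hom[OF lpf]
        h5 eta'[OF Ad] eta'[OF Ae] p'.glue.T.FA_hom[OF lp'f] c(2) c' b(2) b' T\<phi>(2,1)[OF d] T\<phi>(2,1)[OF e]])
    show "SA (FA (ell U D K) f) \<cdot>\<^bsub>Sh'\<^esub> c = b \<cdot>\<^bsub>Sh'\<^esub> FA (ell U D' K') (FA A f)"
      by (rule S_ell_iso_natural[OF fh c(1,3) b(1,3)])
    show "(pt (?L d) \<cdot>\<^bsub>Sh'\<^esub> SA (p.eta d)) \<cdot>\<^bsub>Sh'\<^esub> c =
        p'.TA (FA (ell U C J) (\<phi> d)) \<cdot>\<^bsub>Sh'\<^esub> p'.eta (FO A d)"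
      by (rule ext_eta[OF d c(1,3)])
    show "(pt (?L e) \<cdot>\<^bsub>Sh'\<^esub> SA (p.eta e)) \<cdot>\<^bsub>Sh'\<^esub> b =
        p'.TA (FA (ell U C J) (\<phi> e)) \<cdot>\<^bsub>Sh'\<^esub> p'.eta (FO A e)"
      by (rule ext_eta[OF e b(1,3)])
    show "p'.TA ?lpf \<cdot>\<^bsub>Sh'\<^esub> p'.TA (FA (ell U C J) (\<phi> d)) =
        p'.TA (FA (ell U C J) (\<phi> e)) \<cdot>\<^bsub>Sh'\<^esub> p'.TA (FA (ell U C J) (FA p' (FA A f)))"
      using p'.glue.T.FA_Cmp[OF L.FA_hom[OF \<phi>_hom[OF d]] lpf] p'.glue.T.FA_Cmp[OF lp'f L.FA_hom[OF \<phi>_hom[OF e]]]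
        L.FA_Cmp[OF \<phi>_hom[OF d] p.p.FA_hom[OF fh]] L.FA_Cmp[OF p'.p.FA_hom[OF Af] \<phi>_hom[OF e]] \<phi>_natural[OF fh]
      by simp
  qed
  then show ?thesis
    by (simp add: p'.locally_cartesian_iff[OF Af])
qed

end

section \<open>The comparison is invertible when locally cartesian arrows are preserved\<close>

locale local_fibration_triangle = site_triangle U C J D K D' K' p p' A \<phi>
  for U :: "'u set set" and C :: "('o, 'a) cat" and J :: "'o \<Rightarrow> 'a set set"
    and D :: "('p, 'b) cat" and K :: "'p \<Rightarrow> 'b set set"
    and D' :: "('q, 'c) cat" and K' :: "'q \<Rightarrow> 'c set set"
    and p :: "('p, 'b, 'o, 'a) funct" and p' :: "('q, 'c, 'o, 'a) funct"
    and A :: "('p, 'b, 'q, 'c) funct" and \<phi> :: "'p \<Rightarrow> 'a" +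
  assumes lf: "local_fibration U D K C J p"
    and lc: "locally_cartesian U D K C J p f \<Longrightarrow> locally_cartesian U D' K' C J p' (FA A f)"
begin

text \<open>
  Given an arrow w from b to A d, the local fibration p supplies locally cartesian arrows m into
  d over a cover of p' b; the cover lifts to b, and w lifts locally through the locally cartesian arrows A m.
\<close>

lemma locally_lifts:
  assumes w: "w \<in> hom D' b (FO A d)" and d: "d \<in> Ob D"
  shows "locally D' K' b (\<lambda>g. \<exists>m d1 w1 k h. m \<in> hom D d1 d \<and> w1 \<in> hom D' (Dom D' g) (FO A d1) \<and>
    FA A m \<cdot>\<^bsub>D'\<^esub> w1 = w \<cdot>\<^bsub>D'\<^esub> g \<and>
    k \<in> hom C (FO p d1) (FO p' b) \<and> (\<phi> d \<cdot>\<^bsub>C\<^esub> FA p' w) \<cdot>\<^bsub>C\<^esub> k = FA p m \<and>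
    h \<in> hom C (FO p' (Dom D' g)) (FO p d1) \<and> FA p' g = k \<cdot>\<^bsub>C\<^esub> h \<and>
    (\<forall>E z. is_sheaf U C J E \<longrightarrow> z \<in> Sec E (FO p d1) \<longrightarrow> Res E (\<phi> d1 \<cdot>\<^bsub>C\<^esub> FA p' w1) z = Res E h z))"
proof -
  have b: "b \<in> Ob D'" using D'.hom_Ob[OF w] by simp
  note p'w = p'.p.FA_hom[OF w]
  note f = C.Cmp_hom[OF p'w \<phi>_hom[OF d]]
  let ?f = "\<phi> d \<cdot>\<^bsub>C\<^esub> FA p' w"
  note f' = homD[OF f]
  obtain P where P: "covering_family C J (FO p' b) (fst ` P)"
    "\<And>k m. (k, m) \<in> P \<Longrightarrow> locally_cartesian U D K C J p m \<and> Cod D m = d \<and>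
      k \<in> hom C (FO p (Dom D m)) (FO p' b) \<and> ?f \<cdot>\<^bsub>C\<^esub> k = FA p m"
  proof -
    have "\<exists>P :: ('a \<times> 'b) set. covering_family C J (Dom C ?f) (fst ` P) \<and>
        (\<forall>(k, m)\<in>P. locally_cartesian U D K C J p m \<and> Cod D m = d \<and>
          k \<in> hom C (FO p (Dom D m)) (Dom C ?f) \<and> ?f \<cdot>\<^bsub>C\<^esub> k = FA p m)"
      using lf d f' unfolding local_fibration_def by blast
    then show thesis using that f'(2) by fastforce
  qed
  have "locally C J (FO p' b) (\<lambda>j. \<exists>k m h. (k, m) \<in> P \<and> j = k \<cdot>\<^bsub>C\<^esub> h \<and> h \<in> Ar C \<and> Cod C h = Dom C k)"
    unfolding locally_def
  proof (rule bexI[of _ "generated_sieve C (fst ` P)"])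
    show "generated_sieve C (fst ` P) \<in> J (FO p' b)"
      using P(1) by (simp add: covering_family_def)
    show "\<forall>j\<in>generated_sieve C (fst ` P). \<exists>k m h. (k, m) \<in> P \<and> j = k \<cdot>\<^bsub>C\<^esub> h \<and> h \<in> Ar C \<and> Cod C h = Dom C k"
      unfolding generated_sieve_def
    proof
      fix j assume "j \<in> {f \<cdot>\<^bsub>C\<^esub> g |f g. f \<in> fst ` P \<and> g \<in> Ar C \<and> Cod C g = Dom C f}"
      then obtain x g where "x \<in> P" "j = fst x \<cdot>\<^bsub>C\<^esub> g" "g \<in> Ar C" "Cod C g = Dom C (fst x)"
        by auto
      then show "\<exists>k m h. (k, m) \<in> P \<and> j = k \<cdot>\<^bsub>C\<^esub> h \<and> h \<in> Ar C \<and> Cod C h = Dom C k"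
        by (intro exI[of _ "fst x"] exI[of _ "snd x"] exI[of _ g]) simp
    qed
  qed
  from p'.lift_locally[OF b this] show ?thesis
  proof (rule D'.locally_trans[OF _ b])
    fix g assume g: "g \<in> Ar D'" "Cod D' g = b"
      and "\<exists>k m h. (k, m) \<in> P \<and> FA p' g = k \<cdot>\<^bsub>C\<^esub> h \<and> h \<in> Ar C \<and> Cod C h = Dom C k"
    then obtain k m h where km: "(k, m) \<in> P" and gk: "FA p' g = k \<cdot>\<^bsub>C\<^esub> h" and h: "h \<in> Ar C" "Cod C h = Dom C k"
      by blast
    define d1 where "d1 = Dom D m"
    have lcm: "locally_cartesian U D K C J p m" and k: "k \<in> hom C (FO p d1) (FO p' b)"
      and fk: "?f \<cdot>\<^bsub>C\<^esub> k = FA p m" and m: "m \<in> hom D d1 d"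
      using P(2)[OF km] by (auto simp: d1_def hom_def locally_cartesian_def)
    have d1: "d1 \<in> Ob D" using D.hom_Ob[OF m] by simp
    have gh: "g \<in> hom D' (Dom D' g) b" using g by (simp add: hom_def)
    note p'g = p'.p.FA_hom[OF gh] and k' = homD[OF k]
    have h: "h \<in> hom C (FO p' (Dom D' g)) (FO p d1)"
      using C.Cmp_Ar[OF k'(1) h] homD[OF p'g] h k' by (auto simp: hom_def gk)
    note \<phi>d = \<phi>_hom[OF d] and \<phi>1 = \<phi>_hom[OF d1] and Am = A.FA_hom[OF m] and p'Am = p'.p.FA_hom[OF A.FA_hom[OF m]]
    \<comment> \<open>The arrow h ends in p d1, while the lifting problem for A m asks for one into p' (A d1).\<close>
    obtain i where i: "i \<in> hom C (FO p d1) (FO p' (FO A d1))" "\<phi> d1 \<cdot>\<^bsub>C\<^esub> i = Idn C (FO p d1)"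
      using isoE[OF \<phi>_iso[OF d1] \<phi>1] by blast
    note ih = C.Cmp_hom[OF h i(1)] and wg = D'.Cmp_hom[OF gh w]
    have \<phi>ih: "\<phi> d1 \<cdot>\<^bsub>C\<^esub> (i \<cdot>\<^bsub>C\<^esub> h) = h"
      using C.Cmp_assoc[OF h i(1) \<phi>1] i(2) C.Idn_Cmp[OF h] by simp
    have "FA p' (FA A m) \<cdot>\<^bsub>C\<^esub> (i \<cdot>\<^bsub>C\<^esub> h) = FA p' (w \<cdot>\<^bsub>D'\<^esub> g)"
    proof (rule C.iso_Cmp_cancel[OF \<phi>_iso[OF d] \<phi>d C.Cmp_hom[OF ih p'Am] p'.p.FA_hom[OF wg]])
      have "\<phi> d \<cdot>\<^bsub>C\<^esub> (FA p' (FA A m) \<cdot>\<^bsub>C\<^esub> (i \<cdot>\<^bsub>C\<^esub> h)) = FA p m \<cdot>\<^bsub>C\<^esub> (\<phi> d1 \<cdot>\<^bsub>C\<^esub> (i \<cdot>\<^bsub>C\<^esub> h))"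
        using C.Cmp_assoc[OF ih p'Am \<phi>d] \<phi>_natural[OF m] C.Cmp_assoc[OF ih \<phi>1 p.p.FA_hom[OF m]] by simp
      also have "\<dots> = ?f \<cdot>\<^bsub>C\<^esub> FA p' g"
        unfolding \<phi>ih gk fk[symmetric] by (rule C.Cmp_assoc[OF h k f])
      also have "\<dots> = \<phi> d \<cdot>\<^bsub>C\<^esub> FA p' (w \<cdot>\<^bsub>D'\<^esub> g)"
        using C.Cmp_assoc[OF p'g p'w \<phi>d] p'.p.FA_Cmp[OF gh w] by simp
      finally show "\<phi> d \<cdot>\<^bsub>C\<^esub> (FA p' (FA A m) \<cdot>\<^bsub>C\<^esub> (i \<cdot>\<^bsub>C\<^esub> h)) = \<phi> d \<cdot>\<^bsub>C\<^esub> FA p' (w \<cdot>\<^bsub>D'\<^esub> g)" .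
    qed
    from p'.locally_cartesian_lift[OF lc[OF lcm] Am wg ih this]
    show "locally D' K' (Dom D' g) (\<lambda>g1. \<exists>m d1 w1 k h. m \<in> hom D d1 d \<and> w1 \<in> hom D' (Dom D' (g \<cdot>\<^bsub>D'\<^esub> g1)) (FO A d1) \<and>
      FA A m \<cdot>\<^bsub>D'\<^esub> w1 = w \<cdot>\<^bsub>D'\<^esub> (g \<cdot>\<^bsub>D'\<^esub> g1) \<and>
      k \<in> hom C (FO p d1) (FO p' b) \<and> ?f \<cdot>\<^bsub>C\<^esub> k = FA p m \<and>
      h \<in> hom C (FO p' (Dom D' (g \<cdot>\<^bsub>D'\<^esub> g1))) (FO p d1) \<and> FA p' (g \<cdot>\<^bsub>D'\<^esub> g1) = k \<cdot>\<^bsub>C\<^esub> h \<and>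
      (\<forall>E z. is_sheaf U C J E \<longrightarrow> z \<in> Sec E (FO p d1) \<longrightarrow> Res E (\<phi> d1 \<cdot>\<^bsub>C\<^esub> FA p' w1) z = Res E h z))"
    proof (rule D'.locally_mono[OF _ D'.Dom_Ob[OF g(1)]])
      fix g1 assume g1: "g1 \<in> Ar D'" "Cod D' g1 = Dom D' g"
        and "\<exists>w1\<in>hom D' (Dom D' g1) (FO A d1). FA A m \<cdot>\<^bsub>D'\<^esub> w1 = (w \<cdot>\<^bsub>D'\<^esub> g) \<cdot>\<^bsub>D'\<^esub> g1 \<and>
          (\<forall>E z. is_sheaf U C J E \<longrightarrow> z \<in> Sec E (FO p' (FO A d1)) \<longrightarrow>
            Res E (FA p' w1) z = Res E ((i \<cdot>\<^bsub>C\<^esub> h) \<cdot>\<^bsub>C\<^esub> FA p' g1) z)"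
      then obtain w1 where w1: "w1 \<in> hom D' (Dom D' g1) (FO A d1)" and mw: "FA A m \<cdot>\<^bsub>D'\<^esub> w1 = (w \<cdot>\<^bsub>D'\<^esub> g) \<cdot>\<^bsub>D'\<^esub> g1"
        and Ew: "\<And>E z. is_sheaf U C J E \<Longrightarrow> z \<in> Sec E (FO p' (FO A d1)) \<Longrightarrow>
            Res E (FA p' w1) z = Res E ((i \<cdot>\<^bsub>C\<^esub> h) \<cdot>\<^bsub>C\<^esub> FA p' g1) z"
        by blast
      have g1h: "g1 \<in> hom D' (Dom D' g1) (Dom D' g)" using g1 by (simp add: hom_def)
      note p'g1 = p'.p.FA_hom[OF g1h] and p'w1 = p'.p.FA_hom[OF w1]
      have dom: "Dom D' (g \<cdot>\<^bsub>D'\<^esub> g1) = Dom D' g1" using D'.Cmp_Ar[OF g(1) g1] by simp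
      have pgg: "FA p' (g \<cdot>\<^bsub>D'\<^esub> g1) = k \<cdot>\<^bsub>C\<^esub> (h \<cdot>\<^bsub>C\<^esub> FA p' g1)"
        using p'.p.FA_Cmp[OF g1h gh] gk C.Cmp_assoc[OF p'g1 h k] by simp
      have hE: "Res E (\<phi> d1 \<cdot>\<^bsub>C\<^esub> FA p' w1) z = Res E (h \<cdot>\<^bsub>C\<^esub> FA p' g1) z"
        if E: "is_sheaf U C J E" and z: "z \<in> Sec E (FO p d1)" for E z
      proof -
        note PE = sheaf_presheaf[OF E]
        note \<phi>' = homD[OF \<phi>1] and w1' = homD[OF p'w1] and c' = homD[OF C.Cmp_hom[OF p'g1 ih]]
        have "Res E (\<phi> d1 \<cdot>\<^bsub>C\<^esub> FA p' w1) z = Res E ((i \<cdot>\<^bsub>C\<^esub> h) \<cdot>\<^bsub>C\<^esub> FA p' g1) (Res E (\<phi> d1) z)"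
          using Res_Cmp[OF PE \<phi>'(1) w1'(1)] w1' \<phi>' z Ew[OF E \<phi>_Sec[OF PE d1 z]] by simp
        also have "\<dots> = Res E (\<phi> d1 \<cdot>\<^bsub>C\<^esub> ((i \<cdot>\<^bsub>C\<^esub> h) \<cdot>\<^bsub>C\<^esub> FA p' g1)) z"
          using Res_Cmp[OF PE \<phi>'(1) c'(1)] c' \<phi>' z by simp
        also have "\<phi> d1 \<cdot>\<^bsub>C\<^esub> ((i \<cdot>\<^bsub>C\<^esub> h) \<cdot>\<^bsub>C\<^esub> FA p' g1) = h \<cdot>\<^bsub>C\<^esub> FA p' g1"
          using C.Cmp_assoc[OF p'g1 ih \<phi>1] \<phi>ih by simp
        finally show ?thesis .
      qed
      show "\<exists>m d1 w1 k h. m \<in> hom D d1 d \<and> w1 \<in> hom D' (Dom D' (g \<cdot>\<^bsub>D'\<^esub> g1)) (FO A d1) \<and>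
        FA A m \<cdot>\<^bsub>D'\<^esub> w1 = w \<cdot>\<^bsub>D'\<^esub> (g \<cdot>\<^bsub>D'\<^esub> g1) \<and>
        k \<in> hom C (FO p d1) (FO p' b) \<and> ?f \<cdot>\<^bsub>C\<^esub> k = FA p m \<and>
        h \<in> hom C (FO p' (Dom D' (g \<cdot>\<^bsub>D'\<^esub> g1))) (FO p d1) \<and> FA p' (g \<cdot>\<^bsub>D'\<^esub> g1) = k \<cdot>\<^bsub>C\<^esub> h \<and>
        (\<forall>E z. is_sheaf U C J E \<longrightarrow> z \<in> Sec E (FO p d1) \<longrightarrow> Res E (\<phi> d1 \<cdot>\<^bsub>C\<^esub> FA p' w1) z = Res E h z)"
      proof (intro exI conjI allI impI)
        show "FA A m \<cdot>\<^bsub>D'\<^esub> w1 = w \<cdot>\<^bsub>D'\<^esub> (g \<cdot>\<^bsub>D'\<^esub> g1)"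
          using mw D'.Cmp_assoc[OF g1h gh w] by simp
        show "h \<cdot>\<^bsub>C\<^esub> FA p' g1 \<in> hom C (FO p' (Dom D' (g \<cdot>\<^bsub>D'\<^esub> g1))) (FO p d1)"
          using C.Cmp_hom[OF p'g1 h] by (simp add: dom)
      qed (use m w1 k fk pgg hE dom in simp_all)
    qed
  qed
qed

text \<open>
  After restriction to an arrow w from b to A d, the lifting property supplies k : p d1 \<rightarrow> p' b; the
  inducing section is the restriction along k.
\<close>

lemma locally_induced:
  assumes E: "is_sheaf U C J E" and e: "e \<in> Ob D'" and x: "x \<in> Sec E (FO p' e)"
  shows "locally D' K' e (\<lambda>v. \<exists>d w y. d \<in> Ob D \<and> w \<in> hom D' (Dom D' v) (FO A d) \<and> y \<in> Sec E (FO p d) \<and>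
    Res E (FA p' v) x = Res E (\<phi> d \<cdot>\<^bsub>C\<^esub> FA p' w) y)"
proof (rule D'.locally_trans[OF locally_maps_to_image[OF e] e])
  note PE = sheaf_presheaf[OF E]
  fix v assume v: "v \<in> Ar D'" "Cod D' v = e" and "\<exists>d\<in>Ob D. \<exists>w. w \<in> hom D' (Dom D' v) (FO A d)"
  then obtain d w where d: "d \<in> Ob D" and w: "w \<in> hom D' (Dom D' v) (FO A d)" by blast
  have vh: "v \<in> hom D' (Dom D' v) e" using v by (simp add: hom_def)
  note p'v = homD[OF p'.p.FA_hom[OF vh]]
  have xv: "Res E (FA p' v) x \<in> Sec E (FO p' (Dom D' v))"
    using Res_Sec[OF PE p'v(1)] p'v x by simp
  show "locally D' K' (Dom D' v) (\<lambda>g. \<exists>d w y. d \<in> Ob D \<and> w \<in> hom D' (Dom D' (v \<cdot>\<^bsub>D'\<^esub> g)) (FO A d) \<and>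
    y \<in> Sec E (FO p d) \<and> Res E (FA p' (v \<cdot>\<^bsub>D'\<^esub> g)) x = Res E (\<phi> d \<cdot>\<^bsub>C\<^esub> FA p' w) y)"
  proof (rule D'.locally_mono[OF locally_lifts[OF w d] D'.Dom_Ob[OF v(1)]])
    fix g assume g: "g \<in> Ar D'" "Cod D' g = Dom D' v"
      and "\<exists>m d1 w1 k h. m \<in> hom D d1 d \<and> w1 \<in> hom D' (Dom D' g) (FO A d1) \<and>
        FA A m \<cdot>\<^bsub>D'\<^esub> w1 = w \<cdot>\<^bsub>D'\<^esub> g \<and>
        k \<in> hom C (FO p d1) (FO p' (Dom D' v)) \<and> (\<phi> d \<cdot>\<^bsub>C\<^esub> FA p' w) \<cdot>\<^bsub>C\<^esub> k = FA p m \<and>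
        h \<in> hom C (FO p' (Dom D' g)) (FO p d1) \<and> FA p' g = k \<cdot>\<^bsub>C\<^esub> h \<and>
        (\<forall>E z. is_sheaf U C J E \<longrightarrow> z \<in> Sec E (FO p d1) \<longrightarrow> Res E (\<phi> d1 \<cdot>\<^bsub>C\<^esub> FA p' w1) z = Res E h z)"
    then obtain m d1 w1 k h where m: "m \<in> hom D d1 d" and w1: "w1 \<in> hom D' (Dom D' g) (FO A d1)"
      and k: "k \<in> hom C (FO p d1) (FO p' (Dom D' v))" and h: "h \<in> hom C (FO p' (Dom D' g)) (FO p d1)"
      and gk: "FA p' g = k \<cdot>\<^bsub>C\<^esub> h"
      and Eh: "\<And>E z. is_sheaf U C J E \<Longrightarrow> z \<in> Sec E (FO p d1) \<Longrightarrow> Res E (\<phi> d1 \<cdot>\<^bsub>C\<^esub> FA p' w1) z = Res E h z"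
      by blast
    note k' = homD[OF k] and h' = homD[OF h]
    let ?y = "Res E k (Res E (FA p' v) x)"
    have y: "?y \<in> Sec E (FO p d1)" using Res_Sec[OF PE k'(1)] k' xv by simp
    have "Res E (FA p' (v \<cdot>\<^bsub>D'\<^esub> g)) x = Res E (FA p' g) (Res E (FA p' v) x)"
      using p'.p.FA_Cmp_Ar[OF g(1) v(1) g(2)] Res_Cmp[OF PE p'v(1) p'.p.FA_Ar(1)[OF g(1)]] p'.p.FA_Ar[OF g(1)] g p'v x
      by simp
    also have "\<dots> = Res E h ?y"
      unfolding gk by (rule Res_Cmp[OF PE k'(1) h'(1)]) (use k' h' xv in auto)
    also have "\<dots> = Res E (\<phi> d1 \<cdot>\<^bsub>C\<^esub> FA p' w1) ?y"
      using Eh[OF E y] by simp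
    finally show "\<exists>d w y. d \<in> Ob D \<and> w \<in> hom D' (Dom D' (v \<cdot>\<^bsub>D'\<^esub> g)) (FO A d) \<and>
      y \<in> Sec E (FO p d) \<and> Res E (FA p' (v \<cdot>\<^bsub>D'\<^esub> g)) x = Res E (\<phi> d \<cdot>\<^bsub>C\<^esub> FA p' w) y"
      using D.hom_Ob(1)[OF m] w1 y D'.Cmp_Ar(2)[OF v(1) g]
      by (intro exI[of _ d1] exI[of _ w1] exI[of _ ?y]) simp
  qed
qed

text \<open>
  Over a common refinement w of w1 and w2, the sections y1 and y2 restrict to sections z1 and z2 over
  p d that agree after restriction to p' b, where b is the domain of w. By the lifting property w factors locally through some A m such
  that p m factors through p' b, so z1 and z2 agree after restriction along m.
\<close>

lemma induced_unique:
  assumes E: "is_sheaf U C J E" and H: "is_sheaf U D' K' H"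
    and t: "t \<in> hom (presheaf_cat U D) (FO (precomp D p) E) (FO (precomp D A) H)"
    and d1: "d1 \<in> Ob D" and w1: "w1 \<in> hom D' e (FO A d1)" and y1: "y1 \<in> Sec E (FO p d1)"
    and d2: "d2 \<in> Ob D" and w2: "w2 \<in> hom D' e (FO A d2)" and y2: "y2 \<in> Sec E (FO p d2)"
    and eq: "Res E (\<phi> d1 \<cdot>\<^bsub>C\<^esub> FA p' w1) y1 = Res E (\<phi> d2 \<cdot>\<^bsub>C\<^esub> FA p' w2) y2"
  shows "Res H w1 (ap t d1 y1) = Res H w2 (ap t d2 y2)"
proof -
  note PE = sheaf_presheaf[OF E] and PH = sheaf_presheaf[OF H]
  have e: "e \<in> Ob D'" using D'.hom_Ob[OF w1] by simp
  note w1' = homD[OF w1] and w2' = homD[OF w2]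
  have t_Sec: "ap t d y \<in> Sec H (FO A d)" if "d \<in> Ob D" "y \<in> Sec E (FO p d)" for d y
    using ap_Sec[OF t, of y d] that by (simp add: p.p.Sec_precomp A.Sec_precomp)
  have t_Res: "Res H (FA A f) (ap t d y) = ap t d' (Res E (FA p f) y)"
    if f: "f \<in> hom D d' d" and y: "y \<in> Sec E (FO p d)" for f d d' y
    using ap_Res[OF t homD(1)[OF f], of y] homD[OF f] y D.hom_Ob[OF f]
    by (simp add: p.p.Sec_precomp A.Res_precomp p.p.Res_precomp)
  note t1 = t_Sec[OF d1 y1] and t2 = t_Sec[OF d2 y2]
  show ?thesis
  proof (rule D'.sheaf_separated[OF H, of _ e])
    show "Res H w1 (ap t d1 y1) \<in> Sec H e" "Res H w2 (ap t d2 y2) \<in> Sec H e"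
      using Res_Sec[OF PH w1'(1)] Res_Sec[OF PH w2'(1)] w1' w2' t1 t2 by simp_all
    show "locally D' K' e (\<lambda>v. Res H v (Res H w1 (ap t d1 y1)) = Res H v (Res H w2 (ap t d2 y2)))"
    proof (rule D'.locally_trans[OF locally_common_refinement[OF w1 w2 d1 d2] e])
      fix v assume v: "v \<in> Ar D'" "Cod D' v = e"
        and "\<exists>d w u1 u2. w \<in> hom D' (Dom D' v) (FO A d) \<and> u1 \<in> hom D d d1 \<and> u2 \<in> hom D d d2 \<and>
          FA A u1 \<cdot>\<^bsub>D'\<^esub> w = w1 \<cdot>\<^bsub>D'\<^esub> v \<and> FA A u2 \<cdot>\<^bsub>D'\<^esub> w = w2 \<cdot>\<^bsub>D'\<^esub> v"
      then obtain d w u1 u2 where w: "w \<in> hom D' (Dom D' v) (FO A d)" and u1: "u1 \<in> hom D d d1" and u2: "u2 \<in> hom D d d2"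
        and uw1: "FA A u1 \<cdot>\<^bsub>D'\<^esub> w = w1 \<cdot>\<^bsub>D'\<^esub> v" and uw2: "FA A u2 \<cdot>\<^bsub>D'\<^esub> w = w2 \<cdot>\<^bsub>D'\<^esub> v"
        by blast
      have d: "d \<in> Ob D" using D.hom_Ob[OF u1] by simp
      have vh: "v \<in> hom D' (Dom D' v) e" using v by (simp add: hom_def)
      note p'v = p'.p.FA_hom[OF vh] and p'w = p'.p.FA_hom[OF w] and \<phi>d = \<phi>_hom[OF d]
      note f = C.Cmp_hom[OF p'w \<phi>d]
      let ?f = "\<phi> d \<cdot>\<^bsub>C\<^esub> FA p' w"
      have push: "Res E ?f (Res E (FA p u) y) = Res E (FA p' v) (Res E (\<phi> di \<cdot>\<^bsub>C\<^esub> FA p' wi) y)"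
        if di: "di \<in> Ob D" and u: "u \<in> hom D d di" and wi: "wi \<in> hom D' e (FO A di)"
          and uw: "FA A u \<cdot>\<^bsub>D'\<^esub> w = wi \<cdot>\<^bsub>D'\<^esub> v" and y: "y \<in> Sec E (FO p di)" for di u wi y
      proof -
        note pu = p.p.FA_hom[OF u] and p'wi = p'.p.FA_hom[OF wi] and \<phi>i = \<phi>_hom[OF di] and p'Au = p'.p.FA_hom[OF A.FA_hom[OF u]]
        note c = C.Cmp_hom[OF p'wi \<phi>i]
        have "FA p u \<cdot>\<^bsub>C\<^esub> ?f = (\<phi> di \<cdot>\<^bsub>C\<^esub> FA p' (FA A u)) \<cdot>\<^bsub>C\<^esub> FA p' w"
          using C.Cmp_assoc[OF p'w \<phi>d pu] \<phi>_natural[OF u] by simp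
        also have "\<dots> = \<phi> di \<cdot>\<^bsub>C\<^esub> FA p' (wi \<cdot>\<^bsub>D'\<^esub> v)"
          using C.Cmp_assoc[OF p'w p'Au \<phi>i] p'.p.FA_Cmp[OF w A.FA_hom[OF u]] uw by simp
        also have "\<dots> = (\<phi> di \<cdot>\<^bsub>C\<^esub> FA p' wi) \<cdot>\<^bsub>C\<^esub> FA p' v"
          using C.Cmp_assoc[OF p'v p'wi \<phi>i] p'.p.FA_Cmp[OF vh wi] by simp
        finally show ?thesis
          using Res_Cmp[OF PE homD(1)[OF pu] homD(1)[OF f]] Res_Cmp[OF PE homD(1)[OF c] homD(1)[OF p'v]]
            homD[OF pu] homD[OF f] homD[OF c] homD[OF p'v] y by simp
      qed
      let ?z1 = "Res E (FA p u1) y1" and ?z2 = "Res E (FA p u2) y2"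
      have z1: "?z1 \<in> Sec E (FO p d)" and z2: "?z2 \<in> Sec E (FO p d)"
        using Res_Sec[OF PE homD(1)[OF p.p.FA_hom[OF u1]]] Res_Sec[OF PE homD(1)[OF p.p.FA_hom[OF u2]]]
          homD[OF p.p.FA_hom[OF u1]] homD[OF p.p.FA_hom[OF u2]] y1 y2 by simp_all
      have fz: "Res E ?f ?z1 = Res E ?f ?z2"
        using push[OF d1 u1 w1 uw1 y1] push[OF d2 u2 w2 uw2 y2] eq by simp
      have down: "Res H v (Res H wi (ap t di y)) = Res H w (ap t d (Res E (FA p u) y))"
        if di: "di \<in> Ob D" and u: "u \<in> hom D d di" and wi: "wi \<in> hom D' e (FO A di)"
          and uw: "FA A u \<cdot>\<^bsub>D'\<^esub> w = wi \<cdot>\<^bsub>D'\<^esub> v" and y: "y \<in> Sec E (FO p di)" for di u wi y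
        using Res_Cmp[OF PH homD(1)[OF wi] v(1)] Res_Cmp[OF PH homD(1)[OF A.FA_hom[OF u]] homD(1)[OF w]]
          homD[OF wi] homD[OF A.FA_hom[OF u]] homD[OF w] t_Sec[OF di y] t_Res[OF u y] uw v(2) by simp
      show "locally D' K' (Dom D' v) (\<lambda>g. Res H (v \<cdot>\<^bsub>D'\<^esub> g) (Res H w1 (ap t d1 y1)) =
        Res H (v \<cdot>\<^bsub>D'\<^esub> g) (Res H w2 (ap t d2 y2)))"
      proof (rule D'.locally_mono[OF locally_lifts[OF w d] D'.Dom_Ob[OF v(1)]])
        fix g assume g: "g \<in> Ar D'" "Cod D' g = Dom D' v"
          and "\<exists>m d1 w1 k h. m \<in> hom D d1 d \<and> w1 \<in> hom D' (Dom D' g) (FO A d1) \<and>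
            FA A m \<cdot>\<^bsub>D'\<^esub> w1 = w \<cdot>\<^bsub>D'\<^esub> g \<and>
            k \<in> hom C (FO p d1) (FO p' (Dom D' v)) \<and> ?f \<cdot>\<^bsub>C\<^esub> k = FA p m \<and>
            h \<in> hom C (FO p' (Dom D' g)) (FO p d1) \<and> FA p' g = k \<cdot>\<^bsub>C\<^esub> h \<and>
            (\<forall>E z. is_sheaf U C J E \<longrightarrow> z \<in> Sec E (FO p d1) \<longrightarrow> Res E (\<phi> d1 \<cdot>\<^bsub>C\<^esub> FA p' w1) z = Res E h z)"
        then obtain m b x k where m: "m \<in> hom D b d" and x: "x \<in> hom D' (Dom D' g) (FO A b)"
          and mx: "FA A m \<cdot>\<^bsub>D'\<^esub> x = w \<cdot>\<^bsub>D'\<^esub> g" and k: "k \<in> hom C (FO p b) (FO p' (Dom D' v))" and fk: "?f \<cdot>\<^bsub>C\<^esub> k = FA p m"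
          by blast
        have "Res E (FA p m) z = Res E k (Res E ?f z)" if "z \<in> Sec E (FO p d)" for z
          using Res_Cmp[OF PE homD(1)[OF f] homD(1)[OF k]] homD[OF f] homD[OF k] that fk by simp
        then have mz: "Res E (FA p m) ?z1 = Res E (FA p m) ?z2"
          using fz z1 z2 by simp
        have low: "Res H g (Res H w (ap t d z)) = Res H x (ap t b (Res E (FA p m) z))" if z: "z \<in> Sec E (FO p d)" for z
          using Res_Cmp[OF PH homD(1)[OF w] g(1)] Res_Cmp[OF PH homD(1)[OF A.FA_hom[OF m]] homD(1)[OF x]]
            homD[OF w] homD[OF A.FA_hom[OF m]] homD[OF x] t_Sec[OF d z] t_Res[OF m z] mx g(2) by simp
        have comp: "Res H (v \<cdot>\<^bsub>D'\<^esub> g) s = Res H g (Res H v s)" if "s \<in> Sec H e" for s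
          using Res_Cmp[OF PH v(1) g] that v(2) by simp
        show "Res H (v \<cdot>\<^bsub>D'\<^esub> g) (Res H w1 (ap t d1 y1)) = Res H (v \<cdot>\<^bsub>D'\<^esub> g) (Res H w2 (ap t d2 y2))"
          using comp Res_Sec[OF PH w1'(1)] Res_Sec[OF PH w2'(1)] w1' w2' t1 t2
            down[OF d1 u1 w1 uw1 y1] down[OF d2 u2 w2 uw2 y2] low[OF z1] low[OF z2] mz by simp
      qed
    qed
  qed
qed

text \<open>
  So a morphism from E p to H A extends uniquely along the restriction E p \<rightarrow> E p' A to a morphism
  from E p' to H: the target of the comparison has the universal property of its source.
\<close>

lemma extension_ex:
  assumes E: "is_sheaf U C J E" and H: "is_sheaf U D' K' H"
    and t: "t \<in> hom (presheaf_cat U D) (FO (precomp D p) E) (FO (precomp D A) H)"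
  shows "\<exists>s\<in>hom (presheaf_cat U D') (p'.T E) H. \<forall>d\<in>Ob D. \<forall>y\<in>Sec E (FO p d).
    ap s (FO A d) (p'.\<theta> E (FO A d) (Res E (\<phi> d) y)) = ap t d y"
proof -
  note PE = sheaf_presheaf[OF E] and PH = sheaf_presheaf[OF H]
  \<comment> \<open>The image of x is glued from the images of the sections of E p that induce x locally.\<close>
  define V where "V x v z \<longleftrightarrow> (\<exists>d w y. d \<in> Ob D \<and> w \<in> hom D' (Dom D' v) (FO A d) \<and> y \<in> Sec E (FO p d) \<and>
    Res E (FA p' v) x = Res E (\<phi> d \<cdot>\<^bsub>C\<^esub> FA p' w) y \<and> z = Res H w (ap t d y))" for x v z
  have t_Sec: "ap t d y \<in> Sec H (FO A d)" if "d \<in> Ob D" "y \<in> Sec E (FO p d)" for d y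
    using ap_Sec[OF t, of y d] that by (simp add: p.p.Sec_precomp A.Sec_precomp)
  have V_Sec: "z \<in> Sec H (Dom D' v)" if "V x v z" for x v z
    using that t_Sec Res_Sec[OF PH] unfolding V_def hom_def by force
  have V_unique: "z = z'" if "V x v z" "V x v z'" for x v z z'
    using that induced_unique[OF E H t] unfolding V_def by metis
  have V_ex: "locally D' K' e (\<lambda>v. \<exists>z. V x v z)" if e: "e \<in> Ob D'" and x: "x \<in> Sec E (FO p' e)" for e x
    by (rule D'.locally_mono[OF locally_induced[OF E e x] e]) (auto simp: V_def)
  have V_stable: "V x (v \<cdot>\<^bsub>D'\<^esub> g) (Res H g z)"
    if Vz: "V x v z" and v: "v \<in> Ar D'" "x \<in> Sec E (FO p' (Cod D' v))" and g: "g \<in> Ar D'" "Cod D' g = Dom D' v" for x v g z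
  proof -
    obtain d w y where d: "d \<in> Ob D" and w: "w \<in> hom D' (Dom D' v) (FO A d)" and y: "y \<in> Sec E (FO p d)"
      and xy: "Res E (FA p' v) x = Res E (\<phi> d \<cdot>\<^bsub>C\<^esub> FA p' w) y" and z: "z = Res H w (ap t d y)"
      using Vz by (auto simp: V_def)
    have gh: "g \<in> hom D' (Dom D' g) (Dom D' v)" using g by (simp add: hom_def)
    note wg = D'.Cmp_hom[OF gh w] and p'g = p'.p.FA_hom[OF gh] and p'w = p'.p.FA_hom[OF w] and \<phi>d = \<phi>_hom[OF d]
    note f = C.Cmp_hom[OF p'w \<phi>d] and p'v = p'.p.FA_Ar[OF v(1)]
    have "Res E (FA p' (v \<cdot>\<^bsub>D'\<^esub> g)) x = Res E (FA p' g) (Res E (FA p' v) x)"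
      using p'.p.FA_Cmp_Ar[OF g(1) v(1) g(2)] Res_Cmp[OF PE p'v(1) homD(1)[OF p'g]] p'v homD[OF p'g] v by simp
    also have "\<dots> = Res E (\<phi> d \<cdot>\<^bsub>C\<^esub> FA p' (w \<cdot>\<^bsub>D'\<^esub> g)) y"
      using xy p'.p.FA_Cmp[OF gh w] C.Cmp_assoc[OF p'g p'w \<phi>d] Res_Cmp[OF PE homD(1)[OF f] homD(1)[OF p'g]]
        homD[OF f] homD[OF p'g] y by simp
    finally have "Res E (FA p' (v \<cdot>\<^bsub>D'\<^esub> g)) x = Res E (\<phi> d \<cdot>\<^bsub>C\<^esub> FA p' (w \<cdot>\<^bsub>D'\<^esub> g)) y" .
    moreover have "Res H g z = Res H (w \<cdot>\<^bsub>D'\<^esub> g) (ap t d y)"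
      using Res_Cmp[OF PH homD(1)[OF w] g(1)] homD[OF w] g t_Sec[OF d y] z by simp
    moreover have "w \<cdot>\<^bsub>D'\<^esub> g \<in> hom D' (Dom D' (v \<cdot>\<^bsub>D'\<^esub> g)) (FO A d)"
      using wg D'.Cmp_Ar[OF v(1) g] by simp
    ultimately show ?thesis
      unfolding V_def using d y by blast
  qed
  have "\<exists>s\<in>Sec H e. \<forall>v z. v \<in> Ar D' \<longrightarrow> Cod D' v = e \<longrightarrow> V x v z \<longrightarrow> Res H v s = z"
    if e: "e \<in> Ob D'" and x: "x \<in> Sec E (FO p' e)" for e x
  proof -
    obtain s where "s \<in> Sec H e" "\<And>v z. v \<in> Ar D' \<Longrightarrow> Cod D' v = e \<Longrightarrow> V x v z \<Longrightarrow> Res H v s = z"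
      by (rule D'.sheaf_glue[OF H e V_ex[OF e x]]) (use V_Sec V_unique V_stable x in blast)+
    then show ?thesis by blast
  qed
  then obtain \<tau> where \<tau>: "\<And>e x. e \<in> Ob D' \<Longrightarrow> x \<in> Sec E (FO p' e) \<Longrightarrow> \<tau> e x \<in> Sec H e"
    "\<And>e x v z. e \<in> Ob D' \<Longrightarrow> x \<in> Sec E (FO p' e) \<Longrightarrow> v \<in> Ar D' \<Longrightarrow> Cod D' v = e \<Longrightarrow> V x v z \<Longrightarrow> Res H v (\<tau> e x) = z"
    by metis
  let ?t = "psh_mor (FO (precomp D' p') E) H \<tau>"
  have t': "?t \<in> hom (presheaf_cat U D') (FO (precomp D' p') E) H"
  proof (rule psh_mor_hom[OF p'.p.precomp_presheaf[OF PE] PH])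
    show "\<tau> e x \<in> Sec H e" if "x \<in> Sec (FO (precomp D' p') E) e" for e x
      using \<tau>(1) p'.p.Sec_precompD[OF that] by simp
    fix k x assume k: "k \<in> Ar D'" and "x \<in> Sec (FO (precomp D' p') E) (Cod D' k)"
    then have x: "x \<in> Sec E (FO p' (Cod D' k))" by (auto dest!: p'.p.Sec_precompD)
    note p'k = p'.p.FA_Ar[OF k]
    note b = D'.Dom_Ob[OF k] and c = D'.Cod_Ob[OF k]
    have xk: "Res E (FA p' k) x \<in> Sec E (FO p' (Dom D' k))"
      using Res_Sec[OF PE p'k(1)] x p'k by simp
    have "\<tau> (Dom D' k) (Res E (FA p' k) x) = Res H k (\<tau> (Cod D' k) x)"
    proof (rule D'.sheaf_separated[OF H \<tau>(1)[OF b xk] Res_Sec[OF PH k \<tau>(1)[OF c x]]])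
      show "locally D' K' (Dom D' k) (\<lambda>v. Res H v (\<tau> (Dom D' k) (Res E (FA p' k) x)) = Res H v (Res H k (\<tau> (Cod D' k) x)))"
      proof (rule D'.locally_mono[OF V_ex[OF b xk] b])
        fix v assume v: "v \<in> Ar D'" "Cod D' v = Dom D' k" and "\<exists>z. V (Res E (FA p' k) x) v z"
        then obtain z where z: "V (Res E (FA p' k) x) v z" by blast
        note kv = D'.Cmp_Ar[OF k v] and p'v = p'.p.FA_Ar[OF v(1)]
        have "Res E (FA p' v) (Res E (FA p' k) x) = Res E (FA p' (k \<cdot>\<^bsub>D'\<^esub> v)) x"
          using p'.p.FA_Cmp_Ar[OF v(1) k v(2)] Res_Cmp[OF PE p'k(1) p'v(1)] p'k p'v v x by simp
        then have "V x (k \<cdot>\<^bsub>D'\<^esub> v) z"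
          using z kv(2) by (simp add: V_def)
        then show "Res H v (\<tau> (Dom D' k) (Res E (FA p' k) x)) = Res H v (Res H k (\<tau> (Cod D' k) x))"
          using \<tau>(2)[OF b xk v z] \<tau>(2)[OF c x kv(1,3)] Res_Cmp[OF PH k v \<tau>(1)[OF c x]] by simp
      qed
    qed
    then show "\<tau> (Dom D' k) (Res (FO (precomp D' p') E) k x) = Res H k (\<tau> (Cod D' k) x)"
      by (simp add: p'.p.Res_precomp k)
  qed
  note s = D'.a_transpose[OF t' H, folded p'.T_eq]
  show ?thesis
  proof (rule bexI[OF _ s(1)], intro ballI)
    fix d y assume d: "d \<in> Ob D" and y: "y \<in> Sec E (FO p d)"
    let ?x = "Res E (\<phi> d) y"
    note Ad = A.FO_Ob[OF d] and x = \<phi>_Sec[OF PE d y]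
    note I = D'.Idn_Ar[OF Ad]
    have x': "?x \<in> Sec (FO (precomp D' p') E) (FO A d)" using x Ad by (simp add: p'.p.Sec_precomp)
    have "V ?x (Idn D' (FO A d)) (ap t d y)"
      unfolding V_def
      using d y I D'.Idn_hom[OF Ad] p'.p.FA_Idn[OF Ad] Res_Idn[OF PE x] C.Cmp_Idn[OF \<phi>_hom[OF d]]
        Res_Idn[OF PH t_Sec[OF d y]]
      by (intro exI[of _ d] exI[of _ "Idn D' (FO A d)"] exI[of _ y]) simp
    from \<tau>(2)[OF Ad x I(1,3) this] have "\<tau> (FO A d) ?x = ap t d y"
      using Res_Idn[OF PH \<tau>(1)[OF Ad x]] by simp
    then show "ap (transpose (presheaf_cat U D') (sheaf_cat U D' K') incl (FO (precomp D' p') E) H ?t) (FO A d)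
        (p'.\<theta> E (FO A d) ?x) = ap t d y"
      using s(2)[OF x'] ap_psh_mor[OF x'] by simp
  qed
qed

text \<open>
  The induced sections generate E p' locally, and the images of sections of E p' generate T' E.
\<close>

lemma extension_unique:
  assumes E: "is_sheaf U C J E" and H: "is_sheaf U D' K' H"
    and f: "f \<in> hom (presheaf_cat U D') (p'.T E) H" and g: "g \<in> hom (presheaf_cat U D') (p'.T E) H"
    and eq: "\<And>d y. d \<in> Ob D \<Longrightarrow> y \<in> Sec E (FO p d) \<Longrightarrow>
      ap f (FO A d) (p'.\<theta> E (FO A d) (Res E (\<phi> d) y)) = ap g (FO A d) (p'.\<theta> E (FO A d) (Res E (\<phi> d) y))"
  shows "f = g"
proof (rule D'.a_cancel[OF p'.p.precomp_presheaf[OF sheaf_presheaf[OF E]] H f[unfolded p'.T_eq] g[unfolded p'.T_eq]])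
  note PE = sheaf_presheaf[OF E]
  fix e x assume "x \<in> Sec (FO (precomp D' p') E) e"
  then have e: "e \<in> Ob D'" and x: "x \<in> Sec E (FO p' e)" by (auto dest!: p'.p.Sec_precompD)
  note \<theta>x = p'.\<theta>_Sec[OF PE e x]
  show "ap f e (p'.\<theta> E e x) = ap g e (p'.\<theta> E e x)"
  proof (rule D'.sheaf_separated[OF H ap_Sec[OF f \<theta>x] ap_Sec[OF g \<theta>x] D'.locally_mono[OF locally_induced[OF E e x] e]])
    fix v assume v: "v \<in> Ar D'" "Cod D' v = e"
      and "\<exists>d w y. d \<in> Ob D \<and> w \<in> hom D' (Dom D' v) (FO A d) \<and> y \<in> Sec E (FO p d) \<and>
        Res E (FA p' v) x = Res E (\<phi> d \<cdot>\<^bsub>C\<^esub> FA p' w) y"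
    then obtain d w y where d: "d \<in> Ob D" and w: "w \<in> hom D' (Dom D' v) (FO A d)" and y: "y \<in> Sec E (FO p d)"
      and xy: "Res E (FA p' v) x = Res E (\<phi> d \<cdot>\<^bsub>C\<^esub> FA p' w) y" by blast
    note w' = homD[OF w] and \<phi>y = \<phi>_Sec[OF PE d y] and p'w = homD[OF p'.p.FA_hom[OF w]] and \<phi>d = homD[OF \<phi>_hom[OF d]]
    note s = p'.\<theta>_Sec[OF PE A.FO_Ob[OF d] \<phi>_Sec[OF PE d y]]
    have "Res (p'.T E) v (p'.\<theta> E e x) = p'.\<theta> E (Dom D' v) (Res E (FA p' w) (Res E (\<phi> d) y))"
      using p'.\<theta>_Res[OF PE v(1)] v(2) x xy Res_Cmp[OF PE \<phi>d(1) p'w(1)] \<phi>d p'w y by simp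
    also have "\<dots> = Res (p'.T E) w (p'.\<theta> E (FO A d) (Res E (\<phi> d) y))"
      using p'.\<theta>_Res[OF PE w'(1)] w' \<phi>y by simp
    finally have *: "Res (p'.T E) v (p'.\<theta> E e x) = Res (p'.T E) w (p'.\<theta> E (FO A d) (Res E (\<phi> d) y))" .
    have push: "Res H v (ap h e (p'.\<theta> E e x)) = Res H w (ap h (FO A d) (p'.\<theta> E (FO A d) (Res E (\<phi> d) y)))"
      if h: "h \<in> hom (presheaf_cat U D') (p'.T E) H" for h
      using ap_Res[OF h v(1), of "p'.\<theta> E e x"] ap_Res[OF h w'(1), of "p'.\<theta> E (FO A d) (Res E (\<phi> d) y)"]
        v(2) w' \<theta>x s * by simp
    show "Res H v (ap f e (p'.\<theta> E e x)) = Res H v (ap g e (p'.\<theta> E e x))"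
      using push[OF f] push[OF g] eq[OF d y] by simp
  qed
qed

text \<open>
  The morphism from E p to S T E A extends to T' E; this extension and the comparison are inverse to each
  other, as they are on generators.
\<close>

lemma phi_tilde_iso:
  assumes E: "is_sheaf U C J E"
  shows "iso Sh' (pt E)"
proof -
  note PE = sheaf_presheaf[OF E]
  note TE = p.T_sheaf[OF PE] and STE = S_sheaf[OF p.T_sheaf[OF PE]] and T'E = p'.T_sheaf[OF PE]
  note pre = psh_Cmp_hom[OF p.\<theta>_hom[OF PE] \<sigma>_hom[OF TE]]
  obtain s where s: "s \<in> hom (presheaf_cat U D') (p'.T E) (S (p.T E))"
    and s_eq: "\<And>d y. d \<in> Ob D \<Longrightarrow> y \<in> Sec E (FO p d) \<Longrightarrow>
      ap s (FO A d) (p'.\<theta> E (FO A d) (Res E (\<phi> d) y)) =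
      ap (S.u (p.T E) \<cdot>\<^bsub>presheaf_cat U D\<^esub> sheafification_unit U D K (FO (precomp D p) E)) d y"
    using extension_ex[OF E STE pre] by blast
  have s_eq': "ap s (FO A d) (p'.\<theta> E (FO A d) (Res E (\<phi> d) y)) = \<sigma> (p.T E) d (p.\<theta> E d y)"
    if "d \<in> Ob D" "y \<in> Sec E (FO p d)" for d y
    using s_eq[OF that] ap_Cmp[OF p.\<theta>_hom[OF PE] \<sigma>_hom[OF TE], of y d] that by (simp add: p.p.Sec_precomp)
  note pt = phi_tilde_hom[OF PE]
  have "s \<cdot>\<^bsub>presheaf_cat U D'\<^esub> pt E = Idn (presheaf_cat U D') (S (p.T E))"
  proof (rule ST_cancel[OF PE STE psh_Cmp_hom[OF pt s] psh_Idn_hom[OF sheaf_presheaf[OF STE]]])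
    fix d x assume d: "d \<in> Ob D" and x: "x \<in> Sec E (FO p d)"
    note y = \<sigma>_Sec[OF TE p.\<theta>_Sec[OF PE d x]]
    show "ap (s \<cdot>\<^bsub>presheaf_cat U D'\<^esub> pt E) (FO A d) (\<sigma> (p.T E) d (p.\<theta> E d x)) =
        ap (Idn (presheaf_cat U D') (S (p.T E))) (FO A d) (\<sigma> (p.T E) d (p.\<theta> E d x))"
      using ap_Cmp[OF pt s y] ap_phi_tilde[OF PE d x] s_eq'[OF d x] ap_Idn[OF y] by simp
  qed
  moreover have "pt E \<cdot>\<^bsub>presheaf_cat U D'\<^esub> s = Idn (presheaf_cat U D') (p'.T E)"
  proof (rule extension_unique[OF E T'E psh_Cmp_hom[OF s pt] psh_Idn_hom[OF sheaf_presheaf[OF T'E]]])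
    fix d x assume d: "d \<in> Ob D" and x: "x \<in> Sec E (FO p d)"
    note y = p'.\<theta>_Sec[OF PE A.FO_Ob[OF d] \<phi>_Sec[OF PE d x]]
    show "ap (pt E \<cdot>\<^bsub>presheaf_cat U D'\<^esub> s) (FO A d) (p'.\<theta> E (FO A d) (Res E (\<phi> d) x)) =
        ap (Idn (presheaf_cat U D') (p'.T E)) (FO A d) (p'.\<theta> E (FO A d) (Res E (\<phi> d) x))"
      using ap_Cmp[OF s pt y] ap_phi_tilde[OF PE d x] s_eq'[OF d x] ap_Idn[OF y] by simp
  qed
  ultimately show ?thesis
    by (intro isoI[of _ _ "S (p.T E)" "p'.T E" s]) (use pt s STE T'E in \<open>simp_all add: sheaf_cat_simps\<close>)
qed

end


section \<open>The equivalence\<close>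

lemma small_site_of_site: "universe U \<Longrightarrow> site U C J \<Longrightarrow> small_site U C J"
  unfolding small_site_def small_site_axioms_def by (simp add: site_def)

lemma comorphism_of_comorphism_of_sites:
  "universe U \<Longrightarrow> comorphism_of_sites U D K C J p \<Longrightarrow> comorphism U D K C J p"
  unfolding comorphism_def comorphism_axioms_def comorphism_of_sites_def
  by (auto simp: small_site_of_site)

theorem theorem4p3p1:
  fixes U :: "'u set set"
    and C :: "('o, 'a) cat" and J :: "'o \<Rightarrow> 'a set set"
    and D :: "('p, 'b) cat" and K :: "'p \<Rightarrow> 'b set set"
    and D' :: "('q, 'c) cat" and K' :: "'q \<Rightarrow> 'c set set"
    and p :: "('p, 'b, 'o, 'a) funct" and p' :: "('q, 'c, 'o, 'a) funct"
    and A :: "('p, 'b, 'q, 'c) funct" and \<phi> :: "'p \<Rightarrow> 'a"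
  assumes "universe U"
    and "local_fibration U D K C J p"
    and "local_fibration U D' K' C J p'"
    and "morphism_of_sites U D K D' K' A"
    and "nat_iso D C (p' \<odot> A) p \<phi>"
  shows "(morphism_of_relative_toposes U D K D' K' C J A p p' \<phi> \<longleftrightarrow>
      morphism_of_fibrations
        (gluing U D K C J p) comma_proj (gluing U D' K' C J p') comma_proj (sheaf_cat U C J)
        (eta_extension U D K D' K' A p p' \<phi>)) \<and>
    (morphism_of_fibrations
        (gluing U D K C J p) comma_proj (gluing U D' K' C J p') comma_proj (sheaf_cat U C J)
        (eta_extension U D K D' K' A p p' \<phi>) \<longleftrightarrow>
      morphism_of_local_fibrations U D K p D' K' p' C J A)"
proof -
  have cp: "comorphism U D K C J p" and cp': "comorphism U D' K' C J p'"
    using assms(1-3) by (auto simp: local_fibration_def intro: comorphism_of_comorphism_of_sites)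
  have cont: "continuous_functor U D K D' K' A"
    and lim: "preserves_finite_limits (sheaf_cat U D K) (sheaf_cat U D' K') (Sh_star U D K D' K' A)"
    using assms(4) by (auto simp: morphism_of_sites_def)
  have "continuous_site U D K D' K' A"
    using cont assms(1)
    unfolding continuous_functor_def continuous_site_def continuous_site_axioms_def
    by (auto simp: small_site_of_site)
  then have "site_morphism U D K D' K' A"
    unfolding site_morphism_def site_morphism_axioms_def using lim by simp
  moreover have "small_site U C J"
    using cp by (simp add: comorphism_def)
  ultimately interpret site_triangle U C J D K D' K' p p' A \<phi>
    unfolding site_triangle_def site_triangle_axioms_def using cp cp' assms(5) by simp
  let ?rel = "morphism_of_relative_toposes U D K D' K' C J A p p' \<phi>"
  let ?fib = "morphism_of_fibrations (gluing U D K C J p) comma_proj (gluing U D' K' C J p') comma_proj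
    (sheaf_cat U C J) (eta_extension U D K D' K' A p p' \<phi>)"
  let ?loc = "morphism_of_local_fibrations U D K p D' K' p' C J A"
  have loc_iff: "?loc \<longleftrightarrow> (\<forall>f. locally_cartesian U D K C J p f \<longrightarrow> locally_cartesian U D' K' C J p' (FA A f))"
    unfolding morphism_of_local_fibrations_def using assms(2,3,5) A.cat_functor_axioms by blast
  have "?rel \<Longrightarrow> ?fib"
    unfolding relative_toposes_iff fibrations_iff using ext_cartesian by blast
  moreover have "?fib \<Longrightarrow> ?loc"
    unfolding fibrations_iff loc_iff using locally_cartesian_image by blast
  moreover have ?rel if loc: ?loc
  proof -
    interpret local_fibration_triangle U C J D K D' K' p p' A \<phi>
      by unfold_locales (use assms(2) loc loc_iff in auto)
    show ?thesis
      unfolding relative_toposes_iff using phi_tilde_iso by blast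
  qed
  ultimately show ?thesis by blast
qed

end
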